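(* (i) If $G$ is an odd quadrangulation of a (non-orientable) surface of genus at most six, then $G$ has no local $3$-coloring with at most five colors. (ii) Every non-orientable surface of genus at least seven admits an odd quadrangulation that has a local $3$-coloring using five colors.
   Context: A surface is a compact connected 2-manifold without boundary. The genus of a non-orientable surface is its non-orientable genus $g\ge 1$ (number of crosscaps; the projective plane has genus $1$, the Klein bottle genus $2$, and the Euler characteristic is $2-g$). A quadrangulation of a surface is a (finite) loopless graph embedded on the surface such that all faces are quadrilaterals; parallel edges are allowed, and quadrilateral faces may have some of their vertices or even edges coinciding. Odd and even quadrangulations: choose an arbitrary orientation of each face, viewed as a closed walk along its boundary. Consistency is not broken at an edge if the edge is traversed in opposite directions when considering the faces at its two sides; otherwise the edge breaks consistency. The parity of the number of edges breaking consistency does not depend on the chosen orientations of the faces; the quadrangulation is called odd or even according to this parity. (All quadrangulations of orientable surfaces are even.) For a vertex $v$ of a graph $G$, $N(v)$ denotes the set of vertices adjacent to $v$. A proper vertex-coloring $c$ of $G$ is a local $3$-coloring if $|c(N(v))|\le 2$ for every vertex $v$ of $G$. *)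

theory Defs
  imports "HOL-Analysis.Analysis"
begin

section \<open>Surfaces\<close>

definition surface :: "'a topology \<Rightarrow> bool" where
  "surface X \<longleftrightarrow> topspace X \<noteq> {} \<and> compact_space X \<and> connected_space X \<and> Hausdorff_space X \<and>
     (\<forall>x \<in> topspace X. \<exists>U. openin X U \<and> x \<in> U \<and>
        subtopology X U homeomorphic_space (euclidean :: (real^2) topology))"

text \<open>The boundary circle of the closed unit disc is divided into \<open>2 * g\<close> equal sides. Side
  \<open>2 * k\<close> is glued to side \<open>2 * k + 1\<close>, both traversed counterclockwise. This is the polygon
  with boundary word \<open>a1 a1 a2 a2 ... ag ag\<close>; every pair of sides contributes one crosscap.\<close>

definition crosscap_side :: "nat \<Rightarrow> complex \<Rightarrow> complex \<Rightarrow> bool" where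
  "crosscap_side g z w \<longleftrightarrow> (\<exists>k<g. \<exists>s\<in>{0..1::real}.
     z = cis (pi * (2 * real k + s) / real g) \<and>
     w = cis (pi * (2 * real k + 1 + s) / real g))"

text \<open>The second conjunct says that \<open>X\<close> is, up to homeomorphism, the quotient of the disc by this
  gluing, that is, the sphere with \<open>g\<close> crosscaps.\<close>

definition nonorientable_surface :: "nat \<Rightarrow> 'a topology \<Rightarrow> bool" where
  "nonorientable_surface g X \<longleftrightarrow> surface X \<and> g \<ge> 1 \<and>
     (\<exists>q. quotient_map (top_of_set (cball 0 1)) X q \<and>
        (\<forall>z \<in> cball 0 1. \<forall>w \<in> cball 0 1. q z = q w \<longleftrightarrow> equivclp (crosscap_side g) z w))"


section \<open>Embedded graphs and their faces\<close>

text \<open>An embedded graph is given by its set \<open>V\<close> of vertices, which are points of the surface, and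
  its set \<open>E\<close> of edges, which are the point sets of closed arcs. Parallel edges are different
  arcs with the same ends. An arc has two different ends, so there are no loops.\<close>

definition embedded_graph :: "'a topology \<Rightarrow> 'a set \<Rightarrow> 'a set set \<Rightarrow> bool" where
  "embedded_graph X V E \<longleftrightarrow> finite V \<and> finite E \<and> V \<subseteq> topspace X \<and>
     (\<forall>e \<in> E. \<exists>\<gamma>. embedding_map (top_of_set {0..1::real}) X \<gamma> \<and>
        e = \<gamma> ` {0..1} \<and> e \<inter> V = {\<gamma> 0, \<gamma> 1}) \<and>
     (\<forall>e \<in> E. \<forall>e' \<in> E. e \<noteq> e' \<longrightarrow> e \<inter> e' \<subseteq> V)"

definition faces :: "'a topology \<Rightarrow> 'a set \<Rightarrow> 'a set set \<Rightarrow> 'a set set" where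
  "faces X V E = connected_components_of (subtopology X (topspace X - (V \<union> \<Union>E)))"

text \<open>The model quadrilateral has the corners \<open>\<i> ^ k\<close> for \<open>k < 4\<close>.\<close>

definition quadrilateral :: "complex set" where
  "quadrilateral = convex hull {1, \<i>, -1, -\<i>}"

definition side :: "nat \<Rightarrow> real \<Rightarrow> complex" where
  "side k = linepath (\<i> ^ k) (\<i> ^ Suc k)"

text \<open>A map of the closed quadrilateral onto the closure of the face \<open>f\<close>, which is
  injective inside and maps every side onto an edge. Different sides may be mapped to the same
  edge, and different corners to the same vertex. The closed walk around \<open>f\<close> is the sequence of
  the images of side 0, side 1, side 2 and side 3, so the choice of the map includes the choice of
  an orientation of \<open>f\<close>.\<close>

definition oriented_quadrilateral_face ::
    "'a topology \<Rightarrow> 'a set set \<Rightarrow> 'a set \<Rightarrow> (complex \<Rightarrow> 'a) \<Rightarrow> bool" where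
  "oriented_quadrilateral_face X E f \<phi> \<longleftrightarrow>
     continuous_map (top_of_set quadrilateral) X \<phi> \<and>
     homeomorphic_map (top_of_set (interior quadrilateral)) (subtopology X f) \<phi> \<and>
     (\<forall>k<4. \<exists>e \<in> E. homeomorphic_map (top_of_set {0..1}) (subtopology X e) (\<phi> \<circ> side k))"

definition quadrangulation :: "'a topology \<Rightarrow> 'a set \<Rightarrow> 'a set set \<Rightarrow> bool" where
  "quadrangulation X V E \<longleftrightarrow> embedded_graph X V E \<and>
     (\<forall>f \<in> faces X V E. \<exists>\<phi>. oriented_quadrilateral_face X E f \<phi>)"


section \<open>Odd quadrangulations\<close>

definition face_orientation ::
    "'a topology \<Rightarrow> 'a set \<Rightarrow> 'a set set \<Rightarrow> ('a set \<Rightarrow> complex \<Rightarrow> 'a) \<Rightarrow> bool" where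
  "face_orientation X V E \<Phi> \<longleftrightarrow>
     (\<forall>f \<in> faces X V E. oriented_quadrilateral_face X E f (\<Phi> f))"

text \<open>The two sides of an edge \<open>e\<close> of a quadrangulation are the two pairs \<open>(f, j)\<close> such that side
  \<open>j\<close> of the face \<open>f\<close> is mapped onto \<open>e\<close>; the two faces may coincide. As the ends of \<open>e\<close> are
  different, the direction in which \<open>e\<close> is traversed is determined by the initial vertex, the
  image of the corner \<open>\<i> ^ j\<close>.\<close>

definition breaks_consistency ::
    "'a topology \<Rightarrow> 'a set \<Rightarrow> 'a set set \<Rightarrow> ('a set \<Rightarrow> complex \<Rightarrow> 'a) \<Rightarrow> 'a set \<Rightarrow> bool" where
  "breaks_consistency X V E \<Phi> e \<longleftrightarrow>
     (\<exists>f \<in> faces X V E. \<exists>f' \<in> faces X V E. \<exists>j<4. \<exists>j'<4. (f, j) \<noteq> (f', j') \<and>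
        (\<Phi> f \<circ> side j) ` {0..1} = e \<and> (\<Phi> f' \<circ> side j') ` {0..1} = e \<and>
        \<Phi> f (\<i> ^ j) = \<Phi> f' (\<i> ^ j'))"

text \<open>The parity does not depend on the orientation \<open>\<Phi>\<close>: reversing one face changes the status of
  an edge exactly if just one of its two sides belongs to this face, and the number of these edges
  is even because a face has four sides. Hence an existential quantifier can be used.\<close>

definition odd_quadrangulation :: "'a topology \<Rightarrow> 'a set \<Rightarrow> 'a set set \<Rightarrow> bool" where
  "odd_quadrangulation X V E \<longleftrightarrow> quadrangulation X V E \<and>
     (\<exists>\<Phi>. face_orientation X V E \<Phi> \<and> odd (card {e \<in> E. breaks_consistency X V E \<Phi> e}))"


section \<open>Local colorings\<close>

definition adjacent :: "'a set \<Rightarrow> 'a set set \<Rightarrow> 'a \<Rightarrow> 'a \<Rightarrow> bool" where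
  "adjacent V E u v \<longleftrightarrow> u \<noteq> v \<and> (\<exists>e \<in> E. e \<inter> V = {u, v})"

definition neighbors :: "'a set \<Rightarrow> 'a set set \<Rightarrow> 'a \<Rightarrow> 'a set" where
  "neighbors V E v = {u \<in> V. adjacent V E v u}"

definition proper_coloring :: "'a set \<Rightarrow> 'a set set \<Rightarrow> ('a \<Rightarrow> 'c) \<Rightarrow> bool" where
  "proper_coloring V E c \<longleftrightarrow> (\<forall>u \<in> V. \<forall>v \<in> V. adjacent V E u v \<longrightarrow> c u \<noteq> c v)"

definition local_3_coloring :: "'a set \<Rightarrow> 'a set set \<Rightarrow> ('a \<Rightarrow> 'c) \<Rightarrow> bool" where
  "local_3_coloring V E c \<longleftrightarrow> proper_coloring V E c \<and>
     (\<forall>v \<in> V. card (c ` neighbors V E v) \<le> 2)"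

end

theory Submission
  imports Defs
begin

text \<open>
  In a local 3-coloring with the colors \<open>0, \<dots>, 4\<close> every vertex gets a type \<open>(a, {b, d})\<close>: its own color
  \<open>a\<close> and two other colors among which all its neighbors choose theirs. Let \<open>Z\<close> be the
  two-dimensional complex whose nodes are the ten pairs \<open>ab\<close> of colors, whose arcs are the thirty
  types, \<open>(a, {b, d})\<close> joining \<open>ab\<close> to \<open>ad\<close>, and whose fifteen squares \<open>ab, bc, cd, da\<close> are the cyclic
  arrangements of four colors. Every arc lies on two squares and the squares around a node form
  one cycle, so \<open>Z\<close> is a closed surface; its Euler characteristic is \<open>10 - 30 + 15 = -5\<close>, and it is
  the non-orientable surface of genus 7.

  A colored quadrangulation of \<open>X\<close> yields a map from \<open>X\<close> to \<open>Z\<close>. The middle of an edge goes to the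
  pair of colors of its ends, the corner of a face at a vertex goes along the arc given by the type
  of the vertex (or stays at a node), and a face with four colors covers a square, while all other
  faces are folded. The number of faces over a square has the same parity for all squares, and this
  degree of the map is odd exactly for odd quadrangulations. A map of odd degree is injective on
  cohomology modulo 2, which for \<open>Z\<close> has dimension 7 and for \<open>X\<close> has dimension \<open>g\<close>; hence \<open>g \<ge> 7\<close>.

  For part (i) this argument is carried out with line fields in place of cohomology classes. A
  cocycle \<open>\<beta>\<close> on the arcs of \<open>Z\<close> gives a nowhere vanishing vector field on \<open>X\<close> with values in
  \<open>real^6\<close>, determined up to sign at every point (\<open>line_field_field\<close>). On the disc from which \<open>X\<close> is glued the sign can be
  chosen continuously, and each of the \<open>g\<close> pairs of sides then contributes one bit
  (\<open>line_field_holonomy_exists\<close>). There are \<open>2 ^ 7\<close> independent cocycles, so for \<open>g \<le> 6\<close> two of them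
  have the same bits, and then their line fields differ by a global choice of sign
  (\<open>line_fields_equal_holonomy\<close>). This sign is constant on every edge of the quadrangulation. Counting
  the faces over a square by the value of this sign on a side shows that, if the degree is odd,
  the two cocycles differ by a coboundary (\<open>odd_breaks_coboundary\<close>), contrary to
  independence (\<open>test_cocycles_independent\<close>).
  The counting uses that an edge of a quadrangulation has exactly two sides (\<open>card_sides_of\<close>), which
  follows from the invariance of domain.

  For part (ii), conversely, \<open>X\<close> is presented as a rectangle divided into unit squares. The top
  side carries the boundary word \<open>a1 a1 \<dots> ag ag\<close>, the vertical sides are glued to each other, and
  the bottom side is folded in its middle (\<open>p_eq_iff\<close>). The unit squares form a quadrangulation,
  whose edges breaking consistency are exactly those of the top side (\<open>breaks_grid_top\<close>); there are
  \<open>7 * 11 + (g - 7) * 2\<close> of them, an odd number. A local 3-coloring is a labeling of the grid points by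
  types in which neighboring types fit. Such a labeling is a homotopy, in the graph of types with
  its four-cycles filled in, from a closed walk of the form \<open>w1 w1 \<dots> w7 w7\<close> to a walk that goes back
  and forth along one edge. It is given by the table \<open>homotopy\<close>; every crosscap after the seventh adds
  four columns, in which two neighboring types of the first column alternate.
\<close>

section \<open>Line fields and their holonomy\<close>

text \<open>The products of coordinates determine a vector up to sign, so a line field is a continuous family
  of nonzero vectors up to sign.\<close>

definition line_field :: "'a topology \<Rightarrow> ('a \<Rightarrow> real^'n) \<Rightarrow> bool" where
  "line_field X F \<longleftrightarrow> (\<forall>x \<in> topspace X. F x \<noteq> 0) \<and>
     (\<forall>i j. continuous_map X euclideanreal (\<lambda>x. F x $ i * F x $ j))"

definition outer_square :: "real^'n \<Rightarrow> real^'n^'n" where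
  "outer_square v = (\<chi> i j. v $ i * v $ j)"

lemma outer_square_eq_iff: "outer_square v = outer_square w \<longleftrightarrow> v = w \<or> v = - w"
proof
  assume "outer_square v = outer_square w"
  then have e: "v $ i * v $ j = w $ i * w $ j" for i j
    by (auto simp: outer_square_def vec_eq_iff)
  show "v = w \<or> v = - w"
  proof (cases "w = 0")
    case True
    have "v $ i = 0" for i using e[of i i] True by simp
    then show ?thesis using True by (simp add: vec_eq_iff)
  next
    case False
    then obtain i where i: "w $ i \<noteq> 0" by (auto simp: vec_eq_iff)
    have "v $ i = w $ i \<or> v $ i = - w $ i" using e[of i i] by (simp add: square_eq_iff)
    then show ?thesis
    proof
      assume a: "v $ i = w $ i"
      have "v $ j = w $ j" for j using e[of i j] i a by simp
      then show ?thesis by (simp add: vec_eq_iff)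
    next
      assume a: "v $ i = - w $ i"
      have "v $ j = - w $ j" for j
      proof -
        have "w $ i * (v $ j + w $ j) = 0" using e[of i j] a by (simp add: algebra_simps)
        then show ?thesis using i by simp
      qed
      then show ?thesis by (simp add: vec_eq_iff)
    qed
  qed
qed (auto simp: outer_square_def)

text \<open>Near a vector with \<open>v $ i \<noteq> 0\<close> the two preimages of \<open>v v\<^sup>T\<close> are distinguished by the sign of their
  \<open>i\<close>-th coordinate.\<close>

lemma covering_space_outer_square:
  "covering_space (- {0}) (outer_square :: real^'n \<Rightarrow> real^'n^'n) (outer_square ` (- {0}))"
  unfolding covering_space_def
proof (intro conjI ballI)
  let ?p = "outer_square :: real^'n \<Rightarrow> real^'n^'n"
  let ?S = "?p ` (- {0})"
  show cont: "continuous_on (- {0}) ?p"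
    unfolding outer_square_def by (intro continuous_intros)
  show "?p ` (- {0}) = ?S" ..
  fix x assume "x \<in> ?S"
  then obtain v where v: "x = ?p v" "v \<noteq> 0" by auto
  then obtain i where i: "v $ i \<noteq> 0" by (auto simp: vec_eq_iff)
  define T where "T = ?S \<inter> {m. m $ i $ i > 0}"
  define P where "P = {v::real^'n. v $ i > 0}"
  define N where "N = {v::real^'n. v $ i < 0}"
  define r where "r = (\<lambda>m::real^'n^'n. \<chi> j. m $ i $ j / sqrt (m $ i $ i))"
  have "open {m::real^'n^'n. m $ i $ i > 0}"
    by (intro open_Collect_less continuous_intros)
  then have T: "openin (top_of_set ?S) T" unfolding T_def by (simp add: openin_open_Int)
  have xT: "x \<in> T" using v i by (auto simp: T_def outer_square_def zero_less_mult_iff) 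
  have U: "\<Union>{P,N} = (- {0}) \<inter> ?p -` T"
  proof -
    have "?p w $ i $ i = w $ i * w $ i" for w by (simp add: outer_square_def)
    moreover have "w \<noteq> 0" if "w $ i \<noteq> 0" for w :: "real^'n" using that by auto
    ultimately show ?thesis
      by (auto simp: P_def N_def T_def zero_less_mult_iff intro!: imageI)
  qed
  have opP: "openin (top_of_set (- {0})) P" "openin (top_of_set (- {0})) N"
  proof -
    have "open P" "open N" unfolding P_def N_def by (intro open_Collect_less continuous_intros)+
    moreover have "P \<subseteq> - {0}" "N \<subseteq> - {0}" by (auto simp: P_def N_def)
    ultimately show "openin (top_of_set (- {0})) P" "openin (top_of_set (- {0})) N"
      by (auto intro: open_subset)
  qed
  have rc: "continuous_on T r"
    unfolding r_def T_def by (intro continuous_intros) auto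
  have rP: "r (?p w) = w" if "w \<in> P" for w
    using that by (auto simp: r_def P_def outer_square_def vec_eq_iff)
  have rN: "- r (?p w) = w" if "w \<in> N" for w
    using that by (auto simp: r_def N_def outer_square_def vec_eq_iff)
  have mT: "m = ?p (r m) \<and> r m \<in> P" if mT: "m \<in> T" for m
  proof -
    obtain w where w: "m = ?p w" "w \<noteq> 0" using mT by (auto simp: T_def)
    moreover have "(?p w) $ i $ i = w $ i * w $ i" by (simp add: outer_square_def)
    ultimately have "w $ i * w $ i > 0" using mT by (simp add: T_def)
    then have "w \<in> P \<or> w \<in> N" by (auto simp: P_def N_def zero_less_mult_iff)
    then show ?thesis
    proof
      assume "w \<in> P" then show ?thesis using rP[of w] w by simp
    next
      assume a: "w \<in> N"
      then have "- w = r m" using rN[of w] w by (metis minus_minus)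
      moreover have "- w \<in> P" using a by (simp add: P_def N_def)
      moreover have "?p (- w) = ?p w" by (simp add: outer_square_eq_iff)
      ultimately show ?thesis using w by simp
    qed
  qed
  have hP: "homeomorphism P T ?p r"
    unfolding homeomorphism_def
  proof (intro conjI ballI)
    show "?p ` P = T" using mT U by auto
    show "r ` T = P"
    proof
      show "r ` T \<subseteq> P" using mT by auto
      show "P \<subseteq> r ` T"
      proof
        fix w assume "w \<in> P"
        then have "?p w \<in> T" "w = r (?p w)" using rP U by auto
        then show "w \<in> r ` T" by blast
      qed
    qed
    show "continuous_on P ?p" using cont opP(1) by (meson continuous_on_subset openin_imp_subset)
  qed (use rP mT rc in auto)
  have pm: "?p (- w) = ?p w" for w by (simp add: outer_square_eq_iff)
  have hN: "homeomorphism N T ?p (\<lambda>m. - r m)"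
    unfolding homeomorphism_def
  proof (intro conjI ballI)
    have PN: "- w \<in> N \<longleftrightarrow> w \<in> P" for w by (auto simp: P_def N_def)
    show "?p ` N = T" 
    proof
      show "?p ` N \<subseteq> T" using U by auto
      show "T \<subseteq> ?p ` N" using mT PN pm by (metis image_iff subsetI)
    qed
    show "(\<lambda>m. - r m) ` T = N" 
    proof
      show "(\<lambda>m. - r m) ` T \<subseteq> N" using mT PN by auto
      show "N \<subseteq> (\<lambda>m. - r m) ` T"
      proof
        fix w assume "w \<in> N"
        then have "?p w \<in> T" "w = - r (?p w)" using rN U by auto
        then show "w \<in> (\<lambda>m. - r m) ` T" by blast
      qed
    qed
    show "continuous_on N ?p" using cont opP(2) by (meson continuous_on_subset openin_imp_subset)
    show "continuous_on T (\<lambda>m. - r m)" by (intro continuous_intros rc)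
  qed (use rN mT pm in auto)
  have dis: "pairwise disjnt {P,N}" by (auto simp: pairwise_def disjnt_def P_def N_def)
  show "\<exists>T. x \<in> T \<and> openin (top_of_set ?S) T \<and>
            (\<exists>v. \<Union>v = (- {0}) \<inter> ?p -` T \<and> (\<forall>u\<in>v. openin (top_of_set (- {0})) u) \<and>
                 pairwise disjnt v \<and> (\<forall>u\<in>v. \<exists>q. homeomorphism u T ?p q))"
    by (intro exI[of _ T] conjI xT T exI[of _ "{P,N}"] U dis) (use opP hP hN in auto)
qed

text \<open>The disc is simply connected, so the map \<open>F F\<^sup>T\<close> lifts through the double covering by
  \<open>outer_square\<close>.\<close>

lemma line_field_on_disc:
  fixes F :: "complex \<Rightarrow> real^'n"
  assumes "line_field (top_of_set (cball 0 1)) F"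
  obtains t :: "complex \<Rightarrow> real" where "\<And>z. t z = 1 \<or> t z = -1"
    "continuous_on (cball 0 1) (\<lambda>z. t z *\<^sub>R F z)"
proof -
  let ?D = "cball 0 1 :: complex set"
  have nz: "F z \<noteq> 0" if "z \<in> ?D" for z using assms that by (auto simp: line_field_def)
  have c: "continuous_on ?D (\<lambda>z. outer_square (F z))"
    using assms unfolding outer_square_def line_field_def
    by (intro continuous_on_vec_lambda) auto
  have im: "(\<lambda>z. outer_square (F z)) \<in> ?D \<rightarrow> outer_square ` (- {0})" using nz by auto
  obtain G where G: "continuous_on ?D G" "G \<in> ?D \<rightarrow> - {0}"
    "\<And>z. z \<in> ?D \<Longrightarrow> outer_square (G z) = outer_square (F z)"
    using covering_space_lift[OF covering_space_outer_square _ _ c im]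
    by (metis convex_cball convex_imp_locally_path_connected convex_imp_simply_connected)
  define t where "t z = (if G z = F z then 1 else -1 :: real)" for z
  have "t z *\<^sub>R F z = G z" if "z \<in> ?D" for z
    using G(3)[OF that] by (auto simp: t_def outer_square_eq_iff)
  then have "continuous_on ?D (\<lambda>z. t z *\<^sub>R F z)" using G(1) by (metis (mono_tags, lifting) continuous_on_cong)
  then show ?thesis by (intro that[of t]) (auto simp: t_def)
qed

lemma continuous_sign_constant:
  fixes h :: "'a::topological_space \<Rightarrow> real"
  assumes "connected S" "continuous_on S h" "\<And>x. x \<in> S \<Longrightarrow> h x = 1 \<or> h x = -1"
    and "x \<in> S" "y \<in> S"
  shows "h x = h y"
proof -
  have "h ` S \<subseteq> {1,-1}" using assms(3) by auto
  then have "finite (h ` S)" by (rule finite_subset) auto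
  then have "h constant_on S"
    using continuous_finite_range_constant assms(1,2) by blast
  then show ?thesis using assms(4,5) by (metis constant_on_def)
qed

lemma line_field_sign_ratio:
  fixes a b :: "'a::topological_space \<Rightarrow> real" and F :: "'a \<Rightarrow> real^'n"
  assumes "\<And>x. x \<in> S \<Longrightarrow> F x \<noteq> 0" "continuous_on S (\<lambda>x. a x *\<^sub>R F x)" "continuous_on S (\<lambda>x. b x *\<^sub>R F x)"
    and "\<And>x. a x = 1 \<or> a x = -1" "\<And>x. b x = 1 \<or> b x = -1"
  shows "continuous_on S (\<lambda>x. a x * b x)"
proof -
  have *: "a x * b x = (a x *\<^sub>R F x) \<bullet> (b x *\<^sub>R F x) / ((a x *\<^sub>R F x) \<bullet> (a x *\<^sub>R F x))" if "x \<in> S" for x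
  proof -
    have "F x \<bullet> F x \<noteq> 0" using assms(1)[OF that] by simp
    then show ?thesis using assms(4)[of x] by auto
  qed
  have "continuous_on S (\<lambda>x. (a x *\<^sub>R F x) \<bullet> (b x *\<^sub>R F x) / ((a x *\<^sub>R F x) \<bullet> (a x *\<^sub>R F x)))"
  proof (intro continuous_on_divide continuous_on_inner assms(2,3) ballI)
    fix x assume "x \<in> S"
    then show "(a x *\<^sub>R F x) \<bullet> (a x *\<^sub>R F x) \<noteq> 0" using assms(1)[of x] assms(4)[of x] by auto
  qed
  then show ?thesis using * by (metis (mono_tags, lifting) continuous_on_cong)
qed

text \<open>The bit \<open>b k\<close> tells whether the signs that make the line field continuous on the disc agree on the
  two sides that are glued to the \<open>k\<close>-th crosscap. The bits represent the class of the line field in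
  the cohomology of the surface modulo 2.\<close>

definition sides_holonomy :: "nat \<Rightarrow> (complex \<Rightarrow> 'a) \<Rightarrow> ('a \<Rightarrow> real^'n) \<Rightarrow> (complex \<Rightarrow> real) \<Rightarrow> (nat \<Rightarrow> real) \<Rightarrow> bool" where
  "sides_holonomy g q F t b \<longleftrightarrow> (\<forall>z. t z = 1 \<or> t z = -1) \<and>
     continuous_on (cball 0 1) (\<lambda>z. t z *\<^sub>R F (q z)) \<and> (\<forall>k. b k = 1 \<or> b k = -1) \<and>
     (\<forall>k<g. \<forall>s\<in>{0..1}. t (cis (pi * (2 * real k + s) / real g)) *
                          t (cis (pi * (2 * real k + 1 + s) / real g)) = b k)"

text \<open>On a pair of glued sides the product of the two signs is continuous, hence constant.\<close>

lemma line_field_holonomy_exists: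
  fixes F :: "'a \<Rightarrow> real^'n"
  assumes q: "quotient_map (top_of_set (cball 0 1)) X q"
    and glue: "\<And>z w. z \<in> cball 0 1 \<Longrightarrow> w \<in> cball 0 1 \<Longrightarrow> crosscap_side g z w \<Longrightarrow> q z = q w"
    and F: "line_field X F"
  shows "\<exists>t b. sides_holonomy g q F t b"
proof -
  let ?D = "cball 0 1 :: complex set"
  have qc: "continuous_map (top_of_set ?D) X q" using q quotient_imp_continuous_map by blast
  have qD: "q z \<in> topspace X" if "z \<in> ?D" for z
    using qc that by (auto simp: continuous_map_def)
  have "line_field (top_of_set ?D) (\<lambda>z. F (q z))"
    unfolding line_field_def
  proof (intro conjI allI ballI)
    show "F (q z) \<noteq> 0" if "z \<in> topspace (top_of_set ?D)" for z
      using F qD that by (auto simp: line_field_def)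
    show "continuous_map (top_of_set ?D) euclideanreal (\<lambda>z. F (q z) $ i * F (q z) $ j)" for i j
      using continuous_map_compose[OF qc, of euclideanreal "\<lambda>x. F x $ i * F x $ j"] F
      by (auto simp: line_field_def o_def)
  qed
  then obtain t where t: "\<And>z. t z = 1 \<or> t z = -1" "continuous_on ?D (\<lambda>z. t z *\<^sub>R F (q z))"
    using line_field_on_disc by blast
  define z where "z k s = cis (pi * (2 * real k + s) / real g)" for k s
  define w where "w k s = cis (pi * (2 * real k + 1 + s) / real g)" for k s
  have zw: "t (z k s) * t (w k s) = t (z k 0) * t (w k 0)" if k: "k < g" and s: "s \<in> {0..1}" for k s
  proof -
    have eq: "q (z k s) = q (w k s)" if "s \<in> {0..1}" for s
    proof (rule glue)
      show "crosscap_side g (z k s) (w k s)"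
        unfolding crosscap_side_def z_def w_def using k that by blast
    qed (auto simp: z_def w_def)
    have cz: "continuous_on {0..1} (\<lambda>s. t (z k s) *\<^sub>R F (q (z k s)))"
      by (rule continuous_on_compose2[OF t(2)]) (use k in \<open>auto simp: z_def intro!: continuous_intros\<close>)
    have cw: "continuous_on {0..1} (\<lambda>s. t (w k s) *\<^sub>R F (q (w k s)))"
      by (rule continuous_on_compose2[OF t(2)]) (use k in \<open>auto simp: w_def intro!: continuous_intros\<close>)
    have "continuous_on {0..1} (\<lambda>s. t (w k s) *\<^sub>R F (q (z k s)))"
      by (rule continuous_on_eq[OF cw]) (simp add: eq)
    moreover have "F (q (z k s)) \<noteq> 0" if "s \<in> {0..1}" for s
      using F qD[of "z k s"] by (auto simp: line_field_def z_def)
    ultimately have "continuous_on {0..1} (\<lambda>s. t (z k s) * t (w k s))"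
      using cz t(1) by (intro line_field_sign_ratio[where F="\<lambda>s. F (q (z k s))"]) auto
    moreover have "t (z k s) * t (w k s) = 1 \<or> t (z k s) * t (w k s) = -1" for s
      using t(1)[of "z k s"] t(1)[of "w k s"] by auto
    ultimately show ?thesis
      using continuous_sign_constant[of "{0..1::real}" "\<lambda>s. t (z k s) * t (w k s)" s 0] s by auto
  qed
  have "sides_holonomy g q F t (\<lambda>k. t (z k 0) * t (w k 0))"
    unfolding sides_holonomy_def
  proof (intro conjI)
    show "\<forall>k. t (z k 0) * t (w k 0) = 1 \<or> t (z k 0) * t (w k 0) = - 1"
      using t(1) by (metis mult_1 mult_minus1 minus_minus)
    show "\<forall>k<g. \<forall>s\<in>{0..1}. t (cis (pi * (2 * real k + s) / real g)) *
            t (cis (pi * (2 * real k + 1 + s) / real g)) = t (z k 0) * t (w k 0)"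
      using zw unfolding z_def w_def by blast
  qed (use t in auto)
  then show ?thesis by blast
qed

lemma equivclp_invariant:
  assumes "equivclp r z w" "\<And>z w. r z w \<Longrightarrow> h z = h w"
  shows "h z = h w"
  using assms(1) by (induct rule: equivclp_induct) (use assms(2) in \<open>auto\<close>)

text \<open>The product of the sign functions of the two line fields takes equal values at glued points, so it
  descends to the surface.\<close>

lemma line_fields_equal_holonomy:
  fixes F F' :: "'a \<Rightarrow> real^'n"
  assumes q: "quotient_map (top_of_set (cball 0 1)) X q"
    and glue: "\<And>z w. z \<in> cball 0 1 \<Longrightarrow> w \<in> cball 0 1 \<Longrightarrow> q z = q w \<longleftrightarrow> equivclp (crosscap_side g) z w"
    and h: "sides_holonomy g q F t b" "sides_holonomy g q F' t' b'" and bb: "\<And>k. k < g \<Longrightarrow> b k = b' k"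
  obtains u :: "'a \<Rightarrow> real" where "\<And>x. u x = 1 \<or> u x = -1"
    "\<And>i j. continuous_map X euclideanreal (\<lambda>x. u x * (F x $ i * F' x $ j))"
proof -
  let ?D = "cball 0 1 :: complex set"
  have qim: "q ` ?D = topspace X" using q by (simp add: quotient_map_def)
  have pm: "t z = 1 \<or> t z = -1" "t' z = 1 \<or> t' z = -1" for z using h by (auto simp: sides_holonomy_def)
  have side: "t z * t' z = t w * t' w" if "crosscap_side g z w" for z w
  proof -
    obtain k s where k: "k < g" "s \<in> {0..1::real}" "z = cis (pi * (2 * real k + s) / real g)"
      "w = cis (pi * (2 * real k + 1 + s) / real g)" using \<open>crosscap_side g z w\<close> by (auto simp: crosscap_side_def)
    then have "t z * t w = b k" "t' z * t' w = b' k" using h unfolding sides_holonomy_def by blast+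
    then have "t z * t w = t' z * t' w" using bb k(1) by simp
    then show ?thesis using pm[of z] pm[of w] by auto
  qed
  have inv: "t z * t' z = t w * t' w" if "q z = q w" "z \<in> ?D" "w \<in> ?D" for z w
    using equivclp_invariant[of "crosscap_side g" z w "\<lambda>z. t z * t' z"] side glue that by blast
  define v where "v x = (SOME z. z \<in> ?D \<and> q z = x)" for x
  have v: "v x \<in> ?D \<and> q (v x) = x" if "x \<in> topspace X" for x
  proof -
    have "\<exists>z. z \<in> ?D \<and> q z = x" using that qim by (metis imageE)
    then show ?thesis unfolding v_def by (rule someI_ex)
  qed
  define u where "u x = t (v x) * t' (v x)" for x
  have uq: "u (q z) = t z * t' z" if "z \<in> ?D" for z
    unfolding u_def using inv[of "v (q z)" z] v[of "q z"] that qim by blast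
  show ?thesis
  proof (rule that[of u])
    show "u x = 1 \<or> u x = -1" for x using pm[of "v x"] by (auto simp: u_def)
    fix i j
    have "continuous_on ?D (\<lambda>z. (t z *\<^sub>R F (q z)) $ i * (t' z *\<^sub>R F' (q z)) $ j)"
    proof -
      have "continuous_on ?D (\<lambda>z. t z *\<^sub>R F (q z))" "continuous_on ?D (\<lambda>z. t' z *\<^sub>R F' (q z))"
        using h by (auto simp: sides_holonomy_def)
      then show ?thesis by (intro continuous_on_mult continuous_on_component)
    qed
    then have "continuous_on ?D (\<lambda>z. u (q z) * (F (q z) $ i * F' (q z) $ j))"
      by (rule continuous_on_eq) (simp add: uq mult_ac)
    then have "continuous_map (top_of_set ?D) euclideanreal ((\<lambda>x. u x * (F x $ i * F' x $ j)) \<circ> q)"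
      by (simp add: o_def)
    then show "continuous_map X euclideanreal (\<lambda>x. u x * (F x $ i * F' x $ j))"
      using continuous_compose_quotient_map[OF q] by blast
  qed
qed

section \<open>The model quadrilateral\<close>

lemma less_four_cases: "k < (4::nat) \<Longrightarrow> k = 0 \<or> k = 1 \<or> k = 2 \<or> k = 3"
  by linarith

lemma side_eq: "side k s = \<i> ^ k * Complex (1 - s) s"
proof -
  have "side k s = of_real (1 - s) * \<i> ^ k + of_real s * (\<i> * \<i> ^ k)"
    by (simp only: side_def linepath_def scaleR_conv_of_real power_Suc)
  also have "\<dots> = \<i> ^ k * (of_real (1 - s) + of_real s * \<i>)" by (simp only: distrib_left mult_ac)
  also have "of_real (1 - s) + of_real s * \<i> = Complex (1 - s) s" by (simp add: complex_eq_iff)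
  finally show ?thesis .
qed

lemma side_ends [simp]: "side k 0 = \<i> ^ k" "side k 1 = \<i> ^ Suc k"
  by (simp_all add: side_def linepath_def)

lemma continuous_on_side: "continuous_on S (side k)"
  unfolding side_def by (rule continuous_on_linepath)

text \<open>The quadrilateral is the unit ball of this norm, and multiplication by \<open>\<i>\<close> preserves it.\<close>

definition taxi_norm :: "complex \<Rightarrow> real" where
  "taxi_norm z = \<bar>Re z\<bar> + \<bar>Im z\<bar>"

lemma taxi_norm_rotate: "taxi_norm (\<i> ^ k * z) = taxi_norm z"
proof (induction k arbitrary: z)
  case (Suc k)
  have "taxi_norm (\<i> ^ Suc k * z) = taxi_norm (\<i> ^ k * (\<i> * z))" by (simp only: power_Suc2 mult.assoc)
  also have "\<dots> = taxi_norm (\<i> * z)" by (rule Suc)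
  also have "\<dots> = taxi_norm z" by (simp add: taxi_norm_def)
  finally show ?case .
qed simp

lemma taxi_norm_scale: "taxi_norm (of_real a * z) = \<bar>a\<bar> * taxi_norm z"
  by (simp add: taxi_norm_def abs_mult algebra_simps)

lemma taxi_norm_side: "0 \<le> s \<Longrightarrow> s \<le> 1 \<Longrightarrow> taxi_norm (side k s) = 1"
  by (simp add: side_eq taxi_norm_rotate) (simp add: taxi_norm_def)

lemma continuous_on_taxi_norm [continuous_intros]:
  "continuous_on S f \<Longrightarrow> continuous_on S (\<lambda>x. taxi_norm (f x))"
  unfolding taxi_norm_def by (intro continuous_intros)

lemma quadrilateral_eq: "quadrilateral = {z. taxi_norm z \<le> 1}"
proof
  have "convex {z. taxi_norm z \<le> 1}"
  proof (rule convexI)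
    fix x y u v assume xy: "x \<in> {z. taxi_norm z \<le> 1}" "y \<in> {z. taxi_norm z \<le> 1}"
      and uv: "0 \<le> (u::real)" "0 \<le> v" "u + v = 1"
    have *: "\<bar>u * a + v * b\<bar> \<le> u * \<bar>a\<bar> + v * \<bar>b\<bar>" for a b
      using abs_triangle_ineq[of "u * a" "v * b"] uv by (simp add: abs_mult)
    have "taxi_norm (u *\<^sub>R x + v *\<^sub>R y) \<le> u * taxi_norm x + v * taxi_norm y"
      using *[of "Re x" "Re y"] *[of "Im x" "Im y"] by (simp add: taxi_norm_def distrib_left)
    also have "\<dots> \<le> u * 1 + v * 1" using xy uv by (intro add_mono mult_left_mono) auto
    finally show "u *\<^sub>R x + v *\<^sub>R y \<in> {z. taxi_norm z \<le> 1}" using uv by simp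
  qed
  then show "quadrilateral \<subseteq> {z. taxi_norm z \<le> 1}"
    unfolding quadrilateral_def by (intro hull_minimal) (auto simp: taxi_norm_def)
  show "{z. taxi_norm z \<le> 1} \<subseteq> quadrilateral"
  proof
    fix z assume "z \<in> {z. taxi_norm z \<le> 1}"
    then have z: "\<bar>Re z\<bar> + \<bar>Im z\<bar> \<le> 1" by (simp add: taxi_norm_def)
    define d where "d = (1 - \<bar>Re z\<bar> - \<bar>Im z\<bar>) / 2"
    define a b c e where "a = max (Re z) 0 + d" and "b = max (Im z) 0"
      and "c = max (- Re z) 0 + d" and "e = max (- Im z) 0"
    have nn: "0 \<le> a" "0 \<le> b" "0 \<le> c" "0 \<le> e" using z by (auto simp: a_def b_def c_def e_def d_def)
    have sum1: "a + b + c + e = 1" unfolding a_def b_def c_def e_def d_def by (auto simp: max_def field_simps)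
    have zz: "z = a *\<^sub>R 1 + b *\<^sub>R \<i> + c *\<^sub>R (-1) + e *\<^sub>R (-\<i>)"
      by (auto simp: complex_eq_iff a_def b_def c_def e_def max_def)
    have "convex quadrilateral" "1 \<in> quadrilateral" "\<i> \<in> quadrilateral" "-1 \<in> quadrilateral" "-\<i> \<in> quadrilateral"
      by (auto simp: quadrilateral_def hull_inc)
    define u where "u = (\<lambda>i::nat. if i = 0 then a else if i = 1 then b else if i = 2 then c else e)"
    define y where "y = (\<lambda>i::nat. if i = 0 then 1 else if i = 1 then \<i> else if i = 2 then -1 else -\<i>)"
    have "(\<Sum>i<4. u i *\<^sub>R y i) \<in> quadrilateral"
    proof (rule convex_sum)
      show "(\<Sum>i<4. u i) = 1" using sum1 by (simp add: u_def eval_nat_numeral)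
    qed (use nn \<open>convex quadrilateral\<close> \<open>1 \<in> quadrilateral\<close> \<open>\<i> \<in> quadrilateral\<close> \<open>-1 \<in> quadrilateral\<close> \<open>-\<i> \<in> quadrilateral\<close>
       in \<open>auto simp: u_def y_def\<close>)
    moreover have "(\<Sum>i<4. u i *\<^sub>R y i) = z" unfolding zz by (simp add: u_def y_def eval_nat_numeral)
    ultimately show "z \<in> quadrilateral" by simp
  qed
qed

lemma compact_quadrilateral: "compact quadrilateral"
  unfolding quadrilateral_def by (intro compact_convex_hull finite_imp_compact) simp

lemma interior_quadrilateral: "interior quadrilateral = {z. taxi_norm z < 1}"
proof
  have "open {z. taxi_norm z < 1}" by (intro open_Collect_less continuous_intros)
  then show "{z. taxi_norm z < 1} \<subseteq> interior quadrilateral"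
    by (intro interior_maximal) (auto simp: quadrilateral_eq)
  show "interior quadrilateral \<subseteq> {z. taxi_norm z < 1}"
  proof
    fix z assume z: "z \<in> interior quadrilateral"
    have "continuous (at 0) (\<lambda>e::real. of_real (1 + e) * z)" by (intro continuous_intros)
    then have "((\<lambda>e::real. of_real (1 + e) * z) \<longlongrightarrow> z) (at 0)" by (simp add: continuous_at)
    from topological_tendstoD[OF this open_interior z]
    have "eventually (\<lambda>e::real. of_real (1 + e) * z \<in> interior quadrilateral) (at 0)" .
    then obtain d where d: "d > 0" "\<And>e::real. e \<noteq> 0 \<Longrightarrow> \<bar>e\<bar> < d \<Longrightarrow> of_real (1 + e) * z \<in> interior quadrilateral"
      unfolding eventually_at by (auto simp: dist_real_def)
    have "of_real (1 + d/2) * z \<in> quadrilateral" using d(2)[of "d/2"] d(1) interior_subset by auto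
    then have "(1 + d/2) * taxi_norm z \<le> 1"
      using taxi_norm_scale[of "1+d/2" z] d(1) by (simp add: quadrilateral_eq)
    moreover have "taxi_norm z \<ge> 0" by (simp add: taxi_norm_def)
    moreover have "(1 + d/2) * taxi_norm z > 1" if "taxi_norm z \<ge> 1"
    proof -
      have "1 + d/2 \<le> (1 + d/2) * taxi_norm z" using that d(1) by simp
      then show ?thesis using d(1) by linarith
    qed
    ultimately show "z \<in> {z. taxi_norm z < 1}" by fastforce
  qed
qed

lemma mem_quadrilateral: "z \<in> quadrilateral \<longleftrightarrow> taxi_norm z \<le> 1"
  by (simp add: quadrilateral_eq)

lemma mem_interior_quadrilateral: "z \<in> interior quadrilateral \<longleftrightarrow> taxi_norm z < 1"
  by (simp add: interior_quadrilateral)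

lemma side_polar_exists:
  assumes "z \<noteq> 0"
  obtains k s where "k < 4" "0 \<le> s" "s < 1" "z = of_real (taxi_norm z) * side k s"
proof -
  define n where "n = taxi_norm z"
  have n: "n > 0" using assms by (auto simp: n_def taxi_norm_def complex_eq_iff)
  have nn: "n = \<bar>Re z\<bar> + \<bar>Im z\<bar>" by (simp add: n_def taxi_norm_def)
  have div: "0 \<le> q / n \<and> q / n < 1 \<and> n * (q / n) = q \<and> n * (1 - q / n) = n - q" if "0 \<le> q" "q < n" for q
    using that n by (auto simp: right_diff_distrib)
  have "\<exists>k s. k < 4 \<and> 0 \<le> s \<and> s < 1 \<and> z = of_real n * side k s"
  proof (cases "Re z > 0 \<and> Im z \<ge> 0")
    case True
    then show ?thesis using n nn div[of "Im z"]
      by (intro exI[of _ 0] exI[of _ "(Im z) / n"]) (auto simp: side_eq complex_eq_iff power3_eq_cube)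
  next
    case 1: False
    show ?thesis
    proof (cases "Re z \<le> 0 \<and> Im z > 0")
      case True
      then show ?thesis using n nn div[of "- Re z"]
        by (intro exI[of _ 1] exI[of _ "(- Re z) / n"]) (auto simp: side_eq complex_eq_iff power3_eq_cube)
    next
      case 2: False
      show ?thesis
      proof (cases "Re z < 0 \<and> Im z \<le> 0")
        case True
        then show ?thesis using n nn div[of "- Im z"]
          by (intro exI[of _ 2] exI[of _ "(- Im z) / n"]) (auto simp: side_eq complex_eq_iff power3_eq_cube)
      next
        case False
        with 1 2 assms have "Re z \<ge> 0" "Im z < 0" by (auto simp: complex_eq_iff) 
        then show ?thesis using n nn div[of "Re z"]
          by (intro exI[of _ 3] exI[of _ "(Re z) / n"]) (auto simp: side_eq complex_eq_iff power3_eq_cube)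
      qed
    qed
  qed
  then show ?thesis using that by (auto simp: n_def)
qed

lemma quadrilateral_boundary:
  assumes "z \<in> quadrilateral" "z \<notin> interior quadrilateral"
  obtains k s where "k < 4" "0 \<le> s" "s < 1" "z = side k s"
proof -
  have "taxi_norm z = 1" using assms mem_quadrilateral mem_interior_quadrilateral[of z] by auto
  moreover then have "z \<noteq> 0" by (auto simp: taxi_norm_def)
  ultimately show ?thesis using side_polar_exists[of z] that by (metis mult_1 of_real_1)
qed

lemma side_in_quadrilateral: "0 \<le> s \<Longrightarrow> s \<le> 1 \<Longrightarrow> side k s \<in> quadrilateral - interior quadrilateral"
  by (simp add: mem_quadrilateral mem_interior_quadrilateral taxi_norm_side)

lemma side_inj:
  assumes "side k s = side k' s'" "k < 4" "k' < 4" "0 < s" "s < 1" "0 \<le> s'" "s' \<le> 1"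
  shows "k = k' \<and> s = s'"
  using less_four_cases[OF assms(2)] less_four_cases[OF assms(3)] assms(1,4-)
  by (elim disjE) (simp_all add: side_eq complex_eq_iff power3_eq_cube)

section \<open>Surfaces and oriented quadrangulations\<close>

lemma surface_Hausdorff: "surface X \<Longrightarrow> Hausdorff_space X"
  by (simp add: surface_def)

lemma surface_chart:
  assumes "surface X" "x \<in> topspace X"
  obtains U ch \<psi> where "openin X U" "x \<in> U"
    "homeomorphic_maps (subtopology X U) (euclidean :: (real^2) topology) ch \<psi>"
proof -
  obtain U where "openin X U" "x \<in> U" "subtopology X U homeomorphic_space (euclidean :: (real^2) topology)"
    using assms unfolding surface_def by blast
  then show ?thesis using that unfolding homeomorphic_space_def by blast
qed

text \<open>In a chart this is the invariance of domain of the plane.\<close>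

lemma invariance_of_domain_into_surface:
  assumes X: "surface X" and S: "open (S :: complex set)" and h: "continuous_map (top_of_set S) X h" "inj_on h S"
  shows "openin X (h ` S)"
proof (subst openin_subopen, intro ballI)
  fix x assume "x \<in> h ` S"
  then obtain s where s: "s \<in> S" "x = h s" by auto
  have "x \<in> topspace X" using h(1) s by (auto simp: continuous_map_def)
  then obtain U ch \<psi> where U: "openin X U" "x \<in> U"
    and ch: "homeomorphic_maps (subtopology X U) (euclidean :: (real^2) topology) ch \<psi>"
    using surface_chart[OF X] by blast
  have tU: "topspace (subtopology X U) = U" using U(1) openin_subset by fastforce
  have inv: "\<psi> (ch y) = y" if "y \<in> U" for y using ch that tU by (simp add: homeomorphic_maps_def)
  define S' where "S' = {z \<in> S. h z \<in> U}"
  have "openin (top_of_set S) S'"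
    using openin_continuous_map_preimage[OF h(1) U(1)] by (simp add: S'_def)
  then have S': "open S'" using S openin_open_trans by blast
  have "continuous_map (top_of_set S') (subtopology X U) h"
    unfolding continuous_map_in_subtopology
    using continuous_map_from_subtopology_mono[OF h(1), of S'] by (auto simp: S'_def)
  moreover have "continuous_map (subtopology X U) euclidean ch" using ch by (simp add: homeomorphic_maps_def)
  ultimately have "continuous_map (top_of_set S') euclidean (ch \<circ> h)" by (rule continuous_map_compose)
  then have c: "continuous_on S' (ch \<circ> h)" by simp
  have "inj_on (ch \<circ> h) S'"
    unfolding inj_on_def comp_def
  proof (intro ballI impI)
    fix a b assume ab: "a \<in> S'" "b \<in> S'" "ch (h a) = ch (h b)"
    then have "h a = h b" using inv[of "h a"] inv[of "h b"] unfolding S'_def by (metis (no_types, lifting) mem_Collect_eq)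
    then show "a = b" using inj_onD[OF h(2), of a b] ab by (simp add: S'_def)
  qed
  then have op: "open ((ch \<circ> h) ` S')"
    using invariance_of_domain_gen[OF S' c] by simp
  have eq: "h ` S' = {y \<in> topspace (subtopology X U). ch y \<in> (ch \<circ> h) ` S'}"
  proof
    show "h ` S' \<subseteq> {y \<in> topspace (subtopology X U). ch y \<in> (ch \<circ> h) ` S'}"
      unfolding tU by (auto simp: S'_def)
    show "{y \<in> topspace (subtopology X U). ch y \<in> (ch \<circ> h) ` S'} \<subseteq> h ` S'"
    proof
      fix y assume "y \<in> {y \<in> topspace (subtopology X U). ch y \<in> (ch \<circ> h) ` S'}"
      then obtain z where z: "y \<in> U" "z \<in> S'" "ch y = ch (h z)" using tU by auto
      then have "y = h z" using inv[of y] inv[of "h z"] unfolding S'_def by (metis (no_types, lifting) mem_Collect_eq)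
      then show "y \<in> h ` S'" using z by blast
    qed
  qed
  have "openin (subtopology X U) (h ` S')"
    unfolding eq using ch op
    by (intro openin_continuous_map_preimage[where Y=euclidean]) (auto simp: homeomorphic_maps_def)
  then have "openin X (h ` S')" using U(1) by (simp add: openin_open_subtopology)
  then show "\<exists>T. openin X T \<and> x \<in> T \<and> T \<subseteq> h ` S" using s U by (auto simp: S'_def)
qed

lemma invariance_of_domain_from_surface:
  assumes X: "surface X" and N: "openin X N" and g: "continuous_map (subtopology X N) (euclidean :: complex topology) g" "inj_on g N"
  shows "open (g ` N)"
proof (rule Topological_Spaces.openI)
  fix w assume "w \<in> g ` N"
  then obtain x where x: "x \<in> N" "w = g x" by auto
  have NX: "N \<subseteq> topspace X" using N openin_subset by blast
  then obtain U ch \<psi> where U: "openin X U" "x \<in> U"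
    and ch: "homeomorphic_maps (subtopology X U) (euclidean :: (real^2) topology) ch \<psi>"
    using surface_chart[OF X] x by blast
  have tU: "topspace (subtopology X U) = U" using U(1) openin_subset by fastforce
  have \<psi>c: "continuous_map euclidean (subtopology X U) \<psi>" using ch by (simp add: homeomorphic_maps_def)
  have \<psi>U: "\<psi> v \<in> U" "ch (\<psi> v) = v" for v
  proof -
    show "\<psi> v \<in> U" using \<psi>c tU unfolding continuous_map_def by auto
    show "ch (\<psi> v) = v" using ch unfolding homeomorphic_maps_def by simp
  qed
  define S where "S = {v. \<psi> v \<in> N}"
  have "openin (subtopology X U) (U \<inter> N)" using N by (simp add: openin_subtopology_Int2)
  from openin_continuous_map_preimage[OF \<psi>c this] have S: "open S"
    using \<psi>U by (simp add: S_def)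
  have "continuous_map euclidean X \<psi>" using \<psi>c continuous_map_in_subtopology by blast
  from continuous_map_from_subtopology[OF this, of S]
  have "continuous_map (top_of_set S) (subtopology X N) \<psi>"
    unfolding continuous_map_in_subtopology by (auto simp: S_def)
  then have "continuous_map (top_of_set S) euclidean (g \<circ> \<psi>)" using g(1) by (rule continuous_map_compose)
  then have c: "continuous_on S (g \<circ> \<psi>)" by simp
  have "inj_on (g \<circ> \<psi>) S"
  proof (rule inj_onI)
    fix a b assume ab: "a \<in> S" "b \<in> S" "(g \<circ> \<psi>) a = (g \<circ> \<psi>) b"
    then have "\<psi> a = \<psi> b" using inj_onD[OF g(2), of "\<psi> a" "\<psi> b"] unfolding S_def comp_def by blast
    then show "a = b" using \<psi>U(2)[of a] \<psi>U(2)[of b] by metis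
  qed
  then have "open ((g \<circ> \<psi>) ` S)" using invariance_of_domain_gen[OF S c] by simp
  moreover have "w \<in> (g \<circ> \<psi>) ` S"
  proof -
    have "\<psi> (ch x) = x" using ch U(2) tU by (simp add: homeomorphic_maps_def)
    then show ?thesis using x by (auto simp: S_def intro!: image_eqI[of _ _ "ch x"])
  qed
  moreover have "(g \<circ> \<psi>) ` S \<subseteq> g ` N" by (auto simp: S_def)
  ultimately show "\<exists>T. open T \<and> w \<in> T \<and> T \<subseteq> g ` N" by blast
qed

text \<open>An injective continuous function on an interval is monotone.\<close>

lemma interval_homeo_ends:
  fixes f :: "real \<Rightarrow> real"
  assumes c: "continuous_on {0..1} f" and inj: "inj_on f {0..1}" and im: "f ` {0..1} = {0..1}"
  shows "{f 0, f 1} = {0, 1}"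
proof -
  have f01: "0 \<le> f x \<and> f x \<le> 1" if "0 \<le> x" "x \<le> 1" for x
  proof -
    have "f x \<in> f ` {0..1}" using that by simp
    then show ?thesis unfolding im by simp
  qed
  have ends: "x = 0 \<or> x = 1" if x: "0 \<le> x" "x \<le> 1" "f x = 0 \<or> f x = 1" for x
  proof (rule ccontr)
    assume "\<not> ?thesis"
    then have "0 < x" "x < 1" using x by auto
    from continuous_inj_imp_mono[OF this c inj]
    have "(f 0 < f x \<and> f x < f 1) \<or> (f 1 < f x \<and> f x < f 0)" .
    then show False using x(3) f01[of 0] f01[of 1] by auto
  qed
  have "0 \<in> f ` {0..1}" "1 \<in> f ` {0..1}" unfolding im by simp_all
  then obtain a b where a: "a \<in> {0..1}" "0 = f a" and b: "b \<in> {0..1}" "1 = f b"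
    unfolding image_iff by blast
  have "a = 0 \<or> a = 1" "b = 0 \<or> b = 1" using ends[of a] ends[of b] a b by auto
  then show ?thesis using a(2) b(2) by auto
qed

lemma homeomorphic_map_compact_Hausdorff:
  assumes "compact S" "Hausdorff_space X" "continuous_map (top_of_set S) X f" "inj_on f S"
  shows "homeomorphic_map (top_of_set S) (subtopology X (f ` S)) f"
proof -
  have "compact_space (top_of_set S)" using assms(1) by (simp add: compact_space_subtopology)
  moreover have "inj_on f (topspace (top_of_set S))" using assms(4) by simp
  ultimately have "embedding_map (top_of_set S) X f"
    using assms continuous_imp_embedding_map by blast
  then show ?thesis by (simp add: embedding_map_def)
qed

text \<open>The existence of a face orientation already implies that all faces are quadrilaterals.\<close>

locale oriented_quadrangulation =
  fixes X :: "'a topology" and V :: "'a set" and E :: "'a set set" and \<Phi> :: "'a set \<Rightarrow> complex \<Rightarrow> 'a"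
  assumes X: "surface X" and graph: "embedded_graph X V E" and \<Phi>: "face_orientation X V E \<Phi>"
begin

abbreviation "Faces \<equiv> faces X V E"
abbreviation "Q \<equiv> quadrilateral"

definition side_edge :: "'a set \<Rightarrow> nat \<Rightarrow> 'a set" where
  "side_edge f j = (\<Phi> f \<circ> side j) ` {0..1}"

definition corner :: "'a set \<Rightarrow> nat \<Rightarrow> 'a" where
  "corner f j = \<Phi> f (\<i> ^ j)"

lemma Hausdorff: "Hausdorff_space X" using X surface_Hausdorff by blast

lemma corner_4: "corner f 4 = corner f 0"
  by (simp add: corner_def)

lemma finite_V: "finite V" and finite_E: "finite E" and V_space: "V \<subseteq> topspace X"
  using graph by (auto simp: embedded_graph_def)

lemma edge_arc:
  assumes "e \<in> E"
  obtains \<gamma> where "embedding_map (top_of_set {0..1::real}) X \<gamma>" "e = \<gamma> ` {0..1}" "e \<inter> V = {\<gamma> 0, \<gamma> 1}"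
proof -
  have "\<forall>e \<in> E. \<exists>\<gamma>. embedding_map (top_of_set {0..1::real}) X \<gamma> \<and> e = \<gamma> ` {0..1} \<and> e \<inter> V = {\<gamma> 0, \<gamma> 1}"
    using graph unfolding embedded_graph_def by (elim conjE)
  from bspec[OF this assms] show ?thesis by (elim exE conjE) (rule that)
qed

lemma edges_meet: "e \<in> E \<Longrightarrow> e' \<in> E \<Longrightarrow> x \<in> e \<Longrightarrow> x \<in> e' \<Longrightarrow> x \<notin> V \<Longrightarrow> e = e'"
proof -
  have "\<forall>e \<in> E. \<forall>e' \<in> E. e \<noteq> e' \<longrightarrow> e \<inter> e' \<subseteq> V"
    using graph unfolding embedded_graph_def by (elim conjE)
  then show "e \<in> E \<Longrightarrow> e' \<in> E \<Longrightarrow> x \<in> e \<Longrightarrow> x \<in> e' \<Longrightarrow> x \<notin> V \<Longrightarrow> e = e'" by (meson IntI subsetD)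
qed

lemma edge_space: "e \<in> E \<Longrightarrow> e \<subseteq> topspace X"
proof -
  assume "e \<in> E"
  then obtain \<gamma> where \<gamma>: "embedding_map (top_of_set {0..1::real}) X \<gamma>" "e = \<gamma> ` {0..1}" using edge_arc by blast
  then have "continuous_map (top_of_set {0..1}) X \<gamma>"
    using continuous_map_in_subtopology homeomorphic_imp_continuous_map unfolding embedding_map_def by blast
  then show ?thesis using \<gamma>(2) by (auto simp: continuous_map_def)
qed

lemma face_disjoint: "f \<in> Faces \<Longrightarrow> f \<inter> (V \<union> \<Union>E) = {}" and face_space: "f \<in> Faces \<Longrightarrow> f \<subseteq> topspace X"
proof -
  assume "f \<in> Faces"
  then have "f \<subseteq> topspace (subtopology X (topspace X - (V \<union> \<Union>E)))"
    unfolding faces_def by (rule connected_components_of_subset)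
  then show "f \<inter> (V \<union> \<Union>E) = {}" "f \<subseteq> topspace X" by auto
qed

lemma faces_disjoint: "f \<in> Faces \<Longrightarrow> f' \<in> Faces \<Longrightarrow> x \<in> f \<Longrightarrow> x \<in> f' \<Longrightarrow> f = f'"
  unfolding faces_def using connected_components_of_overlap by blast

lemma Union_faces: "\<Union>Faces = topspace X - (V \<union> \<Union>E)"
  unfolding faces_def by (auto simp: Union_connected_components_of)

lemma face:
  assumes "f \<in> Faces"
  shows "continuous_map (top_of_set Q) X (\<Phi> f)" "\<Phi> f ` interior Q = f" "inj_on (\<Phi> f) (interior Q)"
    "j < 4 \<Longrightarrow> side_edge f j \<in> E"
    "j < 4 \<Longrightarrow> homeomorphic_map (top_of_set {0..1}) (subtopology X (side_edge f j)) (\<Phi> f \<circ> side j)"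
proof -
  have o: "oriented_quadrilateral_face X E f (\<Phi> f)" using \<Phi> assms by (auto simp: face_orientation_def)
  then show "continuous_map (top_of_set Q) X (\<Phi> f)" by (auto simp: oriented_quadrilateral_face_def)
  have h: "homeomorphic_map (top_of_set (interior Q)) (subtopology X f) (\<Phi> f)"
    using o by (auto simp: oriented_quadrilateral_face_def)
  show "\<Phi> f ` interior Q = f"
    using homeomorphic_imp_surjective_map[OF h] face_space[OF assms] by (simp add: Int_absorb1)
  show "inj_on (\<Phi> f) (interior Q)" using homeomorphic_imp_injective_map[OF h] by simp
  have *: "side_edge f j \<in> E \<and> homeomorphic_map (top_of_set {0..1}) (subtopology X (side_edge f j)) (\<Phi> f \<circ> side j)"
    if j: "j < 4"
  proof -
    obtain e where e: "e \<in> E" "homeomorphic_map (top_of_set {0..1}) (subtopology X e) (\<Phi> f \<circ> side j)"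
      using o j unfolding oriented_quadrilateral_face_def by meson
    have "side_edge f j = e"
      using homeomorphic_imp_surjective_map[OF e(2)] edge_space[OF e(1)]
      by (simp add: side_edge_def Int_absorb1)
    then show ?thesis using e by simp
  qed
  show "j < 4 \<Longrightarrow> side_edge f j \<in> E"
    "j < 4 \<Longrightarrow> homeomorphic_map (top_of_set {0..1}) (subtopology X (side_edge f j)) (\<Phi> f \<circ> side j)"
    using * by blast+
qed

text \<open>By this comparison with the embedding of the edge, its two ends are the two corners of the side.\<close>

lemma arc_parameters:
  assumes f: "f \<in> Faces" "j < 4" and \<gamma>: "embedding_map (top_of_set {0..1::real}) X \<gamma>" "side_edge f j = \<gamma> ` {0..1}"
  obtains \<tau> where "continuous_on {0..1} \<tau>" "inj_on \<tau> {0..1}" "\<tau> ` {0..1} = {0..1}" "{\<tau> 0, \<tau> 1} = {0, 1::real}"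
    "\<And>s. s \<in> {0..1} \<Longrightarrow> \<Phi> f (side j (\<tau> s)) = \<gamma> s"
proof -
  let ?I = "{0..1::real}" and ?e = "side_edge f j"
  have h: "homeomorphic_map (top_of_set ?I) (subtopology X ?e) (\<Phi> f \<circ> side j)" using face f by blast
  then obtain k where k: "homeomorphic_maps (top_of_set ?I) (subtopology X ?e) (\<Phi> f \<circ> side j) k"
    using homeomorphic_map_maps by blast
  have g: "homeomorphic_map (top_of_set ?I) (subtopology X ?e) \<gamma>" using \<gamma> by (simp add: embedding_map_def)
  have "homeomorphic_map (subtopology X ?e) (top_of_set ?I) k"
    using k homeomorphic_maps_map by blast
  then have kg: "homeomorphic_map (top_of_set ?I) (top_of_set ?I) (k \<circ> \<gamma>)"
    using homeomorphic_map_compose[OF g] by blast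
  have c: "continuous_on ?I (k \<circ> \<gamma>)" "inj_on (k \<circ> \<gamma>) ?I" "(k \<circ> \<gamma>) ` ?I = ?I"
    using homeomorphic_imp_continuous_map[OF kg] homeomorphic_imp_injective_map[OF kg]
      homeomorphic_imp_surjective_map[OF kg] by (auto simp: continuous_map_in_subtopology)
  have "topspace (subtopology X ?e) = ?e"
    using edge_space face(4)[OF f] by (simp add: Int_absorb1)
  then have "\<Phi> f (side j ((k \<circ> \<gamma>) s)) = \<gamma> s" if "s \<in> ?I" for s
    using k that \<gamma>(2) by (auto simp: homeomorphic_maps_def)
  then show ?thesis using that[of "k \<circ> \<gamma>"] c interval_homeo_ends[OF c] by blast
qed

lemma side_edge_ends:
  assumes f: "f \<in> Faces" "j < 4"
  shows "side_edge f j \<inter> V = {corner f j, corner f (Suc j)}" "corner f j \<noteq> corner f (Suc j)"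
proof -
  obtain \<gamma> where \<gamma>: "embedding_map (top_of_set {0..1::real}) X \<gamma>" "side_edge f j = \<gamma> ` {0..1}"
    "side_edge f j \<inter> V = {\<gamma> 0, \<gamma> 1}" using edge_arc face(4)[OF f] by metis
  obtain \<tau> where t: "{\<tau> 0, \<tau> 1} = {0, 1::real}"
    "\<And>s. s \<in> {0..1} \<Longrightarrow> \<Phi> f (side j (\<tau> s)) = \<gamma> s" using arc_parameters[OF f \<gamma>(1,2)] by metis
  have *: "\<tau> 0 = 0 \<and> \<tau> 1 = 1 \<or> \<tau> 0 = 1 \<and> \<tau> 1 = 0" using t(1) by (auto simp: doubleton_eq_iff)
  then have "{\<gamma> 0, \<gamma> 1} = {corner f j, corner f (Suc j)}"
    using t(2)[of 0] t(2)[of 1] by (auto simp: corner_def)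
  then show "side_edge f j \<inter> V = {corner f j, corner f (Suc j)}" using \<gamma>(3) by simp
  have "inj_on (\<Phi> f \<circ> side j) {0..1}"
    using homeomorphic_imp_injective_map[OF face(5)[OF f]] by simp
  then show "corner f j \<noteq> corner f (Suc j)"
    using inj_onD[of "\<Phi> f \<circ> side j" "{0..1}" 0 1] by (auto simp: corner_def)
qed

lemma side_not_vertex:
  assumes f: "f \<in> Faces" "j < 4" and s: "0 < s" "s < 1"
  shows "\<Phi> f (side j s) \<in> side_edge f j" "\<Phi> f (side j s) \<notin> V"
proof -
  show e: "\<Phi> f (side j s) \<in> side_edge f j" using s by (auto simp: side_edge_def)
  have inj: "inj_on (\<Phi> f \<circ> side j) {0..1}"
    using homeomorphic_imp_injective_map[OF face(5)[OF f]] by simp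
  have "\<Phi> f (side j s) \<noteq> corner f j" "\<Phi> f (side j s) \<noteq> corner f (Suc j)"
    using inj_onD[OF inj, of s 0] inj_onD[OF inj, of s 1] s by (auto simp: corner_def)
  then show "\<Phi> f (side j s) \<notin> V" using side_edge_ends(1)[OF f] e by blast
qed

end

section \<open>An edge has at most two sides\<close>

lemma scaled_side_inj:
  assumes eq: "of_real r * side j s = of_real r' * side j' s'" and "0 < r" "0 < r'"
    and "j < 4" "j' < 4" "0 < s" "s < 1" "0 \<le> s'" "s' \<le> 1"
  shows "r = r' \<and> j = j' \<and> s = s'"
proof -
  have "taxi_norm (of_real r * side j s) = r" "taxi_norm (of_real r' * side j' s') = r'"
    using assms(2-) by (simp_all add: taxi_norm_scale taxi_norm_side)
  then have r: "r = r'" unfolding eq by simp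
  then have "side j s = side j' s'" using eq \<open>0 < r\<close> by simp
  then show ?thesis using side_inj r assms by blast
qed

lemma scaled_side_interior: "0 \<le> r \<Longrightarrow> r < 1 \<Longrightarrow> 0 \<le> s \<Longrightarrow> s \<le> 1 \<Longrightarrow> of_real r * side j s \<in> interior quadrilateral"
  by (simp add: mem_interior_quadrilateral taxi_norm_scale taxi_norm_side)

lemma scaled_side_quadrilateral: "0 \<le> r \<Longrightarrow> r \<le> 1 \<Longrightarrow> 0 \<le> s \<Longrightarrow> s \<le> 1 \<Longrightarrow> of_real r * side j s \<in> quadrilateral"
  by (simp add: mem_quadrilateral taxi_norm_scale taxi_norm_side)

definition half_strip :: "complex set" where
  "half_strip = {z. 0 < Re z \<and> Re z < 1 \<and> 0 \<le> Im z \<and> Im z < 1}"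

lemma mem_half_strip: "z \<in> half_strip \<longleftrightarrow> 0 < Re z \<and> Re z < 1 \<and> 0 \<le> Im z \<and> Im z < 1"
  by (simp add: half_strip_def)

context oriented_quadrangulation begin

text \<open>A page is a one-sided neighborhood of the interior of an edge. It parametrizes a part of the
  triangle spanned by side \<open>j\<close> of \<open>f\<close> and the center of the face in such a way that the pages of all
  sides of one edge agree on the edge itself.\<close>

definition page :: "'a set \<Rightarrow> nat \<Rightarrow> (real \<Rightarrow> 'a) \<Rightarrow> (complex \<Rightarrow> 'a) \<Rightarrow> bool" where
  "page f j \<gamma> P \<longleftrightarrow> continuous_map (top_of_set half_strip) X P \<and> inj_on P half_strip \<and>
     (\<forall>z \<in> half_strip. Im z = 0 \<longrightarrow> P z = \<gamma> (Re z)) \<and>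
     (\<forall>z \<in> half_strip. Im z > 0 \<longrightarrow>
        (\<exists>r s. 0 < r \<and> r < 1 \<and> 0 < s \<and> s < 1 \<and> P z = \<Phi> f (of_real r * side j s)))"

lemma pageD:
  assumes "page f j \<gamma> P"
  shows "continuous_map (top_of_set half_strip) X P" "inj_on P half_strip"
    "\<And>z. z \<in> half_strip \<Longrightarrow> Im z = 0 \<Longrightarrow> P z = \<gamma> (Re z)"
    "\<And>z. z \<in> half_strip \<Longrightarrow> Im z > 0 \<Longrightarrow> \<exists>r s. 0 < r \<and> r < 1 \<and> 0 < s \<and> s < 1 \<and> P z = \<Phi> f (of_real r * side j s)"
  using assms unfolding page_def by blast+

lemma page_exists:
  assumes f: "f \<in> Faces" "j < 4" and \<gamma>: "embedding_map (top_of_set {0..1::real}) X \<gamma>" "side_edge f j = \<gamma> ` {0..1}"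
  obtains P where "page f j \<gamma> P"
proof -
  obtain \<tau> where \<tau>: "continuous_on {0..1} \<tau>" "inj_on \<tau> {0..1}" "\<tau> ` {0..1} = {0..1}" "{\<tau> 0, \<tau> 1} = {0, 1::real}"
    and \<tau>\<gamma>: "\<And>s. s \<in> {0..1} \<Longrightarrow> \<Phi> f (side j (\<tau> s)) = \<gamma> s" using arc_parameters[OF f \<gamma>] by metis
  have \<tau>01: "0 < \<tau> s \<and> \<tau> s < 1" if s: "0 < s" "s < 1" for s
  proof -
    have "\<tau> s \<in> \<tau> ` {0..1}" using s by simp
    then have "0 \<le> \<tau> s \<and> \<tau> s \<le> 1" unfolding \<tau>(3) by simp
    moreover have "\<tau> s \<noteq> \<tau> 0" "\<tau> s \<noteq> \<tau> 1" using inj_onD[OF \<tau>(2), of s 0] inj_onD[OF \<tau>(2), of s 1] s by auto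
    then have "\<tau> s \<noteq> 0" "\<tau> s \<noteq> 1" using \<tau>(4) by (auto simp: doubleton_eq_iff)
    ultimately show ?thesis by linarith
  qed
  define P where "P z = \<Phi> f (of_real (1 - Im z) * side j (\<tau> (Re z)))" for z
  have P0: "P z = \<gamma> (Re z)" if "z \<in> half_strip" "Im z = 0" for z
    using \<tau>\<gamma>[of "Re z"] that by (simp add: P_def mem_half_strip)
  have Pr: "0 < 1 - Im z \<and> 1 - Im z < 1 \<and> 0 < \<tau> (Re z) \<and> \<tau> (Re z) < 1" if "z \<in> half_strip" "Im z > 0" for z
    using \<tau>01[of "Re z"] that by (simp add: mem_half_strip)
  have Pf: "P z \<in> f" if "z \<in> half_strip" "Im z > 0" for z
  proof -
    have "of_real (1 - Im z) * side j (\<tau> (Re z)) \<in> interior Q"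
      using Pr[OF that] by (intro scaled_side_interior) auto
    then show ?thesis using face(2)[OF f(1)] unfolding P_def by blast
  qed
  have Pe: "P z \<in> \<Union>E" if "z \<in> half_strip" "Im z = 0" for z
  proof -
    have "P z \<in> side_edge f j" using P0[OF that] that \<gamma>(2) by (auto simp: mem_half_strip)
    then show ?thesis using face(4)[OF f] by blast
  qed
  have c: "continuous_map (top_of_set half_strip) X P"
  proof -
    have "continuous_on half_strip (\<lambda>z. of_real (1 - Im z) * side j (\<tau> (Re z)))"
      by (intro continuous_intros continuous_on_compose2[OF continuous_on_side[of UNIV]]
          continuous_on_compose2[OF \<tau>(1)]) (auto simp: mem_half_strip)
    moreover have "of_real (1 - Im z) * side j (\<tau> (Re z)) \<in> Q" if "z \<in> half_strip" for z
      using that \<tau>01[of "Re z"] by (intro scaled_side_quadrilateral) (auto simp: mem_half_strip)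
    ultimately have "continuous_map (top_of_set half_strip) (top_of_set Q) (\<lambda>z. of_real (1 - Im z) * side j (\<tau> (Re z)))"
      by auto
    from continuous_map_compose[OF this face(1)[OF f(1)]] show ?thesis by (simp add: P_def[abs_def] o_def)
  qed
  have inj: "inj_on P half_strip"
  proof (rule inj_onI)
    fix z w assume zw: "z \<in> half_strip" "w \<in> half_strip" and eq: "P z = P w"
    have fE: "f \<inter> \<Union>E = {}" using face_disjoint[OF f(1)] by auto
    consider "Im z > 0" "Im w > 0" | "Im z = 0" "Im w = 0" | "Im z > 0" "Im w = 0" | "Im z = 0" "Im w > 0"
      using zw by (auto simp: mem_half_strip le_less)
    then show "z = w"
    proof cases
      case 1
      have "of_real (1 - Im z) * side j (\<tau> (Re z)) = of_real (1 - Im w) * side j (\<tau> (Re w))"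
      proof (rule inj_onD[OF face(3)[OF f(1)]])
        show "\<Phi> f (of_real (1 - Im z) * side j (\<tau> (Re z))) = \<Phi> f (of_real (1 - Im w) * side j (\<tau> (Re w)))"
          using eq by (simp add: P_def)
        show "of_real (1 - Im z) * side j (\<tau> (Re z)) \<in> interior Q"
          using Pr[OF zw(1) 1(1)] by (intro scaled_side_interior) auto
        show "of_real (1 - Im w) * side j (\<tau> (Re w)) \<in> interior Q"
          using Pr[OF zw(2) 1(2)] by (intro scaled_side_interior) auto
      qed
      from scaled_side_inj[OF this] have "1 - Im z = 1 - Im w \<and> \<tau> (Re z) = \<tau> (Re w)"
        using Pr[OF zw(1) 1(1)] Pr[OF zw(2) 1(2)] f(2) by auto
      moreover then have "Re z = Re w" using inj_onD[OF \<tau>(2), of "Re z" "Re w"] zw by (auto simp: mem_half_strip)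
      ultimately show ?thesis by (simp add: complex_eq_iff)
    next
      case 2
      have "inj_on \<gamma> {0..1}"
        using \<gamma>(1) homeomorphic_imp_injective_map unfolding embedding_map_def by fastforce
      then have "Re z = Re w"
        using inj_onD[of \<gamma> "{0..1}" "Re z" "Re w"] eq P0[OF zw(1) 2(1)] P0[OF zw(2) 2(2)] zw by (auto simp: mem_half_strip)
      then show ?thesis using 2 by (simp add: complex_eq_iff)
    next
      case 3
      then show ?thesis using Pf[OF zw(1)] Pe[OF zw(2)] eq fE by auto
    next
      case 4
      then show ?thesis using Pf[OF zw(2)] Pe[OF zw(1)] eq fE by auto
    qed
  qed
  have "\<exists>r s. 0 < r \<and> r < 1 \<and> 0 < s \<and> s < 1 \<and> P z = \<Phi> f (of_real r * side j s)"
    if h: "z \<in> half_strip" "Im z > 0" for z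
    using Pr[OF h] P_def by (intro exI[of _ "1 - Im z"] exI[of _ "\<tau> (Re z)"]) simp
  then have "page f j \<gamma> P" unfolding page_def using c inj P0 by blast
  then show ?thesis by (rule that)
qed

lemma triangles_disjoint:
  assumes "f \<in> Faces" "j < 4" "f' \<in> Faces" "j' < 4" "(f, j) \<noteq> (f', j')"
    and "0 < r" "r < 1" "0 < s" "s < 1" "0 < r'" "r' < 1" "0 < s'" "s' < 1"
  shows "\<Phi> f (of_real r * side j s) \<noteq> \<Phi> f' (of_real r' * side j' s')"
proof
  assume eq: "\<Phi> f (of_real r * side j s) = \<Phi> f' (of_real r' * side j' s')"
  have i: "of_real r * side j s \<in> interior Q" "of_real r' * side j' s' \<in> interior Q"
    using assms by (auto intro!: scaled_side_interior)
  then have "\<Phi> f (of_real r * side j s) \<in> f" "\<Phi> f' (of_real r' * side j' s') \<in> f'"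
    using face(2) assms by blast+
  then have ff: "f = f'" using faces_disjoint assms(1,3) eq by auto
  then have "of_real r * side j s = of_real r' * side j' s'"
    using inj_onD[OF face(3)[OF assms(1)], of "of_real r * side j s" "of_real r' * side j' s'"] eq i by simp
  from scaled_side_inj[OF this] have "j = j'" using assms by auto
  then show False using ff assms(5) by simp
qed

text \<open>Two pages at an edge form an open subset of the surface, by the invariance of domain. A third page
  would have to enter this subset close to the edge.\<close>

lemma at_most_two_sides:
  assumes f: "f \<in> Faces" "j < 4" "side_edge f j = e" and f': "f' \<in> Faces" "j' < 4" "side_edge f' j' = e"
    and f'': "f'' \<in> Faces" "j'' < 4" "side_edge f'' j'' = e"
    and ne: "(f, j) \<noteq> (f', j')" "(f, j) \<noteq> (f'', j'')" "(f', j') \<noteq> (f'', j'')"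
  shows False
proof -
  have eE: "e \<in> E" using face(4)[OF f(1,2)] f(3) by simp
  then obtain \<gamma> where \<gamma>: "embedding_map (top_of_set {0..1::real}) X \<gamma>" "e = \<gamma> ` {0..1}" using edge_arc by blast
  have "side_edge f j = \<gamma> ` {0..1}" "side_edge f' j' = \<gamma> ` {0..1}" "side_edge f'' j'' = \<gamma> ` {0..1}"
    using f f' f'' \<gamma> by simp_all
  note se = this
  obtain P where "page f j \<gamma> P" by (rule page_exists[OF f(1,2) \<gamma>(1) se(1)])
  note P = pageD[OF this]
  obtain P' where "page f' j' \<gamma> P'" by (rule page_exists[OF f'(1,2) \<gamma>(1) se(2)])
  note P' = pageD[OF this]
  obtain P'' where "page f'' j'' \<gamma> P''" by (rule page_exists[OF f''(1,2) \<gamma>(1) se(3)])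
  note P'' = pageD[OF this]
  have dPP': "P z \<noteq> P' w" if h: "z \<in> half_strip" "Im z > 0" "w \<in> half_strip" "Im w > 0" for z w
  proof -
    obtain r s r' s' where "0 < r" "r < 1" "0 < s" "s < 1" "P z = \<Phi> f (of_real r * side j s)"
      "0 < r'" "r' < 1" "0 < s'" "s' < 1" "P' w = \<Phi> f' (of_real r' * side j' s')"
      using P(4)[OF h(1,2)] P'(4)[OF h(3,4)] by blast
    then show ?thesis using triangles_disjoint[OF f(1,2) f'(1,2) ne(1)] by simp
  qed
  have dPP'': "P z \<noteq> P'' w" if h: "z \<in> half_strip" "Im z > 0" "w \<in> half_strip" "Im w > 0" for z w
  proof -
    obtain r s r' s' where "0 < r" "r < 1" "0 < s" "s < 1" "P z = \<Phi> f (of_real r * side j s)"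
      "0 < r'" "r' < 1" "0 < s'" "s' < 1" "P'' w = \<Phi> f'' (of_real r' * side j'' s')"
      using P(4)[OF h(1,2)] P''(4)[OF h(3,4)] by blast
    then show ?thesis using triangles_disjoint[OF f(1,2) f''(1,2) ne(2)] by simp
  qed
  have dP'P'': "P' z \<noteq> P'' w" if h: "z \<in> half_strip" "Im z > 0" "w \<in> half_strip" "Im w > 0" for z w
  proof -
    obtain r s r' s' where "0 < r" "r < 1" "0 < s" "s < 1" "P' z = \<Phi> f' (of_real r * side j' s)"
      "0 < r'" "r' < 1" "0 < s'" "s' < 1" "P'' w = \<Phi> f'' (of_real r' * side j'' s')"
      using P'(4)[OF h(1,2)] P''(4)[OF h(3,4)] by blast
    then show ?thesis using triangles_disjoint[OF f'(1,2) f''(1,2) ne(3)] by simp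
  qed
  have notE: "\<Phi> g (of_real r * side k s) \<notin> \<Union>E" if "g \<in> Faces" "0 < r" "r < 1" "0 < s" "s < 1" for g r k s
  proof -
    have "of_real r * side k s \<in> interior Q" using that by (auto intro!: scaled_side_interior)
    then have "\<Phi> g (of_real r * side k s) \<in> g" using face(2)[OF that(1)] by blast
    then show ?thesis using face_disjoint[OF that(1)] by blast
  qed
  have nP: "P z \<notin> \<Union>E" if "z \<in> half_strip" "Im z > 0" for z using P(4)[OF that] notE[OF f(1)] by metis
  have nP': "P' z \<notin> \<Union>E" if "z \<in> half_strip" "Im z > 0" for z using P'(4)[OF that] notE[OF f'(1)] by metis
  have nP'': "P'' z \<notin> \<Union>E" if "z \<in> half_strip" "Im z > 0" for z using P''(4)[OF that] notE[OF f''(1)] by metis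
  have \<gamma>E: "\<gamma> s \<in> \<Union>E" if "0 < s" "s < 1" for s using that eE \<gamma>(2) by (intro UnionI[of e]) auto
  define D where "D = {z. 0 < Re z \<and> Re z < 1 \<and> -1 < Im z \<and> Im z < 1}"
  have D: "open D" unfolding D_def
    by (intro open_Collect_conj open_Collect_less continuous_intros)
  \<comment> \<open>Two pages, laid together along the edge.\<close>
  define H where "H z = (if 0 \<le> Im z then P z else P' (cnj z))" for z
  have DH: "z \<in> half_strip" if "z \<in> D" "0 \<le> Im z" for z using that by (simp add: D_def mem_half_strip)
  have DH': "cnj z \<in> half_strip" if "z \<in> D" "Im z \<le> 0" for z using that by (simp add: D_def mem_half_strip)
  have "continuous_map (top_of_set D) X H"
    unfolding H_def
  proof (rule continuous_map_cases_le)
    have "{z \<in> topspace (top_of_set D). 0 \<le> Im z} \<subseteq> half_strip" using DH by auto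
    then show "continuous_map (subtopology (top_of_set D) {z \<in> topspace (top_of_set D). 0 \<le> Im z}) X P"
      using continuous_map_from_subtopology_mono[OF P(1)] by (simp add: subtopology_subtopology Int_absorb1 subset_iff)
    have "continuous_map (top_of_set {z \<in> D. Im z \<le> 0}) (top_of_set half_strip) cnj"
      using DH' by (auto intro: continuous_intros)
    from continuous_map_compose[OF this P'(1)]
    show "continuous_map (subtopology (top_of_set D) {z \<in> topspace (top_of_set D). Im z \<le> 0}) X (\<lambda>z. P' (cnj z))"
      by (simp add: subtopology_subtopology Int_absorb1 o_def subset_iff)
    fix z assume "z \<in> topspace (top_of_set D)" "0 = Im z"
    then show "P z = P' (cnj z)" using P(3)[of z] P'(3)[of "cnj z"] DH[of z] DH'[of z] by simp
  qed (auto intro: continuous_intros)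
  moreover have "inj_on H D"
  proof (rule inj_onI)
    fix z w assume zw: "z \<in> D" "w \<in> D" and eq: "H z = H w"
    consider "0 \<le> Im z" "0 \<le> Im w" | "Im z < 0" "Im w < 0" | "0 \<le> Im z" "Im w < 0" | "Im z < 0" "0 \<le> Im w" by linarith
    then show "z = w"
    proof cases
      case 1
      then show ?thesis using inj_onD[OF P(2), of z w] eq DH zw by (simp add: H_def)
    next
      case 2
      then have "cnj z = cnj w" using inj_onD[OF P'(2), of "cnj z" "cnj w"] eq DH' zw by (simp add: H_def)
      then show ?thesis by simp
    next
      case 3
      then have e: "P z = P' (cnj w)" using eq by (simp add: H_def)
      have w: "cnj w \<in> half_strip" "Im (cnj w) > 0" using DH' zw 3 by auto
      have "Im z = 0 \<Longrightarrow> P z \<in> \<Union>E" using P(3)[OF DH[OF zw(1)]] \<gamma>E[of "Re z"] zw(1) by (simp add: D_def)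
      then show ?thesis using e nP'[OF w] dPP'[OF DH[OF zw(1) 3(1)] _ w] 3 by (cases "Im z = 0") auto
    next
      case 4
      then have e: "P w = P' (cnj z)" using eq by (simp add: H_def)
      have w: "cnj z \<in> half_strip" "Im (cnj z) > 0" using DH' zw 4 by auto
      have "Im w = 0 \<Longrightarrow> P w \<in> \<Union>E" using P(3)[OF DH[OF zw(2)]] \<gamma>E[of "Re w"] zw(2) by (simp add: D_def)
      then show ?thesis using e nP'[OF w] dPP'[OF DH[OF zw(2) 4(2)] _ w] 4 by (cases "Im w = 0") auto
    qed
  qed
  ultimately have HO: "openin X (H ` D)" using invariance_of_domain_into_surface[OF X D] by blast
  let ?m = "Complex (1/2) 0"
  have "P'' ?m = H ?m" using P(3)[of ?m] P''(3)[of ?m] by (simp add: H_def mem_half_strip)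
  then have m: "P'' ?m \<in> H ` D" by (auto simp: D_def)
  have "openin (top_of_set half_strip) {z \<in> half_strip. P'' z \<in> H ` D}"
    using openin_continuous_map_preimage[OF P''(1) HO] by simp
  moreover have "?m \<in> {z \<in> half_strip. P'' z \<in> H ` D}" using m by (simp add: mem_half_strip)
  ultimately obtain d where d: "d > 0" "ball ?m d \<inter> half_strip \<subseteq> {z \<in> half_strip. P'' z \<in> H ` D}"
    unfolding openin_contains_ball by blast
  define r where "r = min (d/2) (1/2)"
  have r: "0 < r" "r < 1" "r < d" using d(1) by (auto simp: r_def)
  have zs: "Complex (1/2) r \<in> half_strip" using r by (simp add: mem_half_strip)
  have "dist ?m (Complex (1/2) r) = r" using r by (simp add: dist_norm cmod_def)
  then have "Complex (1/2) r \<in> ball ?m d" using r by simp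
  then obtain w where w: "w \<in> D" "P'' (Complex (1/2) r) = H w" using d(2) zs by blast
  show False
  proof (cases "0 \<le> Im w")
    case True
    then have e: "P'' (Complex (1/2) r) = P w" using w by (simp add: H_def)
    show False
    proof (cases "Im w = 0")
      case True
      then have "P w \<in> \<Union>E" using P(3)[OF DH[OF w(1)]] \<gamma>E[of "Re w"] w(1) by (simp add: D_def)
      then show False using nP''[OF zs] e r by simp
    next
      case False
      then show False using dPP''[OF DH[OF w(1) True] _ zs] e r True by simp
    qed
  next
    case False
    then show False using dP'P''[OF DH'[OF w(1)] _ zs] w r by (simp add: H_def)
  qed
qed

text \<open>There are finitely many edges, each of which belongs to at most two faces.\<close>

lemma finite_faces: "finite Faces"
proof (rule ccontr)
  assume inf: "infinite Faces"
  have "(\<lambda>f. side_edge f 0) ` Faces \<subseteq> E" using face(4)[of _ 0] by auto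
  then have "finite ((\<lambda>f. side_edge f 0) ` Faces)" using finite_E finite_subset by blast
  from pigeonhole_infinite[OF inf this] obtain f0 where "infinite {f \<in> Faces. side_edge f 0 = side_edge f0 0}" by blast
  then obtain B where B: "finite B" "card B = 3" "B \<subseteq> {f \<in> Faces. side_edge f 0 = side_edge f0 0}"
    using infinite_arbitrarily_large by blast
  then obtain a b c where "B = {a,b,c}" "a \<noteq> b" "a \<noteq> c" "b \<noteq> c" by (auto simp: card_3_iff)
  then show False using B(3) at_most_two_sides[of a 0 "side_edge f0 0" b 0 c 0] by auto
qed

end

section \<open>An edge has two sides\<close>

lemma real_line_no_interior:
  assumes "open S" "S \<subseteq> {z. Im z = 0}" shows "S = {}"
proof (rule ccontr)
  assume "S \<noteq> {}"
  then obtain z where z: "z \<in> S" by blast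
  then obtain d where d: "d > 0" "ball z d \<subseteq> S" using assms(1) open_contains_ball by blast
  have "dist z (z + Complex 0 (d/2)) = d/2" using d(1) by (simp add: dist_norm cmod_def)
  then have "z + Complex 0 (d/2) \<in> ball z d" using d(1) by simp
  then have "Im (z + Complex 0 (d/2)) = 0" "Im z = 0" using d(2) assms(2) z by blast+
  then show False using d(1) by simp
qed

context oriented_quadrangulation begin

lemma closed_edge: "e \<in> E \<Longrightarrow> closedin X e"
proof -
  assume "e \<in> E"
  then obtain \<gamma> where \<gamma>: "embedding_map (top_of_set {0..1::real}) X \<gamma>" "e = \<gamma> ` {0..1}" by (rule edge_arc)
  have "continuous_map (top_of_set {0..1}) X \<gamma>"
    using \<gamma>(1) continuous_map_in_subtopology homeomorphic_imp_continuous_map unfolding embedding_map_def by blast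
  moreover have "compactin (top_of_set {0..1::real}) {0..1}" by (simp add: compactin_subtopology)
  ultimately have "compactin X (\<gamma> ` {0..1})" by (rule image_compactin[rotated])
  then show ?thesis using \<gamma>(2) Hausdorff compactin_imp_closedin by blast
qed

lemma closed_face_image: "f \<in> Faces \<Longrightarrow> closed S \<Longrightarrow> S \<subseteq> Q \<Longrightarrow> closedin X (\<Phi> f ` S)"
proof -
  assume f: "f \<in> Faces" and S: "closed S" "S \<subseteq> Q"
  have "compact S" using S compact_quadrilateral by (metis closed_Int_compact inf.absorb1)
  then have "compactin (top_of_set Q) S" using S(2) by (simp add: compactin_subtopology)
  then have "compactin X (\<Phi> f ` S)" using face(1)[OF f] by (rule image_compactin)
  then show ?thesis using Hausdorff compactin_imp_closedin by blast
qed

text \<open>An open part of the surface that lies in an arc would be embedded in a line, against the invariance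
  of domain.\<close>

lemma edge_interior_empty: assumes e: "e \<in> E" shows "X interior_of e = {}"
proof -
  obtain \<gamma> where \<gamma>: "embedding_map (top_of_set {0..1::real}) X \<gamma>" "e = \<gamma> ` {0..1}" using e by (rule edge_arc)
  have "homeomorphic_map (top_of_set {0..1::real}) (subtopology X e) \<gamma>"
    using \<gamma> by (simp add: embedding_map_def)
  then obtain k where k: "homeomorphic_maps (top_of_set {0..1::real}) (subtopology X e) \<gamma> k"
    using homeomorphic_map_maps by blast
  define N where "N = X interior_of e"
  have N: "openin X N" "N \<subseteq> e" unfolding N_def by (simp_all add: interior_of_subset)
  have "continuous_map (subtopology X e) euclideanreal k"
    using k continuous_map_in_subtopology unfolding homeomorphic_maps_def by blast
  then have "continuous_map (subtopology X N) euclideanreal k"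
    using N(2) continuous_map_from_subtopology_mono by blast
  moreover have "continuous_map euclideanreal euclidean complex_of_real" by (simp add: continuous_intros)
  ultimately have c: "continuous_map (subtopology X N) euclidean (complex_of_real \<circ> k)"
    by (rule continuous_map_compose)
  have gk: "\<gamma> (k x) = x" if "x \<in> e" for x
    using k that edge_space[OF e] unfolding homeomorphic_maps_def by auto
  have "inj_on (complex_of_real \<circ> k) N"
  proof (rule inj_onI)
    fix x y assume "x \<in> N" "y \<in> N" "(complex_of_real \<circ> k) x = (complex_of_real \<circ> k) y"
    then have "x \<in> e" "y \<in> e" "k x = k y" using N(2) by auto
    then show "x = y" using gk by metis
  qed
  then have "open ((complex_of_real \<circ> k) ` N)" using invariance_of_domain_from_surface[OF X N(1) c] by blast
  moreover have "(complex_of_real \<circ> k) ` N \<subseteq> {z. Im z = 0}" by auto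
  ultimately have "(complex_of_real \<circ> k) ` N = {}" by (rule real_line_no_interior)
  then show ?thesis by (simp add: N_def)
qed

lemma point_interior_empty: assumes v: "v \<in> topspace X" shows "X interior_of {v} = {}"
proof (rule ccontr)
  assume "X interior_of {v} \<noteq> {}"
  then have "X interior_of {v} = {v}" using interior_of_subset[of X "{v}"] by auto
  then have N: "openin X {v}" using openin_interior_of[of X "{v}"] by simp
  have c: "continuous_map (subtopology X {v}) (euclidean :: complex topology) (\<lambda>_. 0)" by simp
  have "open ((\<lambda>_. 0::complex) ` {v})" by (rule invariance_of_domain_from_surface[OF X N c]) simp
  then show False using not_open_singleton[of "0::complex"] by simp
qed

lemma skeleton_interior_empty: "X interior_of (V \<union> \<Union>E) = {}"
proof -
  have V: "closedin X S \<and> X interior_of S = {}" if "finite S" "S \<subseteq> topspace X" for S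
    using that
  proof (induction rule: finite_induct)
    case (insert v S)
    have "closedin X {v}" using insert Hausdorff by (simp add: closedin_Hausdorff_singleton)
    moreover have "X interior_of ({v} \<union> S) = {}"
      using interior_of_union_eq_empty[OF \<open>closedin X {v}\<close>, of S] point_interior_empty[of v] insert by simp
    ultimately show ?case using insert closedin_Un[of X "{v}" S] by simp
  qed simp
  have E: "closedin X (\<Union>S) \<and> X interior_of (\<Union>S) = {}" if "finite S" "S \<subseteq> E" for S
    using that
  proof (induction rule: finite_induct)
    case (insert e S)
    have c: "closedin X e" using insert closed_edge by simp
    moreover have "X interior_of (e \<union> \<Union>S) = {}"
      using interior_of_union_eq_empty[OF c, of "\<Union>S"] edge_interior_empty[of e] insert by simp
    ultimately show ?case using insert closedin_Un[of X e "\<Union>S"] by simp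
  qed simp
  have v: "closedin X V \<and> X interior_of V = {}" using V finite_V V_space by blast
  have "X interior_of (\<Union>E) = {}" using E[of E] finite_E by blast
  then show ?thesis using interior_of_union_eq_empty[of X V "\<Union>E"] v by blast
qed

text \<open>The faces are dense, and there are finitely many of them, so their closures cover the surface.\<close>

lemma closed_faces_cover: "topspace X = (\<Union>f\<in>Faces. \<Phi> f ` Q)"
proof
  show "(\<Union>f\<in>Faces. \<Phi> f ` Q) \<subseteq> topspace X"
    using face(1) unfolding continuous_map_def by fastforce
  have "closedin X (\<Union>f\<in>Faces. \<Phi> f ` Q)"
    using finite_faces closed_face_image compact_quadrilateral
    by (intro closedin_Union) (auto simp: compact_imp_closed)
  then have "openin X (topspace X - (\<Union>f\<in>Faces. \<Phi> f ` Q))" by blast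
  moreover have "topspace X - (\<Union>f\<in>Faces. \<Phi> f ` Q) \<subseteq> V \<union> \<Union>E"
  proof
    fix x assume x: "x \<in> topspace X - (\<Union>f\<in>Faces. \<Phi> f ` Q)"
    show "x \<in> V \<union> \<Union>E"
    proof (rule ccontr)
      assume "x \<notin> V \<union> \<Union>E"
      then have "x \<in> \<Union>Faces" unfolding Union_faces using x by blast
      then obtain f where f: "f \<in> Faces" "x \<in> f" by blast
      then have "x \<in> \<Phi> f ` interior Q" using face(2) by simp
      then have "x \<in> \<Phi> f ` Q" using interior_subset by blast
      then show False using x f by blast
    qed
  qed
  ultimately have "topspace X - (\<Union>f\<in>Faces. \<Phi> f ` Q) \<subseteq> X interior_of (V \<union> \<Union>E)"
    by (rule interior_of_maximal[rotated])
  then show "topspace X \<subseteq> (\<Union>f\<in>Faces. \<Phi> f ` Q)" using skeleton_interior_empty by blast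
qed

lemma edge_point_on_side:
  assumes e: "e \<in> E" "x \<in> e" "x \<notin> V" and f: "f \<in> Faces" "y \<in> Q" "\<Phi> f y = x"
  obtains j s where "j < 4" "0 < s" "s < 1" "y = side j s" "side_edge f j = e"
proof -
  have "y \<notin> interior Q"
  proof
    assume "y \<in> interior Q"
    then have "x \<in> f" using face(2)[OF f(1)] f(3) by blast
    then show False using face_disjoint[OF f(1)] e by blast
  qed
  then obtain j s where j: "j < 4" "0 \<le> s" "s < 1" "y = side j s" using quadrilateral_boundary f(2) by blast
  have "x \<in> side_edge f j" using j f(3) by (auto simp: side_edge_def)
  then have eq: "side_edge f j = e" using edges_meet[of "side_edge f j" e x] e face(4)[OF f(1) j(1)] by blast
  have "s \<noteq> 0"
  proof
    assume "s = 0"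
    then have "x = corner f j" using j f(3) by (simp add: corner_def)
    then show False using side_edge_ends(1)[OF f(1) j(1)] e(3) by blast
  qed
  then show ?thesis using that[of j s] j eq by simp
qed

lemma edge_has_side: assumes e: "e \<in> E" obtains f j where "f \<in> Faces" "j < 4" "side_edge f j = e"
proof -
  obtain \<gamma> where \<gamma>: "embedding_map (top_of_set {0..1::real}) X \<gamma>" "e = \<gamma> ` {0..1}" "e \<inter> V = {\<gamma> 0, \<gamma> 1}"
    using e by (rule edge_arc)
  have inj: "inj_on \<gamma> {0..1}"
    using \<gamma>(1) homeomorphic_imp_injective_map unfolding embedding_map_def by fastforce
  have x: "\<gamma> (1/2) \<in> e" using \<gamma>(2) by simp
  have "\<gamma> (1/2) \<noteq> \<gamma> 0" "\<gamma> (1/2) \<noteq> \<gamma> 1" using inj_onD[OF inj, of "1/2" 0] inj_onD[OF inj, of "1/2" 1] by auto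
  then have xV: "\<gamma> (1/2) \<notin> V" using \<gamma>(3) x by blast
  have "\<gamma> (1/2) \<in> topspace X" using x edge_space[OF e] by blast
  then obtain f y where f: "f \<in> Faces" "y \<in> Q" "\<Phi> f y = \<gamma> (1/2)" unfolding closed_faces_cover by auto
  obtain j s where "j < 4" "side_edge f j = e" by (rule edge_point_on_side[OF e x xV f])
  then show ?thesis using f(1) that by blast
qed

text \<open>A surface has no boundary: if an edge had just one side, then a point of this side would have a
  neighborhood embedded in the closed quadrilateral.\<close>

lemma edge_has_two_sides:
  assumes f: "f \<in> Faces" "j < 4" "side_edge f j = e"
  shows "\<exists>f' j'. f' \<in> Faces \<and> j' < 4 \<and> side_edge f' j' = e \<and> (f', j') \<noteq> (f, j)"
proof (rule ccontr)
  assume no: "\<not> ?thesis"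
  have only: "f' = f \<and> j' = j" if "f' \<in> Faces" "j' < 4" "side_edge f' j' = e" for f' j'
  proof (rule ccontr)
    assume "\<not> ?thesis"
    then have "(f', j') \<noteq> (f, j)" by auto
    then show False using no that by blast
  qed
  have e: "e \<in> E" using face(4)[OF f(1,2)] f(3) by simp
  define y0 where "y0 = side j (1/2)"
  define p where "p = \<Phi> f y0"
  have y0Q: "y0 \<in> Q - interior Q" unfolding y0_def by (intro side_in_quadrilateral) auto
  have p: "p \<in> e" "p \<notin> V" using side_not_vertex[OF f(1,2), of "1/2"] f(3) by (simp_all add: p_def y0_def)
  \<comment> \<open>The open quadrant that contains the inner points of side \<open>j\<close>.\<close>
  define W where "W = {z. 0 < Re (\<i> ^ (3 * j) * z) \<and> 0 < Im (\<i> ^ (3 * j) * z)}"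
  have ii: "\<i> ^ (3 * j) * (\<i> ^ j * z) = z" for z
  proof -
    have "\<i> ^ (3 * j) * \<i> ^ j = (\<i> ^ 4) ^ j" by (simp add: power_mult[symmetric] power_add[symmetric])
    then show ?thesis by (simp add: mult.assoc[symmetric] power4_eq_xxxx)
  qed
  have W: "open W" unfolding W_def by (intro open_Collect_conj open_Collect_less continuous_intros)
  have sW: "of_real r * side j s \<in> W \<longleftrightarrow> 0 < r * (1 - s) \<and> 0 < r * s" for r s
  proof -
    have "of_real r * side j s = \<i> ^ j * (of_real r * Complex (1 - s) s)" by (simp add: side_eq mult.left_commute)
    then have eq: "\<i> ^ (3 * j) * (of_real r * side j s) = of_real r * Complex (1 - s) s" by (simp only: ii)
    show ?thesis unfolding W_def mem_Collect_eq eq by simp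
  qed
  have WQ: "z \<in> Q \<and> z \<in> W \<Longrightarrow> \<exists>r s. 0 < r \<and> r \<le> 1 \<and> 0 < s \<and> s < 1 \<and> z = of_real r * side j s" for z
  proof -
    assume z: "z \<in> Q \<and> z \<in> W"
    define u where "u = \<i> ^ (3 * j) * z"
    have u: "0 < Re u" "0 < Im u" using z by (auto simp: W_def u_def)
    have "\<i> ^ j * u = z" unfolding u_def using ii[of z] by (metis mult.left_commute)
    define r where "r = taxi_norm z"
    have "taxi_norm u = r" using taxi_norm_rotate[of "3*j" z] by (simp add: u_def r_def)
    then have r: "r = Re u + Im u" using u by (simp add: taxi_norm_def)
    have "u = of_real r * Complex (1 - Im u / r) (Im u / r)"
    proof -
      have "r * (1 - Im u / r) = Re u" "r * (Im u / r) = Im u" using r u by (auto simp: right_diff_distrib)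
      then show ?thesis by (simp add: complex_eq_iff)
    qed
    then have "z = of_real r * side j (Im u / r)"
      using \<open>\<i> ^ j * u = z\<close> by (metis mult.left_commute side_eq)
    moreover have "0 < r" "r \<le> 1" "0 < Im u / r" "Im u / r < 1"
      using u r z mem_quadrilateral[of z] by (auto simp: r_def[symmetric] field_simps)
    ultimately show ?thesis by blast
  qed
  \<comment> \<open>The complement of this closed set is a neighborhood of \<open>p\<close> that is covered by one quadrant of one face.\<close>
  define K where "K = (\<Union>f'\<in>Faces - {f}. \<Phi> f' ` Q) \<union> \<Phi> f ` (Q - W)"
  have "closedin X K" unfolding K_def
  proof (intro closedin_Un closedin_Union)
    show "closedin X (\<Phi> f ` (Q - W))"
      using W compact_quadrilateral by (intro closed_face_image f closed_Diff compact_imp_closed) auto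
  qed (use finite_faces closed_face_image compact_quadrilateral in \<open>auto simp: compact_imp_closed\<close>)
  define N where "N = topspace X - K"
  have N: "openin X N" unfolding N_def using \<open>closedin X K\<close> by blast
  have pK: "p \<notin> K"
  proof
    assume "p \<in> K"
    then obtain f' y where y: "f' \<in> Faces" "y \<in> Q" "\<Phi> f' y = p" "f' \<noteq> f \<or> y \<notin> W"
      unfolding K_def using f(1) by blast
    obtain j' s where s: "j' < 4" "0 < s" "s < 1" "y = side j' s" "side_edge f' j' = e"
      by (rule edge_point_on_side[OF e p y(1,2,3)])
    then have "f' = f" "j' = j" using only y(1) by auto
    moreover have "y \<in> W" using sW[of 1 s] s \<open>j' = j\<close> by simp
    ultimately show False using y(4) by simp
  qed
  have pN: "p \<in> N" using pK p edge_space[OF e] by (auto simp: N_def)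
  define T where "T = {y \<in> Q. \<Phi> f y \<in> N}"
  have TW: "T \<subseteq> W" unfolding T_def N_def K_def by blast
  have imT: "\<Phi> f ` T = N"
  proof
    show "N \<subseteq> \<Phi> f ` T"
    proof
      fix x assume x: "x \<in> N"
      then obtain f' y where y: "f' \<in> Faces" "y \<in> Q" "x = \<Phi> f' y"
        using closed_faces_cover by (auto simp: N_def)
      then have "f' = f" using x by (auto simp: N_def K_def)
      then show "x \<in> \<Phi> f ` T" using x y by (auto simp: T_def)
    qed
  qed (auto simp: T_def)
  have injT: "inj_on (\<Phi> f) T"
  proof (rule inj_onI)
    fix a b assume ab: "a \<in> T" "b \<in> T" "\<Phi> f a = \<Phi> f b"
    have Q: "a \<in> Q" "b \<in> Q" "a \<in> W" "b \<in> W" using ab TW by (auto simp: T_def)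
    have bd: "b \<notin> interior Q" if h: "a \<in> Q" "b \<in> Q" "a \<in> W" "a \<notin> interior Q" "\<Phi> f a = \<Phi> f b" for a b
    proof
      assume "b \<in> interior Q"
      then have 1: "\<Phi> f a \<in> f" using face(2)[OF f(1)] h(5) by auto
      obtain k s where "k < 4" "0 \<le> s" "s < 1" "a = side k s" by (rule quadrilateral_boundary[OF h(1,4)])
      then have "\<Phi> f a \<in> side_edge f k" by (auto simp: side_edge_def)
      then have "\<Phi> f a \<in> \<Union>E" using face(4)[OF f(1) \<open>k < 4\<close>] by blast
      then show False using 1 face_disjoint[OF f(1)] by blast
    qed
    show "a = b"
    proof (cases "a \<in> interior Q")
      case True
      then have "b \<in> interior Q" using bd[of b a] Q ab by metis
      then show ?thesis using True inj_onD[OF face(3)[OF f(1)] ab(3)] by blast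
    next
      case False
      then have bi: "b \<notin> interior Q" using bd[of a b] Q ab by metis
      obtain r s where a: "0 < r" "r \<le> 1" "0 < s" "s < 1" "a = of_real r * side j s" using WQ[of a] Q by blast
      obtain r' s' where b: "0 < r'" "r' \<le> 1" "0 < s'" "s' < 1" "b = of_real r' * side j s'" using WQ[of b] Q by blast
      have "r = 1" using scaled_side_interior[of r s j] a False by fastforce
      moreover have "r' = 1" using scaled_side_interior[of r' s' j] b bi by fastforce
      ultimately have "a = side j s" "b = side j s'" using a b by auto
      moreover have "inj_on (\<Phi> f \<circ> side j) {0..1}"
        using homeomorphic_imp_injective_map[OF face(5)[OF f(1,2)]] by simp
      then have "s = s'" using inj_onD[of "\<Phi> f \<circ> side j" "{0..1}" s s'] ab(3) calculation a b by simp
      ultimately show ?thesis by simp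
    qed
  qed
  have "closed_map (top_of_set Q) X (\<Phi> f)"
    unfolding closed_map_def
  proof (intro allI impI)
    fix C assume "closedin (top_of_set Q) C"
    then have "closed C" "C \<subseteq> Q" using compact_imp_closed[OF compact_quadrilateral]
      by (auto simp: closedin_closed_eq)
    then show "closedin X (\<Phi> f ` C)" using closed_face_image[OF f(1)] by blast
  qed
  moreover have "{x \<in> topspace (top_of_set Q). \<Phi> f x \<in> N} = T" by (simp add: T_def)
  ultimately have "closed_map (subtopology (top_of_set Q) T) (subtopology X N) (\<Phi> f)" by (rule closed_map_restriction)
  moreover have tt: "subtopology (top_of_set Q) T = top_of_set T"
    by (simp add: subtopology_subtopology Int_absorb1 T_def subset_iff)
  ultimately have cl: "closed_map (top_of_set T) (subtopology X N) (\<Phi> f)" by simp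
  have "continuous_map (top_of_set T) X (\<Phi> f)"
    using face(1)[OF f(1)] continuous_map_from_subtopology_mono[of euclidean Q X "\<Phi> f" T] by (auto simp: T_def)
  then have "continuous_map (top_of_set T) (subtopology X N) (\<Phi> f)"
    unfolding continuous_map_in_subtopology by (auto simp: T_def)
  moreover have tN: "topspace (subtopology X N) = N" by (auto simp: N_def)
  ultimately have "homeomorphic_map (top_of_set T) (subtopology X N) (\<Phi> f)"
    using cl imT injT by (intro bijective_closed_imp_homeomorphic_map) simp_all
  then obtain k where k: "homeomorphic_maps (top_of_set T) (subtopology X N) (\<Phi> f) k"
    using homeomorphic_map_maps by blast
  have kc: "continuous_map (subtopology X N) (euclidean :: complex topology) k"
    using k continuous_map_in_subtopology unfolding homeomorphic_maps_def by blast
  have kk: "\<Phi> f (k x) = x" "k x \<in> T" if "x \<in> N" for x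
    using k that tN unfolding homeomorphic_maps_def continuous_map_def by auto
  have "inj_on k N" by (rule inj_on_inverseI[of _ "\<Phi> f"]) (rule kk(1))
  then have o: "open (k ` N)" using invariance_of_domain_from_surface[OF X N kc] by blast
  have "k ` N \<subseteq> Q" using kk(2) by (auto simp: T_def)
  then have "k ` N \<subseteq> interior Q" using o by (rule interior_maximal)
  moreover have "y0 \<in> T" using y0Q pN by (auto simp: T_def p_def)
  then have "k p = y0" using k by (simp add: homeomorphic_maps_def p_def)
  ultimately show False using y0Q pN by blast
qed

definition sides_of :: "'a set \<Rightarrow> ('a set \<times> nat) set" where
  "sides_of e = {(f, j). f \<in> Faces \<and> j < 4 \<and> side_edge f j = e}"

theorem card_sides_of: assumes "e \<in> E" shows "card (sides_of e) = 2"
proof -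
  obtain f j where f: "f \<in> Faces" "j < 4" "side_edge f j = e" by (rule edge_has_side[OF assms])
  obtain f' j' where f': "f' \<in> Faces" "j' < 4" "side_edge f' j' = e" "(f', j') \<noteq> (f, j)"
    using edge_has_two_sides[OF f] by blast
  have "sides_of e = {(f, j), (f', j')}"
  proof
    show "sides_of e \<subseteq> {(f, j), (f', j')}"
    proof (rule subrelI)
      fix g k assume "(g, k) \<in> sides_of e"
      then have "g \<in> Faces" "k < 4" "side_edge g k = e" by (auto simp: sides_of_def)
      then show "(g, k) \<in> {(f, j), (f', j')}"
        using at_most_two_sides[OF f f'(1-3), of g k] f'(4) by auto
    qed
  qed (use f f' in \<open>auto simp: sides_of_def\<close>)
  then show ?thesis using f'(4) by (metis card_2_iff)
qed

end

section \<open>Counting the faces by their colors\<close>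

lemma sum_cyclic_shift:
  fixes h :: "nat \<Rightarrow> 'a::comm_monoid_add"
  assumes "\<And>k. h (k + 4) = h k"
  shows "(\<Sum>k<4. h (k + 1)) = (\<Sum>k<4. h k)" "(\<Sum>k<4. h (k + 3)) = (\<Sum>k<4. h k)"
proof -
  have 4: "{..<4} = {0,1,2,3::nat}" by auto
  have p: "h 4 = h 0" "h 5 = h 1" "h 6 = h 2" using assms[of 0] assms[of 1] assms[of 2] by simp_all
  have q: "h (Suc (Suc 0)) = h 2" by (simp add: numeral_2_eq_2)
  show "(\<Sum>k<4. h (k + 1)) = (\<Sum>k<4. h k)" "(\<Sum>k<4. h (k + 3)) = (\<Sum>k<4. h k)"
    unfolding 4 by (simp_all add: p q add_ac)
qed

lemma even_sum_opposite:
  fixes h :: "nat \<Rightarrow> nat"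
  assumes "\<And>k. h (k + 2) = h k"
  shows "even (\<Sum>k<4. h k)"
proof -
  have 4: "{..<4} = {0,1,2,3::nat}" by auto
  have "h 2 = h 0" "h 3 = h 1" using assms[of 0] assms[of 1] by (simp_all add: eval_nat_numeral)
  then have "(\<Sum>k<4. h k) = 2 * (h 0 + h 1)" unfolding 4 by simp
  then show ?thesis by simp
qed

text \<open>The argument order \<open>a b d x\<close> refers to the square \<open>b a d x\<close> of the complex, on which \<open>a\<close> is
  between \<open>b\<close> and \<open>d\<close> and opposite to \<open>x\<close>; in \<open>five_colors\<close> the last argument is the missing color.\<close>

definition four_colors :: "nat \<Rightarrow> nat \<Rightarrow> nat \<Rightarrow> nat \<Rightarrow> bool" where
  "four_colors a b d x \<longleftrightarrow> distinct [a, b, d, x] \<and> {a, b, d, x} \<subseteq> {..<5}"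

definition five_colors :: "nat \<Rightarrow> nat \<Rightarrow> nat \<Rightarrow> nat \<Rightarrow> nat \<Rightarrow> bool" where
  "five_colors a b d x y \<longleftrightarrow> distinct [a, b, d, x, y] \<and> {a, b, d, x, y} = {..<5}"

lemma five_colors_exists:
  assumes "four_colors a b d x" obtains y where "five_colors a b d x y"
proof -
  have c4: "card {a,b,d,x} = 4" using assms by (simp add: four_colors_def)
  have "card ({..<5} - {a,b,d,x}) = 1"
    using assms c4 by (subst card_Diff_subset) (auto simp: four_colors_def)
  then obtain y where y: "{..<5} - {a,b,d,x} = {y}" by (auto simp: card_1_singleton_iff)
  then have "five_colors a b d x y" using assms unfolding five_colors_def four_colors_def by auto
  then show ?thesis by (rule that)
qed

text \<open>A function of the squares of the complex that only depends on an edge at one corner is in fact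
  a function of that corner, because the squares at a corner form a single cycle.\<close>

lemma corner_function:
  assumes drop: "\<And>a b d x y. five_colors a b d x y \<Longrightarrow> h b a d x = h b a d y"
    and turn: "\<And>a b d x. four_colors a b d x \<Longrightarrow> h b a d x = h a b x d"
  obtains t where "\<And>a b d x. four_colors a b d x \<Longrightarrow> h b a d x = t a b" "\<And>a b. t a b = t b a"
proof -
  have nxt: "h b a d x = h b a x y" if c: "five_colors a b d x y" for a b d x y
  proof -
    have p: "five_colors b a y x d" "five_colors b a y d x" "four_colors a b x y" "four_colors a b d y"
      using c unfolding five_colors_def four_colors_def by auto
    have "h b a d x = h b a d y" using drop[OF c] .
    also have "\<dots> = h a b y d" using turn p by blast
    also have "\<dots> = h a b y x" using drop[OF p(2)] .
    also have "\<dots> = h b a x y" using turn[OF p(3)] by simp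
    finally show ?thesis .
  qed
  have all: "h b a d x = h b a d' x'" if c: "four_colors a b d x" "four_colors a b d' x'" for a b d x d' x'
  proof -
    obtain y where y: "five_colors a b d x y" using five_colors_exists[OF c(1)] .
    have mem: "d' \<in> {d,x,y}" "x' \<in> {d,x,y}" "d' \<noteq> x'"
    proof -
      have "{a,b,d,x,y} = {..<5}" using y by (simp add: five_colors_def)
      moreover have "d' < 5" "x' < 5" "d' \<noteq> a" "d' \<noteq> b" "x' \<noteq> a" "x' \<noteq> b" "d' \<noteq> x'"
        using c(2) by (auto simp: four_colors_def)
      ultimately show "d' \<in> {d,x,y}" "x' \<in> {d,x,y}" "d' \<noteq> x'" by blast+
    qed
    have p: "five_colors a b d x y" "five_colors a b d y x" "five_colors a b x d y" "five_colors a b x y d"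
      "five_colors a b y d x" "five_colors a b y x d" using y unfolding five_colors_def by auto
    have "h b a d x = h b a d y" "h b a d x = h b a x y" "h b a x y = h b a x d" "h b a x y = h b a y d" "h b a y d = h b a y x"
      using drop[OF p(1)] nxt[OF p(1)] drop[OF p(4)] nxt[OF p(4)] drop[OF p(5)] by simp_all
    then show ?thesis using mem by auto
  qed
  define t where "t a b = (SOME v. \<exists>d x. four_colors a b d x \<and> v = h b a d x)" for a b
  have 1: "h b a d x = t a b" if c: "four_colors a b d x" for a b d x
  proof -
    have "\<exists>v. \<exists>d x. four_colors a b d x \<and> v = h b a d x" using c by blast
    then have "\<exists>d x. four_colors a b d x \<and> t a b = h b a d x" unfolding t_def by (rule someI_ex)
    then show ?thesis using all c by metis
  qed
  have ex: "(\<exists>d x. four_colors a b d x \<and> v = h b a d x) \<longleftrightarrow> (\<exists>d x. four_colors b a d x \<and> v = h a b d x)" for a b v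
  proof -
    have "four_colors a b d x \<longleftrightarrow> four_colors b a x d" for a b d x by (auto simp: four_colors_def)
    then show ?thesis using turn by metis
  qed
  have "t a b = t b a" for a b unfolding t_def using ex[of a b] by presburger
  with 1 show ?thesis using that by blast
qed

text \<open>The corners of a face, read from its first corner, run through the square \<open>b a d x\<close> from \<open>a\<close> in one
  of the two directions.\<close>

definition cyclic_pattern :: "nat \<Rightarrow> nat \<Rightarrow> nat \<Rightarrow> nat \<Rightarrow> nat \<Rightarrow> nat \<Rightarrow> nat \<Rightarrow> nat \<Rightarrow> bool" where
  "cyclic_pattern b a d x c0 c1 c2 c3 \<longleftrightarrow> c0 = a \<and> c2 = x \<and> (c1 = b \<and> c3 = d \<or> c3 = b \<and> c1 = d)"

definition pattern_count :: "nat \<Rightarrow> nat \<Rightarrow> nat \<Rightarrow> nat \<Rightarrow> nat \<Rightarrow> nat \<Rightarrow> nat \<Rightarrow> nat \<Rightarrow> nat" where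
  "pattern_count b a d x c0 c1 c2 c3 = of_bool (cyclic_pattern b a d x c0 c1 c2 c3) + of_bool (cyclic_pattern b a d x c1 c2 c3 c0)
   + of_bool (cyclic_pattern b a d x c2 c3 c0 c1) + of_bool (cyclic_pattern b a d x c3 c0 c1 c2)"
text \<open>A finite check of the colorings of a face: the number of ascending sides is odd exactly if the four
  colors are different and appear in increasing or decreasing cyclic order. For each set of four
  colors this is one of its three squares.\<close>

lemma ascents_parity:
  assumes "c0 < 5" "c1 < 5" "c2 < 5" "c3 < 5" "c1 \<noteq> c0" "c2 \<noteq> c1" "c3 \<noteq> c2" "c0 \<noteq> c3"
  shows "even (of_bool (c0 < c1) + of_bool (c1 < c2) + of_bool (c2 < c3) + of_bool (c3 < c0) +
    (pattern_count 0 1 2 3 c0 c1 c2 c3 + pattern_count 0 1 2 4 c0 c1 c2 c3 + pattern_count 0 1 3 4 c0 c1 c2 c3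
     + pattern_count 0 2 3 4 c0 c1 c2 c3 + pattern_count 1 2 3 4 c0 c1 c2 c3))"
proof -
  have "\<forall>c0 \<in> {0,1,2,3,4::nat}. \<forall>c1 \<in> {0,1,2,3,4::nat}. c1 \<noteq> c0 \<longrightarrow> (\<forall>c2 \<in> {0,1,2,3,4::nat}. c2 \<noteq> c1 \<longrightarrow> 
     (\<forall>c3 \<in> {0,1,2,3,4::nat}. c3 \<noteq> c2 \<and> c0 \<noteq> c3 \<longrightarrow>
   even (of_bool (c0 < c1) + of_bool (c1 < c2) + of_bool (c2 < c3) + of_bool (c3 < c0) +
    (pattern_count 0 1 2 3 c0 c1 c2 c3 + pattern_count 0 1 2 4 c0 c1 c2 c3 + pattern_count 0 1 3 4 c0 c1 c2 c3
     + pattern_count 0 2 3 4 c0 c1 c2 c3 + pattern_count 1 2 3 4 c0 c1 c2 c3))))"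
    unfolding pattern_count_def cyclic_pattern_def by simp
  moreover have "c \<in> {0,1,2,3,4}" if "c < 5" for c :: nat using that by auto
  ultimately show ?thesis using assms by blast
qed

text \<open>The combinatorial part of a quadrangulation: faces with four sides, glued in pairs to edges. The
  set \<open>A v\<close> is the second component of the type of the vertex \<open>v\<close>.\<close>

locale five_colored_faces =
  fixes F :: "'f set" and E :: "'e set" and vert :: "'f \<Rightarrow> nat \<Rightarrow> 'v" and edg :: "'f \<Rightarrow> nat \<Rightarrow> 'e"
    and col :: "'v \<Rightarrow> nat" and A :: "'v \<Rightarrow> nat set"
  assumes finite_F: "finite F" and finite_E: "finite E"
    and edg_in: "\<And>f k. f \<in> F \<Longrightarrow> k < 4 \<Longrightarrow> edg f k \<in> E"
    and two_sides: "\<And>e. e \<in> E \<Longrightarrow> card {(f, k). f \<in> F \<and> k < 4 \<and> edg f k = e} = 2"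
    and vert_4: "\<And>f. f \<in> F \<Longrightarrow> vert f 4 = vert f 0"
    and ends: "\<And>f k f' k'. f \<in> F \<Longrightarrow> k < 4 \<Longrightarrow> f' \<in> F \<Longrightarrow> k' < 4 \<Longrightarrow> edg f k = edg f' k' \<Longrightarrow>
       {vert f k, vert f (Suc k)} = {vert f' k', vert f' (Suc k')}"
    and col_less: "\<And>f k. f \<in> F \<Longrightarrow> k < 4 \<Longrightarrow> col (vert f k) < 5"
    and card_A: "\<And>f k. f \<in> F \<Longrightarrow> k < 4 \<Longrightarrow> card (A (vert f k)) = 2"
    and col_notin: "\<And>f k. f \<in> F \<Longrightarrow> k < 4 \<Longrightarrow> col (vert f k) \<notin> A (vert f k)"
    and neighbor_color: "\<And>f k. f \<in> F \<Longrightarrow> k < 4 \<Longrightarrow>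
       col (vert f (Suc k)) \<in> A (vert f k) \<and> col (vert f k) \<in> A (vert f (Suc k))"
begin

text \<open>Colors, types and edges around a face, with cyclic indices.\<close>

definition cc :: "'f \<Rightarrow> nat \<Rightarrow> nat" where "cc f k = col (vert f (k mod 4))"
definition AA :: "'f \<Rightarrow> nat \<Rightarrow> nat set" where "AA f k = A (vert f (k mod 4))"
definition ee :: "'f \<Rightarrow> nat \<Rightarrow> 'e" where "ee f k = edg f (k mod 4)"

lemma periodic [simp]: "cc f (k + 4) = cc f k" "AA f (k + 4) = AA f k" "ee f (k + 4) = ee f k"
  by (simp_all add: cc_def AA_def ee_def)

lemma vert_Suc_mod: "f \<in> F \<Longrightarrow> k < 4 \<Longrightarrow> vert f (Suc k) = vert f (Suc k mod 4)"
  by (cases "k = 3") (simp_all add: vert_4)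

lemma mod4_step: "(k + 1) mod 4 = Suc (k mod 4) mod (4::nat)" by presburger

lemma corner_colors:
  assumes f: "f \<in> F"
  shows "cc f (k + 1) \<in> AA f k" "cc f (k + 3) \<in> AA f k" "cc f k \<notin> AA f k" "card (AA f k) = 2" "cc f k < 5"
    "cc f (k + 1) \<noteq> cc f k"
proof -
  have n: "cc f (k + 1) \<in> AA f k \<and> cc f k \<in> AA f (k + 1)" for k
    using neighbor_color[OF f, of "k mod 4"] vert_Suc_mod[OF f, of "k mod 4"]
    by (simp add: cc_def AA_def mod4_step del: add_Suc_right One_nat_def add_0_right) 
  show "cc f (k + 1) \<in> AA f k" using n by blast
  have "cc f (k + 3) \<in> AA f (k + 4)" 
  proof -
    have "k + 3 + 1 = k + 4" by simp
    then show ?thesis using n[of "k + 3"] by metis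
  qed
  then show "cc f (k + 3) \<in> AA f k" by simp
  show 1: "cc f k \<notin> AA f k" "card (AA f k) = 2" "cc f k < 5"
    using col_notin[OF f, of "k mod 4"] card_A[OF f, of "k mod 4"] col_less[OF f, of "k mod 4"]
    by (simp_all add: cc_def AA_def)
  show "cc f (k + 1) \<noteq> cc f k" using n[of k] 1 by metis
qed

lemma corner_type:
  assumes "f \<in> F" "cc f (k + 1) \<noteq> cc f (k + 3)" shows "AA f k = {cc f (k + 1), cc f (k + 3)}"
proof -
  have "finite (AA f k)" using corner_colors(4)[OF assms(1), of k] by (metis card.infinite zero_neq_numeral)
  then show ?thesis using corner_colors(1,2,4)[OF assms(1), of k] assms(2)
    by (intro card_seteq[symmetric]) auto
qed

lemma sum_sides:
  fixes h :: "'e \<Rightarrow> nat"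
  shows "(\<Sum>f\<in>F. \<Sum>k<4. h (ee f k)) = 2 * (\<Sum>e\<in>E. h e)"
proof -
  have "(\<Sum>f\<in>F. \<Sum>k<4. h (ee f k)) = (\<Sum>f\<in>F. \<Sum>k<4. h (edg f k))"
    by (intro sum.cong) (auto simp: ee_def)
  also have "\<dots> = (\<Sum>p\<in>F \<times> {..<4}. h (edg (fst p) (snd p)))"
    by (simp add: sum.cartesian_product case_prod_beta)
  also have "\<dots> = (\<Sum>e\<in>E. \<Sum>p\<in>{p \<in> F \<times> {..<4}. edg (fst p) (snd p) = e}. h (edg (fst p) (snd p)))"
    by (rule sum.group[symmetric]) (use finite_F finite_E edg_in in auto)
  also have "\<dots> = (\<Sum>e\<in>E. 2 * h e)"
  proof (rule sum.cong)
    fix e assume e: "e \<in> E"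
    have "{p \<in> F \<times> {..<4}. edg (fst p) (snd p) = e} = {(f, k). f \<in> F \<and> k < 4 \<and> edg f k = e}" by auto
    then have "card {p \<in> F \<times> {..<4}. edg (fst p) (snd p) = e} = 2" using two_sides[OF e] by simp
    then show "(\<Sum>p\<in>{p \<in> F \<times> {..<4}. edg (fst p) (snd p) = e}. h (edg (fst p) (snd p))) = 2 * h e"
      by simp
  qed simp
  finally show ?thesis by (simp add: sum_distrib_left)
qed

lemma edge_ends_cyclic:
  assumes "f \<in> F" "f' \<in> F" "ee f k = ee f' k'"
  shows "{vert f (k mod 4), vert f ((k + 1) mod 4)} = {vert f' (k' mod 4), vert f' ((k' + 1) mod 4)}"
  using ends[OF assms(1) _ assms(2), of "k mod 4" "k' mod 4"] assms(3)
    vert_Suc_mod[OF assms(1), of "k mod 4"] vert_Suc_mod[OF assms(2), of "k' mod 4"]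
  by (simp add: ee_def mod_Suc_eq)

text \<open>The type \<open>(a, {b, d})\<close> is crossed by a corner of color \<open>a\<close> whose two neighbors on the face have
  the colors \<open>b\<close> and \<open>d\<close>; \<open>s\<close> is the value of \<open>T\<close> on the side that leads to \<open>b\<close>.\<close>

definition crossing :: "('e \<Rightarrow> bool) \<Rightarrow> nat \<Rightarrow> nat \<Rightarrow> nat \<Rightarrow> bool \<Rightarrow> 'f \<Rightarrow> nat \<Rightarrow> bool" where
  "crossing T b a d s f k \<longleftrightarrow> cc f k = a \<and>
     (cc f (k + 1) = b \<and> cc f (k + 3) = d \<and> T (ee f k) = s \<or>
      cc f (k + 3) = b \<and> cc f (k + 1) = d \<and> T (ee f (k + 3)) = s)"

text \<open>The face covers the square \<open>b a d x\<close>, and its side of colors \<open>a\<close>, \<open>b\<close> has the value \<open>s\<close>.\<close>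

definition reading :: "('e \<Rightarrow> bool) \<Rightarrow> nat \<Rightarrow> nat \<Rightarrow> nat \<Rightarrow> nat \<Rightarrow> bool \<Rightarrow> 'f \<Rightarrow> nat \<Rightarrow> bool" where
  "reading T b a d x s f k \<longleftrightarrow> crossing T b a d s f k \<and> cc f (k + 2) = x"

definition readings :: "('e \<Rightarrow> bool) \<Rightarrow> nat \<Rightarrow> nat \<Rightarrow> nat \<Rightarrow> nat \<Rightarrow> bool \<Rightarrow> nat" where
  "readings T b a d x s = (\<Sum>f\<in>F. \<Sum>k<4. of_bool (reading T b a d x s f k))"

lemma idx: "k + 1 + 1 = k + (2::nat)" "k + 1 + 2 = k + (3::nat)" "k + 1 + 3 = k + (4::nat)" "k + 3 + 1 = k + (4::nat)"
  "k + 2 + 1 = k + (3::nat)" "k + 2 + 2 = k + (4::nat)" "k + 2 + 3 = k + 1 + (4::nat)" "k + 3 + 3 = k + 2 + (4::nat)"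
  "k + 3 + 2 = k + 1 + (4::nat)"
  by simp_all

text \<open>A face on the square \<open>b a d x\<close> contains one side of colors \<open>a\<close>, \<open>b\<close>, and it can be read from both of
  its ends.\<close>

lemma readings_turn:
  assumes "four_colors a b d x" shows "readings T b a d x s = readings T a b x d s"
proof -
  define P where "P b a d x f k \<longleftrightarrow> cc f k = a \<and> cc f (k + 1) = b \<and> cc f (k + 3) = d \<and> cc f (k + 2) = x \<and> T (ee f k) = s"
    for b a d x f k
  define N where "N b a d x f k \<longleftrightarrow> cc f k = a \<and> cc f (k + 3) = b \<and> cc f (k + 1) = d \<and> cc f (k + 2) = x \<and> T (ee f (k + 3)) = s"
    for b a d x f k
  have split: "of_bool (reading T b a d x s f k) = (of_bool (P b a d x f k) + of_bool (N b a d x f k) :: nat)"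
    if "b \<noteq> d" for b a d x f k
    using that unfolding reading_def crossing_def P_def N_def by auto
  have NP: "N a b x d f (k + 1) = P b a d x f k" for a b d x f k
    unfolding N_def P_def idx periodic by blast
  have NPs: "(\<Sum>k<4. of_bool (N a b x d f k) :: nat) = (\<Sum>k<4. of_bool (P b a d x f k))" for a b d x f
  proof -
    have "N a b x d f (k + 4) = N a b x d f k" for k
    proof -
      have "k + 4 + 1 = k + 1 + 4" "k + 4 + 2 = k + 2 + 4" "k + 4 + 3 = k + 3 + 4" by simp_all
      then show ?thesis unfolding N_def by (metis periodic)
    qed
    then show ?thesis
      using sum_cyclic_shift(1)[of "\<lambda>k. of_bool (N a b x d f k) :: nat"] by (simp only: NP)
  qed
  have "(\<Sum>k<4. of_bool (reading T b a d x s f k) :: nat) = (\<Sum>k<4. of_bool (reading T a b x d s f k))" for f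
  proof -
    have "b \<noteq> d" "a \<noteq> x" using assms by (auto simp: four_colors_def)
    then have "(\<Sum>k<4. of_bool (reading T b a d x s f k) :: nat) = (\<Sum>k<4. of_bool (P b a d x f k)) + (\<Sum>k<4. of_bool (N b a d x f k))"
      "(\<Sum>k<4. of_bool (reading T a b x d s f k) :: nat) = (\<Sum>k<4. of_bool (P a b x d f k)) + (\<Sum>k<4. of_bool (N a b x d f k))"
      by (simp_all add: split sum.distrib)
    then show ?thesis using NPs[of a b x d f] NPs[of b a d x f] by simp
  qed
  then show ?thesis unfolding readings_def by simp
qed

text \<open>Turning at a corner changes the value of \<open>T\<close> by \<open>\<beta>\<close>.\<close>

lemma readings_flip:
  assumes T: "\<And>f k. f \<in> F \<Longrightarrow> cc f (k + 1) \<noteq> cc f (k + 3) \<Longrightarrow> (T (ee f k) \<noteq> T (ee f (k + 3))) = \<beta> (cc f k) (AA f k)"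
    and c: "four_colors a b d x"
  shows "readings T d a b x s = readings T b a d x (s \<noteq> \<beta> a {b, d})"
proof -
  have "reading T d a b x s f k = reading T b a d x (s \<noteq> \<beta> a {b, d}) f k" if f: "f \<in> F" for f k
  proof (cases "cc f k = a \<and> {cc f (k + 1), cc f (k + 3)} = {b, d}")
    case True
    have "cc f (k + 1) \<noteq> cc f (k + 3)" using True c by (auto simp: four_colors_def doubleton_eq_iff)
    then have "(T (ee f k) \<noteq> T (ee f (k + 3))) = \<beta> a {b, d}"
      using T[OF f, of k] corner_type[OF f, of k] True by simp
    then show ?thesis using True c unfolding reading_def crossing_def four_colors_def
      by (auto simp: doubleton_eq_iff)
  next
    case False
    then show ?thesis unfolding reading_def crossing_def by auto
  qed
  then show ?thesis unfolding readings_def by (intro sum.cong) auto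
qed

text \<open>The sides of colors \<open>a\<close>, \<open>b\<close> whose end of color \<open>a\<close> has the type \<open>(a, {b, d})\<close> come in pairs. On the
  other hand, a face contains an odd number of them only if it lies over one of the two squares
  at this arc of the complex.\<close>

lemma even_readings:
  assumes T: "\<And>f k. f \<in> F \<Longrightarrow> cc f (k + 1) = cc f (k + 3) \<Longrightarrow> T (ee f k) = T (ee f (k + 3))"
    and c: "five_colors a b d x y"
  shows "even (readings T b a d x s + readings T b a d y s)"
proof -
  have dist: "distinct [a, b, d, x, y]" using c by (simp add: five_colors_def)
  \<comment> \<open>The edge joins the colors \<open>a\<close> and \<open>b\<close>, and its end of color \<open>a\<close> has the type \<open>(a, {b, d})\<close>.\<close>
  define Pe where "Pe e \<longleftrightarrow> T e = s \<and> (\<exists>f\<in>F. \<exists>k. ee f k = e \<and>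
      (\<exists>v w. {v, w} = {vert f (k mod 4), vert f ((k + 1) mod 4)} \<and> col v = a \<and> A v = {b, d} \<and> col w = b))" for e
  define L where "L f k \<longleftrightarrow> cc f k = a \<and> AA f k = {b, d} \<and> cc f (k + 1) = b \<and> T (ee f k) = s" for f k
  define R where "R f k \<longleftrightarrow> cc f k = a \<and> AA f k = {b, d} \<and> cc f (k + 3) = b \<and> T (ee f (k + 3)) = s" for f k
  have Pe: "Pe (ee f k) \<longleftrightarrow> L f k \<or> R f (k + 1)" if f: "f \<in> F" for f k
  proof -
    have "Pe (ee f k) \<longleftrightarrow> T (ee f k) = s \<and>
      (\<exists>v w. {v, w} = {vert f (k mod 4), vert f ((k + 1) mod 4)} \<and> col v = a \<and> A v = {b, d} \<and> col w = b)"
      unfolding Pe_def using edge_ends_cyclic f by metis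
    also have "\<dots> \<longleftrightarrow> L f k \<or> R f (k + 1)"
      unfolding L_def R_def idx periodic unfolding cc_def AA_def by (auto simp: doubleton_eq_iff)
    finally show ?thesis .
  qed
  have LR: "\<not> (L f k \<and> R f (k + 1))" for f k
    using dist unfolding L_def R_def idx periodic by auto
  have Rper: "R f (k + 4) = R f k" for f k
  proof -
    have "k + 4 + 3 = k + 3 + 4" by simp
    then show ?thesis unfolding R_def by (metis periodic)
  qed
  have face: "even ((\<Sum>k<4. of_bool (Pe (ee f k)) :: nat) +
      ((\<Sum>k<4. of_bool (reading T b a d x s f k)) + (\<Sum>k<4. of_bool (reading T b a d y s f k))))" if f: "f \<in> F" for f
  proof -
    define Op where "Op k \<longleftrightarrow> crossing T b a d s f k \<and> cc f (k + 2) = a" for k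
    have "(\<Sum>k<4. of_bool (Pe (ee f k)) :: nat) = (\<Sum>k<4. of_bool (L f k)) + (\<Sum>k<4. of_bool (R f (k + 1)))"
      unfolding sum.distrib[symmetric] by (intro sum.cong) (use Pe[OF f] LR in auto)
    also have "(\<Sum>k<4. of_bool (R f (k + 1)) :: nat) = (\<Sum>k<4. of_bool (R f k))"
      using sum_cyclic_shift(1)[of "\<lambda>k. of_bool (R f k) :: nat"] Rper by simp
    finally have 1: "(\<Sum>k<4. of_bool (Pe (ee f k)) :: nat) = (\<Sum>k<4. of_bool (L f k) + of_bool (R f k))"
      by (simp add: sum.distrib)
    have 2: "even (of_bool (L f k) + of_bool (R f k) + (of_bool (crossing T b a d s f k) :: nat))" for k
    proof (cases "cc f k = a \<and> AA f k = {b, d}")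
      case True
      then have bd: "cc f (k + 1) \<in> {b, d}" "cc f (k + 3) \<in> {b, d}" using corner_colors(1,2)[OF f, of k] by auto
      show ?thesis
      proof (cases "cc f (k + 1) = cc f (k + 3)")
        case eq: True
        then have "L f k = R f k" "\<not> crossing T b a d s f k"
          using T[OF f eq] dist unfolding L_def R_def crossing_def by auto
        then show ?thesis by simp
      next
        case False
        then consider "cc f (k + 1) = b" "cc f (k + 3) = d" | "cc f (k + 1) = d" "cc f (k + 3) = b"
          using bd by auto
        moreover have ne: "b \<noteq> d" "d \<noteq> b" using dist by auto
        ultimately show ?thesis
        proof cases
          case 1
          then have "L f k \<longleftrightarrow> T (ee f k) = s" "\<not> R f k" "crossing T b a d s f k \<longleftrightarrow> T (ee f k) = s"
            using True ne unfolding L_def R_def crossing_def by simp_all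
          then show ?thesis by simp
        next
          case 2
          then have "R f k \<longleftrightarrow> T (ee f (k + 3)) = s" "\<not> L f k" "crossing T b a d s f k \<longleftrightarrow> T (ee f (k + 3)) = s"
            using True ne unfolding L_def R_def crossing_def by simp_all
          then show ?thesis by simp
        qed
      qed
    next
      case False
      have "\<not> crossing T b a d s f k"
      proof
        assume cr: "crossing T b a d s f k"
        then have "cc f (k + 1) \<noteq> cc f (k + 3)" using dist by (auto simp: crossing_def)
        from corner_type[OF f this] show False using cr False by (auto simp: crossing_def)
      qed
      then show ?thesis using False by (auto simp: L_def R_def)
    qed
    have 3: "of_bool (crossing T b a d s f k) = (of_bool (reading T b a d x s f k) + of_bool (reading T b a d y s f k) + of_bool (Op k) :: nat)" for k
    proof (cases "crossing T b a d s f k")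
      case True
      have col5: "cc f (k + 2) \<in> {a, b, d, x, y}" using corner_colors(5)[OF f, of "k + 2"] c by (simp add: five_colors_def)
      have "cc f (k + 2) \<noteq> cc f (k + 1)" "cc f (k + 3) \<noteq> cc f (k + 2)"
        using corner_colors(6)[OF f, of "k + 1"] corner_colors(6)[OF f, of "k + 2"] by (simp_all only: idx not_False_eq_True)
      then have "cc f (k + 2) \<noteq> b" "cc f (k + 2) \<noteq> d" using True by (auto simp: crossing_def)
      then show ?thesis using True col5 dist unfolding reading_def Op_def by auto
    qed (auto simp: reading_def Op_def)
    have "Op (k + 2) = Op k" for k
    proof -
      have per: "cc f (k + 2 + 2) = cc f k" "cc f (k + 2 + 1) = cc f (k + 3)" "cc f (k + 2 + 3) = cc f (k + 1)"
        "ee f (k + 2 + 3) = ee f (k + 1)" by (simp_all only: idx periodic)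
      have t1: "cc f k = cc f (k + 2) \<Longrightarrow> T (ee f (k + 1)) = T (ee f k)"
        using T[OF f, of "k + 1"] by (simp only: idx periodic)
      have t2: "cc f k = cc f (k + 2) \<Longrightarrow> T (ee f (k + 3)) = T (ee f (k + 2))"
        using T[OF f, of "k + 3"] by (simp only: idx periodic)
      show ?thesis unfolding Op_def crossing_def per using t1 t2 by auto
    qed
    then have 4: "even (\<Sum>k<4. of_bool (Op k) :: nat)" by (intro even_sum_opposite) simp
    have "even (\<Sum>k<4. of_bool (L f k) + of_bool (R f k) + (of_bool (crossing T b a d s f k) :: nat))"
      using 2 by (intro dvd_sum) auto
    then have "even ((\<Sum>k<4. of_bool (Pe (ee f k)) :: nat) + (\<Sum>k<4. of_bool (crossing T b a d s f k)))"
      unfolding 1 by (simp add: sum.distrib)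
    also have "(\<Sum>k<4. of_bool (crossing T b a d s f k) :: nat) = (\<Sum>k<4. of_bool (reading T b a d x s f k)) +
        (\<Sum>k<4. of_bool (reading T b a d y s f k)) + (\<Sum>k<4. of_bool (Op k))"
      unfolding 3 by (simp add: sum.distrib)
    finally show ?thesis using 4 by simp
  qed
  have "even (\<Sum>f\<in>F. ((\<Sum>k<4. of_bool (Pe (ee f k)) :: nat) +
      ((\<Sum>k<4. of_bool (reading T b a d x s f k)) + (\<Sum>k<4. of_bool (reading T b a d y s f k)))))"
    using face by (intro dvd_sum) auto
  then have "even ((\<Sum>f\<in>F. \<Sum>k<4. of_bool (Pe (ee f k)) :: nat) + (readings T b a d x s + readings T b a d y s))"
    unfolding readings_def by (simp only: sum.distrib)
  moreover have "even (\<Sum>f\<in>F. \<Sum>k<4. of_bool (Pe (ee f k)) :: nat)"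
    unfolding sum_sides[of "\<lambda>e. of_bool (Pe e)"] by simp
  ultimately show ?thesis by simp
qed

end

section \<open>The degree of an odd quadrangulation\<close>

lemma sum_four: "(\<Sum>k<4. h k) = h 0 + h 1 + h 2 + (h (3::nat) :: nat)"
proof -
  have "{..<4} = {0,1,2,3::nat}" by auto
  then show ?thesis by (simp add: numeral_2_eq_2)
qed

context five_colored_faces begin

definition breaks :: "'e \<Rightarrow> bool" where
  "breaks e \<longleftrightarrow> (\<exists>f\<in>F. \<exists>f'\<in>F. \<exists>k<4. \<exists>k'<4. (f, k) \<noteq> (f', k') \<and> edg f k = e \<and> edg f' k' = e \<and> vert f k = vert f' k')"

definition ascent :: "'f \<Rightarrow> nat \<Rightarrow> bool" where
  "ascent f k \<longleftrightarrow> cc f k < cc f (k + 1)"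

text \<open>An edge is consistent exactly if just one of its sides leads from the smaller to the larger
  color. As the number of edges is even, the parity of the quadrangulation is that of the number of
  ascending sides.\<close>

lemma even_ascents_breaks: "even ((\<Sum>f\<in>F. \<Sum>k<4. of_bool (ascent f k)) + card {e \<in> E. breaks e})"
proof -
  define S where "S e = {(f, k). f \<in> F \<and> k < 4 \<and> edg f k = e}" for e
  have edge: "even ((\<Sum>(f, k)\<in>S e. of_bool (ascent f k)) + of_bool (\<not> breaks e) :: nat)" if e: "e \<in> E" for e
  proof -
    obtain p p' where p: "S e = {p, p'}" "p \<noteq> p'" using two_sides[OF e] unfolding S_def[symmetric] by (auto simp: card_2_iff)
    obtain f k f' k' where pp: "p = (f, k)" "p' = (f', k')" by (cases p, cases p') auto
    have "(f, k) \<in> S e" "(f', k') \<in> S e" using p(1) pp by simp_all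
    then have in1: "f \<in> F" "k < 4" "edg f k = e" and in2: "f' \<in> F" "k' < 4" "edg f' k' = e"
      unfolding S_def by simp_all
    have ne: "(f, k) \<noteq> (f', k')" using p(2) pp by simp
    have en: "{vert f k, vert f (Suc k)} = {vert f' k', vert f' (Suc k')}"
      using ends[OF in1(1,2) in2(1,2)] in1(3) in2(3) by simp
    have nloop: "vert f k \<noteq> vert f (Suc k)"
      using neighbor_color[OF in1(1,2)] col_notin[OF in1(1,2)] by metis
    have br: "breaks e \<longleftrightarrow> vert f k = vert f' k'"
    proof
      assume "breaks e"
      then obtain g l g' l' where g: "(g, l) \<in> S e" "(g', l') \<in> S e" "(g, l) \<noteq> (g', l')" "vert g l = vert g' l'"
        unfolding breaks_def S_def by blast
      then have "(g, l) = (f, k) \<and> (g', l') = (f', k') \<or> (g, l) = (f', k') \<and> (g', l') = (f, k)" using p(1) pp by auto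
      then show "vert f k = vert f' k'" using g(4) by auto
    next
      assume "vert f k = vert f' k'"
      then show "breaks e" unfolding breaks_def using in1 in2 ne by blast
    qed
    have asc: "ascent g l \<longleftrightarrow> col (vert g l) < col (vert g (Suc l))" if "g \<in> F" "l < 4" for g l
      using vert_Suc_mod[OF that] that by (simp add: ascent_def cc_def)
    have col_ne: "col (vert f k) \<noteq> col (vert f (Suc k))"
      using neighbor_color[OF in1(1,2)] col_notin[OF in1(1,2)] by metis
    have "(\<Sum>(f, k)\<in>S e. of_bool (ascent f k)) = (of_bool (ascent f k) + of_bool (ascent f' k') :: nat)"
      unfolding p(1) pp using ne by simp
    moreover have "(ascent f k = ascent f' k') = breaks e"
      unfolding br asc[OF in1(1,2)] asc[OF in2(1,2)] using en nloop col_ne by (auto simp: doubleton_eq_iff)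
    ultimately show ?thesis by auto
  qed
  have "(\<Sum>f\<in>F. \<Sum>k<4. of_bool (ascent f k) :: nat) = (\<Sum>p\<in>F \<times> {..<4}. of_bool (ascent (fst p) (snd p)))"
    unfolding sum.cartesian_product by (intro sum.cong) auto
  also have "\<dots> = (\<Sum>e\<in>E. \<Sum>p\<in>{p \<in> F \<times> {..<4}. edg (fst p) (snd p) = e}. of_bool (ascent (fst p) (snd p)))"
    by (rule sum.group[symmetric]) (use finite_F finite_E edg_in in auto)
  also have "\<dots> = (\<Sum>e\<in>E. \<Sum>(f, k)\<in>S e. of_bool (ascent f k))"
  proof (intro sum.cong refl)
    show "{p \<in> F \<times> {..<4}. edg (fst p) (snd p) = e} = S e" for e by (auto simp: S_def)
  qed auto
  finally have 1: "(\<Sum>f\<in>F. \<Sum>k<4. of_bool (ascent f k) :: nat) = (\<Sum>e\<in>E. \<Sum>(f, k)\<in>S e. of_bool (ascent f k))" .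
  have "even (\<Sum>e\<in>E. (\<Sum>(f, k)\<in>S e. of_bool (ascent f k)) + of_bool (\<not> breaks e) :: nat)"
    using edge by (intro dvd_sum) auto
  then have 2: "even ((\<Sum>f\<in>F. \<Sum>k<4. of_bool (ascent f k) :: nat) + (\<Sum>e\<in>E. of_bool (\<not> breaks e)))"
    unfolding 1 by (simp add: sum.distrib)
  have "(\<Sum>f\<in>F. \<Sum>k<(4::nat). 1) = 2 * (\<Sum>e\<in>E. 1 :: nat)" by (rule sum_sides)
  then have "card F * 4 = 2 * card E" by simp
  then have 3: "even (card E)" by presburger
  have "(\<Sum>e\<in>E. of_bool (\<not> breaks e) :: nat) + (\<Sum>e\<in>E. of_bool (breaks e)) = (\<Sum>e\<in>E. 1)"
    unfolding sum.distrib[symmetric] by (intro sum.cong) auto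
  moreover have "(\<Sum>e\<in>E. of_bool (breaks e) :: nat) = card {e \<in> E. breaks e}"
    using finite_E by (simp add: sum.If_cases of_bool_def Int_def)
  ultimately have "even ((\<Sum>e\<in>E. of_bool (\<not> breaks e) :: nat) + card {e \<in> E. breaks e})" using 3 by simp
  then show ?thesis using 2 by simp
qed

definition total :: "nat \<Rightarrow> nat \<Rightarrow> nat \<Rightarrow> nat \<Rightarrow> nat" where
  "total b a d x = (\<Sum>f\<in>F. pattern_count b a d x (cc f 0) (cc f 1) (cc f 2) (cc f 3))"

text \<open>The degree over a square is the sum of its two parts given by the value of \<open>T\<close>.\<close>

lemma readings_total:
  assumes "four_colors a b d x" shows "readings T b a d x True + readings T b a d x False = total b a d x"
proof -
  have "(\<Sum>k<4. of_bool (reading T b a d x True f k) :: nat) + (\<Sum>k<4. of_bool (reading T b a d x False f k))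
      = pattern_count b a d x (cc f 0) (cc f 1) (cc f 2) (cc f 3)" for f
  proof -
    have 1: "(of_bool (reading T b a d x True f k) :: nat) + of_bool (reading T b a d x False f k)
      = of_bool (cyclic_pattern b a d x (cc f k) (cc f (k+1)) (cc f (k+2)) (cc f (k+3)))" for k
      using assms unfolding reading_def crossing_def cyclic_pattern_def four_colors_def by auto
    have p: "cc f 4 = cc f 0" "cc f 5 = cc f 1" "cc f 6 = cc f 2"
      using periodic(1)[of f 0] periodic(1)[of f 1] periodic(1)[of f 2] by simp_all
    have i: "0 + 1 = (1::nat)" "0 + 2 = (2::nat)" "0 + 3 = (3::nat)" "1 + 1 = (2::nat)" "1 + 2 = (3::nat)" "1 + 3 = (4::nat)"
      "2 + 1 = (3::nat)" "2 + 2 = (4::nat)" "2 + 3 = (5::nat)" "3 + 1 = (4::nat)" "3 + 2 = (5::nat)" "3 + 3 = (6::nat)" by simp_all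
    show ?thesis using 1[of 0] 1[of 1] 1[of 2] 1[of 3] unfolding sum_four i p pattern_count_def by linarith
  qed
  then show ?thesis unfolding readings_def total_def sum.distrib[symmetric] by simp
qed

text \<open>Let \<open>T\<close> be a function of the edges that changes by \<open>\<beta>\<close> at corners that run along an arc of the
  complex. The number of faces over a square with the value \<open>True\<close> of \<open>T\<close> on the side \<open>ab\<close> depends
  only on \<open>ab\<close> modulo 2. If the degree is odd, then exactly one of the two values occurs an odd
  number of times, and this value is a function on the nodes whose coboundary is \<open>\<beta>\<close>.\<close>

theorem odd_breaks_coboundary:
  fixes T :: "'e \<Rightarrow> bool"
  assumes odd: "odd (card {e \<in> E. breaks e})"
    and T_same: "\<And>f k. f \<in> F \<Longrightarrow> cc f (k + 1) = cc f (k + 3) \<Longrightarrow> T (ee f k) = T (ee f (k + 3))"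
    and T_diff: "\<And>f k. f \<in> F \<Longrightarrow> cc f (k + 1) \<noteq> cc f (k + 3) \<Longrightarrow> (T (ee f k) \<noteq> T (ee f (k + 3))) = \<beta> (cc f k) (AA f k)"
  obtains t :: "nat \<Rightarrow> nat \<Rightarrow> bool" where "\<And>a b. t a b = t b a" "\<And>a b d x. four_colors a b d x \<Longrightarrow> \<beta> a {b, d} \<longleftrightarrow> t a b \<noteq> t a d"
proof -
  have drop: "even (readings T b a d x s) = even (readings T b a d y s)" if "five_colors a b d x y" for a b d x y s
    using even_readings[OF T_same that] by auto
  have tdrop: "odd (total b a d x) = odd (total b a d y)" if c: "five_colors a b d x y" for a b d x y
  proof -
    have "four_colors a b d x" "four_colors a b d y" using c unfolding five_colors_def four_colors_def by auto
    then show ?thesis using drop[OF c] readings_total[of a b d _ T] by (metis even_add)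
  qed
  have tturn: "odd (total b a d x) = odd (total a b x d)" if c: "four_colors a b d x" for a b d x
  proof -
    have "four_colors b a x d" using c unfolding four_colors_def by auto
    then show ?thesis using readings_turn[OF c, of T] readings_total[OF c, of T] readings_total[of b a x d T] by simp
  qed
  obtain v where v: "\<And>a b d x. four_colors a b d x \<Longrightarrow> odd (total b a d x) = v a b" "\<And>a b. v a b = v b a"
    using corner_function[of "\<lambda>b a d x. odd (total b a d x)", OF tdrop tturn] by blast
  have flip: "readings T d a b x s = readings T b a d x (s \<noteq> \<beta> a {b, d})" if "four_colors a b d x" for a b d x s
    using T_diff that by (rule readings_flip)
  have vflip: "v a b = v a d" if c: "four_colors a b d x" for a b d x
  proof -
    have c': "four_colors a d b x" using c unfolding four_colors_def by auto
    have "total d a b x = total b a d x"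
      unfolding readings_total[OF c, of T, symmetric] readings_total[OF c', of T, symmetric] flip[OF c]
      by (cases "\<beta> a {b, d}") simp_all
    then show ?thesis using v(1)[OF c] v(1)[OF c'] by simp
  qed
  have conc: "four_colors 1 0 2 3" "four_colors 1 0 2 4" "four_colors 1 0 3 4" "four_colors 2 0 3 4" "four_colors 2 1 3 4"
      "four_colors 0 2 1 3" "four_colors 2 1 0 3" by (simp_all add: four_colors_def)
  \<comment> \<open>If the degree were even, then the faces on increasing squares, and hence the ascents, would be even in number.\<close>
  have v10: "v 1 0"
  proof (rule ccontr)
    assume "\<not> v 1 0"
    then have "\<not> v 2 0" "\<not> v 2 1" using vflip[OF conc(6)] vflip[OF conc(7)] v(2) by metis+
    then have ev: "even (total 0 1 2 3)" "even (total 0 1 2 4)" "even (total 0 1 3 4)" "even (total 0 2 3 4)" "even (total 1 2 3 4)"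
      using v(1)[OF conc(1)] v(1)[OF conc(2)] v(1)[OF conc(3)] v(1)[OF conc(4)] v(1)[OF conc(5)] \<open>\<not> v 1 0\<close> by simp_all
    define PC where "PC f = pattern_count 0 1 2 3 (cc f 0) (cc f 1) (cc f 2) (cc f 3) + pattern_count 0 1 2 4 (cc f 0) (cc f 1) (cc f 2) (cc f 3)
      + pattern_count 0 1 3 4 (cc f 0) (cc f 1) (cc f 2) (cc f 3) + pattern_count 0 2 3 4 (cc f 0) (cc f 1) (cc f 2) (cc f 3)
      + pattern_count 1 2 3 4 (cc f 0) (cc f 1) (cc f 2) (cc f 3)" for f
    have "even ((\<Sum>k<4. of_bool (ascent f k)) + PC f)" if f: "f \<in> F" for f
    proof -
      have p: "cc f 4 = cc f 0" using periodic(1)[of f 0] by simp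
      have i: "0 + 1 = (1::nat)" "1 + 1 = (2::nat)" "2 + 1 = (3::nat)" "3 + 1 = (4::nat)" by simp_all
      have ne: "cc f 1 \<noteq> cc f 0" "cc f 2 \<noteq> cc f 1" "cc f 3 \<noteq> cc f 2" "cc f 0 \<noteq> cc f 3"
        using corner_colors(6)[OF f, of 0] corner_colors(6)[OF f, of 1] corner_colors(6)[OF f, of 2] corner_colors(6)[OF f, of 3]
        unfolding i p by blast+
      have "(\<Sum>k<4. of_bool (ascent f k) :: nat) = of_bool (cc f 0 < cc f 1) + of_bool (cc f 1 < cc f 2) + of_bool (cc f 2 < cc f 3)
          + of_bool (cc f 3 < cc f 0)" unfolding sum_four ascent_def i p by (rule refl)
      then show ?thesis unfolding PC_def
        using ascents_parity[OF corner_colors(5)[OF f, of 0] corner_colors(5)[OF f, of 1] corner_colors(5)[OF f, of 2] corner_colors(5)[OF f, of 3] ne]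
        by simp
    qed
    then have "even (\<Sum>f\<in>F. (\<Sum>k<4. of_bool (ascent f k)) + PC f)" by (intro dvd_sum)
    then have "even ((\<Sum>f\<in>F. \<Sum>k<4. of_bool (ascent f k)) + (\<Sum>f\<in>F. PC f))" by (simp add: sum.distrib)
    moreover have "even (\<Sum>f\<in>F. PC f)"
      unfolding PC_def sum.distrib using ev unfolding total_def by simp
    ultimately have "even (\<Sum>f\<in>F. \<Sum>k<4. of_bool (ascent f k) :: nat)" by simp
    then show False using even_ascents_breaks odd by simp
  qed
  have vv: "v a b" if ab: "a \<noteq> b" "a < 5" "b < 5" for a b
  proof -
    have ex: "\<exists>x. four_colors a b d x" if "a \<noteq> b" "a \<noteq> d" "b \<noteq> d" "a < 5" "b < 5" "d < 5" for a b d
    proof -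
      have "{..<5} - {a,b,d} \<noteq> {}"
      proof
        assume "{..<5} - {a,b,d} = {}"
        then have "card {..<5::nat} \<le> card {a,b,d}" by (intro card_mono) auto
        also have "\<dots> \<le> 3" by (simp add: card_insert_if)
        finally show False by simp
      qed
      then show ?thesis using that by (auto simp: four_colors_def)
    qed
    have st: "v a b = v a d" if "a \<noteq> b" "a \<noteq> d" "a < 5" "b < 5" "d < 5" for a b d
      using ex[of a b d] vflip that by (cases "b = d") auto
    show ?thesis
    proof (cases "a = 0")
      case True
      then show ?thesis using st[of 0 b 1] v10 v(2)[of 0 1] ab by auto
    next
      case False
      then have "v a b = v 0 a" using st[of a b 0] v(2)[of a 0] ab by auto
      also have "\<dots> = v 0 1" using st[of 0 a 1] False ab by auto
      finally show ?thesis using v10 v(2)[of 0 1] by simp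
    qed
  qed
  have turn: "odd (readings T b a d x True) = odd (readings T a b x d True)" if "four_colors a b d x" for a b d x
    using readings_turn[OF that] by simp
  obtain t where t: "\<And>a b d x. four_colors a b d x \<Longrightarrow> odd (readings T b a d x True) = t a b" "\<And>a b. t a b = t b a"
    using corner_function[of "\<lambda>b a d x. odd (readings T b a d x True)", OF _ turn] drop by blast
  have R: "\<beta> a {b, d} \<longleftrightarrow> t a b \<noteq> t a d" if c: "four_colors a b d x" for a b d x
  proof -
    have c': "four_colors a d b x" using c unfolding four_colors_def by auto
    have "odd (total b a d x)" using v(1)[OF c] vv c by (auto simp: four_colors_def)
    then have "odd (readings T b a d x True) \<noteq> odd (readings T b a d x False)"
      using readings_total[OF c, of T] by (metis even_add)
    then show ?thesis using t(1)[OF c] t(1)[OF c'] flip[OF c, of True] by (cases "\<beta> a {b, d}") auto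
  qed
  show ?thesis by (rule that[of t, OF t(2) R])
qed

end

section \<open>Vector fields on the edges of a colored quadrangulation\<close>

lemma i_power_inj: "\<i> ^ k = \<i> ^ m \<Longrightarrow> k < 4 \<Longrightarrow> m < 4 \<Longrightarrow> k = m"
proof -
  assume h: "\<i> ^ k = \<i> ^ m" "k < 4" "m < 4"
  show "k = m" using less_four_cases[OF h(2)] less_four_cases[OF h(3)] h(1)
    by (elim disjE) (simp_all add: complex_eq_iff power3_eq_cube)
qed

lemma i_power_Suc_mod: "k < 4 \<Longrightarrow> \<i> ^ Suc k = \<i> ^ (Suc k mod 4)"
proof -
  assume k: "k < 4"
  show ?thesis
  proof (cases "k = 3")
    case True
    have "Suc 3 = (4::nat)" "\<i> ^ 4 = 1" by (simp_all add: power4_eq_xxxx)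
    then show ?thesis unfolding True by simp
  next
    case False
    then have "Suc k < 4" using k by linarith
    then show ?thesis by (simp only: mod_less)
  qed
qed

text \<open>The sum of \<open>\<beta>\<close> over the four arcs of a square is zero.\<close>

definition cocycle :: "(nat \<Rightarrow> nat set \<Rightarrow> bool) \<Rightarrow> bool" where
  "cocycle \<beta> \<longleftrightarrow> (\<forall>a b c d. distinct [a, b, c, d] \<longrightarrow>
     (\<beta> a {b, d} \<noteq> \<beta> b {a, c}) = (\<beta> c {b, d} \<noteq> \<beta> d {a, c}))"

text \<open>Six axes: the edges of the complete graph on five points have a proper coloring by the sums of
  their ends modulo 5, and the last axis is needed inside the faces.\<close>

definition axis_index :: "nat \<Rightarrow> 6" where
  "axis_index = (SOME h. bij_betw h {..<6} UNIV)"

lemma axis_index_eq_iff: "i < 6 \<Longrightarrow> j < 6 \<Longrightarrow> axis_index i = axis_index j \<longleftrightarrow> i = j"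
proof -
  have "\<exists>h. bij_betw h {..<6::nat} (UNIV :: 6 set)"
    using ex_bij_betw_nat_finite[of "UNIV :: 6 set"] by (auto simp: atLeast0LessThan)
  then have "bij_betw axis_index {..<6} UNIV" unfolding axis_index_def by (rule someI_ex)
  then show "i < 6 \<Longrightarrow> j < 6 \<Longrightarrow> axis_index i = axis_index j \<longleftrightarrow> i = j"
    by (auto simp: bij_betw_def inj_on_def)
qed

definition node :: "nat \<Rightarrow> nat \<Rightarrow> 6" where
  "node a b = axis_index ((a + b) mod 5)"

definition inner :: "6" where "inner = axis_index 5"

lemma node_sym: "node a b = node b a"
  by (simp add: node_def add.commute)

lemma node_neq: "b < 5 \<Longrightarrow> d < 5 \<Longrightarrow> b \<noteq> d \<Longrightarrow> node a b \<noteq> node a d"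
proof -
  assume h: "b < 5" "d < 5" "b \<noteq> d"
  have "c = c'" if "(a + c) mod 5 = (a + c') mod 5" "c \<le> c'" "c' < 5" for c c'
  proof -
    have "5 dvd (a + c') - (a + c)" using that mod_eq_dvd_iff_nat[of "a + c" "a + c'" 5] by simp
    then have "5 dvd c' - c" by simp
    moreover have "c' - c < 5" using that(3) by simp
    ultimately have "c' - c = 0" using nat_dvd_not_less by blast
    then show ?thesis using that(2) by simp
  qed
  from this[of b d] this[of d b] have "(a + b) mod 5 \<noteq> (a + d) mod 5" using h by (metis nat_le_linear)
  moreover have "(a + b) mod 5 < 6" "(a + d) mod 5 < 6" using mod_less_divisor[of 5 "a + b"] mod_less_divisor[of 5 "a + d"] by linarith+
  ultimately show ?thesis unfolding node_def using axis_index_eq_iff by metis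
qed

lemma inner_neq: "inner \<noteq> node a b" "node a b \<noteq> inner"
proof -
  have "(a + b) mod 5 < 5" by simp
  then have "(a + b) mod 5 < 6" "(a + b) mod 5 \<noteq> 5" by linarith+
  then show "inner \<noteq> node a b" "node a b \<noteq> inner" unfolding inner_def node_def using axis_index_eq_iff[of "(a + b) mod 5" 5] by auto
qed

text \<open>The sets \<open>A v\<close> are part of the data: a vertex with fewer than two colors among its neighbors has
  several possible types.\<close>

locale colored_quadrangulation = oriented_quadrangulation X V E \<Phi> for X :: "'a topology" and V E \<Phi> +
  fixes col :: "'a \<Rightarrow> nat" and A :: "'a \<Rightarrow> nat set"
  assumes col_bound: "v \<in> V \<Longrightarrow> col v < 5" and A_bound: "v \<in> V \<Longrightarrow> A v \<subseteq> {..<5}"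
    and card_type: "v \<in> V \<Longrightarrow> card (A v) = 2" and col_type: "v \<in> V \<Longrightarrow> col v \<notin> A v"
    and edge_colors: "e \<in> E \<Longrightarrow> e \<inter> V = {u, v} \<Longrightarrow> u \<noteq> v \<Longrightarrow> col v \<in> A u"
begin

lemma corner_V: "f \<in> Faces \<Longrightarrow> k < 4 \<Longrightarrow> corner f k \<in> V" "f \<in> Faces \<Longrightarrow> k < 4 \<Longrightarrow> corner f (Suc k) \<in> V"
  using side_edge_ends(1) by blast+

sublocale five_colored_faces Faces E corner side_edge col A
proof
  show "finite Faces" by (rule finite_faces)
  show "finite E" by (rule finite_E)
  show "side_edge f k \<in> E" if "f \<in> Faces" "k < 4" for f k using face(4) that by blast
  show "card {(f, k). f \<in> Faces \<and> k < 4 \<and> side_edge f k = e} = 2" if "e \<in> E" for e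
    using card_sides_of[OF that] by (simp add: sides_of_def)
  show "corner f 4 = corner f 0" if "f \<in> Faces" for f by (rule corner_4)
  show "{corner f k, corner f (Suc k)} = {corner f' k', corner f' (Suc k')}"
    if "f \<in> Faces" "k < 4" "f' \<in> Faces" "k' < 4" "side_edge f k = side_edge f' k'" for f k f' k'
    using side_edge_ends(1) that by metis
  show "col (corner f k) < 5" "card (A (corner f k)) = 2" "col (corner f k) \<notin> A (corner f k)"
    if "f \<in> Faces" "k < 4" for f k
    using col_bound card_type col_type corner_V[OF that] by auto
  show "col (corner f (Suc k)) \<in> A (corner f k) \<and> col (corner f k) \<in> A (corner f (Suc k))"
    if "f \<in> Faces" "k < 4" for f k
    using edge_colors[of "side_edge f k" "corner f k" "corner f (Suc k)"]
      edge_colors[of "side_edge f k" "corner f (Suc k)" "corner f k"] side_edge_ends[OF that] face(4)[OF that]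
    by (simp add: insert_commute)
qed

lemma breaks_eq: "breaks e \<longleftrightarrow> breaks_consistency X V E \<Phi> e"
  unfolding breaks_def breaks_consistency_def side_edge_def corner_def by blast

definition other :: "'a \<Rightarrow> nat \<Rightarrow> nat" where
  "other v b = (SOME d. A v = {b, d} \<and> b \<noteq> d)"

lemma other: assumes "v \<in> V" "b \<in> A v" shows "A v = {b, other v b}" "b \<noteq> other v b"
proof -
  obtain x y where xy: "A v = {x, y}" "x \<noteq> y" using card_type[OF assms(1)] by (auto simp: card_2_iff)
  then have "A v = {b, if b = x then y else x} \<and> b \<noteq> (if b = x then y else x)" using assms(2) by auto
  then have "\<exists>d. A v = {b, d} \<and> b \<noteq> d" by blast
  then have "A v = {b, other v b} \<and> b \<noteq> other v b" unfolding other_def by (rule someI_ex)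
  then show "A v = {b, other v b}" "b \<noteq> other v b" by simp_all
qed

lemma other_less: assumes "v \<in> V" "b \<in> A v" shows "other v b < 5" "b < 5"
proof -
  have "other v b \<in> A v" using other(1)[OF assms] by blast
  then show "other v b < 5" "b < 5" using A_bound[OF assms(1)] assms(2) by auto
qed

definition sgn_of :: "(nat \<Rightarrow> nat set \<Rightarrow> bool) \<Rightarrow> 'a \<Rightarrow> real" where
  "sgn_of \<beta> v = (if \<beta> (col v) (A v) then -1 else 1)"

text \<open>The vector at an end \<open>v\<close> of an edge that leads to a vertex of color \<open>b\<close>.\<close>

definition end_vector :: "(nat \<Rightarrow> nat set \<Rightarrow> bool) \<Rightarrow> 'a \<Rightarrow> nat \<Rightarrow> real^6" where
  "end_vector \<beta> v b = axis (node (col v) b) 1 + sgn_of \<beta> v *\<^sub>R axis (node (col v) (other v b)) 1"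

text \<open>At a vertex of type \<open>(a, {b, d})\<close> the fields of edges to the colors \<open>b\<close> and \<open>d\<close> span the same line,
  but they differ by the sign that the cocycle has on this type.\<close>

lemma end_vector_other:
  assumes "v \<in> V" "b \<in> A v" "b' \<in> A v" "b \<noteq> b'"
  shows "end_vector \<beta> v b' = sgn_of \<beta> v *\<^sub>R end_vector \<beta> v b"
proof -
  have "other v b = b'" "other v b' = b" using other[OF assms(1,2)] other[OF assms(1,3)] assms(2-4) by auto
  moreover have "sgn_of \<beta> v * sgn_of \<beta> v = 1" by (simp add: sgn_of_def)
  ultimately show ?thesis by (simp add: end_vector_def scaleR_add_right)
qed

text \<open>The field of an edge has the coordinate 1 at the node of the edge, so it does not vanish, and at
  both ends it has the vector prescribed by the type of the end. The coordinate \<open>inner\<close> is kept zero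
  for the interior of the faces.\<close>

definition edge_field :: "(nat \<Rightarrow> nat set \<Rightarrow> bool) \<Rightarrow> 'a set \<Rightarrow> ('a \<Rightarrow> real^6) \<Rightarrow> bool" where
  "edge_field \<beta> e G \<longleftrightarrow> continuous_map (subtopology X e) euclidean G \<and> (\<forall>x \<in> e. G x $ inner = 0) \<and>
     (\<forall>u v. e \<inter> V = {u, v} \<and> u \<noteq> v \<longrightarrow> G u = end_vector \<beta> u (col v) \<and>
        (\<forall>x \<in> e. G x $ node (col u) (col v) = 1))"

lemma edge_field_exists:
  assumes e: "e \<in> E" shows "\<exists>G. edge_field \<beta> e G"
proof -
  obtain \<gamma> where \<gamma>: "embedding_map (top_of_set {0..1::real}) X \<gamma>" "e = \<gamma> ` {0..1}" "e \<inter> V = {\<gamma> 0, \<gamma> 1}"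
    using e by (rule edge_arc)
  have "homeomorphic_map (top_of_set {0..1::real}) (subtopology X e) \<gamma>"
    using \<gamma> by (simp add: embedding_map_def)
  then obtain h where h: "homeomorphic_maps (top_of_set {0..1::real}) (subtopology X e) \<gamma> h"
    using homeomorphic_map_maps by blast
  have hc: "continuous_map (subtopology X e) euclideanreal h"
    using h continuous_map_in_subtopology unfolding homeomorphic_maps_def by blast
  have h0: "h (\<gamma> 0) = 0" "h (\<gamma> 1) = 1" using h unfolding homeomorphic_maps_def by simp_all
  define u where "u = \<gamma> 0"
  define w where "w = \<gamma> 1"
  have uw: "e \<inter> V = {u, w}" "u \<noteq> w" using \<gamma>(3) h0 by (auto simp: u_def w_def)
  have uV: "u \<in> V" "w \<in> V" using uw by blast+
  have wA: "col w \<in> A u" using edge_colors[OF e uw] .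
  have uA: "col u \<in> A w" using edge_colors[OF e, of w u] uw by (simp add: insert_commute)
  have n1: "node (col u) (other u (col w)) \<noteq> node (col u) (col w)"
    using node_neq other_less[OF uV(1) wA] other(2)[OF uV(1) wA] by metis
  have n2: "node (col w) (other w (col u)) \<noteq> node (col u) (col w)"
    using node_neq[of "other w (col u)" "col u" "col w"] other_less[OF uV(2) uA] other(2)[OF uV(2) uA] node_sym[of "col u" "col w"] by metis
  define G where "G x = axis (node (col u) (col w)) 1 + ((1 - h x) * sgn_of \<beta> u) *\<^sub>R axis (node (col u) (other u (col w))) 1
      + (h x * sgn_of \<beta> w) *\<^sub>R (axis (node (col w) (other w (col u))) 1 :: real^6)" for x
  have c: "continuous_map (subtopology X e) euclidean G"
  proof -
    have "continuous_on UNIV (\<lambda>r::real. axis (node (col u) (col w)) 1 + ((1 - r) * sgn_of \<beta> u) *\<^sub>R axis (node (col u) (other u (col w))) 1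
      + (r * sgn_of \<beta> w) *\<^sub>R (axis (node (col w) (other w (col u))) 1 :: real^6))" by (intro continuous_intros)
    then have "continuous_map euclideanreal euclidean (\<lambda>r::real. axis (node (col u) (col w)) 1 + ((1 - r) * sgn_of \<beta> u) *\<^sub>R axis (node (col u) (other u (col w))) 1
      + (r * sgn_of \<beta> w) *\<^sub>R (axis (node (col w) (other w (col u))) 1 :: real^6))" by simp
    from continuous_map_compose[OF hc this] show ?thesis by (simp add: G_def[abs_def] o_def)
  qed
  have Gu: "G u = end_vector \<beta> u (col w)" using h0 by (simp add: G_def end_vector_def u_def)
  have Gw: "G w = end_vector \<beta> w (col u)" using h0 by (simp add: G_def end_vector_def w_def node_sym)
  have Gn: "G x $ node (col u) (col w) = 1" "G x $ inner = 0" for x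
    using n1 n2 inner_neq by (simp_all add: G_def axis_def)
  have "edge_field \<beta> e G"
    unfolding edge_field_def
  proof (intro conjI allI impI ballI)
    fix a b assume ab: "e \<inter> V = {a, b} \<and> a \<noteq> b"
    then have "a = u \<and> b = w \<or> a = w \<and> b = u" using uw by (auto simp: doubleton_eq_iff)
    then show "G a = end_vector \<beta> a (col b)" "\<And>x. G x $ node (col a) (col b) = 1"
      using Gu Gw Gn node_sym by auto
  qed (use c Gn in auto)
  then show ?thesis by blast
qed

definition G_edge :: "(nat \<Rightarrow> nat set \<Rightarrow> bool) \<Rightarrow> 'a set \<Rightarrow> 'a \<Rightarrow> real^6" where
  "G_edge \<beta> e = (SOME G. edge_field \<beta> e G)"

lemma G_edge: "e \<in> E \<Longrightarrow> edge_field \<beta> e (G_edge \<beta> e)"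
  unfolding G_edge_def using edge_field_exists by (rule someI_ex)

lemma G_edge_side:
  assumes f: "f \<in> Faces" "k < 4"
  shows "G_edge \<beta> (side_edge f k) (corner f k) = end_vector \<beta> (corner f k) (col (corner f (Suc k)))"
    "G_edge \<beta> (side_edge f k) (corner f (Suc k)) = end_vector \<beta> (corner f (Suc k)) (col (corner f k))"
    "x \<in> side_edge f k \<Longrightarrow> G_edge \<beta> (side_edge f k) x $ node (col (corner f k)) (col (corner f (Suc k))) = 1"
    "x \<in> side_edge f k \<Longrightarrow> G_edge \<beta> (side_edge f k) x $ inner = 0"
    "x \<in> side_edge f k \<Longrightarrow> G_edge \<beta> (side_edge f k) x \<noteq> 0"
proof -
  have ef: "edge_field \<beta> (side_edge f k) (G_edge \<beta> (side_edge f k))" using G_edge face(4)[OF f] by blast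
  have en: "side_edge f k \<inter> V = {corner f k, corner f (Suc k)} \<and> corner f k \<noteq> corner f (Suc k)"
    "side_edge f k \<inter> V = {corner f (Suc k), corner f k} \<and> corner f (Suc k) \<noteq> corner f k"
    using side_edge_ends[OF f] by auto
  show "G_edge \<beta> (side_edge f k) (corner f k) = end_vector \<beta> (corner f k) (col (corner f (Suc k)))"
    "G_edge \<beta> (side_edge f k) (corner f (Suc k)) = end_vector \<beta> (corner f (Suc k)) (col (corner f k))"
    and 3: "x \<in> side_edge f k \<Longrightarrow> G_edge \<beta> (side_edge f k) x $ node (col (corner f k)) (col (corner f (Suc k))) = 1"
    using ef en unfolding edge_field_def by blast+
  show "x \<in> side_edge f k \<Longrightarrow> G_edge \<beta> (side_edge f k) x $ inner = 0"
    using ef unfolding edge_field_def by blast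
  show "x \<in> side_edge f k \<Longrightarrow> G_edge \<beta> (side_edge f k) x \<noteq> 0" using 3 by auto
qed

text \<open>Distinct edges only share vertices, and there both vectors are end vectors of one type.\<close>

lemma G_edge_common_end:
  assumes e: "e \<in> E" "e' \<in> E" "x \<in> e" "x \<in> e'"
  shows "G_edge \<beta> e x = G_edge \<beta> e' x \<or> G_edge \<beta> e x = - G_edge \<beta> e' x"
proof (cases "e = e'")
  case False
  then have xV: "x \<in> V" using edges_meet e by blast
  have ends: "\<exists>w. e \<inter> V = {x, w} \<and> x \<noteq> w" if h: "e \<in> E" "x \<in> e" for e
  proof -
    obtain f k where f: "f \<in> Faces" "k < 4" "side_edge f k = e" by (rule edge_has_side[OF h(1)])
    then have "e \<inter> V = {corner f k, corner f (Suc k)}" "corner f k \<noteq> corner f (Suc k)" using side_edge_ends by blast+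
    then show ?thesis using h(2) xV by (metis IntI insertE insert_commute singletonD)
  qed
  obtain w where w: "e \<inter> V = {x, w}" "x \<noteq> w" using ends e by blast
  obtain w' where w': "e' \<inter> V = {x, w'}" "x \<noteq> w'" using ends e by blast
  have g: "G_edge \<beta> e x = end_vector \<beta> x (col w)" "G_edge \<beta> e' x = end_vector \<beta> x (col w')"
    using G_edge[OF e(1)] G_edge[OF e(2)] w w' unfolding edge_field_def by blast+
  have "col w \<in> A x" "col w' \<in> A x" using edge_colors e w w' by blast+
  then have "end_vector \<beta> x (col w) = sgn_of \<beta> x *\<^sub>R end_vector \<beta> x (col w') \<or> col w = col w'"
    using end_vector_other[OF xV] by metis
  then show ?thesis unfolding g by (auto simp: sgn_of_def split: if_splits)
qed simp

end

section \<open>Extension of the vector fields to the faces\<close>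

context colored_quadrangulation begin

definition cv :: "'a set \<Rightarrow> nat \<Rightarrow> 'a" where "cv f k = corner f (k mod 4)"

lemma cv_period [simp]: "cv f (k + 4) = cv f k" by (simp add: cv_def)

lemma cv_V: "f \<in> Faces \<Longrightarrow> cv f k \<in> V"
  using corner_V(1)[of f "k mod 4"] by (simp add: cv_def)

lemma cv_Suc: "f \<in> Faces \<Longrightarrow> corner f (Suc (k mod 4)) = cv f (k + 1)"
  using vert_Suc_mod[of f "k mod 4"] by (simp add: cv_def mod_Suc_eq)

lemma cc_cv: "cc f k = col (cv f k)" and AA_cv: "AA f k = A (cv f k)"
  by (simp_all add: cc_def AA_def cv_def)

lemma ee_E: "f \<in> Faces \<Longrightarrow> ee f k \<in> E"
  using face(4)[of f "k mod 4"] by (simp add: ee_def)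

lemma cv_ee: assumes "f \<in> Faces" shows "cv f k \<in> ee f k" "cv f (k + 1) \<in> ee f k"
  using side_edge_ends(1)[OF assms, of "k mod 4"] cv_Suc[OF assms, of k] by (auto simp: ee_def cv_def)

lemma G_edge_cv:
  assumes f: "f \<in> Faces"
  shows "G_edge \<beta> (ee f k) (cv f k) = end_vector \<beta> (cv f k) (cc f (k + 1))"
    "G_edge \<beta> (ee f k) (cv f (k + 1)) = end_vector \<beta> (cv f (k + 1)) (cc f k)"
  using G_edge_side(1,2)[OF f, of "k mod 4" \<beta>] cv_Suc[OF f, of k]
  by (simp_all add: ee_def cc_cv flip: cv_def)

definition turn_sign :: "(nat \<Rightarrow> nat set \<Rightarrow> bool) \<Rightarrow> 'a set \<Rightarrow> nat \<Rightarrow> real" where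
  "turn_sign \<beta> f k = (if cc f (k + 1) = cc f (k + 3) then 1 else sgn_of \<beta> (cv f k))"

lemma turn_sign_period: "turn_sign \<beta> f (k + 4) = turn_sign \<beta> f k"
proof -
  have "k + 4 + 1 = k + 1 + 4" "k + 4 + 3 = k + 3 + 4" by simp_all
  then show ?thesis unfolding turn_sign_def by (metis periodic(1) cv_period)
qed

lemma sgn_cases: "sgn_of \<beta> v = 1 \<or> sgn_of \<beta> v = -1" "turn_sign \<beta> f k = 1 \<or> turn_sign \<beta> f k = -1"
  by (auto simp: sgn_of_def turn_sign_def)

lemma G_edge_turn:
  assumes f: "f \<in> Faces"
  shows "G_edge \<beta> (ee f k) (cv f (k + 1)) = turn_sign \<beta> f (k + 1) *\<^sub>R G_edge \<beta> (ee f (k + 1)) (cv f (k + 1))"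
proof -
  have i: "k + 1 + 1 = k + 2" "k + 1 + 3 = k + 4" by simp_all
  have A: "cc f k \<in> A (cv f (k + 1))" "cc f (k + 2) \<in> A (cv f (k + 1))"
    using corner_colors(1,2)[OF f, of "k + 1"] unfolding i periodic AA_cv by blast+
  show ?thesis
  proof (cases "cc f (k + 2) = cc f k")
    case True
    then show ?thesis unfolding turn_sign_def G_edge_cv[OF f] i periodic by simp
  next
    case False
    then show ?thesis unfolding turn_sign_def G_edge_cv[OF f] i periodic
      using end_vector_other[OF cv_V[OF f] A(2) A(1)] by simp
  qed
qed

text \<open>A face with four colors runs around a square, where the cocycle condition applies. On all other faces
  the corners that change the sign come in pairs.\<close>

lemma turn_sign_product:
  assumes f: "f \<in> Faces" and \<beta>: "cocycle \<beta>"
  shows "turn_sign \<beta> f 0 * turn_sign \<beta> f 1 * turn_sign \<beta> f 2 * turn_sign \<beta> f 3 = 1"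
proof -
  have i: "0 + 1 = (1::nat)" "0 + 3 = (3::nat)" "1 + 1 = (2::nat)" "1 + 3 = (4::nat)"
      "2 + 1 = (3::nat)" "2 + 3 = (5::nat)" "3 + 1 = (4::nat)" "3 + 3 = (6::nat)" by simp_all
  have p: "cc f 4 = cc f 0" "cc f 5 = cc f 1" "cc f 6 = cc f 2"
    using periodic(1)[of f 0] periodic(1)[of f 1] periodic(1)[of f 2] by simp_all
  have ts: "turn_sign \<beta> f 0 = (if cc f 1 = cc f 3 then 1 else sgn_of \<beta> (cv f 0))"
    "turn_sign \<beta> f 1 = (if cc f 2 = cc f 0 then 1 else sgn_of \<beta> (cv f 1))"
    "turn_sign \<beta> f 2 = (if cc f 3 = cc f 1 then 1 else sgn_of \<beta> (cv f 2))"
    "turn_sign \<beta> f 3 = (if cc f 0 = cc f 2 then 1 else sgn_of \<beta> (cv f 3))"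
    unfolding turn_sign_def i p by (rule refl)+
  have ty: "cc f 1 \<noteq> cc f 3 \<Longrightarrow> A (cv f 0) = {cc f 1, cc f 3}" "cc f 2 \<noteq> cc f 0 \<Longrightarrow> A (cv f 1) = {cc f 2, cc f 0}"
    "cc f 3 \<noteq> cc f 1 \<Longrightarrow> A (cv f 2) = {cc f 3, cc f 1}" "cc f 0 \<noteq> cc f 2 \<Longrightarrow> A (cv f 3) = {cc f 0, cc f 2}"
    using corner_type[OF f, of 0] corner_type[OF f, of 1] corner_type[OF f, of 2] corner_type[OF f, of 3]
    unfolding i p AA_cv by blast+
  have sg: "sgn_of \<beta> (cv f k) = (if \<beta> (cc f k) (A (cv f k)) then -1 else 1)" for k
    by (simp add: sgn_of_def cc_cv)
  have ne: "cc f 1 \<noteq> cc f 0" "cc f 2 \<noteq> cc f 1" "cc f 3 \<noteq> cc f 2" "cc f 0 \<noteq> cc f 3"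
    using corner_colors(6)[OF f, of 0] corner_colors(6)[OF f, of 1] corner_colors(6)[OF f, of 2] corner_colors(6)[OF f, of 3]
    unfolding i p by blast+
  show ?thesis
  proof (cases "cc f 0 = cc f 2")
    case e02: True
    show ?thesis
    proof (cases "cc f 1 = cc f 3")
      case True
      then show ?thesis unfolding ts using e02 by simp
    next
      case False
      then have "sgn_of \<beta> (cv f 0) = sgn_of \<beta> (cv f 2)" unfolding sg using ty(1,3) e02 by (metis insert_commute)
      then show ?thesis unfolding ts using e02 False sgn_cases(1)[of \<beta> "cv f 0"] by auto
    qed
  next
    case n02: False
    show ?thesis
    proof (cases "cc f 1 = cc f 3")
      case True
      then have "sgn_of \<beta> (cv f 1) = sgn_of \<beta> (cv f 3)" unfolding sg using ty(2,4) n02 by (metis insert_commute)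
      then show ?thesis unfolding ts using n02 True sgn_cases(1)[of \<beta> "cv f 1"] by auto
    next
      case False
      have "distinct [cc f 0, cc f 1, cc f 2, cc f 3]" using ne n02 False by auto
      then have "(\<beta> (cc f 0) {cc f 1, cc f 3} \<noteq> \<beta> (cc f 1) {cc f 0, cc f 2}) = (\<beta> (cc f 2) {cc f 1, cc f 3} \<noteq> \<beta> (cc f 3) {cc f 0, cc f 2})"
        using \<beta> unfolding cocycle_def by blast
      then have "(\<beta> (cc f 0) (A (cv f 0)) \<noteq> \<beta> (cc f 1) (A (cv f 1))) = (\<beta> (cc f 2) (A (cv f 2)) \<noteq> \<beta> (cc f 3) (A (cv f 3)))"
        using ty n02 False by (simp add: insert_commute)
      then show ?thesis unfolding ts sg using n02 False by auto
    qed
  qed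
qed

text \<open>Going around a face, the sign is changed at the corners so that the fields of consecutive
  sides fit together; the cocycle condition makes the end fit the beginning (\<open>side_sign_4\<close>).\<close>

definition side_sign :: "(nat \<Rightarrow> nat set \<Rightarrow> bool) \<Rightarrow> 'a set \<Rightarrow> nat \<Rightarrow> real" where
  "side_sign \<beta> f k = (\<Prod>i<k. turn_sign \<beta> f (i + 1))"

lemma side_sign_Suc: "side_sign \<beta> f (Suc k) = side_sign \<beta> f k * turn_sign \<beta> f (k + 1)"
  by (simp add: side_sign_def)

lemma side_sign_cases: "side_sign \<beta> f k = 1 \<or> side_sign \<beta> f k = -1"
proof (induction k)
  case (Suc k)
  then show ?case unfolding side_sign_Suc using sgn_cases(2)[of \<beta> f "k + 1"] by auto
qed (simp add: side_sign_def)

lemma side_sign_4: assumes "f \<in> Faces" "cocycle \<beta>" shows "side_sign \<beta> f 4 = 1"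
proof -
  have i: "Suc 0 = 1" "Suc 1 = 2" "Suc 2 = 3" "Suc 3 = 4" "0 + 1 = (1::nat)" "1 + 1 = (2::nat)" "2 + 1 = (3::nat)" "3 + 1 = (4::nat)"
    by simp_all
  have "side_sign \<beta> f 0 = 1" by (simp add: side_sign_def)
  then have "side_sign \<beta> f 4 = turn_sign \<beta> f 1 * turn_sign \<beta> f 2 * turn_sign \<beta> f 3 * turn_sign \<beta> f 4"
    using side_sign_Suc[of \<beta> f 0] side_sign_Suc[of \<beta> f 1] side_sign_Suc[of \<beta> f 2] side_sign_Suc[of \<beta> f 3]
    by (simp only: i mult_1_left)
  moreover have "turn_sign \<beta> f 4 = turn_sign \<beta> f 0" using turn_sign_period[of \<beta> f 0] by simp
  ultimately show ?thesis using turn_sign_product[OF assms] by (simp add: mult_ac)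
qed

lemma side_sign_turn:
  assumes f: "f \<in> Faces" and \<beta>: "cocycle \<beta>" and k: "k < 4"
  shows "side_sign \<beta> f k *\<^sub>R G_edge \<beta> (side_edge f k) (corner f (Suc k))
       = side_sign \<beta> f (Suc k mod 4) *\<^sub>R G_edge \<beta> (side_edge f (Suc k mod 4)) (corner f (Suc k mod 4))"
proof -
  have "G_edge \<beta> (side_edge f k) (corner f (Suc k)) = turn_sign \<beta> f (k + 1) *\<^sub>R G_edge \<beta> (side_edge f (Suc k mod 4)) (corner f (Suc k mod 4))"
    using G_edge_turn[OF f, of \<beta> k] cv_Suc[OF f, of k] k by (simp add: ee_def cv_def)
  then have "side_sign \<beta> f k *\<^sub>R G_edge \<beta> (side_edge f k) (corner f (Suc k))
     = side_sign \<beta> f (Suc k) *\<^sub>R G_edge \<beta> (side_edge f (Suc k mod 4)) (corner f (Suc k mod 4))"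
    unfolding side_sign_Suc by simp
  moreover have "side_sign \<beta> f (Suc k) = side_sign \<beta> f (Suc k mod 4)"
  proof (cases "k = 3")
    case True
    have "Suc 3 = (4::nat)" by simp
    then show ?thesis unfolding True using side_sign_4[OF f \<beta>] by (simp add: side_sign_def)
  qed (use k in simp)
  ultimately show ?thesis by simp
qed

definition lifts_boundary :: "(nat \<Rightarrow> nat set \<Rightarrow> bool) \<Rightarrow> 'a set \<Rightarrow> (complex \<Rightarrow> real^6) \<Rightarrow> bool" where
  "lifts_boundary \<beta> f g \<longleftrightarrow> (\<forall>k<4. \<forall>s\<in>{0..1}.
     g (side k s) = side_sign \<beta> f k *\<^sub>R G_edge \<beta> (side_edge f k) (\<Phi> f (side k s)))"

lemma boundary_lift_exists:
  assumes f: "f \<in> Faces" and \<beta>: "cocycle \<beta>"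
  obtains g where "continuous_on (Q - interior Q) g" "lifts_boundary \<beta> f g"
proof -
  let ?S = "Q - interior Q"
  define h where "h k y = side_sign \<beta> f k *\<^sub>R G_edge \<beta> (side_edge f k) (\<Phi> f y)" for k y
  define C where "C k = side k ` {0..1}" for k
  have CS: "C k \<subseteq> ?S" for k unfolding C_def using side_in_quadrilateral by auto
  have cover: "topspace (top_of_set ?S) \<subseteq> \<Union>(C ` {..<4})"
  proof
    fix y assume "y \<in> topspace (top_of_set ?S)"
    then obtain k s where "k < 4" "0 \<le> s" "s < 1" "y = side k s"
      using quadrilateral_boundary[of y] by auto
    then have "y \<in> C k" unfolding C_def by (intro image_eqI[of _ _ s]) auto
    then show "y \<in> \<Union>(C ` {..<4})" using \<open>k < 4\<close> by blast
  qed
  have clo: "closedin (top_of_set ?S) (C k)" for k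
  proof -
    have "compact (C k)" unfolding C_def by (intro compact_continuous_image continuous_on_side) simp
    then show ?thesis using CS by (intro closed_subset compact_imp_closed)
  qed
  have cont: "continuous_map (subtopology (top_of_set ?S) (C k)) euclidean (h k)" if k: "k < 4" for k
  proof -
    have sub: "subtopology (top_of_set ?S) (C k) = top_of_set (C k)"
      using CS by (simp add: subtopology_subtopology Int_absorb1)
    have "C k \<subseteq> Q" using CS by blast
    then have "continuous_map (top_of_set (C k)) X (\<Phi> f)"
      using face(1)[OF f] continuous_map_from_subtopology_mono by blast
    then have "continuous_map (top_of_set (C k)) (subtopology X (side_edge f k)) (\<Phi> f)"
      unfolding continuous_map_in_subtopology by (auto simp: C_def side_edge_def)
    moreover have "continuous_map (subtopology X (side_edge f k)) euclidean (G_edge \<beta> (side_edge f k))"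
      using G_edge[of "side_edge f k" \<beta>] face(4)[OF f k] by (simp add: edge_field_def)
    ultimately have "continuous_map (top_of_set (C k)) euclidean (G_edge \<beta> (side_edge f k) \<circ> \<Phi> f)"
      by (rule continuous_map_compose)
    then have "continuous_on (C k) (\<lambda>y. G_edge \<beta> (side_edge f k) (\<Phi> f y))" by (simp add: o_def)
    then have "continuous_on (C k) (h k)" unfolding h_def by (intro continuous_intros)
    then show ?thesis unfolding sub by simp
  qed
  have corner_value: "h k (side k s) = h m (\<i> ^ m)"
    if h: "k < 4" "m < 4" "s = 0 \<or> s = 1" "side k s = \<i> ^ m" for k m s
  proof (cases "s = 0")
    case True
    then have "k = m" using h i_power_inj by simp
    then show ?thesis using True by simp
  next
    case False
    then have s1: "s = 1" using h by simp
    then have "\<i> ^ (Suc k mod 4) = \<i> ^ m" using h(4) i_power_Suc_mod[OF h(1)] by simp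
    then have m: "Suc k mod 4 = m" using i_power_inj[of "Suc k mod 4" m] h(2) by simp
    have "h k (side k s) = side_sign \<beta> f k *\<^sub>R G_edge \<beta> (side_edge f k) (corner f (Suc k))"
      unfolding h_def s1 by (simp add: corner_def)
    also have "\<dots> = h m (\<i> ^ m)" using side_sign_turn[OF f \<beta> h(1)] by (simp only: m h_def corner_def)
    finally show ?thesis .
  qed
  have agree: "h k y = h k' y" if h: "k \<in> {..<4}" "k' \<in> {..<4}" "y \<in> topspace (top_of_set ?S) \<inter> C k \<inter> C k'" for k k' y
  proof (cases "k = k'")
    case False
    obtain s s' where s: "0 \<le> s" "s \<le> 1" "y = side k s" "0 \<le> s'" "s' \<le> 1" "y = side k' s'"
      using h(3) by (auto simp: C_def)
    have "s = 0 \<or> s = 1" using side_inj[of k s k' s'] s h False by fastforce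
    moreover have "s' = 0 \<or> s' = 1" using side_inj[of k' s' k s] s h False by fastforce
    moreover obtain m where m: "m < 4" "y = \<i> ^ m"
    proof (cases "s = 0")
      case True
      then show ?thesis using that[of k] s h by simp
    next
      case False
      then have "s = 1" using \<open>s = 0 \<or> s = 1\<close> by simp
      then have "y = \<i> ^ (Suc k mod 4)" using s(3) i_power_Suc_mod[of k] h(1) by simp
      then show ?thesis using that[of "Suc k mod 4"] by simp
    qed
    ultimately show ?thesis using corner_value[of k m s] corner_value[of k' m s'] s h by (metis lessThan_iff)
  qed simp
  obtain g where g: "continuous_map (top_of_set ?S) euclidean g"
    "\<And>y k. \<lbrakk>k \<in> {..<4}; y \<in> topspace (top_of_set ?S) \<inter> C k\<rbrakk> \<Longrightarrow> g y = h k y"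
    using pasting_lemma_exists_closed[of "{..<4::nat}" "top_of_set ?S" C euclidean h, OF _ cover clo _ agree] cont by auto
  have "lifts_boundary \<beta> f g"
    unfolding lifts_boundary_def
  proof (intro allI ballI impI)
    fix k and s :: real assume "k < (4::nat)" "s \<in> {0..1}"
    then show "g (side k s) = side_sign \<beta> f k *\<^sub>R G_edge \<beta> (side_edge f k) (\<Phi> f (side k s))"
      using g(2)[of k "side k s"] side_in_quadrilateral[of s k] by (auto simp: C_def h_def)
  qed
  then show ?thesis using g(1) that by simp
qed

text \<open>Tietze extension might produce zeros inside the face. They are removed by the coordinate \<open>inner\<close>,
  which is made positive inside and zero on the boundary.\<close>

lemma face_lift_exists:
  assumes f: "f \<in> Faces" and \<beta>: "cocycle \<beta>"
  shows "\<exists>g. continuous_on Q g \<and> (\<forall>y\<in>Q. g y \<noteq> 0) \<and> lifts_boundary \<beta> f g"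
proof -
  obtain g0 where g0: "continuous_on (Q - interior Q) g0" "lifts_boundary \<beta> f g0"
    by (rule boundary_lift_exists[OF f \<beta>])
  have "closed (Q - interior Q)" using compact_imp_closed[OF compact_quadrilateral] by (intro closed_Diff) auto
  then have "closedin (top_of_set Q) (Q - interior Q)" by (intro closed_subset) auto
  from Tietze_unbounded[OF g0(1) this] obtain g1 where g1: "continuous_on Q g1" "\<And>y. y \<in> Q - interior Q \<Longrightarrow> g1 y = g0 y" by blast
  define g where "g y = (\<chi> i. if i = inner then 1 - taxi_norm y else g1 y $ i)" for y
  have bd: "g y = g0 y" if y: "y \<in> Q - interior Q" for y
  proof -
    obtain k s where k: "k < 4" "0 \<le> s" "s < 1" "y = side k s" using quadrilateral_boundary y by blast
    have "g0 y = side_sign \<beta> f k *\<^sub>R G_edge \<beta> (side_edge f k) (\<Phi> f y)" using g0(2) k by (simp add: lifts_boundary_def)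
    moreover have "\<Phi> f y \<in> side_edge f k" using k by (auto simp: side_edge_def)
    ultimately have "g0 y $ inner = 0" using G_edge_side(4)[OF f k(1)] by simp
    moreover have "taxi_norm y = 1" using k taxi_norm_side by simp
    ultimately show ?thesis using g1(2)[OF y] by (simp add: g_def vec_eq_iff)
  qed
  have "continuous_on Q g"
    unfolding g_def
  proof (intro continuous_on_vec_lambda)
    fix i
    show "continuous_on Q (\<lambda>y. if i = inner then 1 - taxi_norm y else g1 y $ i)"
      by (cases "i = inner") (auto intro!: continuous_intros continuous_on_component g1(1))
  qed
  moreover have "g y \<noteq> 0" if y: "y \<in> Q" for y
  proof (cases "y \<in> interior Q")
    case True
    then have "g y $ inner \<noteq> 0" by (simp add: g_def mem_interior_quadrilateral)
    then show ?thesis by auto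
  next
    case False
    then obtain k s where k: "k < 4" "0 \<le> s" "s < 1" "y = side k s" using quadrilateral_boundary y by blast
    have "g y = side_sign \<beta> f k *\<^sub>R G_edge \<beta> (side_edge f k) (\<Phi> f y)"
      using bd[of y] g0(2) k y False by (simp add: lifts_boundary_def)
    moreover have "\<Phi> f y \<in> side_edge f k" using k by (auto simp: side_edge_def)
    ultimately show ?thesis using G_edge_side(5)[OF f k(1)] side_sign_cases[of \<beta> f k] by auto
  qed
  moreover have "lifts_boundary \<beta> f g"
    using g0(2) bd side_in_quadrilateral by (auto simp: lifts_boundary_def)
  ultimately show ?thesis by blast
qed

end

section \<open>The line field of a cocycle\<close>

context colored_quadrangulation begin

definition face_lift :: "(nat \<Rightarrow> nat set \<Rightarrow> bool) \<Rightarrow> 'a set \<Rightarrow> complex \<Rightarrow> real^6" where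
  "face_lift \<beta> f = (SOME g. continuous_on Q g \<and> (\<forall>y\<in>Q. g y \<noteq> 0) \<and> lifts_boundary \<beta> f g)"

lemma face_lift:
  assumes "f \<in> Faces" "cocycle \<beta>"
  shows "continuous_on Q (face_lift \<beta> f)" "y \<in> Q \<Longrightarrow> face_lift \<beta> f y \<noteq> 0" "lifts_boundary \<beta> f (face_lift \<beta> f)"
proof -
  have "continuous_on Q (face_lift \<beta> f) \<and> (\<forall>y\<in>Q. face_lift \<beta> f y \<noteq> 0) \<and> lifts_boundary \<beta> f (face_lift \<beta> f)"
    unfolding face_lift_def using face_lift_exists[OF assms] by (rule someI_ex)
  then show "continuous_on Q (face_lift \<beta> f)" "y \<in> Q \<Longrightarrow> face_lift \<beta> f y \<noteq> 0" "lifts_boundary \<beta> f (face_lift \<beta> f)"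
    by blast+
qed

lemma face_lift_edge:
  assumes f: "f \<in> Faces" "cocycle \<beta>" and y: "y \<in> Q" and e: "e \<in> E" "\<Phi> f y \<in> e"
  shows "face_lift \<beta> f y = G_edge \<beta> e (\<Phi> f y) \<or> face_lift \<beta> f y = - G_edge \<beta> e (\<Phi> f y)"
proof -
  have "y \<notin> interior Q"
  proof
    assume "y \<in> interior Q"
    then have "\<Phi> f y \<in> f" using face(2)[OF f(1)] by blast
    then show False using face_disjoint[OF f(1)] e by blast
  qed
  then obtain k s where k: "k < 4" "0 \<le> s" "s < 1" "y = side k s" using quadrilateral_boundary y by blast
  have "face_lift \<beta> f y = side_sign \<beta> f k *\<^sub>R G_edge \<beta> (side_edge f k) (\<Phi> f y)"
    using face_lift(3)[OF f] k by (simp add: lifts_boundary_def)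
  moreover have "\<Phi> f y \<in> side_edge f k" using k by (auto simp: side_edge_def)
  then have "G_edge \<beta> (side_edge f k) (\<Phi> f y) = G_edge \<beta> e (\<Phi> f y) \<or> G_edge \<beta> (side_edge f k) (\<Phi> f y) = - G_edge \<beta> e (\<Phi> f y)"
    using G_edge_common_end[OF face(4)[OF f(1) k(1)] e(1)] e(2) by blast
  ultimately show ?thesis using side_sign_cases[of \<beta> f k] by auto
qed

lemma face_lift_consistent:
  assumes \<beta>: "cocycle \<beta>" and f: "f \<in> Faces" "y \<in> Q" and f': "f' \<in> Faces" "y' \<in> Q" and eq: "\<Phi> f y = \<Phi> f' y'"
  shows "face_lift \<beta> f y = face_lift \<beta> f' y' \<or> face_lift \<beta> f y = - face_lift \<beta> f' y'"
proof (cases "\<Phi> f y \<in> \<Union>E")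
  case True
  then obtain e where e: "e \<in> E" "\<Phi> f y \<in> e" by blast
  then show ?thesis
    using face_lift_edge[OF f(1) \<beta> f(2) e] face_lift_edge[OF f'(1) \<beta> f'(2) e(1)] eq by auto
next
  case False
  have int: "z \<in> interior Q" if h: "g \<in> Faces" "z \<in> Q" "\<Phi> g z \<notin> \<Union>E" for g z
  proof (rule ccontr)
    assume "z \<notin> interior Q"
    then obtain k s where k: "k < 4" "0 \<le> s" "s < 1" "z = side k s" using quadrilateral_boundary h(2) by blast
    then have "\<Phi> g z \<in> side_edge g k" by (auto simp: side_edge_def)
    then show False using face(4)[OF h(1) k(1)] h(3) by blast
  qed
  have i: "y \<in> interior Q" "y' \<in> interior Q" using int f f' False eq by auto
  then have "\<Phi> f y \<in> f" "\<Phi> f' y' \<in> f'" using face(2) f f' by blast+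
  then have ff: "f = f'" using faces_disjoint f(1) f'(1) eq by auto
  then have "y = y'" using inj_onD[OF face(3)[OF f(1)], of y y'] eq i by simp
  then show ?thesis using ff by simp
qed

text \<open>The lifts of different faces agree up to sign where they meet, so an arbitrary choice is made
  at every point.\<close>

definition field :: "(nat \<Rightarrow> nat set \<Rightarrow> bool) \<Rightarrow> 'a \<Rightarrow> real^6" where
  "field \<beta> x = (let p = (SOME p. fst p \<in> Faces \<and> snd p \<in> Q \<and> \<Phi> (fst p) (snd p) = x) in face_lift \<beta> (fst p) (snd p))"

lemma field_face_lift:
  assumes \<beta>: "cocycle \<beta>" and f: "f \<in> Faces" "y \<in> Q"
  shows "field \<beta> (\<Phi> f y) = face_lift \<beta> f y \<or> field \<beta> (\<Phi> f y) = - face_lift \<beta> f y"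
proof -
  define p where "p = (SOME p. fst p \<in> Faces \<and> snd p \<in> Q \<and> \<Phi> (fst p) (snd p) = \<Phi> f y)"
  have "\<exists>p. fst p \<in> Faces \<and> snd p \<in> Q \<and> \<Phi> (fst p) (snd p) = \<Phi> f y"
    using f by (intro exI[of _ "(f, y)"]) simp
  then have p: "fst p \<in> Faces \<and> snd p \<in> Q \<and> \<Phi> (fst p) (snd p) = \<Phi> f y" unfolding p_def by (rule someI_ex)
  have "field \<beta> (\<Phi> f y) = face_lift \<beta> (fst p) (snd p)" unfolding field_def p_def[symmetric] Let_def ..
  then show ?thesis using face_lift_consistent[OF \<beta> _ _ f, of "fst p" "snd p"] p by simp
qed

text \<open>On each of the finitely many closed faces the products of coordinates are those of the continuous
  lift.\<close>

lemma line_field_field: assumes \<beta>: "cocycle \<beta>" shows "line_field X (field \<beta>)"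
  unfolding line_field_def
proof (intro conjI ballI allI)
  fix x assume "x \<in> topspace X"
  then obtain f y where f: "f \<in> Faces" "y \<in> Q" "x = \<Phi> f y" unfolding closed_faces_cover by blast
  then show "field \<beta> x \<noteq> 0" using field_face_lift[OF \<beta> f(1,2)] face_lift(2)[OF f(1) \<beta> f(2)] by auto
next
  fix i j
  show "continuous_map X euclideanreal (\<lambda>x. field \<beta> x $ i * field \<beta> x $ j)"
  proof (rule pasting_lemma_closed[of Faces X "\<lambda>f. \<Phi> f ` Q" euclideanreal "\<lambda>f x. field \<beta> x $ i * field \<beta> x $ j"])
    show "finite Faces" by (rule finite_faces)
    show "closedin X (\<Phi> f ` Q)" if "f \<in> Faces" for f
      using closed_face_image[OF that compact_imp_closed[OF compact_quadrilateral]] by simp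
    show "\<exists>f. f \<in> Faces \<and> x \<in> \<Phi> f ` Q \<and> field \<beta> x $ i * field \<beta> x $ j = field \<beta> x $ i * field \<beta> x $ j" if "x \<in> topspace X" for x
      using that unfolding closed_faces_cover by blast
    fix f assume f: "f \<in> Faces"
    have q: "quotient_map (top_of_set Q) (subtopology X (\<Phi> f ` Q)) (\<Phi> f)"
    proof (rule continuous_imp_quotient_map)
      show "continuous_map (top_of_set Q) (subtopology X (\<Phi> f ` Q)) (\<Phi> f)"
        using face(1)[OF f] by (simp add: continuous_map_in_subtopology)
      show "compact_space (top_of_set Q)" using compact_quadrilateral by (simp add: compact_space_subtopology)
      show "Hausdorff_space (subtopology X (\<Phi> f ` Q))" using Hausdorff Hausdorff_space_subtopology by blast
      have "\<Phi> f ` Q \<subseteq> topspace X" using closed_faces_cover f by blast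
      then show "\<Phi> f ` topspace (top_of_set Q) = topspace (subtopology X (\<Phi> f ` Q))" by auto
    qed
    have "continuous_on Q (\<lambda>y. face_lift \<beta> f y $ i * face_lift \<beta> f y $ j)"
      using face_lift(1)[OF f \<beta>] by (intro continuous_intros continuous_on_component)
    moreover have "face_lift \<beta> f y $ i * face_lift \<beta> f y $ j = field \<beta> (\<Phi> f y) $ i * field \<beta> (\<Phi> f y) $ j" if "y \<in> Q" for y
      using field_face_lift[OF \<beta> f that] by auto
    ultimately have "continuous_on Q (\<lambda>y. field \<beta> (\<Phi> f y) $ i * field \<beta> (\<Phi> f y) $ j)" by (rule continuous_on_eq)
    then have "continuous_map (top_of_set Q) euclideanreal ((\<lambda>x. field \<beta> x $ i * field \<beta> x $ j) \<circ> \<Phi> f)" by (simp add: o_def)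
    then show "continuous_map (subtopology X (\<Phi> f ` Q)) euclideanreal (\<lambda>x. field \<beta> x $ i * field \<beta> x $ j)"
      using continuous_compose_quotient_map[OF q] by blast
  qed simp
qed

lemma field_edge:
  assumes \<beta>: "cocycle \<beta>" and e: "e \<in> E" "x \<in> e"
  shows "field \<beta> x = G_edge \<beta> e x \<or> field \<beta> x = - G_edge \<beta> e x"
proof -
  have "x \<in> topspace X" using edge_space e by blast
  then obtain f y where f: "f \<in> Faces" "y \<in> Q" "x = \<Phi> f y" unfolding closed_faces_cover by blast
  then show ?thesis using field_face_lift[OF \<beta> f(1,2)] face_lift_edge[OF f(1) \<beta> f(2) e(1)] e(2) by auto
qed

lemma connected_edge: "e \<in> E \<Longrightarrow> connectedin X e"
proof -
  assume "e \<in> E"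
  then obtain \<gamma> where \<gamma>: "embedding_map (top_of_set {0..1::real}) X \<gamma>" "e = \<gamma> ` {0..1}" by (rule edge_arc)
  have "continuous_map (top_of_set {0..1}) X \<gamma>"
    using \<gamma>(1) continuous_map_in_subtopology homeomorphic_imp_continuous_map unfolding embedding_map_def by blast
  moreover have "connectedin (top_of_set {0..1::real}) {0..1}" by (simp add: connectedin_subtopology)
  ultimately show ?thesis unfolding \<gamma>(2) by (rule connectedin_continuous_map_image)
qed

text \<open>A sign function that relates the fields of two cocycles has a constant value on every edge.
  These values lift the edges to the double cover of the complex that belongs to the sum of the
  cocycles.\<close>

lemma related_fields_coboundary:
  assumes \<beta>: "cocycle \<beta>" "cocycle \<beta>'" and u: "\<And>x. u x = 1 \<or> u x = (-1::real)"
    and cont: "\<And>i j. continuous_map X euclideanreal (\<lambda>x. u x * (field \<beta> x $ i * field \<beta>' x $ j))"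
    and odd: "odd (card {e \<in> E. breaks e})"
  obtains t :: "nat \<Rightarrow> nat \<Rightarrow> bool" where "\<And>a b. t a b = t b a"
    "\<And>a b d x. four_colors a b d x \<Longrightarrow> (\<beta> a {b, d} \<noteq> \<beta>' a {b, d}) \<longleftrightarrow> t a b \<noteq> t a d"
proof -
  define val where "val n x = u x * (field \<beta> x $ n * field \<beta>' x $ n)" for n x
  have F: "field b x = end_vector b x (col w) \<or> field b x = - end_vector b x (col w)"
    if "cocycle b" "e \<in> E" "e \<inter> V = {x, w}" "x \<noteq> w" for b e x w
  proof -
    have "G_edge b e x = end_vector b x (col w)" using G_edge[OF that(2)] that(3,4) unfolding edge_field_def by blast
    then show ?thesis using field_edge[OF that(1,2), of x] that(3) by auto
  qed
  have const: "val (node (cc f k) (cc f (k + 1))) (cv f k) = val (node (cc f k) (cc f (k + 1))) (cv f (k + 1))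
     \<and> (val (node (cc f k) (cc f (k + 1))) (cv f k) = 1 \<or> val (node (cc f k) (cc f (k + 1))) (cv f k) = -1)" if f: "f \<in> Faces" for f k
  proof -
    let ?n = "node (cc f k) (cc f (k + 1))"
    have one: "G_edge b (ee f k) x $ ?n = 1" if "x \<in> ee f k" for b x
      using G_edge_side(3)[OF f, of "k mod 4" x b] that cv_Suc[OF f, of k] by (simp add: ee_def cc_cv cv_def)
    have v1: "val ?n x = 1 \<or> val ?n x = -1" if x: "x \<in> ee f k" for x
    proof -
      have "field \<beta> x $ ?n = 1 \<or> field \<beta> x $ ?n = -1" "field \<beta>' x $ ?n = 1 \<or> field \<beta>' x $ ?n = -1"
        using field_edge[OF \<beta>(1) ee_E[OF f] x] field_edge[OF \<beta>(2) ee_E[OF f] x] one[OF x] by auto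
      then show ?thesis using u[of x] by (auto simp: val_def)
    qed
    have c: "connectedin euclideanreal (val ?n ` ee f k)"
      using connected_edge[OF ee_E[OF f]] cont[of ?n ?n] unfolding val_def by (intro connectedin_continuous_map_image) auto
    have "val ?n ` ee f k \<subseteq> {1, -1}" using v1 by auto
    then have "finite (val ?n ` ee f k)" by (rule finite_subset) simp
    then have "\<exists>a. val ?n ` ee f k \<subseteq> {a}" using c connected_finite_iff_sing[of "val ?n ` ee f k"] by (auto simp: connectedin_iff_connected)
    then show ?thesis using v1 cv_ee[OF f, of k] by blast
  qed
  have per: "cv f (k + 4) = cv f k" "cc f (k + 4) = cc f k" for f k by simp_all
  define T where "T e \<longleftrightarrow> (\<exists>f\<in>Faces. \<exists>k. ee f k = e \<and> val (node (cc f k) (cc f (k + 1))) (cv f k) = -1)" for e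
  have T: "T (ee f k) \<longleftrightarrow> val (node (cc f k) (cc f (k + 1))) (cv f k) = -1" if f: "f \<in> Faces" for f k
  proof
    assume "T (ee f k)"
    then obtain f' k' where f': "f' \<in> Faces" "ee f' k' = ee f k" "val (node (cc f' k') (cc f' (k' + 1))) (cv f' k') = -1"
      unfolding T_def by blast
    have "{cv f k, cv f (k + 1)} = {cv f' k', cv f' (k' + 1)}"
      using edge_ends_cyclic[OF f f'(1) f'(2)[symmetric]] by (simp add: cv_def)
    then have "cv f' k' = cv f k \<and> cv f' (k' + 1) = cv f (k + 1) \<or> cv f' k' = cv f (k + 1) \<and> cv f' (k' + 1) = cv f k"
      by (auto simp: doubleton_eq_iff)
    then show "val (node (cc f k) (cc f (k + 1))) (cv f k) = -1"
      using f'(3) const[OF f, of k] unfolding cc_cv by (metis node_sym)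
  qed (use f in \<open>unfold T_def, blast\<close>)
  have corner: "T (ee f k) \<longleftrightarrow> val (node (cc f k) (cc f (k + 1))) (cv f k) = -1"
     "T (ee f (k + 3)) \<longleftrightarrow> val (node (cc f k) (cc f (k + 3))) (cv f k) = -1" if f: "f \<in> Faces" for f k
  proof -
    have i: "k + 3 + 1 = k + 4" by simp
    have "T (ee f (k + 3)) \<longleftrightarrow> val (node (cc f (k + 3)) (cc f (k + 4))) (cv f (k + 4)) = -1"
      using T[OF f, of "k + 3"] const[OF f, of "k + 3"] unfolding i by metis
    then show "T (ee f (k + 3)) \<longleftrightarrow> val (node (cc f k) (cc f (k + 3))) (cv f k) = -1"
      unfolding per by (metis node_sym)
  qed (rule T[OF f])
  have same: "T (ee f k) = T (ee f (k + 3))" if "f \<in> Faces" "cc f (k + 1) = cc f (k + 3)" for f k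
    using corner[OF that(1), of k] that(2) by simp
  have diff: "(T (ee f k) \<noteq> T (ee f (k + 3))) = (\<beta> (cc f k) (AA f k) \<noteq> \<beta>' (cc f k) (AA f k))"
    if f: "f \<in> Faces" and ne: "cc f (k + 1) \<noteq> cc f (k + 3)" for f k
  proof -
    let ?v = "cv f k" and ?n = "node (cc f k) (cc f (k + 1))" and ?m = "node (cc f k) (cc f (k + 3))"
    have V: "?v \<in> V" by (rule cv_V[OF f])
    have A: "cc f (k + 1) \<in> A ?v" "cc f (k + 3) \<in> A ?v" using corner_colors(1,2)[OF f, of k] by (simp_all add: AA_cv)
    have oth: "other ?v (cc f (k + 1)) = cc f (k + 3)" using other[OF V A(1)] A(2) ne by auto
    have nm: "?n \<noteq> ?m" using node_neq other_less(2)[OF V A(1)] other_less(2)[OF V A(2)] ne by blast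
    have fb: "field b ?v $ ?m = sgn_of b ?v * field b ?v $ ?n" if b: "cocycle b" for b
    proof -
      have "field b ?v = G_edge b (ee f k) ?v \<or> field b ?v = - G_edge b (ee f k) ?v"
        using field_edge[OF b ee_E[OF f] cv_ee(1)[OF f]] .
      moreover have "G_edge b (ee f k) ?v = end_vector b ?v (cc f (k + 1))" by (rule G_edge_cv(1)[OF f])
      moreover have "end_vector b ?v (cc f (k + 1)) $ ?n = 1" "end_vector b ?v (cc f (k + 1)) $ ?m = sgn_of b ?v"
        unfolding end_vector_def oth cc_cv[symmetric] using nm by (simp_all add: axis_def)
      ultimately show ?thesis by auto
    qed
    have "val ?m ?v = (sgn_of \<beta> ?v * sgn_of \<beta>' ?v) * val ?n ?v"
      unfolding val_def fb[OF \<beta>(1)] fb[OF \<beta>(2)] by simp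
    moreover have "sgn_of \<beta> ?v * sgn_of \<beta>' ?v = (if \<beta> (cc f k) (AA f k) \<noteq> \<beta>' (cc f k) (AA f k) then -1 else 1)"
      by (auto simp: sgn_of_def cc_cv AA_cv)
    ultimately show ?thesis using corner[OF f, of k] const[OF f, of k] by (auto split: if_splits)
  qed
  show ?thesis
  proof (rule odd_breaks_coboundary[of T "\<lambda>a B. \<beta> a B \<noteq> \<beta>' a B"])
    show "odd (card {e \<in> E. breaks e})" by (rule odd)
    show "T (ee f k) = T (ee f (k + 3))" if "f \<in> Faces" "cc f (k + 1) = cc f (k + 3)" for f k
      using that by (rule same)
    show "(T (ee f k) \<noteq> T (ee f (k + 3))) = (\<beta> (cc f k) (AA f k) \<noteq> \<beta>' (cc f k) (AA f k))"
      if "f \<in> Faces" "cc f (k + 1) \<noteq> cc f (k + 3)" for f k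
      using that by (rule diff)
    fix t :: "nat \<Rightarrow> nat \<Rightarrow> bool"
    assume "\<And>a b. t a b = t b a" "\<And>a b d x. four_colors a b d x \<Longrightarrow> (\<beta> a {b, d} \<noteq> \<beta>' a {b, d}) \<longleftrightarrow> t a b \<noteq> t a d"
    then show thesis by (rule that)
  qed
qed

end

section \<open>A family of independent cocycles\<close>

text \<open>Together with the indicators of \<open>test_pairs\<close> this gives seven cocycles whose classes form a basis.\<close>

definition separates :: "nat \<Rightarrow> nat set \<Rightarrow> bool" where
  "separates a B \<longleftrightarrow> (\<exists>b\<in>B. \<exists>d\<in>B. b < a \<and> a < d)"

definition test_cocycle :: "nat set set \<times> bool \<Rightarrow> nat \<Rightarrow> nat set \<Rightarrow> bool" where
  "test_cocycle p a B \<longleftrightarrow> (B \<in> fst p) \<noteq> (snd p \<and> separates a B)"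

lemma cocycle_test_cocycle: "cocycle (test_cocycle p)"
  unfolding cocycle_def
proof (intro allI impI)
  fix a b c d :: nat assume "distinct [a, b, c, d]"
  then have "(separates a {b, d} \<noteq> separates b {a, c}) = (separates c {b, d} \<noteq> separates d {a, c})"
  proof -
    have sp: "separates a {b, d} \<longleftrightarrow> b < a \<and> a < d \<or> d < a \<and> a < b" for a b d
      by (auto simp: separates_def)
    show ?thesis using \<open>distinct [a, b, c, d]\<close> unfolding sp by (simp, presburger)
  qed
  then show "(test_cocycle p a {b, d} \<noteq> test_cocycle p b {a, c}) = (test_cocycle p c {b, d} \<noteq> test_cocycle p d {a, c})"
    unfolding test_cocycle_def by auto
qed

definition test_pairs :: "nat set set" where
  "test_pairs = (\<lambda>(b, d). {b, d}) ` {(1,2), (1,3), (1,4), (2,3), (2,4), (3,4)}"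

lemma card_test_index: "card (Pow test_pairs \<times> (UNIV :: bool set)) = 128"
proof -
  have "card test_pairs = 6" unfolding test_pairs_def by (simp add: doubleton_eq_iff)
  then show ?thesis by (simp add: card_cartesian_product card_Pow test_pairs_def)
qed

text \<open>The sum of a coboundary over a closed path vanishes. The types \<open>(0, {1, 2})\<close>, \<open>(1, {0, 2})\<close>, \<open>(2, {0, 1})\<close>
  form a closed path, and so do \<open>(3, {0, 1})\<close>, \<open>(3, {1, 2})\<close>, \<open>(3, {0, 2})\<close>. In the sum over both paths the
  indicators of pairs cancel, while \<open>separates\<close> holds once. After that the closed paths
  \<open>(0, {b, d})\<close>, \<open>(b, {0, d})\<close>, \<open>(d, {0, b})\<close> detect the single pairs \<open>{b, d}\<close>.\<close>

lemma test_cocycles_independent: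
  assumes S: "S \<subseteq> test_pairs" "S' \<subseteq> test_pairs" and t: "\<And>a b. t a b = t b a"
    and cob: "\<And>a b d x. four_colors a b d x \<Longrightarrow>
       (test_cocycle (S, \<epsilon>) a {b, d} \<noteq> test_cocycle (S', \<epsilon>') a {b, d}) \<longleftrightarrow> t a b \<noteq> (t a d :: bool)"
  shows "(S, \<epsilon>) = (S', \<epsilon>')"
proof -
  have cob': "(({b,d} \<in> S) \<noteq> ({b,d} \<in> S')) \<noteq> ((\<epsilon> \<noteq> \<epsilon>') \<and> separates a {b, d}) \<longleftrightarrow> t a b \<noteq> t a d"
    if "four_colors a b d x" for a b d x
    using cob[OF that] unfolding test_cocycle_def by auto
  have fc: "four_colors 0 1 2 3" "four_colors 1 0 2 3" "four_colors 2 0 1 3" "four_colors 3 0 1 4" "four_colors 3 1 2 4" "four_colors 3 0 2 4"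
    by (simp_all add: four_colors_def)
  have sep: "\<not> separates 0 {1,2}" "separates 1 {0,2}" "\<not> separates 2 {0,1}" "\<not> separates 3 {0,1}" "\<not> separates 3 {1,2}" "\<not> separates 3 {0,2}"
    by (auto simp: separates_def)
  have eps: "\<epsilon> = \<epsilon>'"
    using cob'[OF fc(1)] cob'[OF fc(2)] cob'[OF fc(3)] cob'[OF fc(4)] cob'[OF fc(5)] cob'[OF fc(6)] sep t by metis
  have zero: "{0, b} \<notin> test_pairs" for b unfolding test_pairs_def by (auto simp: doubleton_eq_iff)
  have mem: "({b, d} \<in> S) = ({b, d} \<in> S')" if h: "b \<in> {1,2,3,4}" "d \<in> {1,2,3,4}" "b \<noteq> d" for b d
  proof -
    obtain x where x: "x < 5" "x \<noteq> 0" "x \<noteq> b" "x \<noteq> d"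
    proof -
      have "\<exists>x\<in>{1,2,3::nat}. x \<noteq> b \<and> x \<noteq> d" by auto
      then obtain y where "y \<in> {1,2,3::nat}" "y \<noteq> b" "y \<noteq> d" by blast
      then show ?thesis using that[of y] by auto
    qed
    then have c: "four_colors 0 b d x" "four_colors b 0 d x" "four_colors d 0 b x" using h by (auto simp: four_colors_def)
    show ?thesis
      using cob'[OF c(1)] cob'[OF c(2)] cob'[OF c(3)] zero[of d] zero[of b] S eps t by (metis subsetD)
  qed
  have "p \<in> S \<longleftrightarrow> p \<in> S'" if "p \<in> test_pairs" for p
  proof -
    have "p \<in> (\<lambda>q. {fst q, snd q}) ` {(1,2), (1,3), (1,4), (2,3), (2,4), (3,4)}"
      using that by (simp only: test_pairs_def case_prod_unfold)
    then obtain q where q: "p = {fst q, snd q}" "q \<in> {(1,2), (1,3), (1,4), (2,3), (2,4), (3,4::nat)}"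
      by (rule imageE)
    have "fst q \<in> {1,2,3,4}" "snd q \<in> {1,2,3,4}" "fst q \<noteq> snd q" using q(2) by auto
    then show ?thesis using mem[of "fst q" "snd q"] q(1) by simp
  qed
  then show ?thesis using S eps by blast
qed

section \<open>Odd quadrangulations of surfaces of small genus\<close>

text \<open>Pigeonhole: there are 128 test cocycles and at most \<open>2 ^ 6\<close> sequences of bits.\<close>

theorem no_local_3_coloring:
  fixes c :: "'a \<Rightarrow> nat"
  assumes N: "nonorientable_surface g X" and g: "g \<le> 6" and odd: "odd_quadrangulation X V E"
    and lc: "local_3_coloring V E c" and five: "card (c ` V) \<le> 5"
  shows False
proof -
  have X: "surface X" using N by (simp add: nonorientable_surface_def)
  have graph: "embedded_graph X V E" using odd by (simp add: odd_quadrangulation_def quadrangulation_def)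
  obtain \<Phi> where ori: "face_orientation X V E \<Phi>" "odd (card {e \<in> E. breaks_consistency X V E \<Phi> e})"
    using odd by (auto simp: odd_quadrangulation_def)
  interpret oriented_quadrangulation X V E \<Phi> by unfold_locales (use X graph ori in auto)
  have "finite (c ` V)" using finite_V by simp
  then obtain r where r: "inj_on r (c ` V)" "r ` c ` V \<subseteq> {..<5::nat}"
    using five card_le_inj[of "c ` V" "{..<5::nat}"] by auto
  define col where "col v = r (c v)" for v
  have nbr: "neighbors V E v \<subseteq> V" for v by (auto simp: neighbors_def)
  \<comment> \<open>A vertex with fewer than two colors among its neighbors is given an arbitrary type that fits.\<close>
  have "\<exists>B. col ` neighbors V E v \<subseteq> B \<and> B \<subseteq> {..<5} - {col v} \<and> card B = 2" if v: "v \<in> V" for v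
  proof (rule exists_subset_between)
    have "col ` neighbors V E v = r ` c ` neighbors V E v" by (auto simp: col_def)
    then have "card (col ` neighbors V E v) \<le> card (c ` neighbors V E v)"
      using card_image_le finite_subset[OF nbr finite_V] by (metis finite_imageI)
    then show "card (col ` neighbors V E v) \<le> 2" using lc v by (auto simp: local_3_coloring_def)
    have "col v < 5" using r v by (auto simp: col_def)
    then show "2 \<le> card ({..<5} - {col v})" by simp
    show "col ` neighbors V E v \<subseteq> {..<5} - {col v}"
    proof
      fix z assume "z \<in> col ` neighbors V E v"
      then obtain w where w: "w \<in> V" "adjacent V E v w" "z = col w" by (auto simp: neighbors_def)
      then have "c v \<noteq> c w" using lc v by (auto simp: local_3_coloring_def proper_coloring_def)
      then have "col v \<noteq> col w" using inj_onD[OF r(1), of "c v" "c w"] v w by (auto simp: col_def)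
      moreover have "col w < 5" using r w by (auto simp: col_def)
      ultimately show "z \<in> {..<5} - {col v}" using w by auto
    qed
  qed simp
  then obtain A where A: "\<And>v. v \<in> V \<Longrightarrow> col ` neighbors V E v \<subseteq> A v \<and> A v \<subseteq> {..<5} - {col v} \<and> card (A v) = 2"
    by metis
  interpret colored_quadrangulation X V E \<Phi> col A
  proof
    show "col v < 5" if "v \<in> V" for v using r that by (auto simp: col_def)
    show "A v \<subseteq> {..<5}" "card (A v) = 2" "col v \<notin> A v" if "v \<in> V" for v using A[OF that] by auto
    show "col v \<in> A u" if "e \<in> E" "e \<inter> V = {u, v}" "u \<noteq> v" for e u v
    proof -
      have uv: "u \<in> V" "v \<in> V" using that by blast+
      then have "v \<in> neighbors V E u" using that by (auto simp: neighbors_def adjacent_def)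
      then show ?thesis using A[OF uv(1)] by blast
    qed
  qed
  have oddb: "odd (card {e \<in> E. breaks e})" using ori(2) breaks_eq by simp
  obtain q where q: "quotient_map (top_of_set (cball 0 1)) X q"
    and glue: "\<And>z w. z \<in> cball 0 1 \<Longrightarrow> w \<in> cball 0 1 \<Longrightarrow> q z = q w \<longleftrightarrow> equivclp (crosscap_side g) z w"
    using N unfolding nonorientable_surface_def by blast
  have glue': "q z = q w" if "z \<in> cball 0 1" "w \<in> cball 0 1" "crosscap_side g z w" for z w
    using glue that by blast
  have "\<exists>b t. sides_holonomy g q (field (test_cocycle p)) t b" for p
    using line_field_holonomy_exists[OF q glue' line_field_field[OF cocycle_test_cocycle]] by blast
  then obtain b t where bt: "\<And>p. sides_holonomy g q (field (test_cocycle p)) (t p) (b p)" by metis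
  define I where "I = Pow test_pairs \<times> (UNIV :: bool set)"
  \<comment> \<open>The sequence of bits, as the set of crosscaps with the bit 1.\<close>
  define code where "code p = {k. k < g \<and> b p k = (1::real)}" for p
  have "code ` I \<subseteq> Pow {..<g}" by (auto simp: code_def)
  then have "card (code ` I) \<le> 2 ^ g" using card_mono[of "Pow {..<g}" "code ` I"] by (simp add: card_Pow)
  also have "\<dots> \<le> 2 ^ 6" using g by (intro power_increasing) auto
  also have "\<dots> < card I" unfolding I_def card_test_index by simp
  finally have "\<not> inj_on code I" by (rule pigeonhole)
  then obtain p p' where p: "p \<in> I" "p' \<in> I" "p \<noteq> p'" "code p = code p'" by (auto simp: inj_on_def)
  have bb: "b p k = b p' k" if "k < g" for k
  proof -
    have "b p k = 1 \<or> b p k = -1" "b p' k = 1 \<or> b p' k = -1" using bt by (auto simp: sides_holonomy_def)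
    moreover have "k \<in> code p \<longleftrightarrow> k \<in> code p'" using p(4) by simp
    ultimately show ?thesis using that by (auto simp: code_def)
  qed
  obtain u :: "'a \<Rightarrow> real" where u: "\<And>x. u x = 1 \<or> u x = -1"
    "\<And>i j. continuous_map X euclideanreal (\<lambda>x. u x * (field (test_cocycle p) x $ i * field (test_cocycle p') x $ j))"
    using line_fields_equal_holonomy[OF q glue bt bt bb] by blast
  obtain s :: "nat \<Rightarrow> nat \<Rightarrow> bool" where s: "\<And>a b. s a b = s b a"
    "\<And>a b d x. four_colors a b d x \<Longrightarrow> (test_cocycle p a {b, d} \<noteq> test_cocycle p' a {b, d}) \<longleftrightarrow> s a b \<noteq> s a d"
    using related_fields_coboundary[OF cocycle_test_cocycle cocycle_test_cocycle u oddb] by blast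
  obtain S \<epsilon> S' \<epsilon>' where pp: "p = (S, \<epsilon>)" "p' = (S', \<epsilon>')" by fastforce
  have "p = p'" unfolding pp
    using s p(1,2) unfolding pp I_def by (intro test_cocycles_independent[of S S' s]) auto
  then show False using p(3) by simp
qed

section \<open>A homotopy in the graph of types\<close>

text \<open>A type is stored as a triple: the color of a vertex and the colors allowed for its neighbors.\<close>

type_synonym vertex_type = "nat \<times> nat \<times> nat"

definition type_color :: "vertex_type \<Rightarrow> nat" where "type_color u = fst u"

definition type_set :: "vertex_type \<Rightarrow> nat set" where "type_set u = {fst (snd u), snd (snd u)}"

definition type_adj :: "vertex_type \<Rightarrow> vertex_type \<Rightarrow> bool" where
  "type_adj = (\<lambda>(a, b, d) (a', b', d'). (a' = b \<or> a' = d) \<and> (a = b' \<or> a = d'))"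

definition type_ok :: "vertex_type \<Rightarrow> bool" where
  "type_ok = (\<lambda>(a, b, d). a < 5 \<and> a \<noteq> b \<and> a \<noteq> d)"

lemma type_adj_iff: "type_adj u v \<longleftrightarrow> type_color v \<in> type_set u \<and> type_color u \<in> type_set v"
  by (auto simp: type_adj_def type_color_def type_set_def split: prod.splits)

lemma type_ok_iff: "type_ok u \<longleftrightarrow> type_color u < 5 \<and> type_color u \<notin> type_set u"
  by (auto simp: type_ok_def type_color_def type_set_def split: prod.splits)

text \<open>The first row is the walk \<open>w1 w1 \<dots> w7 w7\<close>, where all seven \<open>wk\<close> are closed walks of length 11 from
  the same type. From row to row every type moves to a neighboring type. The row with index 9 alternates
  between two types, so it is symmetric under folding; the last row is its shift by one step and
  serves the columns of the further crosscaps.\<close>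

definition homotopy :: "vertex_type list list" where
  "homotopy =
    [[(0,1,2), (1,0,3), (0,1,2), (1,0,4), (0,1,4), (4,0,1), (1,3,4), (3,1,2), (1,2,3), (2,0,1), (1,0,2), (0,1,2),
      (1,0,3), (0,1,2), (1,0,4), (0,1,4), (4,0,1), (1,3,4), (3,1,2), (1,2,3), (2,0,1), (1,0,2), (0,1,2), (2,0,3),
      (0,2,4), (2,0,3), (0,1,2), (1,0,2), (2,0,1), (0,2,3), (3,0,4), (0,1,3), (1,0,3), (0,1,2), (2,0,3), (0,2,4),
      (2,0,3), (0,1,2), (1,0,2), (2,0,1), (0,2,3), (3,0,4), (0,1,3), (1,0,3), (0,1,2), (1,0,4), (0,1,2), (1,0,4),
      (0,1,3), (3,0,1), (1,2,3), (2,0,1), (1,2,4), (4,1,2), (2,0,4), (0,1,2), (1,0,4), (0,1,2), (1,0,4), (0,1,3),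
      (3,0,1), (1,2,3), (2,0,1), (1,2,4), (4,1,2), (2,0,4), (0,1,2), (2,0,1), (0,1,2), (1,0,4), (4,0,1), (0,2,4),
      (2,0,3), (0,1,2), (1,0,2), (0,1,2), (2,0,4), (0,1,2), (2,0,1), (0,1,2), (1,0,4), (4,0,1), (0,2,4), (2,0,3),
      (0,1,2), (1,0,2), (0,1,2), (2,0,4), (0,1,2), (2,0,1), (1,2,4), (4,1,2), (2,0,4), (4,2,3), (3,2,4), (2,3,4),
      (4,1,2), (1,2,4), (2,0,1), (0,1,2), (2,0,1), (1,2,4), (4,1,2), (2,0,4), (4,2,3), (3,2,4), (2,3,4), (4,1,2),
      (1,2,4), (2,0,1), (0,1,2), (2,0,1), (1,2,4), (2,0,1), (1,2,4), (4,1,2), (2,3,4), (3,0,2), (2,0,3), (3,0,2),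
      (2,0,3), (0,1,2), (2,0,1), (1,2,4), (2,0,1), (1,2,4), (4,1,2), (2,3,4), (3,0,2), (2,0,3), (3,0,2), (2,0,3),
      (0,1,2), (2,0,4), (0,1,2), (1,0,3), (3,0,1), (0,3,4), (3,0,1), (0,3,4), (4,0,3), (3,1,4), (1,0,3), (0,1,2),
      (2,0,4), (0,1,2), (1,0,3), (3,0,1), (0,3,4), (3,0,1), (0,3,4), (4,0,3), (3,1,4), (1,0,3)],
     [(1,0,2), (0,1,4), (1,0,2), (0,1,4), (4,0,1), (1,3,4), (3,1,4), (1,2,3), (2,1,4), (1,0,2), (2,1,4), (1,0,2),
      (0,1,4), (1,0,2), (0,1,4), (4,0,2), (0,3,4), (4,0,1), (1,3,4), (3,0,1), (0,2,3), (2,0,1), (1,0,2), (0,1,2),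
      (2,0,3), (0,1,2), (1,0,2), (2,0,1), (0,2,3), (3,0,2), (0,3,4), (3,0,2), (0,1,3), (1,0,2), (0,1,2), (2,0,4),
      (0,1,2), (1,0,2), (0,1,3), (1,0,2), (2,0,1), (0,2,3), (3,0,1), (0,1,3), (1,0,4), (0,1,3), (1,0,4), (0,1,3),
      (3,0,1), (1,2,3), (2,1,3), (1,0,2), (2,1,3), (1,2,4), (4,1,2), (1,0,4), (4,1,3), (1,0,4), (4,1,3), (3,0,4),
      (0,1,3), (3,0,1), (0,2,3), (2,0,1), (1,2,4), (4,1,2), (1,0,4), (0,1,2), (1,0,4), (4,0,1), (0,2,4), (2,0,4),
      (0,2,3), (2,0,4), (0,1,2), (2,0,4), (4,2,3), (2,0,4), (0,2,3), (2,0,4), (4,1,2), (1,0,4), (4,0,1), (0,2,4),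
      (2,0,1), (0,1,2), (2,0,1), (0,2,4), (2,0,1), (1,2,4), (4,1,2), (2,0,4), (4,2,3), (3,2,4), (2,3,4), (4,0,2),
      (2,3,4), (4,1,2), (1,2,4), (2,0,1), (1,2,4), (4,1,2), (2,1,4), (4,0,2), (2,1,4), (4,2,3), (3,2,4), (2,3,4),
      (4,1,2), (1,2,4), (2,0,1), (1,2,4), (4,1,2), (1,2,4), (4,1,2), (2,3,4), (3,2,4), (2,0,3), (3,2,4), (2,0,3),
      (3,2,4), (2,0,3), (0,2,4), (4,0,1), (0,2,4), (4,0,1), (1,2,4), (4,1,2), (2,3,4), (3,1,2), (2,3,4), (3,1,2),
      (1,0,3), (0,1,2), (1,0,3), (3,0,1), (0,3,4), (4,0,3), (0,3,4), (4,0,3), (3,1,4), (4,2,3), (3,1,4), (1,0,3),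
      (0,1,2), (1,0,3), (3,1,4), (1,2,3), (3,0,1), (1,2,3), (3,0,1), (0,3,4), (4,0,3), (0,1,4)],
     [(0,1,4), (4,0,1), (0,1,4), (4,0,1), (1,3,4), (3,1,4), (4,2,3), (2,1,4), (4,0,2), (2,1,4), (4,0,2), (2,1,4),
      (4,0,2), (2,1,4), (4,0,2), (2,1,4), (4,0,2), (0,1,4), (4,0,1), (0,3,4), (3,0,2), (0,2,3), (2,0,1), (1,0,2),
      (0,1,2), (1,0,2), (2,0,1), (0,2,3), (3,0,2), (2,3,4), (4,0,2), (2,3,4), (3,0,2), (0,1,3), (1,0,2), (0,1,2),
      (1,0,2), (0,1,3), (3,0,2), (0,1,3), (1,0,2), (2,0,1), (1,2,3), (3,0,1), (0,1,3), (3,0,1), (0,1,3), (3,0,1),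
      (1,2,3), (2,1,3), (3,0,2), (0,1,3), (3,0,2), (2,1,3), (1,2,4), (4,1,3), (3,2,4), (4,1,3), (3,2,4), (4,1,3),
      (3,0,4), (0,1,3), (3,0,4), (0,2,3), (2,0,1), (1,2,4), (4,0,1), (1,0,4), (4,0,1), (0,2,4), (2,0,4), (4,2,3),
      (3,0,4), (4,2,3), (2,0,4), (4,2,3), (3,2,4), (4,2,3), (3,0,4), (4,2,3), (2,0,4), (4,1,2), (1,0,4), (4,0,1),
      (1,2,4), (2,0,1), (1,2,4), (4,0,1), (1,2,4), (4,1,2), (2,0,4), (4,2,3), (3,2,4), (2,3,4), (4,0,2), (2,1,4),
      (4,0,2), (2,3,4), (4,1,2), (1,2,4), (4,1,2), (2,1,4), (4,0,2), (2,1,4), (4,0,2), (2,1,4), (4,2,3), (3,2,4),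
      (2,3,4), (4,1,2), (1,2,4), (4,1,2), (2,3,4), (4,1,2), (2,3,4), (3,2,4), (4,2,3), (3,2,4), (4,2,3), (3,2,4),
      (4,2,3), (3,2,4), (4,0,3), (0,1,4), (4,0,3), (0,1,4), (4,0,1), (1,2,4), (4,1,2), (1,3,4), (4,1,2), (1,3,4),
      (3,0,1), (1,0,3), (3,0,1), (0,3,4), (4,0,3), (3,1,4), (4,0,3), (3,1,4), (4,2,3), (2,1,4), (4,2,3), (3,1,4),
      (1,0,3), (3,1,4), (4,2,3), (2,1,4), (1,2,3), (2,1,4), (1,2,3), (3,0,1), (0,3,4), (4,0,1)],
     [(4,0,1), (1,3,4), (4,0,1), (1,3,4), (3,1,4), (4,2,3), (2,1,4), (4,0,2), (2,1,4), (4,0,2), (2,1,4), (4,0,2),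
      (2,1,4), (4,0,2), (2,1,4), (4,0,2), (2,1,4), (4,0,2), (0,1,4), (4,0,2), (2,3,4), (3,0,2), (0,2,3), (2,0,1),
      (1,0,2), (2,0,1), (0,2,3), (3,0,2), (2,3,4), (4,0,2), (2,1,4), (4,0,2), (2,3,4), (3,0,2), (0,1,3), (1,0,2),
      (0,1,3), (3,0,2), (2,3,4), (3,0,2), (0,1,3), (1,0,2), (2,1,3), (1,2,3), (3,0,1), (1,2,3), (3,0,1), (1,2,3),
      (2,1,3), (3,0,2), (2,3,4), (3,0,2), (2,3,4), (3,0,2), (2,1,3), (3,2,4), (2,3,4), (3,2,4), (2,3,4), (3,2,4),
      (4,1,3), (3,0,4), (4,1,3), (3,0,4), (0,2,3), (2,0,1), (0,2,4), (4,0,1), (0,2,4), (2,0,4), (4,2,3), (3,2,4),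
      (4,1,3), (3,2,4), (4,2,3), (3,2,4), (2,3,4), (3,2,4), (4,1,3), (3,2,4), (4,2,3), (2,0,4), (4,1,2), (1,0,4),
      (4,1,2), (1,2,4), (4,1,2), (1,0,4), (4,1,2), (2,0,4), (4,2,3), (3,2,4), (2,3,4), (4,0,2), (2,1,4), (4,0,2),
      (2,1,4), (4,0,2), (2,3,4), (4,1,2), (2,1,4), (4,0,2), (2,1,4), (4,0,2), (2,1,4), (4,0,2), (2,1,4), (4,2,3),
      (3,2,4), (2,3,4), (4,1,2), (2,3,4), (3,2,4), (2,3,4), (3,2,4), (4,2,3), (2,1,4), (4,2,3), (2,1,4), (4,2,3),
      (2,1,4), (4,2,3), (3,1,4), (4,0,3), (3,1,4), (4,0,3), (0,1,4), (4,0,1), (1,2,4), (4,0,1), (1,2,4), (4,0,1),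
      (0,3,4), (3,0,1), (0,3,4), (4,0,3), (3,1,4), (4,2,3), (3,1,4), (4,2,3), (2,1,4), (4,0,2), (2,1,4), (4,2,3),
      (3,1,4), (4,2,3), (2,1,4), (4,0,2), (2,1,4), (4,0,2), (2,1,4), (1,2,3), (3,0,1), (1,3,4)],
     [(1,3,4), (3,1,4), (1,3,4), (3,1,4), (4,2,3), (2,1,4), (4,0,2), (2,1,4), (4,0,2), (2,1,4), (4,0,2), (2,1,4),
      (4,0,2), (2,1,4), (4,0,2), (2,1,4), (4,0,2), (2,1,4), (4,0,2), (2,1,4), (4,0,2), (2,3,4), (3,0,2), (0,2,3),
      (2,0,1), (0,2,3), (3,0,2), (2,3,4), (4,0,2), (2,1,4), (4,0,2), (2,1,4), (4,0,2), (2,3,4), (3,0,2), (0,1,3),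
      (3,0,2), (2,3,4), (4,0,2), (2,3,4), (3,0,2), (0,1,3), (3,0,2), (2,1,3), (1,2,3), (2,1,3), (1,2,3), (2,1,3),
      (3,0,2), (2,3,4), (4,0,2), (2,3,4), (4,0,2), (2,3,4), (3,0,2), (2,3,4), (4,0,2), (2,3,4), (4,0,2), (2,3,4),
      (3,2,4), (4,1,3), (3,2,4), (4,1,3), (3,0,4), (0,2,3), (2,0,4), (0,2,4), (2,0,4), (4,2,3), (3,2,4), (2,3,4),
      (3,2,4), (2,3,4), (3,2,4), (2,3,4), (4,0,2), (2,3,4), (3,2,4), (2,3,4), (3,2,4), (4,2,3), (2,0,4), (4,1,2),
      (2,0,4), (4,1,2), (2,0,4), (4,1,2), (2,0,4), (4,2,3), (3,2,4), (2,3,4), (4,0,2), (2,1,4), (4,0,2), (2,1,4),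
      (4,0,2), (2,1,4), (4,0,2), (2,1,4), (4,0,2), (2,1,4), (4,0,2), (2,1,4), (4,0,2), (2,1,4), (4,0,2), (2,1,4),
      (4,2,3), (3,2,4), (2,3,4), (3,2,4), (4,2,3), (3,2,4), (4,2,3), (2,1,4), (4,0,2), (2,1,4), (4,0,2), (2,1,4),
      (4,0,2), (2,1,4), (4,2,3), (3,1,4), (4,2,3), (3,1,4), (4,0,3), (0,1,4), (4,0,1), (0,1,4), (4,0,1), (0,1,4),
      (4,0,3), (0,3,4), (4,0,3), (3,1,4), (4,2,3), (2,1,4), (4,2,3), (2,1,4), (4,0,2), (2,1,4), (4,0,2), (2,1,4),
      (4,2,3), (2,1,4), (4,0,2), (2,1,4), (4,0,2), (2,1,4), (4,0,2), (2,1,4), (1,2,3), (3,1,4)],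
     [(3,1,4), (4,2,3), (3,1,4), (4,2,3), (2,1,4), (4,0,2), (2,1,4), (4,0,2), (2,1,4), (4,0,2), (2,1,4), (4,0,2),
      (2,1,4), (4,0,2), (2,1,4), (4,0,2), (2,1,4), (4,0,2), (2,1,4), (4,0,2), (2,1,4), (4,0,2), (2,3,4), (3,0,2),
      (0,2,3), (3,0,2), (2,3,4), (4,0,2), (2,1,4), (4,0,2), (2,1,4), (4,0,2), (2,1,4), (4,0,2), (2,3,4), (3,0,2),
      (2,3,4), (4,0,2), (2,1,4), (4,0,2), (2,3,4), (3,0,2), (2,3,4), (3,0,2), (2,1,3), (3,0,2), (2,1,3), (3,0,2),
      (2,3,4), (4,0,2), (2,1,4), (4,0,2), (2,1,4), (4,0,2), (2,3,4), (4,0,2), (2,1,4), (4,0,2), (2,1,4), (4,0,2),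
      (2,3,4), (3,2,4), (2,3,4), (3,2,4), (4,1,3), (3,0,4), (4,2,3), (2,0,4), (4,2,3), (3,2,4), (2,3,4), (4,0,2),
      (2,3,4), (4,0,2), (2,3,4), (4,0,2), (2,1,4), (4,0,2), (2,3,4), (4,0,2), (2,3,4), (3,2,4), (4,2,3), (2,0,4),
      (4,2,3), (2,0,4), (4,2,3), (2,0,4), (4,2,3), (3,2,4), (2,3,4), (4,0,2), (2,1,4), (4,0,2), (2,1,4), (4,0,2),
      (2,1,4), (4,0,2), (2,1,4), (4,0,2), (2,1,4), (4,0,2), (2,1,4), (4,0,2), (2,1,4), (4,0,2), (2,1,4), (4,0,2),
      (2,1,4), (4,2,3), (3,2,4), (4,2,3), (2,1,4), (4,2,3), (2,1,4), (4,0,2), (2,1,4), (4,0,2), (2,1,4), (4,0,2),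
      (2,1,4), (4,0,2), (2,1,4), (4,2,3), (2,1,4), (4,2,3), (3,1,4), (4,0,3), (0,1,4), (4,0,3), (0,1,4), (4,0,3),
      (3,1,4), (4,0,3), (3,1,4), (4,2,3), (2,1,4), (4,0,2), (2,1,4), (4,0,2), (2,1,4), (4,0,2), (2,1,4), (4,0,2),
      (2,1,4), (4,0,2), (2,1,4), (4,0,2), (2,1,4), (4,0,2), (2,1,4), (4,0,2), (2,1,4), (4,2,3)],
     [(4,2,3), (2,1,4), (4,2,3), (2,1,4), (4,0,2), (2,1,4), (4,0,2), (2,1,4), (4,0,2), (2,1,4), (4,0,2), (2,1,4),
      (4,0,2), (2,1,4), (4,0,2), (2,1,4), (4,0,2), (2,1,4), (4,0,2), (2,1,4), (4,0,2), (2,1,4), (4,0,2), (2,3,4),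
      (3,0,2), (2,3,4), (4,0,2), (2,1,4), (4,0,2), (2,1,4), (4,0,2), (2,1,4), (4,0,2), (2,1,4), (4,0,2), (2,3,4),
      (4,0,2), (2,1,4), (4,0,2), (2,1,4), (4,0,2), (2,3,4), (4,0,2), (2,3,4), (3,0,2), (2,3,4), (3,0,2), (2,3,4),
      (4,0,2), (2,1,4), (4,0,2), (2,1,4), (4,0,2), (2,1,4), (4,0,2), (2,1,4), (4,0,2), (2,1,4), (4,0,2), (2,1,4),
      (4,0,2), (2,3,4), (4,0,2), (2,3,4), (3,2,4), (4,1,3), (3,2,4), (4,2,3), (3,2,4), (2,3,4), (4,0,2), (2,1,4),
      (4,0,2), (2,1,4), (4,0,2), (2,1,4), (4,0,2), (2,1,4), (4,0,2), (2,1,4), (4,0,2), (2,3,4), (3,2,4), (4,2,3),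
      (3,2,4), (4,2,3), (3,2,4), (4,2,3), (3,2,4), (2,3,4), (4,0,2), (2,1,4), (4,0,2), (2,1,4), (4,0,2), (2,1,4),
      (4,0,2), (2,1,4), (4,0,2), (2,1,4), (4,0,2), (2,1,4), (4,0,2), (2,1,4), (4,0,2), (2,1,4), (4,0,2), (2,1,4),
      (4,0,2), (2,1,4), (4,2,3), (2,1,4), (4,0,2), (2,1,4), (4,0,2), (2,1,4), (4,0,2), (2,1,4), (4,0,2), (2,1,4),
      (4,0,2), (2,1,4), (4,0,2), (2,1,4), (4,0,2), (2,1,4), (4,2,3), (3,1,4), (4,0,3), (3,1,4), (4,0,3), (3,1,4),
      (4,2,3), (3,1,4), (4,2,3), (2,1,4), (4,0,2), (2,1,4), (4,0,2), (2,1,4), (4,0,2), (2,1,4), (4,0,2), (2,1,4),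
      (4,0,2), (2,1,4), (4,0,2), (2,1,4), (4,0,2), (2,1,4), (4,0,2), (2,1,4), (4,0,2), (2,1,4)],
     [(2,1,4), (4,0,2), (2,1,4), (4,0,2), (2,1,4), (4,0,2), (2,1,4), (4,0,2), (2,1,4), (4,0,2), (2,1,4), (4,0,2),
      (2,1,4), (4,0,2), (2,1,4), (4,0,2), (2,1,4), (4,0,2), (2,1,4), (4,0,2), (2,1,4), (4,0,2), (2,1,4), (4,0,2),
      (2,3,4), (4,0,2), (2,1,4), (4,0,2), (2,1,4), (4,0,2), (2,1,4), (4,0,2), (2,1,4), (4,0,2), (2,1,4), (4,0,2),
      (2,1,4), (4,0,2), (2,1,4), (4,0,2), (2,1,4), (4,0,2), (2,1,4), (4,0,2), (2,3,4), (4,0,2), (2,3,4), (4,0,2),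
      (2,1,4), (4,0,2), (2,1,4), (4,0,2), (2,1,4), (4,0,2), (2,1,4), (4,0,2), (2,1,4), (4,0,2), (2,1,4), (4,0,2),
      (2,1,4), (4,0,2), (2,1,4), (4,0,2), (2,3,4), (3,2,4), (2,3,4), (3,2,4), (2,3,4), (4,0,2), (2,1,4), (4,0,2),
      (2,1,4), (4,0,2), (2,1,4), (4,0,2), (2,1,4), (4,0,2), (2,1,4), (4,0,2), (2,1,4), (4,0,2), (2,3,4), (3,2,4),
      (2,3,4), (3,2,4), (2,3,4), (3,2,4), (2,3,4), (4,0,2), (2,1,4), (4,0,2), (2,1,4), (4,0,2), (2,1,4), (4,0,2),
      (2,1,4), (4,0,2), (2,1,4), (4,0,2), (2,1,4), (4,0,2), (2,1,4), (4,0,2), (2,1,4), (4,0,2), (2,1,4), (4,0,2),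
      (2,1,4), (4,0,2), (2,1,4), (4,0,2), (2,1,4), (4,0,2), (2,1,4), (4,0,2), (2,1,4), (4,0,2), (2,1,4), (4,0,2),
      (2,1,4), (4,0,2), (2,1,4), (4,0,2), (2,1,4), (4,0,2), (2,1,4), (4,2,3), (3,1,4), (4,2,3), (3,1,4), (4,2,3),
      (2,1,4), (4,2,3), (2,1,4), (4,0,2), (2,1,4), (4,0,2), (2,1,4), (4,0,2), (2,1,4), (4,0,2), (2,1,4), (4,0,2),
      (2,1,4), (4,0,2), (2,1,4), (4,0,2), (2,1,4), (4,0,2), (2,1,4), (4,0,2), (2,1,4), (4,0,2)],
     [(4,0,2), (2,1,4), (4,0,2), (2,1,4), (4,0,2), (2,1,4), (4,0,2), (2,1,4), (4,0,2), (2,1,4), (4,0,2), (2,1,4),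
      (4,0,2), (2,1,4), (4,0,2), (2,1,4), (4,0,2), (2,1,4), (4,0,2), (2,1,4), (4,0,2), (2,1,4), (4,0,2), (2,1,4),
      (4,0,2), (2,1,4), (4,0,2), (2,1,4), (4,0,2), (2,1,4), (4,0,2), (2,1,4), (4,0,2), (2,1,4), (4,0,2), (2,1,4),
      (4,0,2), (2,1,4), (4,0,2), (2,1,4), (4,0,2), (2,1,4), (4,0,2), (2,1,4), (4,0,2), (2,1,4), (4,0,2), (2,1,4),
      (4,0,2), (2,1,4), (4,0,2), (2,1,4), (4,0,2), (2,1,4), (4,0,2), (2,1,4), (4,0,2), (2,1,4), (4,0,2), (2,1,4),
      (4,0,2), (2,1,4), (4,0,2), (2,1,4), (4,0,2), (2,3,4), (4,0,2), (2,3,4), (4,0,2), (2,1,4), (4,0,2), (2,1,4),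
      (4,0,2), (2,1,4), (4,0,2), (2,1,4), (4,0,2), (2,1,4), (4,0,2), (2,1,4), (4,0,2), (2,1,4), (4,0,2), (2,3,4),
      (4,0,2), (2,3,4), (4,0,2), (2,3,4), (4,0,2), (2,1,4), (4,0,2), (2,1,4), (4,0,2), (2,1,4), (4,0,2), (2,1,4),
      (4,0,2), (2,1,4), (4,0,2), (2,1,4), (4,0,2), (2,1,4), (4,0,2), (2,1,4), (4,0,2), (2,1,4), (4,0,2), (2,1,4),
      (4,0,2), (2,1,4), (4,0,2), (2,1,4), (4,0,2), (2,1,4), (4,0,2), (2,1,4), (4,0,2), (2,1,4), (4,0,2), (2,1,4),
      (4,0,2), (2,1,4), (4,0,2), (2,1,4), (4,0,2), (2,1,4), (4,0,2), (2,1,4), (4,2,3), (2,1,4), (4,2,3), (2,1,4),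
      (4,0,2), (2,1,4), (4,0,2), (2,1,4), (4,0,2), (2,1,4), (4,0,2), (2,1,4), (4,0,2), (2,1,4), (4,0,2), (2,1,4),
      (4,0,2), (2,1,4), (4,0,2), (2,1,4), (4,0,2), (2,1,4), (4,0,2), (2,1,4), (4,0,2), (2,1,4)],
     [(2,1,4), (4,0,2), (2,1,4), (4,0,2), (2,1,4), (4,0,2), (2,1,4), (4,0,2), (2,1,4), (4,0,2), (2,1,4), (4,0,2),
      (2,1,4), (4,0,2), (2,1,4), (4,0,2), (2,1,4), (4,0,2), (2,1,4), (4,0,2), (2,1,4), (4,0,2), (2,1,4), (4,0,2),
      (2,1,4), (4,0,2), (2,1,4), (4,0,2), (2,1,4), (4,0,2), (2,1,4), (4,0,2), (2,1,4), (4,0,2), (2,1,4), (4,0,2),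
      (2,1,4), (4,0,2), (2,1,4), (4,0,2), (2,1,4), (4,0,2), (2,1,4), (4,0,2), (2,1,4), (4,0,2), (2,1,4), (4,0,2),
      (2,1,4), (4,0,2), (2,1,4), (4,0,2), (2,1,4), (4,0,2), (2,1,4), (4,0,2), (2,1,4), (4,0,2), (2,1,4), (4,0,2),
      (2,1,4), (4,0,2), (2,1,4), (4,0,2), (2,1,4), (4,0,2), (2,1,4), (4,0,2), (2,1,4), (4,0,2), (2,1,4), (4,0,2),
      (2,1,4), (4,0,2), (2,1,4), (4,0,2), (2,1,4), (4,0,2), (2,1,4), (4,0,2), (2,1,4), (4,0,2), (2,1,4), (4,0,2),
      (2,1,4), (4,0,2), (2,1,4), (4,0,2), (2,1,4), (4,0,2), (2,1,4), (4,0,2), (2,1,4), (4,0,2), (2,1,4), (4,0,2),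
      (2,1,4), (4,0,2), (2,1,4), (4,0,2), (2,1,4), (4,0,2), (2,1,4), (4,0,2), (2,1,4), (4,0,2), (2,1,4), (4,0,2),
      (2,1,4), (4,0,2), (2,1,4), (4,0,2), (2,1,4), (4,0,2), (2,1,4), (4,0,2), (2,1,4), (4,0,2), (2,1,4), (4,0,2),
      (2,1,4), (4,0,2), (2,1,4), (4,0,2), (2,1,4), (4,0,2), (2,1,4), (4,0,2), (2,1,4), (4,0,2), (2,1,4), (4,0,2),
      (2,1,4), (4,0,2), (2,1,4), (4,0,2), (2,1,4), (4,0,2), (2,1,4), (4,0,2), (2,1,4), (4,0,2), (2,1,4), (4,0,2),
      (2,1,4), (4,0,2), (2,1,4), (4,0,2), (2,1,4), (4,0,2), (2,1,4), (4,0,2), (2,1,4), (4,0,2)],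
     [(4,0,2), (2,1,4), (4,0,2), (2,1,4), (4,0,2), (2,1,4), (4,0,2), (2,1,4), (4,0,2), (2,1,4), (4,0,2), (2,1,4),
      (4,0,2), (2,1,4), (4,0,2), (2,1,4), (4,0,2), (2,1,4), (4,0,2), (2,1,4), (4,0,2), (2,1,4), (4,0,2), (2,1,4),
      (4,0,2), (2,1,4), (4,0,2), (2,1,4), (4,0,2), (2,1,4), (4,0,2), (2,1,4), (4,0,2), (2,1,4), (4,0,2), (2,1,4),
      (4,0,2), (2,1,4), (4,0,2), (2,1,4), (4,0,2), (2,1,4), (4,0,2), (2,1,4), (4,0,2), (2,1,4), (4,0,2), (2,1,4),
      (4,0,2), (2,1,4), (4,0,2), (2,1,4), (4,0,2), (2,1,4), (4,0,2), (2,1,4), (4,0,2), (2,1,4), (4,0,2), (2,1,4),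
      (4,0,2), (2,1,4), (4,0,2), (2,1,4), (4,0,2), (2,1,4), (4,0,2), (2,1,4), (4,0,2), (2,1,4), (4,0,2), (2,1,4),
      (4,0,2), (2,1,4), (4,0,2), (2,1,4), (4,0,2), (2,1,4), (4,0,2), (2,1,4), (4,0,2), (2,1,4), (4,0,2), (2,1,4),
      (4,0,2), (2,1,4), (4,0,2), (2,1,4), (4,0,2), (2,1,4), (4,0,2), (2,1,4), (4,0,2), (2,1,4), (4,0,2), (2,1,4),
      (4,0,2), (2,1,4), (4,0,2), (2,1,4), (4,0,2), (2,1,4), (4,0,2), (2,1,4), (4,0,2), (2,1,4), (4,0,2), (2,1,4),
      (4,0,2), (2,1,4), (4,0,2), (2,1,4), (4,0,2), (2,1,4), (4,0,2), (2,1,4), (4,0,2), (2,1,4), (4,0,2), (2,1,4),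
      (4,0,2), (2,1,4), (4,0,2), (2,1,4), (4,0,2), (2,1,4), (4,0,2), (2,1,4), (4,0,2), (2,1,4), (4,0,2), (2,1,4),
      (4,0,2), (2,1,4), (4,0,2), (2,1,4), (4,0,2), (2,1,4), (4,0,2), (2,1,4), (4,0,2), (2,1,4), (4,0,2), (2,1,4),
      (4,0,2), (2,1,4), (4,0,2), (2,1,4), (4,0,2), (2,1,4), (4,0,2), (2,1,4), (4,0,2), (2,1,4)]]"

lemma homotopy_row_adj: "list_all (\<lambda>r. list_all2 type_adj r (rotate1 r)) homotopy"
  by code_simp

lemma homotopy_col_adj: "list_all2 (list_all2 type_adj) (butlast homotopy) (tl homotopy)"
  by code_simp

lemma homotopy_length: "map length homotopy = replicate 11 154"
  by (simp add: homotopy_def eval_nat_numeral)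

lemma homotopy_ok: "list_all (list_all type_ok) homotopy"
  by code_simp

lemma homotopy_sides: "concat (map (\<lambda>r. r @ r) (map (\<lambda>k. take 11 (drop (22 * k) (hd homotopy))) [0..<7])) = hd homotopy"
  by code_simp

lemma homotopy_corners: "map (\<lambda>j. hd homotopy ! (11 * j)) [0..<14] = replicate 14 (hd (hd homotopy))"
  by code_simp

lemma homotopy_last: "homotopy ! 9 = concat (replicate 77 [hd (homotopy ! 9), hd (tl (homotopy ! 9))])"
  by code_simp

lemma homotopy_colors: "\<forall>a \<in> {0,1,2,3,4}. \<exists>u \<in> set (hd homotopy). type_color u = a"
  by (simp add: homotopy_def type_color_def)

section \<open>The gluing of the boundary circle\<close>

text \<open>The boundary of the polygon is parametrized by \<open>{0..2 * g}\<close>, with unit intervals as sides. The ends of all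
  sides are glued to one point, represented by 0; an inner point of a side of odd number is represented
  by its partner on the preceding side.\<close>

definition side_class :: "real \<Rightarrow> real" where
  "side_class t = (if t \<in> \<int> then 0 else if even \<lfloor>t\<rfloor> then t else t - 1)"

definition circle_point :: "nat \<Rightarrow> real \<Rightarrow> complex" where
  "circle_point g t = cis (pi * t / real g)"

lemma norm_circle_point [simp]: "norm (circle_point g t) = 1"
  by (simp add: circle_point_def)

lemma side_class_Ints [simp]: "t \<in> \<int> \<Longrightarrow> side_class t = 0"
  by (simp add: side_class_def)

lemma side_class_partner:
  assumes "0 \<le> s" "s \<le> 1" shows "side_class (2 * real k + s) = side_class (2 * real k + 1 + s)"
proof (cases "s = 0 \<or> s = 1")
  case True
  then have "2 * real k + s \<in> \<int>" "2 * real k + 1 + s \<in> \<int>" by auto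
  then show ?thesis by simp
next
  case False
  then have s: "0 < s" "s < 1" using assms by auto
  have f: "\<lfloor>2 * real k + s\<rfloor> = 2 * int k" "\<lfloor>2 * real k + 1 + s\<rfloor> = 2 * int k + 1"
  proof -
    show "\<lfloor>2 * real k + s\<rfloor> = 2 * int k" by (rule floor_unique) (use s in simp_all)
    show "\<lfloor>2 * real k + 1 + s\<rfloor> = 2 * int k + 1" by (rule floor_unique) (use s in simp_all)
  qed
  have n: "2 * real k + s \<notin> \<int>" "2 * real k + 1 + s \<notin> \<int>"
  proof -
    show "2 * real k + s \<notin> \<int>"
    proof
      assume "2 * real k + s \<in> \<int>"
      then have "of_int \<lfloor>2 * real k + s\<rfloor> = 2 * real k + s" by (metis Ints_cases floor_of_int)
      then show False unfolding f using s by simp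
    qed
    show "2 * real k + 1 + s \<notin> \<int>"
    proof
      assume "2 * real k + 1 + s \<in> \<int>"
      then have "of_int \<lfloor>2 * real k + 1 + s\<rfloor> = 2 * real k + 1 + s" by (metis Ints_cases floor_of_int)
      then show False unfolding f using s by simp
    qed
  qed
  have e: "even \<lfloor>2 * real k + s\<rfloor>" "odd \<lfloor>2 * real k + 1 + s\<rfloor>" unfolding f by simp_all
  show ?thesis unfolding side_class_def by (simp only: n e if_True if_False)
qed

lemma Arg2pi_circle_point:
  assumes "0 \<le> t" "t \<le> 2 * real g" "g > 0"
  shows "side_class (Arg2pi (circle_point g t) * real g / pi) = side_class t"
proof (cases "t = 2 * real g")
  case True
  then have "pi * t / real g = 2 * pi" using assms by simp
  then have "circle_point g t = 1" unfolding circle_point_def by (simp only: cis_2pi)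
  moreover have "t \<in> \<int>" using True by simp
  moreover have "Arg2pi 1 = 0" by (rule Arg2pi_unique[of 1]) simp_all
  ultimately show ?thesis by simp
next
  case False
  then have "pi * t / real g < 2 * pi" using assms by (simp add: divide_less_eq)
  then have "Arg2pi (circle_point g t) = pi * t / real g"
    using assms by (intro Arg2pi_unique[of 1]) (simp_all add: circle_point_def cis_conv_exp)
  then show ?thesis using assms by simp
qed

lemma side_class_crosscap:
  assumes "crosscap_side g z w"
  shows "norm z = 1" "norm w = 1"
    "side_class (Arg2pi z * real g / pi) = side_class (Arg2pi w * real g / pi)"
proof -
  obtain k s where k: "k < g" "0 \<le> s" "s \<le> 1" "z = circle_point g (2 * real k + s)" "w = circle_point g (2 * real k + 1 + s)"
    using assms by (auto simp: crosscap_side_def circle_point_def)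
  then show "norm z = 1" "norm w = 1" by simp_all
  have "real k + 1 \<le> real g" using k(1) by linarith
  then have "2 * real k + 1 + s \<le> 2 * real g" "2 * real k + s \<le> 2 * real g" using k by linarith+
  then show "side_class (Arg2pi z * real g / pi) = side_class (Arg2pi w * real g / pi)"
    using k Arg2pi_circle_point side_class_partner by simp
qed

text \<open>\<open>side_class\<close> is constant along the generating relation. Conversely, a point is glued to its partner on
  the other side of its pair, and the end points of all sides form a single class.\<close>

lemma equivclp_crosscap_iff:
  assumes g: "g > 0" and t: "0 \<le> t" "t \<le> 2 * real g" "0 \<le> t'" "t' \<le> 2 * real g"
  shows "equivclp (crosscap_side g) (circle_point g t) (circle_point g t') \<longleftrightarrow> side_class t = side_class t'"
proof
  assume "equivclp (crosscap_side g) (circle_point g t) (circle_point g t')"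
  then have "side_class (Arg2pi (circle_point g t) * real g / pi) = side_class (Arg2pi (circle_point g t') * real g / pi)"
    by (induction rule: equivclp_induct) (use side_class_crosscap(3) in \<open>metis\<close>)+
  then show "side_class t = side_class t'" using Arg2pi_circle_point t g by simp
next
  assume eq: "side_class t = side_class t'"
  have side: "equivclp (crosscap_side g) (circle_point g (2 * real k + s)) (circle_point g (2 * real k + 1 + s))"
    if "k < g" "0 \<le> s" "s \<le> 1" for k s
  proof (rule r_into_equivclp)
    show "crosscap_side g (circle_point g (2 * real k + s)) (circle_point g (2 * real k + 1 + s))"
      unfolding crosscap_side_def circle_point_def
      using that by (intro exI[of _ k] conjI bexI[of _ s]) auto
  qed
  have int: "m \<le> 2 * g \<Longrightarrow> equivclp (crosscap_side g) (circle_point g (real m)) (circle_point g 0)" for m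
  proof (induction m)
    case (Suc m)
    have "equivclp (crosscap_side g) (circle_point g (real m)) (circle_point g (real (Suc m)))"
    proof (cases "even m")
      case True
      then obtain k where "m = 2 * k" by auto
      then show ?thesis using side[of k 0] Suc.prems by (simp add: add.commute)
    next
      case False
      then obtain k where "m = 2 * k + 1" by (auto elim: oddE)
      then show ?thesis using side[of k 1] Suc.prems by (simp add: add.commute)
    qed
    then show ?case using Suc.IH Suc.prems by (meson equivclp_sym equivclp_trans Suc_leD)
  qed (simp add: equivclp_def)
  have canon: "equivclp (crosscap_side g) (circle_point g t) (circle_point g (side_class t))" if t: "0 \<le> t" "t \<le> 2 * real g" for t
  proof (cases "t \<in> \<int>")
    case True
    then obtain i where i: "t = of_int i" by (auto elim: Ints_cases)
    then have "0 \<le> i" using t by simp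
    then obtain m where m: "i = int m" by (metis nonneg_int_cases)
    then have "m \<le> 2 * g" using t i by simp
    then show ?thesis using int[of m] i m True by simp
  next
    case False
    show ?thesis
    proof (cases "even \<lfloor>t\<rfloor>")
      case True
      then show ?thesis using False by (simp add: side_class_def equivclp_def)
    next
      case odd: False
      then obtain j where j: "\<lfloor>t\<rfloor> = 2 * j + 1" by (auto elim: oddE)
      have "0 \<le> \<lfloor>t\<rfloor>" using t by simp
      then have "0 \<le> j" using j by simp
      then obtain k where k: "j = int k" by (metis nonneg_int_cases)
      define s where "s = t - (2 * real k + 1)"
      have fl: "real_of_int \<lfloor>t\<rfloor> = 2 * real k + 1" using j k by simp
      have s: "0 \<le> s" "s < 1" using fl floor_correct[of t] by (simp_all add: s_def)
      have "2 * real k + 1 \<le> 2 * real g" using s t by (simp add: s_def)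
      then have "2 * k + 1 \<le> 2 * g" by linarith
      then have "k < g" by presburger
      moreover have "t = 2 * real k + 1 + s" "side_class t = 2 * real k + s"
        using False odd by (simp_all add: s_def side_class_def)
      ultimately show ?thesis using side[of k s] s by (metis equivclp_sym less_eq_real_def)
    qed
  qed
  show "equivclp (crosscap_side g) (circle_point g t) (circle_point g t')"
    using canon[OF t(1,2)] canon[OF t(3,4)] eq by (metis equivclp_sym equivclp_trans)
qed

text \<open>Only points of the boundary circle are glued.\<close>

lemma equivclp_crosscap_interior:
  assumes "equivclp (crosscap_side g) z w" "norm z \<noteq> 1" shows "w = z"
proof -
  have "norm w = 1 \<longleftrightarrow> norm z = 1 \<and> (norm z \<noteq> 1 \<longrightarrow> w = z)" if "equivclp (crosscap_side g) z w" for z w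
    using that by (induction rule: equivclp_induct) (use side_class_crosscap(1,2) in \<open>auto\<close>)
  have "norm z \<noteq> 1 \<longrightarrow> w = z" 
    using assms(1) by (induction rule: equivclp_induct) (use side_class_crosscap(1,2) in \<open>auto\<close>)
  then show ?thesis using assms(2) by blast
qed

section \<open>The disc as a rectangle with three glued sides\<close>

text \<open>The circle of height \<open>v\<close> becomes an ellipse with half-axes \<open>(1 + v) / 2\<close> and \<open>v\<close>. For \<open>v = 1\<close> it is the
  unit circle, and for \<open>v = 0\<close> it is a segment that is run through twice. The ellipses in between
  fill the disc.\<close>

definition pinch :: "real \<Rightarrow> real \<Rightarrow> complex" where
  "pinch v a = Complex ((1 + v) / 2 * cos a) (v * sin a)"

lemma cos_eq_2pi:
  assumes "cos a = cos b" "0 \<le> a" "a \<le> 2 * pi" "0 \<le> b" "b \<le> 2 * pi"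
  shows "b = a \<or> b = 2 * pi - a"
proof -
  have red: "\<exists>c. 0 \<le> c \<and> c \<le> pi \<and> cos c = cos a \<and> (a = c \<or> a = 2 * pi - c)" if "0 \<le> a" "a \<le> 2 * pi" for a
  proof (cases "a \<le> pi")
    case False
    have "cos (2 * pi - a) = cos a" by (simp add: cos_diff)
    then show ?thesis using that False by (intro exI[of _ "2 * pi - a"]) auto
  qed (use that in auto)
  obtain c where c: "0 \<le> c" "c \<le> pi" "cos c = cos a" "a = c \<or> a = 2 * pi - c" using red assms by blast
  obtain d where d: "0 \<le> d" "d \<le> pi" "cos d = cos b" "b = d \<or> b = 2 * pi - d" using red assms by blast
  have "c = d" using cos_inj_pi[of c d] c d assms(1) by simp
  then show ?thesis using c(4) d(4) by (elim disjE; simp)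
qed

lemma sin_cos_eq_2pi:
  assumes "cos a = cos b" "sin a = sin b" "0 \<le> a" "a \<le> 2 * pi" "0 \<le> b" "b \<le> 2 * pi"
  shows "a = b \<or> (a = 0 \<and> b = 2 * pi) \<or> (a = 2 * pi \<and> b = 0)"
proof (cases "a = b")
  case False
  then have b: "b = 2 * pi - a" using cos_eq_2pi[OF assms(1,3-6)] by auto
  then have "sin b = - sin a" by (simp add: sin_diff)
  then have "sin a = 0" using assms(2) by simp
  have "a = 0 \<or> a = pi \<or> a = 2 * pi"
  proof (rule ccontr)
    assume "\<not> ?thesis"
    then have "0 < a \<and> a < pi \<or> pi < a \<and> a < 2 * pi" using assms(3,4) by auto
    then show False using \<open>sin a = 0\<close> sin_gt_zero[of a] sin_lt_zero[of a] by auto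
  qed
  then show ?thesis using False b by auto
qed simp

lemma norm_pinch:
  assumes "0 \<le> v" "v \<le> 1"
  shows "norm (pinch v a) \<le> 1" "norm (pinch v a) = 1 \<longleftrightarrow> v = 1"
proof -
  have n: "(norm (pinch v a))\<^sup>2 = ((1 + v) / 2)\<^sup>2 * (cos a)\<^sup>2 + v\<^sup>2 * (sin a)\<^sup>2"
    by (simp add: pinch_def cmod_power2 power_mult_distrib power_divide)
  have sc: "(cos a)\<^sup>2 + (sin a)\<^sup>2 = 1" by simp
  have v1: "((1 + v) / 2)\<^sup>2 \<le> 1" "v\<^sup>2 \<le> 1" using assms by (auto simp: power_le_one)
  have "(norm (pinch v a))\<^sup>2 \<le> 1 * (cos a)\<^sup>2 + 1 * (sin a)\<^sup>2"
    unfolding n using v1 by (intro add_mono mult_right_mono) auto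
  then have "(norm (pinch v a))\<^sup>2 \<le> 1" using sc by simp
  then show "norm (pinch v a) \<le> 1" by (simp add: power_le_one_iff abs_square_le_1)
  show "norm (pinch v a) = 1 \<longleftrightarrow> v = 1"
  proof
    assume "norm (pinch v a) = 1"
    then have eq: "((1 + v) / 2)\<^sup>2 * (cos a)\<^sup>2 + v\<^sup>2 * (sin a)\<^sup>2 = 1" using n by simp
    show "v = 1"
    proof (rule ccontr)
      assume "v \<noteq> 1"
      then have "v < 1" using assms by simp
      define w where "w = (1 + v) / 2"
      have w: "0 \<le> w" "w < 1" "v \<le> w" using assms \<open>v < 1\<close> by (simp_all add: w_def)
      have "v\<^sup>2 \<le> w\<^sup>2" using w assms by (intro power_mono) auto
      then have "w\<^sup>2 * (cos a)\<^sup>2 + v\<^sup>2 * (sin a)\<^sup>2 \<le> w\<^sup>2 * (cos a)\<^sup>2 + w\<^sup>2 * (sin a)\<^sup>2"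
        by (intro add_left_mono mult_right_mono) auto
      also have "\<dots> = w\<^sup>2" using sc by (metis distrib_left mult.right_neutral)
      also have "\<dots> < 1" using w by (simp add: power_less_one_iff abs_square_less_1)
      finally show False using eq by (simp add: w_def)
    qed
  next
    assume "v = 1"
    then show "norm (pinch v a) = 1" by (simp add: pinch_def cmod_def)
  qed
qed

text \<open>Different ellipses of the family are disjoint, because both half-axes increase with \<open>v\<close>.\<close>

lemma pinch_eq:
  assumes eq: "pinch v a = pinch v' a'" and v: "0 \<le> v" "v \<le> 1" "0 \<le> v'" "v' \<le> 1"
  shows "v = v' \<and> cos a = cos a' \<and> (v = 0 \<or> sin a = sin a')"
proof -
  have less: "\<not> v < v'" if e: "(1 + v) / 2 * cos a = (1 + v') / 2 * cos a'" "v * sin a = v' * sin a'" and v: "0 \<le> v" "v' \<le> 1" for v v' a a' :: real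
  proof
    assume l: "v < v'"
    have c: "cos a' = (1 + v) / (1 + v') * cos a" using e(1) v l by (simp add: field_simps)
    have s: "sin a' = v / v' * sin a" using e(2) v l by (simp add: field_simps)
    define x where "x = (1 + v) / (1 + v')"
    define y where "y = v / v'"
    have xy: "0 \<le> x" "x < 1" "0 \<le> y" "y < 1" using v l by (auto simp: x_def y_def)
    have "y \<le> x" unfolding x_def y_def using v l by (simp add: frac_le_eq divide_simps) (simp add: algebra_simps)
    then have "y\<^sup>2 \<le> x\<^sup>2" using xy by (intro power_mono) auto
    have "1 = x\<^sup>2 * (cos a)\<^sup>2 + y\<^sup>2 * (sin a)\<^sup>2"
      using sin_cos_squared_add2[of a'] unfolding c s x_def[symmetric] y_def[symmetric] by (simp add: power_mult_distrib)
    also have "\<dots> \<le> x\<^sup>2 * (cos a)\<^sup>2 + x\<^sup>2 * (sin a)\<^sup>2"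
      using \<open>y\<^sup>2 \<le> x\<^sup>2\<close> by (intro add_left_mono mult_right_mono) auto
    also have "\<dots> = x\<^sup>2" by (metis distrib_left mult.right_neutral sin_cos_squared_add2)
    also have "\<dots> < 1" using xy by (simp add: power_less_one_iff abs_square_less_1)
    finally show False by simp
  qed
  have e: "(1 + v) / 2 * cos a = (1 + v') / 2 * cos a'" "v * sin a = v' * sin a'"
    using eq by (simp_all add: pinch_def)
  have "v = v'" using less[OF e v(1,4)] less[OF e[symmetric] v(3,2)] by linarith
  then show ?thesis using e v by auto
qed

text \<open>A point off the real axis lies on an ellipse of the family by the intermediate value theorem.\<close>

lemma pinch_onto:
  assumes "norm z \<le> 1"
  obtains v a where "0 \<le> v" "v \<le> 1" "0 \<le> a" "a \<le> 2 * pi" "z = pinch v a"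
proof (cases "Im z = 0")
  case True
  have r: "\<bar>Re z\<bar> \<le> 1" using assms abs_Re_le_cmod order_trans by blast
  show ?thesis
  proof (cases "\<bar>Re z\<bar> \<le> 1/2")
    case half: True
    have "0 \<le> arccos (2 * Re z) \<and> arccos (2 * Re z) \<le> pi" using half by (intro conjI arccos_lbound arccos_ubound) auto
    moreover have "z = pinch 0 (arccos (2 * Re z))" using half True by (simp add: pinch_def complex_eq_iff)
    moreover have "pi \<le> 2 * pi" by simp
    ultimately show ?thesis using that[of 0 "arccos (2 * Re z)"] by linarith
  next
    case False
    show ?thesis
    proof (cases "Re z > 0")
      case pos: True
      then show ?thesis using that[of "2 * Re z - 1" 0] False r True by (auto simp: pinch_def complex_eq_iff)
    next
      case neg: False
      then show ?thesis using that[of "- 2 * Re z - 1" pi] False r True by (auto simp: pinch_def complex_eq_iff)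
    qed
  qed
next
  case False
  define a where "a = Re z"
  define b where "b = Im z"
  define h where "h v = v\<^sup>2 * (1 + v)\<^sup>2 - 4 * a\<^sup>2 * v\<^sup>2 - b\<^sup>2 * (1 + v)\<^sup>2" for v :: real
  have ab: "a\<^sup>2 + b\<^sup>2 \<le> 1" using assms by (simp add: a_def b_def cmod_def)
  have "h 0 \<le> 0" "0 \<le> h 1" using ab by (simp_all add: h_def power2_eq_square)
  moreover have "continuous_on {0..1} h" unfolding h_def by (intro continuous_intros)
  ultimately obtain v where v: "0 \<le> v" "v \<le> 1" "h v = 0" using IVT'[of h 0 0 1] by auto
  have "v \<noteq> 0" using v(3) False by (auto simp: h_def b_def)
  then have v0: "0 < v" using v by simp
  have "(2 * a / (1 + v))\<^sup>2 + (b / v)\<^sup>2 = 1"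
    using v(3) v0 unfolding h_def by (simp add: power_divide divide_simps) (simp add: power_mult_distrib algebra_simps)
  then obtain t where t: "0 \<le> t" "t < 2 * pi" "2 * a / (1 + v) = cos t" "b / v = sin t"
    using sincos_total_2pi by metis
  have "z = pinch v t"
    unfolding pinch_def t(3,4)[symmetric] using v0 by (simp add: complex_eq_iff a_def b_def)
  then show ?thesis using that[of v t] v t by simp
qed

section \<open>Surfaces as quotients of a rectangle\<close>

text \<open>The position on the top side of the rectangle is translated into the parameter of the boundary of the
  polygon: the first 14 sides have the length 11, all others the length 2.\<close>

definition side_param :: "real \<Rightarrow> real" where
  "side_param x = min x 154 / 11 + max 0 (x - 154) / 2"

text \<open>A side of odd number is moved back to its partner by the length of the side.\<close>

definition side_shift :: "int \<Rightarrow> int" where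
  "side_shift i = (if i < 154 then (if even (i div 11) then 0 else 11) else if even ((i - 154) div 2) then 0 else 2)"

text \<open>Positions on the top side are glued exactly if they have the same canonical position. The ends of all
  sides are glued together, and their canonical position is 0.\<close>

definition canonical :: "real \<Rightarrow> real" where
  "canonical x = (if side_param x \<in> \<int> then 0 else x - of_int (side_shift \<lfloor>x\<rfloor>))"

lemma side_param_less: "x < y \<Longrightarrow> side_param x < side_param y"
  unfolding side_param_def by (auto simp: min_def max_def field_simps)

lemma side_param_inj: "side_param x = side_param y \<Longrightarrow> x = y"
  using side_param_less[of x y] side_param_less[of y x] by (cases x y rule: linorder_cases) auto

lemma side_param_0 [simp]: "side_param 0 = 0"
  by (simp add: side_param_def)

lemma continuous_on_side_param [continuous_intros]:
  "continuous_on S f \<Longrightarrow> continuous_on S (\<lambda>x. side_param (f x))"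
  unfolding side_param_def by (intro continuous_intros) auto

lemma floor_side_param:
  "\<lfloor>side_param x\<rfloor> = (if x < 154 then \<lfloor>x\<rfloor> div 11 else 14 + (\<lfloor>x\<rfloor> - 154) div 2)"
proof (cases "x < 154")
  case True
  then show ?thesis using floor_divide_real_eq_div[of 11 x] by (simp add: side_param_def)
next
  case False
  have "side_param x = (x - 154) / 2 + 14" using False by (simp add: side_param_def)
  then have "\<lfloor>side_param x\<rfloor> = \<lfloor>(x - 154) / 2\<rfloor> + 14" using floor_add_int[of "(x - 154) / 2" 14] by simp
  also have "\<lfloor>(x - 154) / 2\<rfloor> = (\<lfloor>x\<rfloor> - 154) div 2" using floor_divide_real_eq_div[of 2 "x - 154"] by simp
  finally show ?thesis using False by simp
qed

lemma side_param_canonical: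
  assumes "0 \<le> x" shows "side_param (canonical x) = side_class (side_param x)"
proof (cases "side_param x \<in> \<int>")
  case False
  have fl: "\<lfloor>x\<rfloor> < 154 \<longleftrightarrow> x < 154" using floor_less_iff[of x 154] by simp
  show ?thesis
  proof (cases "x < 154")
    case True
    have par: "even \<lfloor>side_param x\<rfloor> = even (\<lfloor>x\<rfloor> div 11)" using True by (simp add: floor_side_param)
    have c: "canonical x = (if even \<lfloor>side_param x\<rfloor> then x else x - 11)"
      using False True unfolding canonical_def side_shift_def par fl by simp
    have "side_param (x - 11) = side_param x - 1" using True by (simp add: side_param_def)
    then show ?thesis using False c unfolding side_class_def by simp
  next
    case ge: False
    have par: "even \<lfloor>side_param x\<rfloor> = even ((\<lfloor>x\<rfloor> - 154) div 2)" using ge by (simp add: floor_side_param)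
    have c: "canonical x = (if even \<lfloor>side_param x\<rfloor> then x else x - 2)"
      using False ge unfolding canonical_def side_shift_def par fl by simp
    have "side_param (x - 2) = side_param x - 1" if odd: "odd \<lfloor>side_param x\<rfloor>"
    proof -
      have sp: "side_param x = 14 + (x - 154) / 2" using ge by (simp add: side_param_def)
      then have "14 \<le> \<lfloor>side_param x\<rfloor>" using ge by (simp add: le_floor_iff)
      then have "15 \<le> \<lfloor>side_param x\<rfloor>" using odd by presburger
      then have "15 \<le> side_param x" by (simp add: le_floor_iff)
      then have "156 \<le> x" using sp by simp
      then show ?thesis by (simp add: side_param_def field_simps)
    qed
    then show ?thesis using False c unfolding side_class_def by simp
  qed
qed (simp add: canonical_def)

locale crosscap_disc =
  fixes X :: "'a topology" and g :: nat and q :: "complex \<Rightarrow> 'a"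
  assumes g7: "g \<ge> 7" and surf: "surface X"
    and quot: "quotient_map (top_of_set (cball 0 1)) X q"
    and glue: "\<And>z w. z \<in> cball 0 1 \<Longrightarrow> w \<in> cball 0 1 \<Longrightarrow> q z = q w \<longleftrightarrow> equivclp (crosscap_side g) z w"
begin

text \<open>The rectangle has the height 9. Its first 14 top sides have length 11, and those of the
  further crosscaps have length 2.\<close>

definition L :: nat where "L = 154 + 4 * (g - 7)"

abbreviation M :: nat where "M \<equiv> 9"

definition R :: "complex set" where
  "R = {z. 0 \<le> Re z \<and> Re z \<le> real L \<and> 0 \<le> Im z \<and> Im z \<le> real M}"

lemma L_pos: "154 \<le> L" "even L" "0 < real L"
  by (simp_all add: L_def)

lemma side_param_L: "side_param (real L) = 2 * real g"
  using g7 by (simp add: side_param_def L_def of_nat_diff diff_divide_distrib)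

text \<open>The position on the top side is the one prescribed by the polygon, where the sides have equal
  length. Towards the bottom it is deformed into the proportional position, so that the
  fold of the bottom is at its middle.\<close>

definition angle :: "real \<Rightarrow> real \<Rightarrow> real" where
  "angle v x = v * (pi * side_param x / real g) + (1 - v) * (2 * pi * x / real L)"

definition height :: "complex \<Rightarrow> real" where "height z = 1 - Im z / 9"

definition proj :: "complex \<Rightarrow> complex" where
  "proj z = pinch (height z) (angle (height z) (Re z))"

definition p :: "complex \<Rightarrow> 'a" where "p z = q (proj z)"

lemma angle_less: assumes "0 \<le> v" "v \<le> 1" "x < y" shows "angle v x < angle v y"
proof -
  have a: "pi * side_param x / real g < pi * side_param y / real g"
    using side_param_less[OF assms(3)] g7 by (simp add: divide_strict_right_mono)
  have b: "2 * pi * x / real L < 2 * pi * y / real L"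
    using assms(3) L_pos by (simp add: divide_strict_right_mono)
  show ?thesis
  proof (cases "v = 0")
    case True
    then show ?thesis using b by (simp add: angle_def)
  next
    case False
    then have "v * (pi * side_param x / real g) < v * (pi * side_param y / real g)"
      using a assms(1) by (intro mult_strict_left_mono) auto
    moreover have "(1 - v) * (2 * pi * x / real L) \<le> (1 - v) * (2 * pi * y / real L)"
      using b assms(2) by (intro mult_left_mono) auto
    ultimately show ?thesis by (simp add: angle_def)
  qed
qed

lemma angle_inj: "0 \<le> v \<Longrightarrow> v \<le> 1 \<Longrightarrow> angle v x = angle v y \<Longrightarrow> x = y"
  using angle_less[of v x y] angle_less[of v y x] by (cases x y rule: linorder_cases) auto

lemma angle_ends: "angle v 0 = 0" "angle v (real L) = 2 * pi"
proof -
  show "angle v 0 = 0" by (simp add: angle_def)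
  have "pi * side_param (real L) / real g = 2 * pi" "2 * pi * real L / real L = 2 * pi"
    unfolding side_param_L using g7 L_pos by simp_all
  then show "angle v (real L) = 2 * pi" unfolding angle_def by (simp add: algebra_simps)
qed

lemma angle_range: assumes "0 \<le> v" "v \<le> 1" "0 \<le> x" "x \<le> real L" shows "0 \<le> angle v x" "angle v x \<le> 2 * pi"
proof -
  show "0 \<le> angle v x" using angle_less[OF assms(1,2), of 0 x] angle_ends(1)[of v] assms(3) by (cases "x = 0") auto
  show "angle v x \<le> 2 * pi"
    using angle_less[OF assms(1,2), of x "real L"] angle_ends(2)[of v] assms(4) by (cases "x = real L") auto
qed

lemma height: assumes "z \<in> R" shows "0 \<le> height z" "height z \<le> 1"
  "height z = 0 \<longleftrightarrow> Im z = 9" "height z = 1 \<longleftrightarrow> Im z = 0"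
  using assms by (auto simp: R_def height_def)

lemma height_eq: "height z = height w \<longleftrightarrow> Im z = Im w"
  by (simp add: height_def)

lemma compact_R: "compact R"
proof -
  have "R = cbox 0 (Complex (real L) 9)" by (auto simp: R_def in_cbox_complex_iff)
  then show ?thesis by simp
qed

lemma continuous_proj: "continuous_on S proj"
proof -
  have "continuous_on S (\<lambda>z. Complex ((1 + height z) / 2 * cos (angle (height z) (Re z))) (height z * sin (angle (height z) (Re z))))"
    unfolding height_def angle_def Complex_eq using g7 L_pos by (intro continuous_intros) auto
  then show ?thesis by (simp add: proj_def[abs_def] pinch_def)
qed

lemma proj_disc: "z \<in> R \<Longrightarrow> proj z \<in> cball 0 1"
  using norm_pinch(1)[of "height z"] height by (simp add: proj_def)

lemma proj_norm: "z \<in> R \<Longrightarrow> norm (proj z) = 1 \<longleftrightarrow> Im z = 0"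
  using norm_pinch(2)[of "height z"] height by (simp add: proj_def)

lemma proj_onto: assumes "w \<in> cball 0 1" obtains z where "z \<in> R" "proj z = w"
proof -
  obtain v a where v: "0 \<le> v" "v \<le> 1" "0 \<le> a" "a \<le> 2 * pi" "w = pinch v a"
    using pinch_onto[of w] assms by auto
  have "continuous_on {0..real L} (angle v)" unfolding angle_def using g7 L_pos by (intro continuous_intros) auto
  then obtain x where x: "0 \<le> x" "x \<le> real L" "angle v x = a"
    using IVT'[of "angle v" 0 a "real L"] angle_ends v L_pos by auto
  define z where "z = Complex x (9 * (1 - v))"
  have "z \<in> R" using x v by (simp add: z_def R_def)
  moreover have "height z = v" by (simp add: z_def height_def diff_divide_distrib)
  then have "proj z = w" using x v by (simp add: proj_def z_def)
  ultimately show ?thesis by (rule that)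
qed

lemma proj_top: assumes "z \<in> R" "Im z = 0" shows "proj z = circle_point g (side_param (Re z))"
proof -
  have "height z = 1" using assms by (simp add: height_def)
  then show ?thesis by (simp add: proj_def pinch_def circle_point_def angle_def complex_eq_iff)
qed

lemma proj_eq_iff:
  assumes "z \<in> R" "w \<in> R" "0 < Im z"
  shows "proj z = proj w \<longleftrightarrow> Im w = Im z \<and> (Re w = Re z \<or> (Re w = real L - Re z \<and> (Re z = 0 \<or> Re z = real L \<or> Im z = 9)))"
proof -
  let ?v = "height z"
  have v: "0 \<le> ?v" "?v \<le> 1" using height assms by auto
  have rz: "0 \<le> Re z" "Re z \<le> real L" "0 \<le> Re w" "Re w \<le> real L" using assms by (auto simp: R_def)
  note ar = angle_range[OF v rz(1,2)] angle_range[OF v rz(3,4)]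
  have flat: "angle 0 x = 2 * pi * x / real L" for x by (simp add: angle_def)
  show ?thesis
  proof
    assume eq: "proj z = proj w"
    have hw: "0 \<le> height w" "height w \<le> 1" using height assms by auto
    have pe: "?v = height w \<and> cos (angle ?v (Re z)) = cos (angle (height w) (Re w)) \<and>
        (?v = 0 \<or> sin (angle ?v (Re z)) = sin (angle (height w) (Re w)))"
      using pinch_eq[OF eq[unfolded proj_def] v hw] .
    then have I: "Im w = Im z" using height_eq by metis
    have c: "cos (angle ?v (Re z)) = cos (angle ?v (Re w))" using pe by metis
    show "Im w = Im z \<and> (Re w = Re z \<or> (Re w = real L - Re z \<and> (Re z = 0 \<or> Re z = real L \<or> Im z = 9)))"
    proof (cases "?v = 0")
      case True
      have "angle 0 (Re w) = angle 0 (Re z) \<or> angle 0 (Re w) = 2 * pi - angle 0 (Re z)"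
        using cos_eq_2pi[OF c ar] True by simp
      then have "Re w = Re z \<or> Re w = real L - Re z"
      proof
        assume "angle 0 (Re w) = 2 * pi - angle 0 (Re z)"
        then have "2 * pi * (Re w + Re z) / real L = 2 * pi" unfolding flat by (simp add: add_divide_distrib distrib_left)
        then have "(2 * pi) * ((Re w + Re z) / real L) = (2 * pi) * 1" by simp
        then have "(Re w + Re z) / real L = 1" unfolding mult_cancel_left using pi_gt_zero by auto
        then have "Re w + Re z = real L" using L_pos by (simp add: divide_eq_eq)
        then show ?thesis by linarith
      qed (use angle_inj[of 0] in auto)
      then show ?thesis using I True height(3)[OF assms(1)] by auto
    next
      case False
      then have "sin (angle ?v (Re z)) = sin (angle ?v (Re w))" using pe by auto
      from sin_cos_eq_2pi[OF c this ar]
      have "angle ?v (Re z) = angle ?v (Re w) \<or> (angle ?v (Re z) = angle ?v 0 \<and> angle ?v (Re w) = angle ?v (real L))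
        \<or> (angle ?v (Re z) = angle ?v (real L) \<and> angle ?v (Re w) = angle ?v 0)" using angle_ends by auto
      then have "Re z = Re w \<or> (Re z = 0 \<and> Re w = real L) \<or> (Re z = real L \<and> Re w = 0)"
        using angle_inj[OF v] by blast
      then show ?thesis using I by auto
    qed
  next
    assume h: "Im w = Im z \<and> (Re w = Re z \<or> (Re w = real L - Re z \<and> (Re z = 0 \<or> Re z = real L \<or> Im z = 9)))"
    then have hh: "height w = ?v" using height_eq by metis
    have "Re w = Re z \<or> (Re w = real L - Re z \<and> ?v = 0) \<or> (Re z = 0 \<and> Re w = real L) \<or> (Re z = real L \<and> Re w = 0)"
      using h height(3)[OF assms(1)] by auto
    then show "proj z = proj w"
    proof (elim disjE conjE)
      assume r: "Re w = real L - Re z" "?v = 0"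
      have "angle 0 (Re w) = 2 * pi - angle 0 (Re z)" unfolding flat r(1) using L_pos by (simp add: field_simps)
      then have "cos (angle 0 (Re w)) = cos (angle 0 (Re z))" by (simp add: cos_diff)
      then show ?thesis unfolding proj_def hh r(2) by (simp add: pinch_def)
    qed (simp_all add: proj_def hh angle_ends pinch_def)
  qed
qed

lemma p_eq_iff:
  assumes "z \<in> R" "w \<in> R"
  shows "p z = p w \<longleftrightarrow> (Im z = 0 \<and> Im w = 0 \<and> canonical (Re z) = canonical (Re w)) \<or>
     (0 < Im z \<and> Im w = Im z \<and> (Re w = Re z \<or> (Re w = real L - Re z \<and> (Re z = 0 \<or> Re z = real L \<or> Im z = 9))))"
proof -
  have pe: "p z = p w \<longleftrightarrow> equivclp (crosscap_side g) (proj z) (proj w)"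
    unfolding p_def using glue proj_disc assms by blast
  have nn: "0 \<le> Im z" "0 \<le> Im w" using assms by (auto simp: R_def)
  show ?thesis
  proof (cases "Im z = 0 \<and> Im w = 0")
    case True
    have r: "0 \<le> Re z" "Re z \<le> real L" "0 \<le> Re w" "Re w \<le> real L" using assms by (auto simp: R_def)
    have m: "side_param x \<le> side_param y" if "x \<le> y" for x y using side_param_less[of x y] that by (cases "x = y") auto
    have s: "0 \<le> side_param (Re z)" "side_param (Re z) \<le> 2 * real g" "0 \<le> side_param (Re w)" "side_param (Re w) \<le> 2 * real g"
      using m[OF r(1)] m[OF r(2)] m[OF r(3)] m[OF r(4)] side_param_L by simp_all
    have "p z = p w \<longleftrightarrow> side_class (side_param (Re z)) = side_class (side_param (Re w))"
      unfolding pe using proj_top assms True equivclp_crosscap_iff[OF _ s] g7 by simp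
    also have "\<dots> \<longleftrightarrow> canonical (Re z) = canonical (Re w)"
      using side_param_canonical[OF r(1)] side_param_canonical[OF r(3)] side_param_inj by metis
    finally show ?thesis using True by simp
  next
    case False
    have int: "equivclp (crosscap_side g) a b \<longleftrightarrow> a = b" if "norm a \<noteq> 1 \<or> norm b \<noteq> 1" for a b
    proof
      assume e: "equivclp (crosscap_side g) a b"
      then show "a = b" using that equivclp_crosscap_interior equivclp_sym by metis
    qed (simp add: equivclp_def)
    have "norm (proj z) \<noteq> 1 \<or> norm (proj w) \<noteq> 1" using False proj_norm assms by auto
    then have "p z = p w \<longleftrightarrow> proj z = proj w" unfolding pe using int by blast
    also have "\<dots> \<longleftrightarrow> 0 < Im z \<and> Im w = Im z \<and> (Re w = Re z \<or> (Re w = real L - Re z \<and> (Re z = 0 \<or> Re z = real L \<or> Im z = 9)))"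
    proof (cases "0 < Im z")
      case True
      then show ?thesis using proj_eq_iff[OF assms True] by simp
    next
      case z0: False
      then have "Im z = 0" "Im w \<noteq> 0" using nn False by auto
      then have "norm (proj z) \<noteq> norm (proj w)" using proj_norm[OF assms(1)] proj_norm[OF assms(2)] by metis
      then show ?thesis using z0 by auto
    qed
    finally show ?thesis using False by auto
  qed
qed

lemma continuous_p: "continuous_map (top_of_set R) X p"
proof -
  have "continuous_map (top_of_set R) (top_of_set (cball 0 1)) proj"
    using continuous_proj proj_disc by auto
  from continuous_map_compose[OF this quotient_imp_continuous_map[OF quot]] show ?thesis
    by (simp add: p_def[abs_def] o_def)
qed

lemma p_onto: "p ` R = topspace X"
proof
  show "p ` R \<subseteq> topspace X" using continuous_p unfolding continuous_map_def by auto
  show "topspace X \<subseteq> p ` R"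
  proof
    fix x assume "x \<in> topspace X"
    moreover have "q ` cball 0 1 = topspace X" using quot by (simp add: quotient_map_def)
    ultimately obtain w where w: "x = q w" "w \<in> cball 0 1" by (metis imageE)
    obtain z where "z \<in> R" "proj z = w" by (rule proj_onto[OF w(2)])
    then show "x \<in> p ` R" using w(1) by (auto simp: p_def)
  qed
qed

text \<open>A continuous map of a compact space onto a Hausdorff space is a quotient map.\<close>

lemma quotient_p: "quotient_map (top_of_set R) X p"
  using continuous_p p_onto compact_R surf
  by (intro continuous_imp_quotient_map) (auto simp: compact_space_subtopology surface_def)

end

section \<open>Coincidences on the boundary of the grid\<close>

lemma side_param_Ints: assumes "side_param x \<in> \<int>" shows "x \<in> \<int>"
proof -
  obtain m where m: "side_param x = of_int m" using assms by (rule Ints_cases)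
  show ?thesis
  proof (cases "x < 154")
    case True
    then have "x = of_int (11 * m)" using m by (simp add: side_param_def)
    then show ?thesis by (metis Ints_of_int)
  next
    case False
    then have "14 + (x - 154) / 2 = of_int m" using m by (simp add: side_param_def)
    then have "x = of_int (2 * (m - 14) + 154)" by (simp add: field_simps)
    then show ?thesis by (metis Ints_of_int)
  qed
qed

lemma canonical_Ints_iff: "canonical x \<in> \<int> \<longleftrightarrow> x \<in> \<int>"
proof (cases "side_param x \<in> \<int>")
  case True
  then show ?thesis using side_param_Ints by (simp add: canonical_def)
next
  case False
  have "x \<in> \<int>" if "x - of_int k \<in> \<int>" for k using Ints_add[OF that Ints_of_int[of k]] by simp
  then show ?thesis using False unfolding canonical_def by auto
qed

lemma unit_frac_eq:
  assumes "of_int a + r = of_int b + (s::real)" "0 < r" "r < 1" "0 < s" "s < 1"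
  shows "a = b \<and> r = s"
proof -
  have "\<lfloor>of_int a + r\<rfloor> = a" "\<lfloor>of_int b + s\<rfloor> = b" by (intro floor_unique; use assms in simp)+
  then have "a = b" using assms(1) by simp
  then show ?thesis using assms(1) by simp
qed

lemma frac_not_Ints: "0 < r \<Longrightarrow> r < 1 \<Longrightarrow> of_int a + (r::real) \<notin> \<int>"
proof
  assume r: "0 < r" "r < 1" "of_int a + r \<in> \<int>"
  then obtain m where m: "of_int a + r = of_int m" by (auto elim: Ints_cases)
  have f: "\<lfloor>of_int a + r\<rfloor> = a" by (rule floor_unique) (use r in simp_all)
  have "m = a" using f unfolding m by simp
  then have "r = 0" using m by simp
  then show False using r(1) by simp
qed

text \<open>A unit interval on the top side is glued to the one that is \<open>shift i\<close> to its left.\<close>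

definition shift :: "nat \<Rightarrow> nat" where
  "shift i = (if i < 154 then (if even (i div 11) then 0 else 11) else if even ((i - 154) div 2) then 0 else 2)"

lemma side_shift_shift: "side_shift (int i) = int (shift i)"
proof -
  have "even (int i div 11) = even (i div 11)" by (metis even_of_nat of_nat_numeral zdiv_int)
  moreover have "even ((int i - 154) div 2) = even ((i - 154) div 2)" if "154 \<le> i"
  proof -
    have "int i - 154 = int (i - 154)" using that by simp
    then show ?thesis by (metis even_of_nat of_nat_numeral zdiv_int)
  qed
  ultimately show ?thesis unfolding side_shift_def shift_def by auto
qed

lemma shift_le: "shift i \<le> i"
proof (cases "i < 154")
  case True
  have "11 \<le> i" if "odd (i div 11)" using that by (cases "i < 11") auto
  then show ?thesis using True by (simp add: shift_def)
next
  case False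
  then show ?thesis by (simp add: shift_def)
qed

lemma canonical_unit:
  assumes "0 < r" "r < 1" shows "canonical (real i + r) = real (i - shift i) + r"
proof -
  have "real i + r \<notin> \<int>" using frac_not_Ints[OF assms, of "int i"] by simp
  then have "side_param (real i + r) \<notin> \<int>" using side_param_Ints by blast
  moreover have "\<lfloor>real i + r\<rfloor> = int i" by (rule floor_unique) (use assms in simp_all)
  ultimately show ?thesis unfolding canonical_def side_shift_shift[symmetric]
    using shift_le[of i] by (simp add: side_shift_shift of_nat_diff)
qed

lemma side_class_shift:
  assumes "0 \<le> r" "r \<le> 1"
  shows "side_class (side_param (real (i - shift i) + r)) = side_class (side_param (real i + r))"
proof (cases "shift i = 0")
  case False
  show ?thesis
  proof (cases "i < 154")
    case True
    then have sh: "shift i = 11" "odd (i div 11)" using False by (auto simp: shift_def split: if_splits)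
    then obtain k where k: "i div 11 = 2 * k + 1" by (auto elim: oddE)
    have "i = 11 * (2 * k + 1) + i mod 11" using k div_mult_mod_eq[of i 11] by simp
    moreover have "i mod 11 < 11" by simp
    ultimately have "11 * (2 * k + 1) \<le> i \<and> i + 1 \<le> 11 * (2 * k + 2)"
      by (intro conjI; presburger)
    then have "11 * (2 * k + 1) \<le> i" "i + 1 \<le> 11 * (2 * k + 2)" by blast+
    then have "real (11 * (2 * k + 1)) \<le> real i" "real (i + 1) \<le> real (11 * (2 * k + 2))" by (simp_all only: of_nat_le_iff)
    then have kr: "11 * (2 * real k + 1) \<le> real i" "real i + 1 \<le> 11 * (2 * real k + 2)" by simp_all
    define s where "s = (real i + r) / 11 - (2 * real k + 1)"
    have s: "0 \<le> s" "s \<le> 1" using kr assms by (simp_all add: s_def field_simps)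
    have le: "real i + r \<le> 154" using True assms by linarith
    have ri: "real (i - shift i) = real i - 11" using shift_le[of i] sh by (simp add: of_nat_diff)
    have "side_param (real i + r) = 2 * real k + 1 + s" using le by (simp add: side_param_def s_def)
    moreover have "side_param (real (i - shift i) + r) = 2 * real k + s"
      unfolding ri using le by (simp add: side_param_def s_def diff_divide_distrib add_divide_distrib)
    ultimately show ?thesis using side_class_partner[OF s, of k] by simp
  next
    case ge: False
    then have sh: "shift i = 2" "odd ((i - 154) div 2)" using False by (auto simp: shift_def split: if_splits)
    then obtain m where m: "(i - 154) div 2 = 2 * m + 1" by (auto elim: oddE)
    have "2 * (2 * m + 1) \<le> i - 154 \<and> i - 154 + 1 \<le> 2 * (2 * m + 2)" using m by presburger
    then have "2 * (2 * m + 1) \<le> i - 154" "i - 154 + 1 \<le> 2 * (2 * m + 2)" by blast+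
    then have "real (2 * (2 * m + 1)) \<le> real (i - 154)" "real (i - 154 + 1) \<le> real (2 * (2 * m + 2))" by (simp_all only: of_nat_le_iff)
    then have mr: "2 * (2 * real m + 1) \<le> real i - 154" "real i - 154 + 1 \<le> 2 * (2 * real m + 2)" using ge by (simp_all add: of_nat_diff)
    define s where "s = (real i + r - 154) / 2 - (2 * real m + 1)"
    have s: "0 \<le> s" "s \<le> 1" using mr assms by (simp_all add: s_def field_simps)
    have ri: "real (i - shift i) = real i - 2" using shift_le[of i] sh by (simp add: of_nat_diff)
    have "156 \<le> i" using m ge by presburger
    then have "156 \<le> real i" by simp
    then have le: "156 \<le> real i + r" using assms(1) by linarith
    have "side_param (real i + r) = 2 * real (7 + m) + 1 + s" using le by (simp add: side_param_def s_def)
    moreover have "side_param (real (i - shift i) + r) = 2 * real (7 + m) + s"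
      unfolding ri using le by (simp add: side_param_def s_def diff_divide_distrib add_divide_distrib)
    ultimately show ?thesis using side_class_partner[OF s, of "7 + m"] by simp
  qed
qed simp

lemma canonical_shift:
  assumes "0 \<le> r" "r \<le> 1" shows "canonical (real (i - shift i) + r) = canonical (real i + r)"
proof -
  have "side_param (canonical (real (i - shift i) + r)) = side_param (canonical (real i + r))"
    using side_class_shift[OF assms, of i] side_param_canonical[of "real (i - shift i) + r"] side_param_canonical[of "real i + r"] assms
    by simp
  then show ?thesis by (rule side_param_inj)
qed

context crosscap_disc begin

definition hpt :: "nat \<Rightarrow> nat \<Rightarrow> real \<Rightarrow> complex" where "hpt a b r = Complex (real a + r) (real b)"
definition vpt :: "nat \<Rightarrow> nat \<Rightarrow> real \<Rightarrow> complex" where "vpt a b r = Complex (real a) (real b + r)"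

lemma hpt_R: "a < L \<Longrightarrow> b \<le> 9 \<Longrightarrow> 0 \<le> r \<Longrightarrow> r \<le> 1 \<Longrightarrow> hpt a b r \<in> R"
  by (simp add: hpt_def R_def)

lemma vpt_R: "a \<le> L \<Longrightarrow> b < 9 \<Longrightarrow> 0 \<le> r \<Longrightarrow> r \<le> 1 \<Longrightarrow> vpt a b r \<in> R"
  by (simp add: vpt_def R_def)

definition lattice :: "complex \<Rightarrow> bool" where "lattice z \<longleftrightarrow> Re z \<in> \<int> \<and> Im z \<in> \<int>"

text \<open>All gluings move lattice points by integral amounts or reflect them, so grid vertices are not
  identified with interior points of grid edges.\<close>

lemma lattice_invariant:
  assumes "z \<in> R" "w \<in> R" "p z = p w" shows "lattice z = lattice w"
proof -
  have L: "real L - x \<in> \<int> \<longleftrightarrow> x \<in> \<int>" for x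
  proof
    assume "real L - x \<in> \<int>"
    from Ints_diff[OF Ints_of_nat[of L] this] show "x \<in> \<int>" by simp
  qed simp
  show ?thesis using assms(3) unfolding p_eq_iff[OF assms(1,2)] lattice_def
    using canonical_Ints_iff[of "Re z"] canonical_Ints_iff[of "Re w"] L by auto
qed

lemma hpt_lattice: "0 < r \<Longrightarrow> r < 1 \<Longrightarrow> \<not> lattice (hpt a b r)" and vpt_lattice: "0 < r \<Longrightarrow> r < 1 \<Longrightarrow> \<not> lattice (vpt a b r)"
  using frac_not_Ints[of r "int a"] frac_not_Ints[of r "int b"] by (simp_all add: lattice_def hpt_def vpt_def)

lemma unit_strict:
  assumes "\<not> lattice (hpt a b r) \<or> \<not> lattice (vpt a b r)" "0 \<le> r" "r \<le> 1" shows "0 < r \<and> r < 1"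
proof (rule ccontr)
  assume "\<not> ?thesis"
  then have "r = 0 \<or> r = 1" using assms(2,3) by auto
  then have "lattice (hpt a b r) \<and> lattice (vpt a b r)" by (auto simp: lattice_def hpt_def vpt_def)
  then show False using assms(1) by blast
qed

text \<open>Horizontal unit edges are identified with each other in two ways: with the same direction on the
  top side and with the reversed direction on the bottom side.\<close>

lemma p_hpt_hpt:
  assumes "a < L" "b \<le> 9" "a' < L" "b' \<le> 9" "0 < r" "r < 1" "0 \<le> r'" "r' \<le> 1" and eq: "p (hpt a b r) = p (hpt a' b' r')"
  shows "b' = b \<and> (r' = r \<and> (a' = a \<or> b = 0 \<and> a - shift a = a' - shift a') \<or> r' = 1 - r \<and> b = 9 \<and> a + a' + 1 = L)"
proof -
  have R: "hpt a b r \<in> R" "hpt a' b' r' \<in> R" using assms by (auto intro!: hpt_R)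
  have r': "0 < r'" "r' < 1"
    using unit_strict[of a' b' r'] lattice_invariant[OF R eq] hpt_lattice[OF assms(5,6), of a b] assms(7,8) by auto
  consider "b = 0" "b' = 0" "canonical (real a + r) = canonical (real a' + r')"
    | "b' = b" "real a' + r' = real a + r"
    | "b' = b" "real a' + r' = real L - (real a + r)" "real a + r = 0 \<or> real a + r = real L \<or> b = 9"
    using eq unfolding p_eq_iff[OF R] by (auto simp: hpt_def)
  then show ?thesis
  proof cases
    case 1
    then have "of_int (int (a - shift a)) + r = of_int (int (a' - shift a')) + r'"
      using canonical_unit assms(5,6) r' by simp
    from unit_frac_eq[OF this assms(5,6) r'] show ?thesis using 1 by auto
  next
    case 2
    then have "of_int (int a) + r = of_int (int a') + r'" by simp
    from unit_frac_eq[OF this assms(5,6) r'] show ?thesis using 2 by auto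
  next
    case 3
    have "real a + r \<noteq> 0" "real a + r \<noteq> real L"
    proof -
      show "real a + r \<noteq> 0" using assms(5) by (simp add: add_nonneg_pos less_imp_neq[symmetric])
      have "real a + 1 \<le> real L" using assms(1) by linarith
      then show "real a + r \<noteq> real L" using assms(6) by linarith
    qed
    then have b: "b = 9" using 3 by blast
    have "of_int (int L - 1 - int a) + (1 - r) = of_int (int a') + r'" using 3(2) by simp
    from unit_frac_eq[OF this _ _ r'] have "int L - 1 - int a = int a' \<and> 1 - r = r'" using assms(5,6) by auto
    then have "a + a' + 1 = L" "r' = 1 - r" by linarith+
    then show ?thesis using 3 b by auto
  qed
qed

lemma p_vpt_vpt:
  assumes "a \<le> L" "b < 9" "a' \<le> L" "b' < 9" "0 < r" "r < 1" "0 \<le> r'" "r' \<le> 1" and eq: "p (vpt a b r) = p (vpt a' b' r')"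
  shows "b' = b \<and> r' = r \<and> (a' = a \<or> a = 0 \<and> a' = L \<or> a = L \<and> a' = 0)"
proof -
  have R: "vpt a b r \<in> R" "vpt a' b' r' \<in> R" using assms by (auto intro!: vpt_R)
  have r': "0 < r'" "r' < 1"
    using unit_strict[of a' b' r'] lattice_invariant[OF R eq] vpt_lattice[OF assms(5,6), of a b] assms(7,8) by auto
  have pos: "0 < real b + r" using assms(5) by simp
  have "real b + 1 \<le> 9" using assms(2) by linarith
  then have n9: "real b + r \<noteq> 9" using assms(6) by linarith
  have h: "real b' + r' = real b + r \<and> (real a' = real a \<or> (real a' = real L - real a \<and> (a = 0 \<or> a = L)))"
    using eq pos n9 unfolding p_eq_iff[OF R] by (auto simp: vpt_def)
  then have "of_int (int b) + r = of_int (int b') + r'" by simp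
  from unit_frac_eq[OF this assms(5,6) r'] show ?thesis using h by auto
qed

lemma p_hpt_vpt:
  assumes "a < L" "b \<le> 9" "a' \<le> L" "b' < 9" "0 \<le> r" "r \<le> 1" "0 < r'" "r' < 1"
  shows "p (hpt a b r) \<noteq> p (vpt a' b' r')"
proof
  assume eq: "p (hpt a b r) = p (vpt a' b' r')"
  have R: "hpt a b r \<in> R" "vpt a' b' r' \<in> R" using assms by (auto intro!: vpt_R hpt_R)
  have "0 < real b' + r'" using assms(7) by simp
  then have "real b' + r' = real b" using eq unfolding p_eq_iff[OF R] by (auto simp: hpt_def vpt_def)
  then have "of_int (int b') + r' \<in> \<int>" by simp
  then show False using frac_not_Ints[OF assms(7,8)] by blast
qed

lemma p_hpt_shift: "a < L \<Longrightarrow> 0 \<le> r \<Longrightarrow> r \<le> 1 \<Longrightarrow> p (hpt (a - shift a) 0 r) = p (hpt a 0 r)"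
proof -
  assume h: "a < L" "0 \<le> r" "r \<le> 1"
  then have R: "hpt (a - shift a) 0 r \<in> R" "hpt a 0 r \<in> R" by (auto intro!: hpt_R)
  show ?thesis unfolding p_eq_iff[OF R] using canonical_shift[OF h(2,3), of a] by (simp add: hpt_def)
qed

lemma p_hpt_bottom: "a + a' + 1 = L \<Longrightarrow> 0 \<le> r \<Longrightarrow> r \<le> 1 \<Longrightarrow> p (hpt a 9 r) = p (hpt a' 9 (1 - r))"
proof -
  assume h: "a + a' + 1 = L" "0 \<le> r" "r \<le> 1"
  then have R: "hpt a 9 r \<in> R" "hpt a' 9 (1 - r) \<in> R" by (auto intro!: hpt_R)
  show ?thesis unfolding p_eq_iff[OF R] using h(1) by (auto simp: hpt_def)
qed

lemma p_vpt_sides: "b < 9 \<Longrightarrow> 0 \<le> r \<Longrightarrow> r \<le> 1 \<Longrightarrow> p (vpt 0 b r) = p (vpt L b r)"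
proof -
  assume h: "b < 9" "0 \<le> r" "r \<le> 1"
  then have R: "vpt 0 b r \<in> R" "vpt L b r \<in> R" by (auto intro!: vpt_R)
  have "canonical 0 = canonical (real L)" using side_param_L by (simp add: canonical_def)
  then show ?thesis unfolding p_eq_iff[OF R] using h by (auto simp: vpt_def)
qed

section \<open>The labels\<close>

text \<open>In the columns of the crosscaps after the seventh, walks of length two go back and forth between
  the types \<open>homotopy ! j ! 0\<close> and \<open>homotopy ! (j + 1) ! 0\<close>.\<close>

definition label :: "nat \<Rightarrow> nat \<Rightarrow> vertex_type" where
  "label i j = (if i < 154 then homotopy ! j ! i else if even i then homotopy ! j ! 0 else homotopy ! (j + 1) ! 0)"

end

lemma homotopy_lengths: "length homotopy = 11" "j < 11 \<Longrightarrow> length (homotopy ! j) = 154"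
proof -
  show l: "length homotopy = 11" using homotopy_length by (metis length_map length_replicate)
  assume "j < 11"
  then have "map length homotopy ! j = 154" unfolding homotopy_length by simp
  then show "length (homotopy ! j) = 154" using l \<open>j < 11\<close> by simp
qed

lemma type_adj_sym: "type_adj u v = type_adj v u"
  by (auto simp: type_adj_iff)

lemma homotopy_row: "j < 11 \<Longrightarrow> i < 154 \<Longrightarrow> type_adj (homotopy ! j ! i) (homotopy ! j ! (Suc i mod 154))"
proof -
  assume h: "j < 11" "i < 154"
  then have "list_all2 type_adj (homotopy ! j) (rotate1 (homotopy ! j))"
    using homotopy_row_adj homotopy_lengths by (simp add: list_all_length)
  then have "type_adj (homotopy ! j ! i) (rotate1 (homotopy ! j) ! i)"
    using h homotopy_lengths by (simp add: list_all2_conv_all_nth)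
  then show ?thesis using h homotopy_lengths by (simp add: nth_rotate1)
qed

lemma homotopy_col: "j < 10 \<Longrightarrow> i < 154 \<Longrightarrow> type_adj (homotopy ! j ! i) (homotopy ! Suc j ! i)"
proof -
  assume h: "j < 10" "i < 154"
  have "list_all2 type_adj (butlast homotopy ! j) (tl homotopy ! j)"
    using homotopy_col_adj h homotopy_lengths by (auto simp: list_all2_conv_all_nth)
  then have "list_all2 type_adj (homotopy ! j) (homotopy ! Suc j)"
    using h homotopy_lengths by (simp add: nth_butlast nth_tl)
  then show ?thesis using h homotopy_lengths by (simp add: list_all2_conv_all_nth)
qed

lemma homotopy_type_ok: "j < 11 \<Longrightarrow> i < 154 \<Longrightarrow> type_ok (homotopy ! j ! i)"
  using homotopy_ok homotopy_lengths by (simp add: list_all_length)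

lemma homotopy_0: "hd homotopy = homotopy ! 0"
  using homotopy_lengths by (intro hd_conv_nth) auto

lemma homotopy_corner: "j < 14 \<Longrightarrow> homotopy ! 0 ! (11 * j) = homotopy ! 0 ! 0"
proof -
  assume j: "j < 14"
  have "hd (homotopy ! 0) = homotopy ! 0 ! 0" using homotopy_lengths(2)[of 0] by (intro hd_conv_nth) auto
  moreover have "map (\<lambda>j. hd homotopy ! (11 * j)) [0..<14] ! j = replicate 14 (hd (hd homotopy)) ! j" by (simp only: homotopy_corners)
  ultimately show ?thesis using j by (simp add: homotopy_0 del: upt_Suc)
qed

lemma nth_concat_blocks:
  assumes "\<And>xs. xs \<in> set xss \<Longrightarrow> length xs = n" "k < length xss" "s < n"
  shows "concat xss ! (n * k + s) = xss ! k ! s"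
  using assms
proof (induction xss arbitrary: k)
  case (Cons xs xss)
  show ?case
  proof (cases k)
    case 0
    then show ?thesis using Cons.prems by (simp add: nth_append)
  next
    case (Suc k')
    have "length xs = n" using Cons.prems by simp
    then show ?thesis using Suc Cons.IH[of k'] Cons.prems by (simp add: nth_append)
  qed
qed simp

lemma homotopy_side: "k < 7 \<Longrightarrow> s < 11 \<Longrightarrow> homotopy ! 0 ! (22 * k + 11 + s) = homotopy ! 0 ! (22 * k + s)"
proof -
  assume h: "k < 7" "s < 11"
  define B where "B = map (\<lambda>r. r @ r) (map (\<lambda>k. take 11 (drop (22 * k) (hd homotopy))) [0..<7])"
  have len: "length (hd homotopy) = 154" using homotopy_lengths homotopy_0 by simp
  have lB: "length xs = 22" if "xs \<in> set B" for xs
    using that len unfolding B_def by (auto simp del: upt_Suc)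
  have Bk: "B ! k = take 11 (drop (22 * k) (hd homotopy)) @ take 11 (drop (22 * k) (hd homotopy))"
    using h by (simp add: B_def del: upt_Suc)
  have l11: "length (take 11 (drop (22 * k) (hd homotopy))) = 11" using len h by simp
  have kB: "k < length B" using h by (simp add: B_def del: upt_Suc)
  have cB: "concat B = hd homotopy" unfolding B_def by (rule homotopy_sides)
  have "hd homotopy ! (22 * k + (11 + s)) = B ! k ! (11 + s)"
    using nth_concat_blocks[OF lB kB, of "11 + s"] h cB by simp
  moreover have "hd homotopy ! (22 * k + s) = B ! k ! s"
    using nth_concat_blocks[OF lB kB, of s] h cB by simp
  ultimately show ?thesis unfolding homotopy_0[symmetric] Bk using l11 h by (simp add: nth_append add.assoc)
qed

lemma homotopy_bottom: "i < 154 \<Longrightarrow> homotopy ! 9 ! i = homotopy ! 9 ! (i mod 2)"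
proof -
  assume i: "i < 154"
  define a where "a = hd (homotopy ! 9)"
  define b where "b = hd (tl (homotopy ! 9))"
  define B where "B = replicate 77 [a, b]"
  have cB: "concat B = homotopy ! 9" unfolding B_def a_def b_def by (rule homotopy_last[symmetric])
  have v: "homotopy ! 9 ! i = [a, b] ! (i mod 2)" if "i < 154" for i
  proof -
    have "i div 2 < 77" using that by linarith
    moreover have "2 * (i div 2) + i mod 2 = i" by simp
    ultimately show ?thesis using nth_concat_blocks[of B 2 "i div 2" "i mod 2"] cB by (simp add: B_def del: replicate.simps)
  qed
  show ?thesis using v[OF i] v[of "i mod 2"] by simp
qed

lemma homotopy_period: "homotopy ! 10 ! 0 = homotopy ! 9 ! 1"
  by (simp add: homotopy_def)

lemma type_adj_neq: "type_ok u \<Longrightarrow> type_adj u v \<Longrightarrow> u \<noteq> v"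
  by (auto simp: type_adj_iff type_ok_iff)

context crosscap_disc begin

lemma label_ok: "j \<le> 9 \<Longrightarrow> type_ok (label i j)"
  unfolding label_def using homotopy_type_ok by simp

lemma label_row: "j \<le> 9 \<Longrightarrow> type_adj (label i j) (label (Suc i) j)"
proof -
  assume j: "j \<le> 9"
  consider "Suc i < 154" | "i = 153" | "154 \<le> i" by linarith
  then show ?thesis
  proof cases
    case 1
    then show ?thesis using homotopy_row[of j i] j by (simp add: label_def)
  next
    case 2
    then show ?thesis using homotopy_row[of j 153] j by (simp add: label_def)
  next
    case 3
    have "type_adj (homotopy ! j ! 0) (homotopy ! Suc j ! 0)" using homotopy_col[of j 0] j by simp
    then show ?thesis using 3 type_adj_sym[of "homotopy ! Suc j ! 0" "homotopy ! j ! 0"] by (simp add: label_def)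
  qed
qed

lemma label_col: "j < 9 \<Longrightarrow> type_adj (label i j) (label i (Suc j))"
  using homotopy_col[of j i] homotopy_col[of j 0] homotopy_col[of "Suc j" 0] by (simp add: label_def)

lemma label_side: assumes "i \<le> L" shows "label (i - shift i) 0 = label i 0"
proof (cases "shift i = 0")
  case False
  show ?thesis
  proof (cases "i < 154")
    case True
    then have sh: "shift i = 11" "odd (i div 11)" using False by (auto simp: shift_def split: if_splits)
    then obtain k where k: "i div 11 = 2 * k + 1" by (auto elim: oddE)
    have i: "i = 22 * k + 11 + i mod 11" using k div_mult_mod_eq[of i 11] by simp
    have "k < 7" using True i by linarith
    moreover have "i mod 11 < 11" by simp
    ultimately have "homotopy ! 0 ! i = homotopy ! 0 ! (22 * k + i mod 11)"
      using homotopy_side[of k "i mod 11"] i by simp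
    moreover have "i - 11 = 22 * k + i mod 11" using i by linarith
    moreover have "label (i - 11) 0 = homotopy ! 0 ! (i - 11)" "label i 0 = homotopy ! 0 ! i"
      using True by (auto simp: label_def)
    ultimately show ?thesis by (simp only: sh)
  next
    case ge: False
    then have sh: "shift i = 2" "odd ((i - 154) div 2)" using False by (auto simp: shift_def split: if_splits)
    then have "156 \<le> i" using ge by presburger
    then have "\<not> i - 2 < 154" "even (i - 2) = even i" by auto
    then show ?thesis using sh ge by (simp add: label_def)
  qed
qed simp

lemma label_canonical:
  assumes "i \<le> L" obtains k where "canonical (real i) = real k" "label k 0 = label i 0"
proof (cases "side_param (real i) \<in> \<int>")
  case True
  then obtain m where m: "side_param (real i) = of_int m" by (rule Ints_cases)
  have "label i 0 = label 0 0"
  proof (cases "i < 154")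
    case True
    then have "real i = 11 * of_int m" using m by (simp add: side_param_def)
    then have "of_int (int i) = (of_int (11 * m) :: real)" by simp
    then have im: "int i = 11 * m" by (simp only: of_int_eq_iff)
    then have "i = 11 * nat m" "nat m < 14" using True by linarith+
    then show ?thesis using homotopy_corner[of "nat m"] True by (simp add: label_def)
  next
    case False
    then have "14 + (real i - 154) / 2 = of_int m" using m by (simp add: side_param_def)
    then have "real i = 2 * of_int m + 126" by (simp add: field_simps)
    then have "of_int (int i) = (of_int (2 * m + 126) :: real)" by simp
    then have "int i = 2 * m + 126" by (simp only: of_int_eq_iff)
    then have "even i" by presburger
    then show ?thesis using False by (simp add: label_def)
  qed
  then show ?thesis using that[of 0] True by (simp add: canonical_def)
next
  case False
  then have "canonical (real i) = real (i - shift i)"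
    using shift_le[of i] by (simp add: canonical_def side_shift_shift of_nat_diff)
  then show ?thesis using that label_side[OF assms] by blast
qed

lemma label_bottom: "label i 9 = homotopy ! 9 ! (if even i then 0 else 1)"
  using homotopy_bottom[of i] homotopy_period by (simp add: label_def mod2_eq_if)

definition pt :: "nat \<Rightarrow> nat \<Rightarrow> 'a" where "pt i j = p (Complex (real i) (real j))"

text \<open>The labels respect the three gluings: the top row repeats the same walk on both sides of a pair, the
  first and the last column are equal, and the bottom row alternates with an even period.\<close>

lemma label_pt:
  assumes "i \<le> L" "i' \<le> L" "j \<le> 9" "j' \<le> 9" "pt i j = pt i' j'"
  shows "label i j = label i' j'"
proof -
  have R: "Complex (real i) (real j) \<in> R" "Complex (real i') (real j') \<in> R" using assms by (simp_all add: R_def)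
  have "(real j = 0 \<and> real j' = 0 \<and> canonical (real i) = canonical (real i')) \<or>
    real j' = real j \<and> (real i' = real i \<or> real i' = real L - real i \<and> (real i = 0 \<or> real i = real L \<or> real j = real 9))"
    using assms(5) unfolding pt_def p_eq_iff[OF R] by auto
  moreover have "i' = L - i" if "real i' = real L - real i" using that by linarith
  ultimately consider "j = 0" "j' = 0" "canonical (real i) = canonical (real i')" | "j' = j" "i' = i"
    | "j' = j" "i' = L - i" "i = 0 \<or> i = L \<or> j = 9"
    unfolding of_nat_eq_iff of_nat_eq_0_iff by blast
  then show ?thesis
  proof cases
    case 1
    obtain k where k: "canonical (real i) = real k" "label k 0 = label i 0" by (rule label_canonical[OF assms(1)])
    obtain k' where k': "canonical (real i') = real k'" "label k' 0 = label i' 0" by (rule label_canonical[OF assms(2)])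
    show ?thesis using 1 k k' by simp
  next
    case 3
    have ends: "label L j = label 0 j" using L_pos by (simp add: label_def)
    have "even (L - i) = even i" using L_pos(2) assms(1) by simp
    then show ?thesis using 3 ends label_bottom[of i] label_bottom[of "L - i"] by auto
  qed simp
qed

text \<open>A type does not fit itself, so the labels show that no edge of the grid becomes a loop.\<close>

lemma pt_neq: "i < L \<Longrightarrow> j \<le> 9 \<Longrightarrow> pt i j \<noteq> pt (Suc i) j" "i \<le> L \<Longrightarrow> j < 9 \<Longrightarrow> pt i j \<noteq> pt i (Suc j)"
proof -
  show "pt i j \<noteq> pt (Suc i) j" if "i < L" "j \<le> 9"
    using label_pt[of i "Suc i" j j] that type_adj_neq[OF label_ok label_row, of j i] by auto
  show "pt i j \<noteq> pt i (Suc j)" if "i \<le> L" "j < 9"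
    using label_pt[of i i j "Suc j"] that type_adj_neq[OF label_ok label_col, of j i] by auto
qed

section \<open>The grid as an embedded graph\<close>

text \<open>A step \<open>(h, a, b)\<close> is the unit edge from \<open>(a, b)\<close> to the right or, if \<open>h\<close> is false, downwards.\<close>

definition valid_step :: "bool \<times> nat \<times> nat \<Rightarrow> bool" where
  "valid_step = (\<lambda>(h, a, b). if h then a < L \<and> b \<le> 9 else a \<le> L \<and> b < 9)"

definition step :: "bool \<times> nat \<times> nat \<Rightarrow> real \<Rightarrow> complex" where
  "step = (\<lambda>(h, a, b). if h then hpt a b else vpt a b)"

lemma step_R: "valid_step u \<Longrightarrow> 0 \<le> r \<Longrightarrow> r \<le> 1 \<Longrightarrow> step u r \<in> R"
  by (cases u) (auto simp: valid_step_def step_def intro: hpt_R vpt_R split: if_splits)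

lemma step_lattice: "0 < r \<Longrightarrow> r < 1 \<Longrightarrow> \<not> lattice (step u r)"
  by (cases u) (auto simp: step_def hpt_lattice vpt_lattice)

lemma p_step_ends: "p (step (h, a, b) 0) = pt a b" "p (step (True, a, b) 1) = pt (Suc a) b" "p (step (False, a, b) 1) = pt a (Suc b)"
  by (simp_all add: step_def hpt_def vpt_def pt_def add.commute)

lemma step_ends_neq: "valid_step u \<Longrightarrow> p (step u 0) \<noteq> p (step u 1)"
proof -
  assume v: "valid_step u"
  obtain h a b where u: "u = (h, a, b)" by (cases u) auto
  show ?thesis using v pt_neq[of a b] unfolding u by (cases h) (auto simp: p_step_ends valid_step_def)
qed

lemma continuous_step: "continuous_on S (step u)"
proof -
  have "continuous_on S (\<lambda>r. Complex (x + r) y)" "continuous_on S (\<lambda>r. Complex x (y + r))" for x y :: real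
    unfolding Complex_eq by (intro continuous_intros)+
  then show ?thesis by (cases u) (auto simp: step_def hpt_def[abs_def] vpt_def[abs_def])
qed

lemma p_step_eq:
  assumes "valid_step u" "valid_step u'" "0 < r" "r < 1" "0 \<le> r'" "r' \<le> 1" and eq: "p (step u r) = p (step u' r')"
  shows "(r' = r \<and> (\<forall>\<rho>\<in>{0..1}. p (step u \<rho>) = p (step u' \<rho>))) \<or> (r' = 1 - r \<and> (\<forall>\<rho>\<in>{0..1}. p (step u \<rho>) = p (step u' (1 - \<rho>))))"
proof -
  obtain h a b where u: "u = (h, a, b)" by (cases u) auto
  obtain h' a' b' where u': "u' = (h', a', b')" by (cases u') auto
  have "lattice (step u' r') = lattice (step u r)"
    using lattice_invariant[OF step_R step_R eq] assms by auto
  then have "\<not> lattice (step u' r')" using step_lattice[OF assms(3,4), of u] by simp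
  then have "r' \<noteq> 0" "r' \<noteq> 1" by (auto simp: u' step_def lattice_def hpt_def vpt_def split: if_splits)
  then have r': "0 < r'" "r' < 1" using assms(5,6) by auto
  show ?thesis
  proof (cases h)
    case True
    then have ab: "a < L" "b \<le> 9" using assms(1) u by (auto simp: valid_step_def)
    have h': h'
    proof (rule ccontr)
      assume n: "\<not> h'"
      then have ab': "a' \<le> L" "b' < 9" using assms(2) u' by (auto simp: valid_step_def)
      show False using p_hpt_vpt[OF ab ab', of r r'] assms(3,4) r' eq n True by (simp add: u u' step_def)
    qed
    then have ab': "a' < L" "b' \<le> 9" using assms(2) u' by (auto simp: valid_step_def)
    have e: "p (hpt a b r) = p (hpt a' b' r')" using eq True h' by (simp add: u u' step_def)
    have pe: "p (step u \<rho>) = p (hpt a b \<rho>)" "p (step u' \<rho>) = p (hpt a' b' \<rho>)" for \<rho>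
      using True h' by (simp_all add: u u' step_def)
    from p_hpt_hpt[OF ab ab' assms(3-6) e]
    consider "b' = b" "r' = r" "a' = a" | "b' = 0" "b = 0" "r' = r" "a - shift a = a' - shift a'" | "b' = 9" "b = 9" "r' = 1 - r" "a + a' + 1 = L"
      by blast
    then show ?thesis
    proof cases
      case 2
      then have "p (step u \<rho>) = p (step u' \<rho>)" if "\<rho> \<in> {0..1}" for \<rho>
        using p_hpt_shift[OF ab(1), of \<rho>] p_hpt_shift[OF ab'(1), of \<rho>] that unfolding pe by simp
      then show ?thesis using 2 by blast
    next
      case 3
      then have "p (step u \<rho>) = p (step u' (1 - \<rho>))" if "\<rho> \<in> {0..1}" for \<rho>
        using p_hpt_bottom[of a a' \<rho>] that unfolding pe by simp
      then show ?thesis using 3 by blast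
    qed (simp add: pe)
  next
    case False
    then have ab: "a \<le> L" "b < 9" using assms(1) u by (auto simp: valid_step_def)
    have h': "\<not> h'"
    proof
      assume n: h'
      then have ab': "a' < L" "b' \<le> 9" using assms(2) u' by (auto simp: valid_step_def)
      show False using p_hpt_vpt[OF ab' ab, of r' r] assms(3,4) r' eq n False by (simp add: u u' step_def)
    qed
    then have ab': "a' \<le> L" "b' < 9" using assms(2) u' by (auto simp: valid_step_def)
    have e: "p (vpt a b r) = p (vpt a' b' r')" using eq False h' by (simp add: u u' step_def)
    have pe: "p (step u \<rho>) = p (vpt a b \<rho>)" "p (step u' \<rho>) = p (vpt a' b' \<rho>)" for \<rho>
      using False h' by (simp_all add: u u' step_def)
    have "b' = b \<and> r' = r \<and> (a' = a \<or> a = 0 \<and> a' = L \<or> a = L \<and> a' = 0)"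
      by (rule p_vpt_vpt[OF ab ab' assms(3-6) e])
    then show ?thesis using p_vpt_sides[OF ab(2)] unfolding pe by auto
  qed
qed

lemma p_step_inj: assumes "valid_step u" shows "inj_on (\<lambda>r. p (step u r)) {0..1}"
proof (rule inj_onI)
  have strict: "r' = r" if "0 < r" "r < 1" "0 \<le> r'" "r' \<le> 1" "p (step u r) = p (step u r')" for r r'
  proof (rule ccontr)
    assume "r' \<noteq> r"
    then have "\<forall>\<rho>\<in>{0..1}. p (step u \<rho>) = p (step u (1 - \<rho>))" using p_step_eq[OF assms assms that] by blast
    then have "p (step u 0) = p (step u (1 - 0))" by (rule bspec) simp
    then show False using step_ends_neq[OF assms] by simp
  qed
  fix r r' :: real assume h: "r \<in> {0..1}" "r' \<in> {0..1}" "p (step u r) = p (step u r')"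
  consider "0 < r" "r < 1" | "0 < r'" "r' < 1" | "r = 0 \<or> r = 1" "r' = 0 \<or> r' = 1" using h(1,2) by fastforce
  then show "r = r'"
  proof cases
    case 1
    then show ?thesis using strict[of r r'] h by simp
  next
    case 2
    then show ?thesis using strict[of r' r] h by simp
  next
    case 3
    then show ?thesis using h(3) step_ends_neq[OF assms] by auto
  qed
qed

definition grid_arc :: "bool \<times> nat \<times> nat \<Rightarrow> 'a set" where "grid_arc u = (\<lambda>r. p (step u r)) ` {0..1}"

definition V :: "'a set" where "V = {pt i j |i j. i \<le> L \<and> j \<le> 9}"

definition E :: "'a set set" where "E = grid_arc ` {u. valid_step u}"

lemma finite_VE: "finite V" "finite E"
proof -
  have "V = (\<lambda>(i, j). pt i j) ` ({..L} \<times> {..9})" by (auto simp: V_def image_iff)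
  then show "finite V" by simp
  have "{u. valid_step u} \<subseteq> UNIV \<times> {..L} \<times> {..9}" by (auto simp: valid_step_def split: if_splits)
  then have "finite {u. valid_step u}" by (rule finite_subset) simp
  then show "finite E" by (simp add: E_def)
qed

lemma step_ends_V: "valid_step u \<Longrightarrow> p (step u 0) \<in> V" "valid_step u \<Longrightarrow> p (step u 1) \<in> V"
proof -
  assume v: "valid_step u"
  obtain h a b where u: "u = (h, a, b)" by (cases u) auto
  have "pt i j \<in> V" if "i \<le> L" "j \<le> 9" for i j using that by (auto simp: V_def)
  then show "p (step u 0) \<in> V" "p (step u 1) \<in> V"
    using v unfolding u by (cases h; simp add: p_step_ends valid_step_def)+
qed

lemma step_inner_V: assumes "valid_step u" "0 < r" "r < 1" shows "p (step u r) \<notin> V"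
proof
  assume "p (step u r) \<in> V"
  then obtain i j where ij: "i \<le> L" "j \<le> 9" "p (step u r) = p (Complex (real i) (real j))" by (auto simp: V_def pt_def)
  have R: "Complex (real i) (real j) \<in> R" "step u r \<in> R" using ij step_R[OF assms(1)] assms by (simp_all add: R_def)
  have "lattice (step u r) = lattice (Complex (real i) (real j))" by (rule lattice_invariant[OF R(2,1) ij(3)])
  then show False using step_lattice[OF assms(2,3), of u] by (simp add: lattice_def)
qed

lemma grid_arc_V: assumes "valid_step u" shows "grid_arc u \<inter> V = {p (step u 0), p (step u 1)}"
proof
  show "grid_arc u \<inter> V \<subseteq> {p (step u 0), p (step u 1)}"
  proof
    fix x assume "x \<in> grid_arc u \<inter> V"
    then obtain r where r: "0 \<le> r" "r \<le> 1" "x = p (step u r)" "x \<in> V" by (auto simp: grid_arc_def)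
    then have "r = 0 \<or> r = 1" using step_inner_V[OF assms, of r] by fastforce
    then show "x \<in> {p (step u 0), p (step u 1)}" using r by auto
  qed
  show "{p (step u 0), p (step u 1)} \<subseteq> grid_arc u \<inter> V" using step_ends_V[OF assms] by (auto simp: grid_arc_def)
qed

lemma continuous_p_step: assumes "valid_step u" shows "continuous_map (top_of_set {0..1}) X (\<lambda>r. p (step u r))"
proof -
  have "continuous_map (top_of_set {0..1}) (top_of_set R) (step u)"
    using continuous_step step_R[OF assms] by auto
  from continuous_map_compose[OF this continuous_p] show ?thesis by (simp add: o_def)
qed

lemma homeomorphic_arc: assumes "valid_step u"
  shows "homeomorphic_map (top_of_set {0..1}) (subtopology X (grid_arc u)) (\<lambda>r. p (step u r))"
  unfolding grid_arc_def
  by (rule homeomorphic_map_compact_Hausdorff[OF compact_Icc surface_Hausdorff[OF surf] continuous_p_step[OF assms] p_step_inj[OF assms]])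

lemma pt_topspace: "i \<le> L \<Longrightarrow> j \<le> 9 \<Longrightarrow> pt i j \<in> topspace X"
  unfolding pt_def p_onto[symmetric] by (rule imageI) (simp add: R_def)

lemma arcs_meet:
  assumes u: "valid_step u" and u': "valid_step u'" and r: "0 < r" "r < 1" and m: "p (step u r) \<in> grid_arc u'"
  shows "grid_arc u = grid_arc u'"
proof -
  obtain r' where r': "0 \<le> r'" "r' \<le> 1" "p (step u r) = p (step u' r')" using m by (auto simp: grid_arc_def)
  from p_step_eq[OF u u' r r'] consider "\<forall>\<rho>\<in>{0..1}. p (step u \<rho>) = p (step u' \<rho>)"
    | "\<forall>\<rho>\<in>{0..1}. p (step u \<rho>) = p (step u' (1 - \<rho>))" by blast
  then show ?thesis
  proof cases
    case 1
    then show ?thesis by (auto simp: grid_arc_def)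
  next
    case 2
    have "grid_arc u = (\<lambda>r. p (step u' r)) ` ((\<lambda>\<rho>. 1 - \<rho>) ` {0..1})"
      unfolding grid_arc_def image_image by (rule image_cong) (use 2 in auto)
    then show ?thesis by (simp add: grid_arc_def image_diff_atLeastAtMost)
  qed
qed

lemma embedded_grid: "embedded_graph X V E"
  unfolding embedded_graph_def
proof (intro conjI ballI impI)
  show "V \<subseteq> topspace X" using pt_topspace by (auto simp: V_def)
  fix e assume "e \<in> E"
  then obtain u where u: "valid_step u" "e = grid_arc u" by (auto simp: E_def)
  have sub: "grid_arc u = topspace X \<inter> grid_arc u"
    using continuous_map_image_subset_topspace[OF continuous_p_step[OF u(1)]] by (auto simp: grid_arc_def)
  have emb: "embedding_map (top_of_set {0..1}) X (\<lambda>r. p (step u r))"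
    unfolding embedding_map_def using homeomorphic_arc[OF u(1)] by (simp add: grid_arc_def)
  show "\<exists>\<gamma>. embedding_map (top_of_set {0..1::real}) X \<gamma> \<and> e = \<gamma> ` {0..1} \<and> e \<inter> V = {\<gamma> 0, \<gamma> 1}"
    unfolding u(2) grid_arc_V[OF u(1)] by (intro exI[of _ "\<lambda>r. p (step u r)"] conjI) (simp_all add: emb grid_arc_def)
  fix e' assume "e' \<in> E" "e \<noteq> e'"
  then obtain u' where u': "valid_step u'" "e' = grid_arc u'" by (auto simp: E_def)
  show "e \<inter> e' \<subseteq> V"
  proof
    fix x assume x: "x \<in> e \<inter> e'"
    then obtain r where r: "0 \<le> r" "r \<le> 1" "x = p (step u r)" by (auto simp: u(2) grid_arc_def)
    have "r = 0 \<or> r = 1"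
    proof (rule ccontr)
      assume "\<not> ?thesis"
      then have "0 < r" "r < 1" using r by auto
      then have "grid_arc u = grid_arc u'" using arcs_meet[OF u(1) u'(1)] x r(3) u'(2) by simp
      then show False using \<open>e \<noteq> e'\<close> u u' by simp
    qed
    then show "x \<in> V" using step_ends_V[OF u(1)] r(3) by auto
  qed
qed (use finite_VE in auto)

section \<open>The coloring of the grid\<close>

definition lab :: "'a \<Rightarrow> vertex_type" where
  "lab x = (SOME t. \<exists>i j. i \<le> L \<and> j \<le> 9 \<and> x = pt i j \<and> t = label i j)"

lemma lab_pt: assumes "i \<le> L" "j \<le> 9" shows "lab (pt i j) = label i j"
proof -
  have "\<exists>i' j'. i' \<le> L \<and> j' \<le> 9 \<and> pt i j = pt i' j' \<and> lab (pt i j) = label i' j'"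
    unfolding lab_def by (rule someI_ex) (use assms in blast)
  then obtain i' j' where "i' \<le> L" "j' \<le> 9" "pt i j = pt i' j'" "lab (pt i j) = label i' j'" by blast
  then show ?thesis using label_pt[of i i' j j'] assms by simp
qed

lemma lab_ok: "x \<in> V \<Longrightarrow> type_ok (lab x)"
  using lab_pt label_ok by (auto simp: V_def)

lemma lab_adj: assumes "adjacent V E x y" shows "type_adj (lab x) (lab y)"
proof -
  obtain e where "e \<in> E" "e \<inter> V = {x, y}" using assms by (auto simp: adjacent_def)
  then obtain u where u: "valid_step u" "{x, y} = {p (step u 0), p (step u 1)}" using grid_arc_V by (auto simp: E_def)
  obtain h a b where h: "u = (h, a, b)" by (cases u) auto
  have "type_adj (lab (p (step u 0))) (lab (p (step u 1)))"
    using u(1) label_row[of b a] label_col[of b a] unfolding h by (cases h) (auto simp: p_step_ends valid_step_def lab_pt)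
  moreover have "x = p (step u 0) \<and> y = p (step u 1) \<or> x = p (step u 1) \<and> y = p (step u 0)"
    using u(2) by (auto simp: doubleton_eq_iff)
  ultimately show ?thesis using type_adj_sym[of "lab x" "lab y"] by auto
qed

lemma local_coloring: "local_3_coloring V E (\<lambda>x. type_color (lab x))"
  unfolding local_3_coloring_def proper_coloring_def
proof (intro conjI ballI impI)
  show "type_color (lab x) \<noteq> type_color (lab y)" if "x \<in> V" "adjacent V E x y" for x y
    using lab_adj[OF that(2)] lab_ok[OF that(1)] by (auto simp: type_adj_iff type_ok_iff)
  fix x assume "x \<in> V"
  have "(\<lambda>y. type_color (lab y)) ` neighbors V E x \<subseteq> type_set (lab x)"
    using lab_adj by (auto simp: neighbors_def type_adj_iff)
  then have "card ((\<lambda>y. type_color (lab y)) ` neighbors V E x) \<le> card (type_set (lab x))"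
    by (rule card_mono[rotated]) (simp add: type_set_def)
  also have "\<dots> \<le> 2" by (simp add: type_set_def card_insert_if)
  finally show "card ((\<lambda>y. type_color (lab y)) ` neighbors V E x) \<le> 2" .
qed

lemma five_colors_used: "card ((\<lambda>x. type_color (lab x)) ` V) = 5"
proof -
  have "(\<lambda>x. type_color (lab x)) ` V = {0,1,2,3,4}"
  proof
    show "(\<lambda>x. type_color (lab x)) ` V \<subseteq> {0,1,2,3,4}" using lab_ok by (fastforce simp: type_ok_iff)
    show "{0,1,2,3,4} \<subseteq> (\<lambda>x. type_color (lab x)) ` V"
    proof
      fix c :: nat assume "c \<in> {0,1,2,3,4}"
      then obtain t where t: "t \<in> set (homotopy ! 0)" "type_color t = c" using homotopy_colors homotopy_0 by auto
      then obtain i where i: "i < 154" "homotopy ! 0 ! i = t" using homotopy_lengths(2)[of 0] by (auto simp: in_set_conv_nth)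
      have "i \<le> L" using i L_pos by linarith
      then have "type_color (lab (pt i 0)) = c" "pt i 0 \<in> V" using t i lab_pt[of i 0] by (auto simp: label_def V_def)
      then show "c \<in> (\<lambda>x. type_color (lab x)) ` V" by blast
    qed
  qed
  then show ?thesis by simp
qed

end

section \<open>The squares of the grid\<close>

text \<open>Each member of the partition is also closed, as the complement of the union of the others.\<close>

lemma connected_components_of_partition:
  assumes "\<And>c. c \<in> C \<Longrightarrow> openin Y c \<and> connectedin Y c \<and> c \<noteq> {}"
    and disj: "\<And>c d. c \<in> C \<Longrightarrow> d \<in> C \<Longrightarrow> c \<noteq> d \<Longrightarrow> c \<inter> d = {}" and un: "\<Union>C = topspace Y"
  shows "connected_components_of Y = C"
proof -
  have comp: "connected_component_of_set Y x = c" if c: "c \<in> C" "x \<in> c" for c x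
  proof
    have "x \<in> topspace Y" using c un by blast
    have "d \<inter> c = {}" if "d \<in> C - {c}" for d using disj[of d c] that c(1) by simp
    then have "\<Union>(C - {c}) \<inter> c = {}" by fast
    moreover have "topspace Y = c \<union> \<Union>(C - {c})" unfolding un[symmetric] using c(1) by auto
    ultimately have "topspace Y - c = \<Union>(C - {c})" by auto
    moreover have "openin Y (\<Union>(C - {c}))" by (rule openin_Union) (use assms(1) in simp)
    ultimately have "openin Y (topspace Y - c)" by simp
    moreover have op: "openin Y c" using assms(1)[OF c(1)] by simp
    ultimately have "closedin Y c" using openin_subset[OF op] by (simp add: closedin_def)
    then have "connected_component_of_set Y x \<subseteq> c \<or> disjnt (connected_component_of_set Y x) c"
      by (rule connectedin_clopen_cases[OF connectedin_connected_component_of _ op])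
    moreover have "x \<in> connected_component_of_set Y x" using \<open>x \<in> topspace Y\<close> by (simp add: connected_component_of_refl)
    ultimately show "connected_component_of_set Y x \<subseteq> c" using c(2) unfolding disjnt_def by blast
    show "c \<subseteq> connected_component_of_set Y x"
      by (rule connected_component_of_maximal) (use assms(1)[OF c(1)] c(2) in simp_all)
  qed
  show ?thesis
  proof
    show "connected_components_of Y \<subseteq> C"
    proof
      fix K assume "K \<in> connected_components_of Y"
      then obtain x where x: "x \<in> topspace Y" "K = connected_component_of_set Y x"
        by (auto simp: connected_components_of_def)
      then obtain c where "c \<in> C" "x \<in> c" unfolding un[symmetric] by auto
      then show "K \<in> C" using comp[of c x] x(2) by simp
    qed
    show "C \<subseteq> connected_components_of Y"
    proof
      fix c assume c: "c \<in> C"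
      then obtain x where x: "x \<in> c" using assms(1)[OF c] by auto
      then have "x \<in> topspace Y" unfolding un[symmetric] using c by auto
      then have "connected_component_of_set Y x \<in> connected_components_of Y" by (simp add: connected_components_of_def)
      then show "c \<in> connected_components_of Y" using comp[OF c x] by simp
    qed
  qed
qed

context crosscap_disc begin

definition squares :: "(nat \<times> nat) set" where "squares = {..<L} \<times> {..<9}"

definition open_square :: "nat \<times> nat \<Rightarrow> complex set" where
  "open_square = (\<lambda>(a, b). {z. real a < Re z \<and> Re z < real a + 1 \<and> real b < Im z \<and> Im z < real b + 1})"

definition cell :: "nat \<times> nat \<Rightarrow> 'a set" where "cell s = p ` open_square s"

lemma p_interior:
  assumes "z \<in> R" "w \<in> R" "p z = p w" "0 < Re z" "Re z < real L" "0 < Im z" "Im z < 9" shows "w = z"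
  using assms(3-7) unfolding p_eq_iff[OF assms(1,2)] by (auto simp: complex_eq_iff)

lemma open_square_R: assumes "s \<in> squares" "z \<in> open_square s"
  shows "z \<in> R" "0 < Re z" "Re z < real L" "0 < Im z" "Im z < 9"
proof -
  obtain a b where s: "s = (a, b)" "a < L" "b < 9" using assms(1) by (auto simp: squares_def)
  then have "real a + 1 \<le> real L" "real b + 1 \<le> 9" by linarith+
  then show "z \<in> R" "0 < Re z" "Re z < real L" "0 < Im z" "Im z < 9"
    using assms(2) by (auto simp: s(1) open_square_def R_def)
qed

lemma open_square_not_Ints: assumes "z \<in> open_square s" shows "Re z \<notin> \<int>" "Im z \<notin> \<int>"
proof -
  obtain a b where s: "s = (a, b)" by (cases s)
  show "Re z \<notin> \<int>" using frac_not_Ints[of "Re z - real a" "int a"] assms by (simp add: s open_square_def)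
  show "Im z \<notin> \<int>" using frac_not_Ints[of "Im z - real b" "int b"] assms by (simp add: s open_square_def)
qed

lemma cell_point: assumes "s \<in> squares" "w \<in> R" "p w \<in> cell s" shows "w \<in> open_square s"
proof -
  obtain z where z: "z \<in> open_square s" "p w = p z" using assms(3) by (auto simp: cell_def)
  then have "w = z" using p_interior[of z w] open_square_R[OF assms(1) z(1)] assms(2) by simp
  then show ?thesis using z by simp
qed

lemma open_square_box: "open_square (a, b) = box (Complex (real a) (real b)) (Complex (real a + 1) (real b + 1))"
  by (auto simp: open_square_def in_box_complex_iff)

lemma open_square_unique: assumes "z \<in> open_square s" "z \<in> open_square s'" shows "s = s'"
proof -
  obtain a b a' b' where s: "s = (a, b)" "s' = (a', b')" by (cases s; cases s') auto
  have "real a < real a' + 1" "real a' < real a + 1" "real b < real b' + 1" "real b' < real b + 1"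
    using assms by (auto simp: s open_square_def)
  then show ?thesis unfolding s by auto
qed

lemma center_open_square: "Complex (real a + 1/2) (real b + 1/2) \<in> open_square (a, b)"
  by (simp add: open_square_def)

lemma cells_disjoint: assumes "s \<in> squares" "s' \<in> squares" "cell s \<inter> cell s' \<noteq> {}" shows "s = s'"
proof -
  obtain z where z: "z \<in> open_square s" "p z \<in> cell s'" using assms(3) by (auto simp: cell_def)
  then have "z \<in> open_square s'" using cell_point[OF assms(2)] open_square_R[OF assms(1)] by blast
  then show ?thesis using open_square_unique z(1) by blast
qed

lemma cell_nonempty: "cell s \<noteq> {}"
  using center_open_square by (cases s) (auto simp: cell_def)

lemma openin_cell: assumes "s \<in> squares" shows "openin X (cell s)"
proof -
  have sub: "cell s \<subseteq> topspace X" using open_square_R(1)[OF assms] p_onto by (auto simp: cell_def)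
  have "{x \<in> topspace (top_of_set R). p x \<in> cell s} = open_square s"
    using cell_point[OF assms] open_square_R(1)[OF assms] by (auto simp: cell_def)
  moreover have "open (open_square s)" by (cases s) (simp only: open_square_box open_box)
  moreover have "open_square s \<subseteq> R" using open_square_R(1)[OF assms] by blast
  ultimately have "openin (top_of_set R) {x \<in> topspace (top_of_set R). p x \<in> cell s}"
    by (simp add: openin_open_eq openin_open_Int open_subset)
  then show ?thesis using quotient_p sub unfolding quotient_map_def by blast
qed

lemma connectedin_cell: assumes "s \<in> squares" shows "connectedin X (cell s)"
proof -
  have "connected (open_square s)" by (cases s) (auto simp: open_square_box intro: convex_connected)
  moreover have "open_square s \<subseteq> R" using open_square_R(1)[OF assms] by blast
  ultimately have "connectedin (top_of_set R) (open_square s)" by (simp add: connectedin_subtopology)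
  then show ?thesis unfolding cell_def by (rule connectedin_continuous_map_image[OF continuous_p])
qed

lemma step_not_in_cell: assumes "s \<in> squares" "valid_step u" "0 \<le> r" "r \<le> 1" shows "p (step u r) \<notin> cell s"
proof
  assume "p (step u r) \<in> cell s"
  then have "step u r \<in> open_square s" using cell_point[OF assms(1) step_R[OF assms(2-4)]] by blast
  then have "Re (step u r) \<notin> \<int>" "Im (step u r) \<notin> \<int>" by (rule open_square_not_Ints)+
  moreover have "Re (step u r) \<in> \<int> \<or> Im (step u r) \<in> \<int>" by (cases u) (simp add: step_def hpt_def vpt_def)
  ultimately show False by blast
qed

lemma pt_on_arc: assumes "i \<le> L" "j \<le> 9" obtains u where "valid_step u" "pt i j \<in> grid_arc u"
proof (cases "j < 9")
  case True
  have "pt i j \<in> grid_arc (False, i, j)"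
    using p_step_ends(1)[of False i j] by (auto simp: grid_arc_def intro: rev_image_eqI[of 0])
  then show ?thesis using that[of "(False, i, j)"] True assms by (simp add: valid_step_def)
next
  case False
  then have "j = Suc 8" using assms by simp
  then have "pt i j \<in> grid_arc (False, i, 8)"
    using p_step_ends(3)[of i 8] by (auto simp: grid_arc_def intro: rev_image_eqI[of 1])
  then show ?thesis using that[of "(False, i, 8)"] assms by (simp add: valid_step_def)
qed

lemma V_on_arcs: "V \<subseteq> \<Union>E"
  using pt_on_arc by (fastforce simp: V_def E_def)

lemma step_on_grid: "valid_step u \<Longrightarrow> 0 \<le> r \<Longrightarrow> r \<le> 1 \<Longrightarrow> p (step u r) \<in> \<Union>E"
  unfolding E_def grid_arc_def by (intro UnionI imageI) auto

lemma Ints_split: assumes "0 \<le> x" "x \<le> real n" "0 < n" obtains a r where "a < n" "0 \<le> r" "r \<le> 1" "x = real a + r"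
proof (cases "x = real n")
  case True
  then show ?thesis using that[of "n - 1" 1] assms by (simp add: of_nat_diff)
next
  case False
  define a where "a = nat \<lfloor>x\<rfloor>"
  have a: "real a \<le> x" "x < real a + 1" using assms(1) by (simp_all add: a_def)
  moreover have "a < n" using a False assms(2) by linarith
  ultimately show ?thesis using that[of a "x - real a"] by simp
qed

lemma grid_covered: assumes "z \<in> R" "Re z \<in> \<int> \<or> Im z \<in> \<int>" shows "p z \<in> \<Union>E"
proof -
  have z: "0 \<le> Re z" "Re z \<le> real L" "0 \<le> Im z" "Im z \<le> 9" using assms(1) by (auto simp: R_def)
  have nat: "\<exists>n::nat. x = real n" if "x \<in> \<int>" "0 \<le> x" for x :: real using that by (metis Ints_cases nonneg_int_cases of_int_0_le_iff of_int_of_nat_eq)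
  show ?thesis
  proof (cases "Im z \<in> \<int>")
    case True
    then obtain b where b: "Im z = real b" using nat z(3) by blast
    obtain a r where a: "a < L" "0 \<le> r" "r \<le> 1" "Re z = real a + r" using Ints_split[OF z(1,2)] L_pos by auto
    have "z = step (True, a, b) r" using a b by (simp add: step_def hpt_def complex_eq_iff)
    moreover have "valid_step (True, a, b)" using a b z by (simp add: valid_step_def)
    ultimately show ?thesis using a step_on_grid by simp
  next
    case False
    then obtain a where a: "Re z = real a" using assms(2) nat z(1) by blast
    have "Im z \<le> real 9" using z by simp
    then obtain b r where b: "b < 9" "0 \<le> r" "r \<le> 1" "Im z = real b + r" by (rule Ints_split[OF z(3)]) auto
    have "z = step (False, a, b) r" using a b by (simp add: step_def vpt_def complex_eq_iff)
    moreover have "valid_step (False, a, b)" using a b z by (simp add: valid_step_def)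
    ultimately show ?thesis using b step_on_grid by simp
  qed
qed

lemma off_grid: assumes "z \<in> R" "Re z \<notin> \<int>" "Im z \<notin> \<int>" obtains s where "s \<in> squares" "z \<in> open_square s"
proof -
  have z: "0 \<le> Re z" "Re z \<le> real L" "0 \<le> Im z" "Im z \<le> real 9" using assms(1) by (auto simp: R_def)
  obtain a r where a: "a < L" "0 \<le> r" "r \<le> 1" "Re z = real a + r" using Ints_split[OF z(1,2)] L_pos by auto
  obtain b t where b: "b < 9" "0 \<le> t" "t \<le> 1" "Im z = real b + t" using Ints_split[OF z(3,4)] by auto
  have "r \<noteq> 0" "r \<noteq> 1" "t \<noteq> 0" "t \<noteq> 1" using assms(2,3) a(4) b(4) by auto
  then have "z \<in> open_square (a, b)" using a b by (simp add: open_square_def)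
  then show ?thesis using that[of "(a, b)"] a b by (simp add: squares_def)
qed

lemma cells_cover: "\<Union>(cell ` squares) = topspace X - (V \<union> \<Union>E)"
proof
  show "\<Union>(cell ` squares) \<subseteq> topspace X - (V \<union> \<Union>E)"
  proof
    fix x assume "x \<in> \<Union>(cell ` squares)"
    then obtain s where s: "s \<in> squares" "x \<in> cell s" by blast
    have "x \<in> topspace X" using openin_subset[OF openin_cell[OF s(1)]] s(2) by blast
    moreover have "x \<notin> \<Union>E" using step_not_in_cell[OF s(1)] s(2) by (auto simp: E_def grid_arc_def)
    ultimately show "x \<in> topspace X - (V \<union> \<Union>E)" using V_on_arcs by blast
  qed
  show "topspace X - (V \<union> \<Union>E) \<subseteq> \<Union>(cell ` squares)"
  proof
    fix x assume x: "x \<in> topspace X - (V \<union> \<Union>E)"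
    then obtain z where z: "z \<in> R" "x = p z" using p_onto by blast
    then have "Re z \<notin> \<int>" "Im z \<notin> \<int>" using grid_covered x by blast+
    then obtain s where "s \<in> squares" "z \<in> open_square s" by (rule off_grid[OF z(1)])
    then show "x \<in> \<Union>(cell ` squares)" using z(2) by (auto simp: cell_def)
  qed
qed

text \<open>The open unit squares are mapped injectively onto disjoint connected open sets, and these fill the
  complement of the grid.\<close>

lemma faces_grid: "faces X V E = cell ` squares"
  unfolding faces_def
proof (rule connected_components_of_partition)
  let ?W = "topspace X - (V \<union> \<Union>E)"
  have sub: "cell s \<subseteq> ?W" if "s \<in> squares" for s using cells_cover that by blast
  show "openin (subtopology X ?W) c \<and> connectedin (subtopology X ?W) c \<and> c \<noteq> {}" if "c \<in> cell ` squares" for c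
  proof -
    obtain s where s: "s \<in> squares" "c = cell s" using \<open>c \<in> cell ` squares\<close> by blast
    have "openin (subtopology X ?W) (cell s)"
      using openin_subtopology_Int[OF openin_cell[OF s(1)], of ?W] sub[OF s(1)] by (simp add: Int_absorb2)
    then show ?thesis using connectedin_cell[OF s(1)] sub[OF s(1)] cell_nonempty by (simp add: connectedin_subtopology s(2))
  qed
  show "c \<inter> d = {}" if "c \<in> cell ` squares" "d \<in> cell ` squares" "c \<noteq> d" for c d
    using that cells_disjoint by blast
  show "\<Union>(cell ` squares) = topspace (subtopology X ?W)" unfolding cells_cover by auto
qed

text \<open>The similarity that takes the corners \<open>1, \<i>, -1, -\<i>\<close> of the model to the corners of the unit
  square at \<open>s\<close>, beginning at \<open>s\<close> and going along the upper side first.\<close>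

definition square_map :: "nat \<times> nat \<Rightarrow> complex \<Rightarrow> complex" where
  "square_map s w = Complex (real (fst s) + 1/2) (real (snd s) + 1/2) + Complex (-1/2) (-1/2) * w"

definition side_step :: "nat \<times> nat \<Rightarrow> nat \<Rightarrow> bool \<times> nat \<times> nat" where
  "side_step s k = (if k = 0 then (True, fst s, snd s) else if k = 1 then (False, Suc (fst s), snd s)
     else if k = 2 then (True, fst s, Suc (snd s)) else (False, fst s, snd s))"

lemma valid_side_step: "s \<in> squares \<Longrightarrow> valid_step (side_step s k)"
  by (auto simp: squares_def valid_step_def side_step_def)

lemma square_map_side: assumes "k < 4" shows "square_map s (side k r) = step (side_step s k) (if k < 2 then r else 1 - r)"
proof -
  obtain a b where s: "s = (a, b)" by (cases s)
  show ?thesis using less_four_cases[OF assms] unfolding s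
    by (elim disjE) (simp_all add: square_map_def side_eq side_step_def step_def hpt_def vpt_def complex_eq_iff power3_eq_cube field_simps)
qed

lemma square_map_Re: "2 * Re (square_map s w) = 2 * real (fst s) + 1 + Im w - Re w"
  and square_map_Im: "2 * Im (square_map s w) = 2 * real (snd s) + 1 - Re w - Im w"
  by (simp_all add: square_map_def field_simps)

lemma square_map_interior: "square_map s w \<in> open_square s \<longleftrightarrow> w \<in> interior quadrilateral"
proof -
  let ?x = "Re (square_map s w)" and ?y = "Im (square_map s w)"
  have "w \<in> interior quadrilateral \<longleftrightarrow> \<bar>Re w\<bar> + \<bar>Im w\<bar> < 1"
    by (simp add: mem_interior_quadrilateral taxi_norm_def)
  also have "\<dots> \<longleftrightarrow> real (fst s) < ?x \<and> ?x < real (fst s) + 1 \<and> real (snd s) < ?y \<and> ?y < real (snd s) + 1"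
    (is "?l \<longleftrightarrow> ?r")
  proof
    assume ?l
    then show ?r using square_map_Re[of s w] square_map_Im[of s w] by (intro conjI; linarith)
  next
    assume ?r
    then have "real (fst s) < ?x" "?x < real (fst s) + 1" "real (snd s) < ?y" "?y < real (snd s) + 1" by blast+
    then show ?l using square_map_Re[of s w] square_map_Im[of s w] by linarith
  qed
  also have "\<dots> \<longleftrightarrow> square_map s w \<in> open_square s" by (cases s) (simp add: open_square_def)
  finally show ?thesis by simp
qed

lemma square_map_R: assumes "s \<in> squares" "w \<in> quadrilateral" shows "square_map s w \<in> R"
proof -
  have "fst s < L" "snd s < 9" using assms(1) by (auto simp: squares_def)
  then have ab: "real (fst s) + 1 \<le> real L" "real (snd s) + 1 \<le> 9" by linarith+
  have w: "\<bar>Re w\<bar> + \<bar>Im w\<bar> \<le> 1" using assms(2) by (simp add: mem_quadrilateral taxi_norm_def)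
  have n: "0 \<le> real (fst s)" "0 \<le> real (snd s)" by simp_all
  have "0 \<le> Re (square_map s w)" "Re (square_map s w) \<le> real L"
    "0 \<le> Im (square_map s w)" "Im (square_map s w) \<le> 9"
    using w ab n square_map_Re[of s w] square_map_Im[of s w] by linarith+
  then show ?thesis by (simp add: R_def)
qed

lemma homeomorphic_square_map:
  "homeomorphic_map (top_of_set (interior quadrilateral)) (top_of_set (open_square s)) (square_map s)"
proof -
  define h where "h z = (z - Complex (real (fst s) + 1/2) (real (snd s) + 1/2)) / Complex (-1/2) (-1/2)" for z
  have n: "Complex (-1/2) (-1/2) \<noteq> 0" by (simp add: complex_eq_iff)
  have hs: "h (square_map s w) = w" for w using n by (simp add: h_def square_map_def)
  have sh: "square_map s (h z) = z" for z using n by (simp add: h_def square_map_def)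
  have "continuous_on S h" "continuous_on S (square_map s)" for S
    unfolding h_def square_map_def using n by (intro continuous_intros; simp)+
  moreover have "h z \<in> interior quadrilateral" if "z \<in> open_square s" for z
    using that square_map_interior[of s "h z"] sh by simp
  ultimately have "homeomorphic_maps (top_of_set (interior quadrilateral)) (top_of_set (open_square s)) (square_map s) h"
    using square_map_interior[of s] hs sh by (auto simp: homeomorphic_maps_def)
  then show ?thesis by (rule homeomorphic_maps_imp_map)
qed

lemma homeomorphic_cell: assumes "s \<in> squares"
  shows "homeomorphic_map (top_of_set (open_square s)) (subtopology X (cell s)) p"
proof -
  have sub: "open_square s \<subseteq> R" using open_square_R(1)[OF assms] by blast
  have "{x \<in> topspace (top_of_set R). p x \<in> cell s} = open_square s"
    using cell_point[OF assms] sub by (auto simp: cell_def)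
  from quotient_map_restriction[OF quotient_p this] openin_cell[OF assms]
  have "quotient_map (subtopology (top_of_set R) (open_square s)) (subtopology X (cell s)) p" by blast
  then have "quotient_map (top_of_set (open_square s)) (subtopology X (cell s)) p"
    using sub by (simp add: subtopology_subtopology Int_absorb1)
  moreover have "inj_on p (open_square s)"
  proof (rule inj_onI)
    fix z w assume h: "z \<in> open_square s" "w \<in> open_square s" "p z = p w"
    have "w = z" by (rule p_interior[OF _ _ h(3)]) (use open_square_R[OF assms h(1)] open_square_R[OF assms h(2)] in auto)
    then show "z = w" by simp
  qed
  ultimately show ?thesis by (simp add: homeomorphic_map_def)
qed

lemma homeomorphic_reverse_interval: "homeomorphic_map (top_of_set {0..1}) (top_of_set {0..1::real}) (\<lambda>r. 1 - r)"
proof (rule homeomorphic_maps_imp_map)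
  show "homeomorphic_maps (top_of_set {0..1}) (top_of_set {0..1::real}) (\<lambda>r. 1 - r) (\<lambda>r. 1 - r)"
    by (auto simp: homeomorphic_maps_def intro!: continuous_intros)
qed

lemma oriented_cell: assumes "s \<in> squares" shows "oriented_quadrilateral_face X E (cell s) (p \<circ> square_map s)"
  unfolding oriented_quadrilateral_face_def
proof (intro conjI allI impI)
  have "continuous_on quadrilateral (square_map s)" unfolding square_map_def by (intro continuous_intros)
  then have "continuous_map (top_of_set quadrilateral) (top_of_set R) (square_map s)" using square_map_R[OF assms] by auto
  then show "continuous_map (top_of_set quadrilateral) X (p \<circ> square_map s)" by (rule continuous_map_compose[OF _ continuous_p])
  show "homeomorphic_map (top_of_set (interior quadrilateral)) (subtopology X (cell s)) (p \<circ> square_map s)"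
    by (rule homeomorphic_map_compose[OF homeomorphic_square_map homeomorphic_cell[OF assms]])
  fix k :: nat assume k: "k < 4"
  let ?u = "side_step s k"
  have h: "homeomorphic_map (top_of_set {0..1}) (subtopology X (grid_arc ?u)) (\<lambda>r. p (step ?u r))"
    by (rule homeomorphic_arc[OF valid_side_step[OF assms]])
  have "homeomorphic_map (top_of_set {0..1}) (subtopology X (grid_arc ?u)) (p \<circ> square_map s \<circ> side k)"
  proof (cases "k < 2")
    case True
    then have "p \<circ> square_map s \<circ> side k = (\<lambda>r. p (step ?u r))" using square_map_side[OF k, of s] by (auto simp: fun_eq_iff)
    then show ?thesis using h by simp
  next
    case False
    then have "p \<circ> square_map s \<circ> side k = (\<lambda>r. p (step ?u r)) \<circ> (\<lambda>r. 1 - r)"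
      using square_map_side[OF k, of s] by (auto simp: fun_eq_iff)
    then show ?thesis using homeomorphic_map_compose[OF homeomorphic_reverse_interval h] by simp
  qed
  moreover have "grid_arc ?u \<in> E" using valid_side_step[OF assms] by (auto simp: E_def)
  ultimately show "\<exists>e\<in>E. homeomorphic_map (top_of_set {0..1}) (subtopology X e) (p \<circ> square_map s \<circ> side k)" by blast
qed

lemma quadrangulation_grid: "quadrangulation X V E"
  using embedded_grid oriented_cell by (auto simp: quadrangulation_def faces_grid)

definition grid_map :: "'a set \<Rightarrow> complex \<Rightarrow> 'a" where
  "grid_map f = p \<circ> square_map (SOME s. s \<in> squares \<and> cell s = f)"

lemma grid_map_cell: assumes "s \<in> squares" shows "grid_map (cell s) = p \<circ> square_map s"
proof -
  have "(SOME s'. s' \<in> squares \<and> cell s' = cell s) = s"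
  proof (rule some_equality)
    show "s' = s" if "s' \<in> squares \<and> cell s' = cell s" for s'
      using cells_disjoint[of s' s] that assms cell_nonempty[of s] by simp
  qed (use assms in simp)
  then show ?thesis by (simp add: grid_map_def)
qed

lemma face_orientation_grid: "face_orientation X V E grid_map"
  using oriented_cell by (auto simp: face_orientation_def faces_grid grid_map_cell)

section \<open>The edges breaking consistency\<close>

definition side_start :: "nat \<times> nat \<Rightarrow> nat \<Rightarrow> 'a" where
  "side_start s k = p (step (side_step s k) (if k < 2 then 0 else 1))"

lemma grid_map_side: assumes "s \<in> squares" "k < 4"
  shows "(grid_map (cell s) \<circ> side k) ` {0..1} = grid_arc (side_step s k)" "grid_map (cell s) (\<i> ^ k) = side_start s k"
proof -
  show "(grid_map (cell s) \<circ> side k) ` {0..1} = grid_arc (side_step s k)"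
  proof (cases "k < 2")
    case True
    then show ?thesis using square_map_side[OF assms(2), of s] by (simp add: grid_map_cell[OF assms(1)] grid_arc_def)
  next
    case False
    have "(grid_map (cell s) \<circ> side k) ` {0..1} = (\<lambda>r. p (step (side_step s k) r)) ` ((\<lambda>r. 1 - r) ` {0..1})"
      unfolding image_image using False square_map_side[OF assms(2), of s] by (simp add: grid_map_cell[OF assms(1)])
    then show ?thesis by (simp add: grid_arc_def image_diff_atLeastAtMost)
  qed
  show "grid_map (cell s) (\<i> ^ k) = side_start s k"
    using square_map_side[OF assms(2), of s 0] by (simp add: grid_map_cell[OF assms(1)] side_start_def)
qed

lemma breaks_grid_iff:
  "breaks_consistency X V E grid_map e \<longleftrightarrow>
     (\<exists>s\<in>squares. \<exists>s'\<in>squares. \<exists>k<4. \<exists>k'<4. (s, k) \<noteq> (s', k') \<and> grid_arc (side_step s k) = e \<and>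
        grid_arc (side_step s' k') = e \<and> side_start s k = side_start s' k')"
  (is "?l = ?r")
proof
  assume ?l
  then obtain f f' k k' where f: "f \<in> faces X V E" "f' \<in> faces X V E" and h0: "k < 4" "k' < 4" "(f, k) \<noteq> (f', k')"
    "(grid_map f \<circ> side k) ` {0..1} = e" "(grid_map f' \<circ> side k') ` {0..1} = e" "grid_map f (\<i> ^ k) = grid_map f' (\<i> ^ k')"
    unfolding breaks_consistency_def by blast
  obtain s s' where s: "s \<in> squares" "s' \<in> squares" "f = cell s" "f' = cell s'"
    using f unfolding faces_grid by blast
  note h = s(1,2) h0[unfolded s(3,4)]
  have "(s, k) \<noteq> (s', k')" using h(5) by auto
  then show ?r
    using h(6-8) h(1-4) unfolding grid_map_side[OF h(1,3)] grid_map_side[OF h(2,4)] by blast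
next
  assume ?r
  then obtain s s' k k' where h: "s \<in> squares" "s' \<in> squares" "k < 4" "k' < 4" "(s, k) \<noteq> (s', k')"
    "grid_arc (side_step s k) = e" "grid_arc (side_step s' k') = e" "side_start s k = side_start s' k'" by blast
  have "(cell s, k) \<noteq> (cell s', k')" using cells_disjoint[OF h(1,2)] cell_nonempty[of s] h(5) by auto
  moreover note h(4) h(6-8)[folded grid_map_side[OF h(1,3)] grid_map_side[OF h(2,4)]]
  ultimately have w: "k' < 4 \<and> (cell s, k) \<noteq> (cell s', k') \<and> (grid_map (cell s) \<circ> side k) ` {0..1} = e \<and>
    (grid_map (cell s') \<circ> side k') ` {0..1} = e \<and> grid_map (cell s) (\<i> ^ k) = grid_map (cell s') (\<i> ^ k')" by simp
  have f: "cell s \<in> faces X V E" "cell s' \<in> faces X V E" using h(1,2) by (simp_all add: faces_grid)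
  have ww: "\<exists>j<4. \<exists>j'<4. (cell s, j) \<noteq> (cell s', j') \<and> (grid_map (cell s) \<circ> side j) ` {0..1} = e \<and>
    (grid_map (cell s') \<circ> side j') ` {0..1} = e \<and> grid_map (cell s) (\<i> ^ j) = grid_map (cell s') (\<i> ^ j')"
    by (rule exI[of _ k], rule conjI[OF h(3)], rule exI[of _ k'], rule w)
  show ?l unfolding breaks_consistency_def by (rule bexI[OF _ f(1)], rule bexI[OF _ f(2)], rule ww)
qed

text \<open>Apart from the top side, different sides of squares are glued against their directions: this is
  clear for neighboring squares, for the vertical sides of the rectangle, and for the bottom side,
  where the fold reverses the direction. The top side is glued with the direction
  preserved.\<close>

lemma same_start_top:
  assumes s: "s \<in> squares" "s' \<in> squares" and k: "k < 4" "k' < 4" "k \<le> k'" and ne: "(s, k) \<noteq> (s', k')"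
    and eq: "grid_arc (side_step s k) = grid_arc (side_step s' k')" "side_start s k = side_start s' k'"
  shows "k = 0 \<and> snd s = 0"
proof (rule ccontr)
  assume contra: "\<not> ?thesis"
  obtain a b a' b' where ab: "s = (a, b)" "s' = (a', b')" "a < L" "b < 9" "a' < L" "b' < 9"
    using s by (auto simp: squares_def)
  \<comment> \<open>The two sides are compared at the middle of the first one.\<close>
  have "p (step (side_step s k) (1/2)) \<in> grid_arc (side_step s k)" by (simp add: grid_arc_def)
  then obtain r where r: "0 \<le> r" "r \<le> 1" "p (step (side_step s k) (1/2)) = p (step (side_step s' k') r)"
    unfolding eq by (auto simp: grid_arc_def)
  have half: "0 < (1/2::real)" "1/2 < (1::real)" by simp_all
  consider "k = 0 \<or> k = 2" "k' = 0 \<or> k' = 2" | "k = 1 \<or> k = 3" "k' = 1 \<or> k' = 3"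
    | "k = 0 \<or> k = 2" "k' = 1 \<or> k' = 3" | "k = 1 \<or> k = 3" "k' = 0 \<or> k' = 2"
    using less_four_cases[OF k(1)] less_four_cases[OF k(2)] by blast
  then show False
  proof cases
    case 1
    define j where "j = (if k = 0 then b else Suc b)"
    define j' where "j' = (if k' = 0 then b' else Suc b')"
    have st: "step (side_step s k) \<rho> = hpt a j \<rho>" "step (side_step s' k') \<rho> = hpt a' j' \<rho>" for \<rho>
      using 1 by (auto simp: side_step_def step_def ab j_def j'_def)
    have j: "j \<le> 9" "j' \<le> 9" using ab by (auto simp: j_def j'_def)
    have "j' = j \<and> (r = 1/2 \<and> (a' = a \<or> j = 0 \<and> a - shift a = a' - shift a') \<or> r = 1 - 1/2 \<and> j = 9 \<and> a + a' + 1 = L)"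
      by (rule p_hpt_hpt[OF ab(3) j(1) ab(5) j(2) half r(1,2) r(3)[unfolded st]])
    moreover have "j \<noteq> 0" using contra 1 ab by (auto simp: j_def)
    ultimately have c: "j' = j" "a' = a \<or> j = 9 \<and> a + a' + 1 = L" by auto
    have start: "p (hpt a j (if k = 0 then 0 else 1)) = p (hpt a' j' (if k' = 0 then 0 else 1))"
      using eq(2) 1 unfolding side_start_def st by auto
    have loop: "p (hpt a j 0) \<noteq> p (hpt a j 1)"
      using step_ends_neq[of "(True, a, j)"] ab j by (simp add: valid_step_def step_def)
    have "\<not> (k = 0 \<and> k' = 2 \<and> a' = a)" "\<not> (k = 2 \<and> k' = 0 \<and> a' = a)" using start loop c(1) by auto
    moreover have "\<not> (k = k' \<and> a' = a)" using ne c(1) ab by (auto simp: j_def j'_def split: if_splits)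
    ultimately have "a' \<noteq> a" using 1 by auto
    then have c': "j = 9" "a + a' + 1 = L" using c(2) by auto
    then have "k = 2" "k' = 2" using c(1) 1 ab by (auto simp: j_def j'_def split: if_splits)
    then have "p (hpt a 9 1) = p (hpt a' 9 1)" using start c(1) c' by simp
    also have "\<dots> = p (hpt a 9 0)" using p_hpt_bottom[of a a' 0] c'(2) by simp
    finally show False using loop c' by simp
  next
    case 2
    define i where "i = (if k = 1 then Suc a else a)"
    define i' where "i' = (if k' = 1 then Suc a' else a')"
    have st: "step (side_step s k) \<rho> = vpt i b \<rho>" "step (side_step s' k') \<rho> = vpt i' b' \<rho>" for \<rho>
      using 2 by (auto simp: side_step_def step_def ab i_def i'_def)
    have i: "i \<le> L" "i' \<le> L" using ab by (auto simp: i_def i'_def)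
    have c: "b' = b \<and> r = 1/2 \<and> (i' = i \<or> i = 0 \<and> i' = L \<or> i = L \<and> i' = 0)"
      by (rule p_vpt_vpt[OF i(1) ab(4) i(2) ab(6) half r(1,2) r(3)[unfolded st]])
    then have same: "p (vpt i' b' \<rho>) = p (vpt i b \<rho>)" if "0 \<le> \<rho>" "\<rho> \<le> 1" for \<rho>
      using p_vpt_sides[OF ab(4) that] by auto
    have start: "p (vpt i b (if k = 1 then 0 else 1)) = p (vpt i' b' (if k' = 1 then 0 else 1))"
      using eq(2) 2 unfolding side_start_def st by auto
    have loop: "p (vpt i b 0) \<noteq> p (vpt i b 1)"
      using step_ends_neq[of "(False, i, b)"] ab i by (simp add: valid_step_def step_def)
    have "k = k'"
    proof (rule ccontr)
      assume "k \<noteq> k'"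
      then show False using start loop same[of 0] same[of 1] 2 by (auto split: if_splits)
    qed
    then show False using c ne ab L_pos by (auto simp: i_def i'_def split: if_splits)
  next
    case 3
    define j where "j = (if k = 0 then b else Suc b)"
    define i' where "i' = (if k' = 1 then Suc a' else a')"
    have st: "step (side_step s k) \<rho> = hpt a j \<rho>" "step (side_step s' k') \<rho> = vpt i' b' \<rho>" for \<rho>
      using 3 by (auto simp: side_step_def step_def ab j_def i'_def)
    have v: "valid_step (True, a, j)" "valid_step (False, i', b')" using ab by (auto simp: valid_step_def j_def i'_def)
    have e: "p (step (True, a, j) (1/2)) = p (step (False, i', b') r)" using r(3) unfolding st by (simp add: step_def)
    have "r = 1/2" using p_step_eq[OF v half r(1,2) e] by auto
    then show False using p_hpt_vpt[of a j i' b' "1/2" r] e v by (simp add: step_def valid_step_def)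
  next
    case 4
    define i where "i = (if k = 1 then Suc a else a)"
    define j' where "j' = (if k' = 0 then b' else Suc b')"
    have st: "step (side_step s k) \<rho> = vpt i b \<rho>" "step (side_step s' k') \<rho> = hpt a' j' \<rho>" for \<rho>
      using 4 by (auto simp: side_step_def step_def ab i_def j'_def)
    have "i \<le> L" "j' \<le> 9" using ab by (auto simp: i_def j'_def)
    then show False using p_hpt_vpt[of a' j' i b r "1/2"] r ab unfolding st by simp
  qed
qed

lemma shift_shift: "shift (i - shift i) = 0"
proof (cases "shift i = 0")
  case False
  have i: "shift i \<le> i" by (rule shift_le)
  show ?thesis
  proof (cases "i < 154")
    case True
    then have "shift i = 11" "odd (i div 11)" "11 \<le> i" using False i by (auto simp: shift_def split: if_splits)
    moreover have "(i - 11) div 11 = i div 11 - 1" using \<open>11 \<le> i\<close> by (simp add: le_div_geq)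
    ultimately show ?thesis using True by (simp add: shift_def)
  next
    case ge: False
    then have sh: "shift i = 2" "odd ((i - 154) div 2)" using False by (auto simp: shift_def split: if_splits)
    then have "156 \<le> i" "even ((i - 2 - 154) div 2)" using ge by presburger+
    then show ?thesis by (simp add: sh shift_def)
  qed
qed simp

lemma shift_partner: assumes "i < L" obtains i' where "i' < L" "i' \<noteq> i" "i' - shift i' = i - shift i"
proof (cases "shift i = 0")
  case False
  show ?thesis using that[of "i - shift i"] assms False shift_le[of i] shift_shift[of i] by simp
next
  case True
  show ?thesis
  proof (cases "i < 154")
    case lt: True
    then have ev: "even (i div 11)" using True by (auto simp: shift_def split: if_splits)
    have "i div 11 \<noteq> 13" using ev by auto
    then have "i + 11 < 154" using lt by linarith
    moreover have "(i + 11) div 11 = i div 11 + 1" by simp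
    ultimately have "shift (i + 11) = 11" using ev by (simp add: shift_def)
    then show ?thesis using that[of "i + 11"] True \<open>i + 11 < 154\<close> L_pos by simp
  next
    case ge: False
    then have ev: "even ((i - 154) div 2)" using True by (auto simp: shift_def split: if_splits)
    then have "odd ((i + 2 - 154) div 2)" using ge by presburger
    then have sh: "shift (i + 2) = 2" using ge by (simp add: shift_def)
    obtain m where "L = 154 + 4 * m" by (simp add: L_def)
    then have "i + 2 < L" using ev ge assms by presburger
    then show ?thesis using that[of "i + 2"] True sh by simp
  qed
qed

definition top_arc :: "nat \<Rightarrow> 'a set" where "top_arc i = grid_arc (True, i, 0)"

lemma top_arc_shift: "i < L \<Longrightarrow> top_arc (i - shift i) = top_arc i"
  unfolding top_arc_def grid_arc_def by (rule image_cong) (auto simp: step_def p_hpt_shift)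

lemma top_arc_eq: assumes "i < L" "i' < L" "top_arc i = top_arc i'" shows "i - shift i = i' - shift i'"
proof -
  have "p (hpt i 0 (1/2)) \<in> top_arc i" by (simp add: top_arc_def grid_arc_def step_def)
  then obtain r where "0 \<le> r" "r \<le> 1" "p (hpt i 0 (1/2)) = p (hpt i' 0 r)"
    unfolding assms(3) by (auto simp: top_arc_def grid_arc_def step_def)
  from p_hpt_hpt[OF assms(1) _ assms(2) _ _ _ this] show ?thesis by auto
qed

lemma breaks_grid_top: "{e \<in> E. breaks_consistency X V E grid_map e} = top_arc ` {i. i < L \<and> shift i = 0}"
proof
  show "{e \<in> E. breaks_consistency X V E grid_map e} \<subseteq> top_arc ` {i. i < L \<and> shift i = 0}"
  proof
    fix e assume "e \<in> {e \<in> E. breaks_consistency X V E grid_map e}"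
    then obtain s s' k k' where h: "s \<in> squares" "s' \<in> squares" "k < 4" "k' < 4" "(s, k) \<noteq> (s', k')"
      "grid_arc (side_step s k) = e" "grid_arc (side_step s' k') = e" "side_start s k = side_start s' k'"
      unfolding breaks_grid_iff by blast
    have "\<exists>t\<in>squares. e = grid_arc (side_step t 0) \<and> snd t = 0"
    proof (cases "k \<le> k'")
      case True
      then show ?thesis using same_start_top[OF h(1-4) True h(5)] h by auto
    next
      case False
      then show ?thesis using same_start_top[OF h(2,1,4,3)] h by auto
    qed
    then obtain i where i: "i < L" "e = top_arc i" by (auto simp: squares_def top_arc_def side_step_def)
    have "\<exists>j<L. shift j = 0 \<and> top_arc j = e"
    proof (cases "shift i = 0")
      case False
      have "shift (i - shift i) = 0" by (rule shift_shift)
      then show ?thesis using i top_arc_shift[OF i(1)] by (intro exI[of _ "i - shift i"]) auto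
    qed (use i in auto)
    then show "e \<in> top_arc ` {i. i < L \<and> shift i = 0}" by auto
  qed
  show "top_arc ` {i. i < L \<and> shift i = 0} \<subseteq> {e \<in> E. breaks_consistency X V E grid_map e}"
  proof
    fix e assume "e \<in> top_arc ` {i. i < L \<and> shift i = 0}"
    then obtain i where i: "i < L" "e = top_arc i" by auto
    obtain i' where i': "i' < L" "i' \<noteq> i" "i' - shift i' = i - shift i" by (rule shift_partner[OF i(1)])
    have e': "top_arc i' = e" using top_arc_shift[OF i(1)] top_arc_shift[OF i'(1)] i'(3) i(2) by simp
    have "side_start (i, 0) 0 = side_start (i', 0) 0"
      using p_hpt_shift[OF i(1), of 0] p_hpt_shift[OF i'(1), of 0] i'(3) by (simp add: side_start_def side_step_def step_def)
    moreover have "(i, 0) \<in> squares" "(i', 0) \<in> squares" "((i, 0), 0) \<noteq> ((i', 0), 0::nat)"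
      using i i' by (auto simp: squares_def)
    moreover have "grid_arc (side_step (i, 0) 0) = e" "grid_arc (side_step (i', 0) 0) = e"
      using i e' by (simp_all add: side_step_def top_arc_def)
    ultimately have "breaks_consistency X V E grid_map e" unfolding breaks_grid_iff by (metis zero_less_numeral)
    moreover have "e \<in> E" using i by (auto simp: E_def top_arc_def valid_step_def)
    ultimately show "e \<in> {e \<in> E. breaks_consistency X V E grid_map e}" by blast
  qed
qed

text \<open>Seven sides of length 11, and two for every further crosscap.\<close>

lemma card_shift_0: "card {i. i < 154 + 4 * m \<and> shift i = 0} = 77 + 2 * m"
proof -
  have "length (filter (\<lambda>i. shift i = 0) [0..<154 + 4 * m]) = 77 + 2 * m"
  proof (induction m)
    case 0
    show ?case by code_simp
  next
    case (Suc m)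
    have s: "shift (154 + 4 * m) = 0" "shift (155 + 4 * m) = 0" "shift (156 + 4 * m) = 2" "shift (157 + 4 * m) = 2"
    proof -
      have "(4 * m) div 2 = 2 * m" "(1 + 4 * m) div 2 = 2 * m" "(2 + 4 * m) div 2 = 2 * m + 1" "(3 + 4 * m) div 2 = 2 * m + 1" by linarith+
      then show "shift (154 + 4 * m) = 0" "shift (155 + 4 * m) = 0" "shift (156 + 4 * m) = 2" "shift (157 + 4 * m) = 2"
        by (simp_all add: shift_def)
    qed
    have "[0..<154 + 4 * Suc m] = [0..<154 + 4 * m] @ [154 + 4 * m..<154 + 4 * m + 4]"
      using upt_add_eq_append[of 0 "154 + 4 * m" 4] by (simp add: algebra_simps)
    also have "[154 + 4 * m..<154 + 4 * m + 4] = [154 + 4 * m, 155 + 4 * m, 156 + 4 * m, 157 + 4 * m]"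
      by (simp add: upt_conv_Cons)
    finally have "[0..<154 + 4 * Suc m] = [0..<154 + 4 * m] @ [154 + 4 * m, 155 + 4 * m, 156 + 4 * m, 157 + 4 * m]" .
    then show ?case using Suc s by simp
  qed
  moreover have "length (filter (\<lambda>i. shift i = 0) [0..<154 + 4 * m]) = card {i. i < 154 + 4 * m \<and> shift i = 0}"
    unfolding length_filter_conv_card by (rule arg_cong[where f = card]) auto
  ultimately show ?thesis by simp
qed

lemma odd_grid: "odd_quadrangulation X V E"
proof -
  have "inj_on top_arc {i. i < L \<and> shift i = 0}"
  proof (rule inj_onI)
    fix i i' assume "i \<in> {i. i < L \<and> shift i = 0}" "i' \<in> {i. i < L \<and> shift i = 0}" "top_arc i = top_arc i'"
    then show "i = i'" using top_arc_eq[of i i'] by simp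
  qed
  then have "card {e \<in> E. breaks_consistency X V E grid_map e} = card {i. i < L \<and> shift i = 0}"
    unfolding breaks_grid_top by (rule card_image)
  also have "\<dots> = 77 + 2 * (g - 7)" unfolding L_def by (rule card_shift_0)
  finally show ?thesis using quadrangulation_grid face_orientation_grid unfolding odd_quadrangulation_def by auto
qed

end

lemma odd_quadrangulation_with_five_colors:
  fixes X :: "'a topology"
  assumes "nonorientable_surface g X" "g \<ge> 7"
  shows "\<exists>(V :: 'a set) E (c :: 'a \<Rightarrow> nat). odd_quadrangulation X V E \<and> local_3_coloring V E c \<and> card (c ` V) = 5"
proof -
  obtain q where "quotient_map (top_of_set (cball 0 1)) X q"
    "\<forall>z \<in> cball 0 1. \<forall>w \<in> cball 0 1. q z = q w \<longleftrightarrow> equivclp (crosscap_side g) z w"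
    using assms(1) unfolding nonorientable_surface_def by blast
  then interpret crosscap_disc X g q
    using assms by unfold_locales (auto simp: nonorientable_surface_def)
  show ?thesis using odd_grid local_coloring five_colors_used by blast
qed

theorem theorem1p5:
  shows "(\<forall>(X :: 'a topology) (g :: nat) (V :: 'a set) (E :: 'a set set).
            nonorientable_surface g X \<and> g \<le> 6 \<and> odd_quadrangulation X V E \<longrightarrow>
            \<not> (\<exists>c :: 'a \<Rightarrow> nat. local_3_coloring V E c \<and> card (c ` V) \<le> 5))
       \<and> (\<forall>(X :: 'a topology) (g :: nat).
            nonorientable_surface g X \<and> g \<ge> 7 \<longrightarrow>
            (\<exists>(V :: 'a set) (E :: 'a set set) (c :: 'a \<Rightarrow> nat).
               odd_quadrangulation X V E \<and> local_3_coloring V E c \<and> card (c ` V) = 5))"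
proof (intro conjI allI impI notI)
  fix X :: "'a topology" and g :: nat and V :: "'a set" and E :: "'a set set"
  assume "nonorientable_surface g X \<and> g \<le> 6 \<and> odd_quadrangulation X V E"
    and "\<exists>c :: 'a \<Rightarrow> nat. local_3_coloring V E c \<and> card (c ` V) \<le> 5"
  then show False using no_local_3_coloring by blast
next
  fix X :: "'a topology" and g :: nat
  assume "nonorientable_surface g X \<and> g \<ge> 7"
  then show "\<exists>(V :: 'a set) (E :: 'a set set) (c :: 'a \<Rightarrow> nat).
      odd_quadrangulation X V E \<and> local_3_coloring V E c \<and> card (c ` V) = 5"
    using odd_quadrangulation_with_five_colors by blast
qed

end
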